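(* A finite connected graph $\Gamma$ is planar if and only if $H_1(B_2\Gamma;\mathbb Z)$ is torsion-free.
   Context: $B_2\Gamma=\pi_1(UC_2\Gamma)$, where $UC_2\Gamma=\{\{x,y\}\subset\Gamma: x\ne y\}$ is the unordered configuration space of two points in $\Gamma$. *)

theory Defs
  imports "HOL-Analysis.Analysis" "HOL-Algebra.Algebra"
begin

text \<open>A finite (multi)graph as a topological space: a Hausdorff space which is the union of
finitely many vertices and finitely many edges, each edge being a continuous map of [0,1]
sending the endpoints to vertices, injective on the open interval (0,1), whose open cells are
pairwise disjoint and disjoint from the vertex set (loops and multiple edges allowed).
Such a space is (compact Hausdorff, hence) homeomorphic to the CW realization of the graph.\<close>

definition finite_graph_space :: "'a topology \<Rightarrow> bool" where
  "finite_graph_space Gr \<longleftrightarrow> Hausdorff_space Gr \<and>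
    (\<exists>(Vs::'a set) (Es::(real \<Rightarrow> 'a) set). finite Vs \<and> finite Es \<and> Vs \<subseteq> topspace Gr \<and>
      (\<forall>ed\<in>Es. continuous_map (top_of_set {0..1}) Gr ed \<and> ed 0 \<in> Vs \<and> ed 1 \<in> Vs \<and>
               inj_on ed {0<..<1} \<and> ed ` {0<..<1} \<inter> Vs = {}) \<and>
      (\<forall>ed\<in>Es. \<forall>ed'\<in>Es. ed \<noteq> ed' \<longrightarrow> ed ` {0<..<1} \<inter> ed' ` {0<..<1} = {}) \<and>
      topspace Gr = Vs \<union> (\<Union>ed\<in>Es. ed ` {0..1}))"

definition planar_space :: "'a topology \<Rightarrow> bool" where
  "planar_space Gr \<longleftrightarrow> (\<exists>f :: 'a \<Rightarrow> real \<times> real. embedding_map Gr euclidean f)"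

definition conf2 :: "'a topology \<Rightarrow> ('a \<times> 'a) topology" where
  "conf2 Gr = subtopology (prod_topology Gr Gr) {(x, y). x \<noteq> y}"

definition UC2 :: "'a topology \<Rightarrow> 'a set topology" where
  "UC2 Gr = topology (\<lambda>U. U \<subseteq> {{x, y} | x y. x \<in> topspace Gr \<and> y \<in> topspace Gr \<and> x \<noteq> y} \<and>
       openin (conf2 Gr) {(x, y) \<in> topspace (conf2 Gr). {x, y} \<in> U})"

definition loops_at :: "'a topology \<Rightarrow> 'a \<Rightarrow> (real \<Rightarrow> 'a) set" where
  "loops_at Gr b = {p. continuous_map (top_of_set {0..1}) Gr p \<and> p 0 = b \<and> p 1 = b}"

definition loop_class :: "'a topology \<Rightarrow> 'a \<Rightarrow> (real \<Rightarrow> 'a) \<Rightarrow> (real \<Rightarrow> 'a) set" where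
  "loop_class Gr b p = {q \<in> loops_at Gr b.
      homotopic_with (\<lambda>h. h 0 = b \<and> h 1 = b) (top_of_set {0..1}) Gr p q}"

definition loop_join :: "(real \<Rightarrow> 'a) \<Rightarrow> (real \<Rightarrow> 'a) \<Rightarrow> real \<Rightarrow> 'a" where
  "loop_join p q = (\<lambda>t. if t \<le> 1/2 then p (2 * t) else q (2 * t - 1))"

definition fundamental_group :: "'a topology \<Rightarrow> 'a \<Rightarrow> (real \<Rightarrow> 'a) set monoid" where
  "fundamental_group Gr b =
    \<lparr> carrier = loop_class Gr b ` loops_at Gr b,
      mult = (\<lambda>A B. loop_class Gr b (loop_join (SOME p. p \<in> A) (SOME q. q \<in> B))),
      one = loop_class Gr b (\<lambda>t. b) \<rparr>"

text \<open>H_1(G;Z) = G^{ab} = G / [G,G]; torsion-free means no nontrivial element of finite order.\<close>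
definition abelianization :: "('a, 'b) monoid_scheme \<Rightarrow> 'a set monoid" where
  "abelianization G = G Mod (derived G (carrier G))"

definition torsion_free_group :: "('a, 'b) monoid_scheme \<Rightarrow> bool" where
  "torsion_free_group A \<longleftrightarrow>
     (\<forall>a \<in> carrier A. \<forall>n::nat. n > 0 \<longrightarrow> a [^]\<^bsub>A\<^esub> n = \<one>\<^bsub>A\<^esub> \<longrightarrow> a = \<one>\<^bsub>A\<^esub>)"

definition H1_B2_torsion_free :: "'a topology \<Rightarrow> bool" where
  "H1_B2_torsion_free Gr \<longleftrightarrow>
     (\<forall>b \<in> topspace (UC2 Gr). torsion_free_group (abelianization (fundamental_group (UC2 Gr) b)))"

end

theory Submission
  imports Defs
begin

text \<open>Subdividing every edge into three, the graph becomes simple and free of 4-cycles. Pairs of points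
ordered by a barycentric coordinate \<open>v\<close> of the one and \<open>w\<close> of the other form a good cover of the
configuration space, whose nerve is the complex of pairs of disjoint cells. So homomorphisms from
the fundamental group to R, to the circle or to Z/4 are given by cochains \<open>c v a b\<close> (one point
rests at the vertex \<open>v\<close>, the other moves from \<open>a\<close> to \<open>b\<close>) whose coboundary vanishes on pairs of
disjoint edges, and torsion-freeness means that every circle-valued cochain lifts to a real one.

Both conditions of the theorem yield an integral cochain \<open>c\<close> with \<open>c v a b\<close> odd iff the number \<open>v\<close> lies between
\<open>a\<close> and \<open>b\<close>, and with coboundary divisible by 4 on disjoint edges: for a plane drawing, \<open>c\<close> counts
half turns of the direction from \<open>v\<close> to the moving point; for torsion-free homology, the cocycle
mod 2 recording the exchange of the two points is twice a cocycle mod 4. Its coboundary at the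
vertices is an alternating odd form on the neighbours of each vertex such that the sum of these
forms over all vertices is divisible by 4 on pairs of cycles. Correcting it along the 2-point cuts
turns the local forms into the sign forms of linear orders: a rotation system whose cycles do not
cross, as seen modulo 4.

Given these orders, a rooted spanning tree is laid out on nested intervals. The remaining edges
then join the ends of non-crossing chords, which gives a plane drawing. The faces cut out by the
chords also show that an integral form on pairs of cycles that is a sum of real forms at the vertices
is a sum of integral ones; so circle-valued cochains lift, and the homology is torsion-free.\<close>

section \<open>Flows in a finite graph\<close>

text \<open>Modulus 4 is coarse enough to be reached and fine enough to be useful. Two distinct
  chords whose ends interleave give the total 2 or -2 on their fundamental cycles, all others give
  0, so a crossing is invisible modulo 2 but visible modulo 4; and dividing a class modulo 2 by 2
  leads exactly to Z/4. The price is that the forms at the vertices are known only modulo 4, so the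
  orders must be recovered from congruences. The obstruction is four neighbours of a vertex
  \<open>v\<close> none of whose three pairings has a value divisible by 4. Such a quadruple can
  only persist where some \<open>x\<close> together with \<open>v\<close> separates all four
  neighbours. There the form is not determined: an even form depending only on the parts cut out by
  \<open>v\<close> and \<open>x\<close> may be added at \<open>v\<close> and subtracted at
  \<open>x\<close> without any effect on cycles, the algebraic shadow of rearranging these parts.
  This freedom removes the obstruction. The absence of 4-cycles serves the cover: it leaves a single
  way to match the two points of overlapping cover sets, which makes the overlaps connected.\<close>

locale sgraph =
  fixes n :: nat and adj :: "nat => nat => bool"
  assumes adj_sym: "adj a b ==> adj b a"
    and adj_irrefl: "\<not> adj a a"
    and adj_less: "adj a b ==> a < n"
begin

lemma adj_less2: "adj a b ==> b < n"
  using adj_less adj_sym by blast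

definition step :: "nat set => nat => nat => bool" where
  "step S x y \<longleftrightarrow> x \<in> S \<and> y \<in> S \<and> adj x y"

definition reach :: "nat set => nat => nat => bool" where
  "reach S = (step S)\<^sup>*\<^sup>*"

definition conn :: "nat set => bool" where
  "conn S \<longleftrightarrow> (\<forall>a\<in>S. \<forall>b\<in>S. reach S a b)"

definition comp :: "nat set => nat => nat set" where
  "comp S a = {b. a \<in> S \<and> reach S a b}"

lemma reach_refl [simp]: "reach S a a"
  by (simp add: reach_def)

lemma reach_trans: "reach S a b ==> reach S b c ==> reach S a c"
  by (simp add: reach_def)

lemma reach_sym: "reach S a b ==> reach S b a"
  unfolding reach_def
  by (rule sympD[OF symp_rtranclp]) (auto simp: symp_def step_def adj_sym)

lemma reach_step: "a \<in> S ==> b \<in> S ==> adj a b ==> reach S a b"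
  by (simp add: reach_def step_def r_into_rtranclp)

lemma reach_induct [consumes 1, case_names refl step]:
  assumes "reach S a b" "P a"
    "\<And>y z. reach S a y ==> y \<in> S ==> z \<in> S ==> adj y z ==> P y ==> P z"
  shows "P b"
  using assms(1) unfolding reach_def
proof (induction rule: rtranclp_induct)
  case base show ?case by (fact assms(2))
next
  case (step y z)
  then show ?case using assms(3)[of y z] by (auto simp: step_def reach_def)
qed

lemma reach_mono: assumes "reach S a b" "S \<subseteq> T" shows "reach T a b"
  using assms(1)
proof (induction rule: reach_induct)
  case (step y z)
  then show ?case using assms(2) reach_step[of y T z] reach_trans by blast
qed simp

lemma reach_in: "reach S a b ==> a = b \<or> a \<in> S \<and> b \<in> S"
proof (induction rule: reach_induct)
  case (step y z)
  then show ?case by auto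
qed simp

lemma comp_subset: "comp S a \<subseteq> S"
  using reach_in by (fastforce simp: comp_def)

lemma comp_self: "a \<in> S ==> a \<in> comp S a"
  by (simp add: comp_def)

lemma reach_comp:
  assumes "reach S a b" "a \<in> S" shows "reach (comp S a) a b"
  using assms(1)
proof (induction rule: reach_induct)
  case (step y z)
  have "y \<in> comp S a" "z \<in> comp S a"
    using step assms(2) reach_trans[OF _ reach_step] by (auto simp: comp_def)
  then show ?case using step reach_step reach_trans by blast
qed simp

lemma conn_comp: "conn (comp S a)"
  unfolding conn_def using reach_comp reach_sym reach_trans by (metis comp_def mem_Collect_eq)

lemma conn_empty [simp]: "conn {}" and conn_single [simp]: "conn {a}"
  by (auto simp: conn_def)

lemma conn_Un_meet: assumes "conn A" "conn B" "p \<in> A" "p \<in> B" shows "conn (A \<union> B)"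
proof -
  have *: "reach (A \<union> B) p a" if "a \<in> A \<union> B" for a
    using that assms reach_mono[of A p a "A \<union> B"] reach_mono[of B p a "A \<union> B"]
    by (auto simp: conn_def)
  show ?thesis unfolding conn_def using * reach_sym reach_trans by blast
qed

lemma conn_Un_adj: assumes "conn A" "conn B" "p \<in> A" "q \<in> B" "adj p q" shows "conn (A \<union> B)"
proof -
  have "conn {p, q}"
    unfolding conn_def using assms(5) adj_sym by (auto intro!: reach_step)
  from conn_Un_meet[OF assms(1) this assms(3)] have "conn (A \<union> {p, q})" by simp
  from conn_Un_meet[OF this assms(2), of q] assms(3,4) show ?thesis
    by (simp add: insert_absorb)
qed

text \<open>Stop a path at its first vertex in \<open>T\<close>: everything before it stays in
  \<open>S - T\<close>.\<close>

lemma reach_attach: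
  assumes "reach S a b" "a \<notin> T" "b \<in> T"
  shows "\<exists>p q. reach (S - T) a p \<and> p \<in> S - T \<and> q \<in> S \<inter> T \<and> adj p q"
proof -
  have "(b \<notin> T \<and> reach (S - T) a b) \<or> (\<exists>p q. reach (S - T) a p \<and> p \<in> S - T \<and> q \<in> S \<inter> T \<and> adj p q)"
    using assms(1)
  proof (induction rule: reach_induct)
    case (step y z)
    show ?case
    proof (cases "y \<notin> T \<and> reach (S - T) a y")
      case True
      then show ?thesis using step reach_trans[OF _ reach_step[of y "S - T" z]] by blast
    next
      case False
      then show ?thesis using step by blast
    qed
  qed (use assms in auto)
  then show ?thesis using assms(3) by blast
qed

lemma comp_attach:
  assumes "reach S a b" "a \<in> S" "a \<notin> T" "b \<in> T"
  shows "\<exists>p q. p \<in> comp (S - T) a \<and> q \<in> S \<inter> T \<and> adj p q"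
  using reach_attach[OF assms(1,3,4)] assms by (auto simp: comp_def)

text \<open>Integral 1-chains, encoded as antisymmetric functions on ordered pairs; the name
  abbreviates "antisymmetric chain" and is unrelated to orders. With \<open>dvg\<close> as boundary
  up to sign, \<open>flow\<close> describes the integral 1-cycles.\<close>

definition antichain :: "(nat => nat => int) => bool" where
  "antichain z \<longleftrightarrow> (\<forall>a b. z a b = - z b a) \<and> (\<forall>a b. z a b \<noteq> 0 --> adj a b)"

definition dvg :: "(nat => nat => int) => nat => int" where
  "dvg z v = (\<Sum>b<n. z v b)"

definition flow :: "(nat => nat => int) => bool" where
  "flow z \<longleftrightarrow> antichain z \<and> (\<forall>v<n. dvg z v = 0)"

definition arrow :: "nat => nat => nat => nat => int" where
  "arrow p q x y = of_bool (x = p \<and> y = q) - of_bool (x = q \<and> y = p)"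

lemma arrow_zero: "x \<noteq> p ==> x \<noteq> q ==> arrow p q x y = 0"
  by (simp add: arrow_def)

lemma arrow_zero2: "y \<noteq> p ==> y \<noteq> q ==> arrow p q x y = 0"
  by (simp add: arrow_def)

lemma antichain_arrow: "adj p q ==> antichain (arrow p q)"
  unfolding antichain_def
proof (intro conjI allI impI)
  fix a b assume pq: "adj p q"
  show "arrow p q a b = - arrow p q b a" by (simp add: arrow_def conj_commute)
  assume "arrow p q a b \<noteq> 0"
  then show "adj a b" using pq adj_sym by (auto simp: arrow_def of_bool_def split: if_splits)
qed

lemma antichain_add: "antichain z ==> antichain w ==> antichain (\<lambda>a b. z a b + w a b)"
  unfolding antichain_def by (metis (no_types, lifting) add.right_neutral minus_add_distrib)

lemma antichain_diff: "antichain z ==> antichain w ==> antichain (\<lambda>a b. z a b - w a b)"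
  unfolding antichain_def by (metis (no_types, lifting) diff_0_right minus_diff_eq minus_diff_minus)

lemma antichain_0: "antichain (\<lambda>a b. 0)"
  by (simp add: antichain_def)

lemma antichain_swap: "antichain z ==> z a b = - z b a"
  unfolding antichain_def by blast

lemma antichain_zero: "antichain z ==> \<not> adj a b ==> z a b = 0"
  unfolding antichain_def by blast

lemma dvg_add: "dvg (\<lambda>a b. z a b + w a b) v = dvg z v + dvg w v"
  by (simp add: dvg_def sum.distrib)

lemma dvg_diff: "dvg (\<lambda>a b. z a b - w a b) v = dvg z v - dvg w v"
  by (simp add: dvg_def sum_subtractf)

lemma dvg_arrow: assumes "adj p q" shows "dvg (arrow p q) v = of_bool (v = p) - of_bool (v = q)"
proof -
  have "p < n" "q < n" "p \<noteq> q" using assms adj_less adj_less2 adj_irrefl by auto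
  then show ?thesis
    by (auto simp: dvg_def arrow_def sum_subtractf of_bool_def sum.delta)
qed

lemma path_chain:
  assumes "reach S a b"
  shows "\<exists>u. antichain u \<and> (\<forall>v. dvg u v = of_bool (v = a) - of_bool (v = b)) \<and>
    (\<forall>p q. u p q \<noteq> 0 --> p \<in> S \<and> q \<in> S)"
  using assms
proof (induction rule: reach_induct)
  case refl
  then show ?case by (intro exI[of _ "\<lambda>a b. 0"]) (simp add: antichain_0 dvg_def)
next
  case (step y z)
  then obtain u where u: "antichain u" "\<And>v. dvg u v = of_bool (v = a) - of_bool (v = y)"
    "\<And>p q. u p q \<noteq> 0 ==> p \<in> S \<and> q \<in> S" by blast
  show ?case
  proof (intro exI[of _ "\<lambda>p q. u p q + arrow y z p q"] conjI allI impI)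
    show "antichain (\<lambda>p q. u p q + arrow y z p q)"
      by (intro antichain_add u antichain_arrow step)
    show "dvg (\<lambda>p q. u p q + arrow y z p q) v = of_bool (v = a) - of_bool (v = z)" for v
      by (simp add: dvg_add u dvg_arrow step)
      fix p q assume nz: "u p q + arrow y z p q \<noteq> 0"
    show "p \<in> S"
    proof (rule ccontr)
      assume "p \<notin> S"
      then have "u p q = 0" "arrow y z p q = 0" using u(3)[of p q] step arrow_zero[of p y z q] by blast+
      then show False using nz by simp
    qed
    show "q \<in> S"
    proof (rule ccontr)
      assume "q \<notin> S"
      then have "u p q = 0" "arrow y z p q = 0" using u(3)[of p q] step arrow_zero2[of q y z p] by blast+
      then show False using nz by simp
    qed
  qed
qed

lemma star_cycle:
  assumes "adj v a" "adj v b" "conn S" "a \<in> S" "b \<in> S" "v \<notin> S"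
  shows "\<exists>z. flow z \<and> (\<forall>y. z v y = of_bool (y = a) - of_bool (y = b)) \<and>
    (\<forall>p q. z p q \<noteq> 0 --> p \<in> insert v S)"
proof -
  obtain u where u: "antichain u" "\<And>v. dvg u v = of_bool (v = a) - of_bool (v = b)"
    "\<And>p q. u p q \<noteq> 0 ==> p \<in> S \<and> q \<in> S"
    using path_chain[of S a b] assms by (auto simp: conn_def)
  let ?z = "\<lambda>p q. (u p q + arrow v a p q) - arrow v b p q"
  have "flow ?z"
    unfolding flow_def
    by (intro conjI antichain_add antichain_diff antichain_arrow u assms)
       (simp add: dvg_add dvg_diff u dvg_arrow assms)
  moreover have "?z v y = of_bool (y = a) - of_bool (y = b)" for y
  proof -
    have "u v y = 0" using u(3)[of v y] assms(6) by blast
    then show ?thesis using assms by (auto simp: arrow_def of_bool_def)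
  qed
  moreover have "p \<in> insert v S" if "?z p q \<noteq> 0" for p q
  proof (rule ccontr)
    assume *: "p \<notin> insert v S"
    then have "u p q = 0" using u(3)[of p q] by blast
    moreover have "arrow v a p q = 0" "arrow v b p q = 0"
      using * assms(4,5) by (intro arrow_zero; blast)+
    ultimately show False using that by simp
  qed
  ultimately show ?thesis by blast
qed

text \<open>One strand of a theta graph with poles \<open>v\<close> and \<open>x\<close>: it leaves
  \<open>v\<close> through \<open>a\<close>, reaches \<open>x\<close> through \<open>b\<close>, and
  its interior lies in \<open>B\<close>. The first alternative is the edge between the poles, whose
  interior has no vertices.\<close>

definition linked :: "nat => nat => nat set => nat => nat => bool" where
  "linked v x B a b \<longleftrightarrow> v \<notin> B \<and> x \<notin> B \<and> adj v a \<and> adj x b \<and>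
     (a = x \<and> b = v \<or> conn B \<and> a \<in> B \<and> b \<in> B)"

lemma linked_chain:
  assumes "linked v x B a b" "v \<noteq> x"
  shows "\<exists>u. antichain u \<and> (\<forall>y. dvg u y = of_bool (y = v) - of_bool (y = x)) \<and>
    (\<forall>y. u v y = of_bool (y = a)) \<and> (\<forall>y. u x y = - of_bool (y = b)) \<and>
    (\<forall>p q. u p q \<noteq> 0 --> p \<in> insert v (insert x B))"
proof (cases "a = x \<and> b = v")
  case True
  then have "adj v x" using assms by (simp add: linked_def)
  then show ?thesis using True assms(2)
    by (intro exI[of _ "arrow v x"]) (auto simp: antichain_arrow dvg_arrow arrow_def of_bool_def split: if_splits)
next
  case False
  then have *: "v \<notin> B" "x \<notin> B" "adj v a" "adj b x" "conn B" "a \<in> B" "b \<in> B"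
    using assms adj_sym by (auto simp: linked_def)
  obtain u where u: "antichain u" "\<And>v. dvg u v = of_bool (v = a) - of_bool (v = b)"
    "\<And>p q. u p q \<noteq> 0 ==> p \<in> B \<and> q \<in> B"
    using path_chain[of B a b] * by (auto simp: conn_def)
  let ?z = "\<lambda>p q. (u p q + arrow v a p q) + arrow b x p q"
  have uz: "u v y = 0" "u x y = 0" for y using u(3) * by blast+
  have "antichain ?z" by (intro antichain_add antichain_arrow u *)
  moreover have "dvg ?z y = of_bool (y = v) - of_bool (y = x)" for y
    by (simp add: dvg_add u dvg_arrow *)
  moreover have "?z v y = of_bool (y = a)" "?z x y = - of_bool (y = b)" for y
    using uz * assms(2) by (auto simp: arrow_def of_bool_def)
  moreover have "p \<in> insert v (insert x B)" if "?z p q \<noteq> 0" for p q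
  proof (rule ccontr)
    assume out: "p \<notin> insert v (insert x B)"
    then have "u p q = 0" using u(3)[of p q] by blast
    moreover have "arrow v a p q = 0" "arrow b x p q = 0"
      using out *(6,7) by (intro arrow_zero; blast)+
    ultimately show False using that by simp
  qed
  ultimately show ?thesis by blast
qed

end

section \<open>Disjoint connected sets through four terminals\<close>

context sgraph
begin

lemma conn_star:
  assumes "\<And>s. s \<in> S ==> \<exists>A\<subseteq>S. conn A \<and> x \<in> A \<and> s \<in> A"
  shows "conn S"
proof -
  have *: "reach S x s" if "s \<in> S" for s
    using assms[OF that] reach_mono unfolding conn_def by blast
  show ?thesis unfolding conn_def using * reach_sym reach_trans by blast
qed

text \<open>An arm of a star with centre \<open>x\<close> and tip \<open>a\<close>, stored without
  the centre; it is empty when the tip is the centre itself.\<close>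

definition leg :: "nat set => nat => nat => bool" where
  "leg L x a \<longleftrightarrow> x \<notin> L \<and> (a = x \<and> L = {} \<or> conn L \<and> a \<in> L \<and> (\<exists>l\<in>L. adj l x))"

lemma leg_conn: assumes "leg L x a" shows "conn (insert x L)" "a \<in> insert x L"
proof -
  show "conn (insert x L)"
  proof (cases "L = {}")
    case False
    then obtain l where "conn L" "l \<in> L" "adj l x" using assms by (auto simp: leg_def)
    then show ?thesis using conn_Un_adj[of L "{x}" l x] by simp
  qed simp
  show "a \<in> insert x L" using assms by (auto simp: leg_def)
qed

lemma leg_comp: assumes "conn P" "y \<in> P" "a \<in> P" shows "leg (comp (P - {y}) a) y a"
proof (cases "a = y")
  case True
  then show ?thesis by (simp add: leg_def comp_def)
next
  case False
  obtain p q where "p \<in> comp (P - {y}) a" "q \<in> P \<inter> {y}" "adj p q"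
    using comp_attach[of P a y "{y}"] assms False by (auto simp: conn_def)
  then show ?thesis using comp_subset[of "P - {y}" a] comp_self[of a "P - {y}"] assms False conn_comp
    by (auto simp: leg_def)
qed

lemma comp_leg_outside:
  assumes "reach U c a" "c \<in> U" "a \<in> P" "P \<subseteq> U"
  shows "\<exists>C y. y \<in> P \<and> leg C y c \<and> C \<subseteq> U \<and> C \<inter> P = {}"
proof (cases "c \<in> P")
  case True
  then show ?thesis by (intro exI[of _ "{}"] exI[of _ c]) (simp add: leg_def)
next
  case False
  then obtain p q where *: "p \<in> comp (U - P) c" "q \<in> U \<inter> P" "adj p q"
    using comp_attach[of U c a P] assms by auto
  have sub: "comp (U - P) c \<subseteq> U - P" "c \<in> comp (U - P) c"
    using comp_subset[of "U - P" c] comp_self[of c "U - P"] assms False by auto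
  then show ?thesis using * conn_comp[of "U - P" c]
    by (intro exI[of _ "comp (U - P) c"] exI[of _ q]) (auto simp: leg_def)
qed

text \<open>Take a connected \<open>P\<close> containing \<open>a\<close> and \<open>b\<close> with
  as few elements as possible and attach \<open>c\<close> to it at \<open>y\<close>. If
  \<open>a\<close> and \<open>b\<close> were still joined in \<open>P - {y}\<close>, their component
  there would be a smaller choice; so \<open>y\<close> is the centre of the star.\<close>

lemma tripod:
  assumes "finite U" "a \<in> U" "b \<in> U" "c \<in> U" "reach U a b" "reach U a c"
  shows "\<exists>y A B C. leg A y a \<and> leg B y b \<and> leg C y c \<and> insert y (A \<union> B \<union> C) \<subseteq> U \<and>
    A \<inter> B = {} \<and> A \<inter> C = {} \<and> B \<inter> C = {}"
proof -
  let ?Q = "\<lambda>P. conn P \<and> a \<in> P \<and> b \<in> P \<and> P \<subseteq> U"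
  have "?Q (comp U a)"
    using assms conn_comp comp_self comp_subset[of U a] by (metis sgraph.reach_comp sgraph.reach_in sgraph_axioms)
  then obtain P where P: "conn P" "a \<in> P" "b \<in> P" "P \<subseteq> U"
    and min: "\<And>P'. ?Q P' ==> card P \<le> card P'"
    using ex_has_least_nat[of ?Q _ card] by fastforce
  obtain C y where C: "y \<in> P" "leg C y c" "C \<subseteq> U" "C \<inter> P = {}"
    using comp_leg_outside[of U c a P] assms P reach_sym by blast
  let ?A = "comp (P - {y}) a" and ?B = "comp (P - {y}) b"
  have sub: "?A \<subseteq> P - {y}" "?B \<subseteq> P - {y}" by (simp_all add: comp_subset)
  have "?A \<inter> ?B = {}"
  proof (rule ccontr)
    assume "?A \<inter> ?B \<noteq> {}"
    then obtain s where s: "a \<in> P - {y}" "b \<in> P - {y}" "reach (P - {y}) a s" "reach (P - {y}) b s"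
      by (auto simp: comp_def)
    then have "b \<in> ?A" using reach_trans[OF s(3) reach_sym[OF s(4)]] by (simp add: comp_def)
    then have "?Q ?A" using s conn_comp comp_self[OF s(1)] sub P by auto
    then have "card P \<le> card ?A" by (rule min)
    moreover have "card ?A < card P"
      using sub C(1) P(4) assms(1) by (intro psubset_card_mono finite_subset[of P U]) auto
    ultimately show False by simp
  qed
  then show ?thesis using leg_comp[OF P(1) C(1)] P C sub
    by blast
qed

text \<open>A connection between two tips that avoids the centre leaves leg \<open>i\<close> and,
  after some vertices on no leg, enters another leg \<open>k\<close>, not necessarily
  \<open>j\<close>. These two legs with the connection form \<open>S\<close>; the centre with the
  other two legs forms \<open>S'\<close>.\<close>

lemma spider:
  assumes leg: "\<And>i. i < (4::nat) ==> leg (L i) x (t i)" and sub: "\<And>i. i < 4 ==> L i \<subseteq> U" and "x \<in> U"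
    and dis: "\<And>i j. i < 4 ==> j < 4 ==> i \<noteq> j ==> L i \<inter> L j = {}"
    and ij: "i < 4" "j < 4" "i \<noteq> j" "t i \<noteq> t j" "reach (U - {x}) (t i) (t j)"
  shows "\<exists>S S' i j. i < 4 \<and> j < 4 \<and> i \<noteq> j \<and> conn S \<and> conn S' \<and> S \<inter> S' = {} \<and> S \<union> S' \<subseteq> U \<and>
    t i \<in> S \<and> t j \<in> S \<and> (\<forall>k<4. k \<noteq> i --> k \<noteq> j --> t k \<in> S')"
proof -
  define W where "W = U - {x} - (\<Union>i<4. L i)"
  have tx: "t i \<noteq> x" "t j \<noteq> x" using reach_in[OF ij(5)] ij(4) by auto
  then have ti: "t i \<in> L i" "conn (L i)" and tj: "t j \<in> L j" "conn (L j)"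
    using leg[OF ij(1)] leg[OF ij(2)] by (auto simp: leg_def)
  \<comment> \<open>Otherwise everything reachable from \<open>t i\<close> without the centre stays
    in leg \<open>i\<close> and the free vertices \<open>W\<close>, and \<open>t j\<close> would
    never be reached.\<close>
  have "\<exists>s q k. k < 4 \<and> k \<noteq> i \<and> s \<in> W \<union> L i \<and> reach (W \<union> L i) (t i) s \<and> q \<in> L k \<and> adj s q"
  proof (rule ccontr)
    assume nl: "\<not> ?thesis"
    have "t j \<in> W \<union> L i \<and> reach (W \<union> L i) (t i) (t j)"
      using ij(5)
    proof (induction rule: reach_induct)
      case (step y z)
      have "z \<in> W \<union> L i"
      proof (rule ccontr)
        assume "z \<notin> W \<union> L i"
        then obtain k where "k < 4" "k \<noteq> i" "z \<in> L k" using step by (auto simp: W_def)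
        then show False using nl step by blast
      qed
      then show ?case using step reach_trans[OF _ reach_step[of y "W \<union> L i" z], of "t i"] by blast
    qed (use ti in simp)
    then show False using dis[OF ij(1,2,3)] tj ij(2) by (auto simp: W_def)
  qed
  then obtain s q k where sq: "k < 4" "k \<noteq> i" "s \<in> W \<union> L i" "reach (W \<union> L i) (t i) s" "q \<in> L k" "adj s q"
    by blast
  have k: "conn (L k)" "t k \<in> L k" using leg[OF sq(1)] sq(5) by (auto simp: leg_def)
  let ?C = "comp (W \<union> L i) (t i)"
  let ?S = "?C \<union> L k" and ?S' = "insert x (\<Union>l\<in>{..<4} - {i, k}. L l)"
  have C: "?C \<subseteq> W \<union> L i" "s \<in> ?C" "t i \<in> ?C"
    by (rule comp_subset) (use ti sq(4) in \<open>simp_all add: comp_def\<close>)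
  have "conn ?S" by (rule conn_Un_adj[OF conn_comp k(1) C(2) sq(5,6)])
  moreover have "conn ?S'"
  proof (rule conn_star[of _ x])
    fix y assume y: "y \<in> ?S'"
    show "\<exists>A\<subseteq>?S'. conn A \<and> x \<in> A \<and> y \<in> A"
    proof (cases "y = x")
      case False
      then obtain l where l: "l < 4" "l \<noteq> i" "l \<noteq> k" "y \<in> L l" using y by auto
      then show ?thesis using leg_conn[OF leg[OF l(1)]] by (intro exI[of _ "insert x (L l)"]) auto
    qed (auto intro!: exI[of _ "{x}"])
  qed
  moreover have "?S \<inter> ?S' = {}"
  proof -
    have "x \<notin> L i" "x \<notin> L k" using leg ij sq by (auto simp: leg_def)
    moreover have "L i \<inter> L l = {}" "L k \<inter> L l = {}" if "l < 4" "l \<noteq> i" "l \<noteq> k" for l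
      using that dis ij sq by simp_all
    ultimately show ?thesis using C(1) by (fastforce simp: W_def)
  qed
  moreover have "?S \<union> ?S' \<subseteq> U"
  proof -
    have "W \<union> L i \<subseteq> U" using sub[OF ij(1)] by (auto simp: W_def)
    then show ?thesis using C(1) sub[OF sq(1)] sub \<open>x \<in> U\<close> by auto
  qed
  moreover have "t l \<in> ?S'" if "l < 4" "l \<noteq> i" "l \<noteq> k" for l
    using leg_conn(2)[OF leg[OF that(1)]] that by auto
  ultimately show ?thesis using C k sq(1,2) ij(1)
    by blast
qed

text \<open>Three terminals span a star, and the fourth is attached to it at some \<open>z\<close>.
  If \<open>z\<close> lies on a leg, the star becomes an H and splits the terminals two against two.
  If \<open>z\<close> is the centre there are four legs, and either \<open>spider\<close> reroutes
  two of them or the centre separates all terminals.\<close>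

lemma four_terminals:
  fixes t :: "nat => nat"
  assumes "finite U" and inU: "\<And>i. i < 4 ==> t i \<in> U" and inj: "inj_on t {..<4}"
    and re: "\<And>i. i < 4 ==> reach U (t 0) (t i)"
  shows "(\<exists>S S' i j. i < 4 \<and> j < 4 \<and> i \<noteq> j \<and> conn S \<and> conn S' \<and> S \<inter> S' = {} \<and> S \<union> S' \<subseteq> U \<and>
      t i \<in> S \<and> t j \<in> S \<and> (\<forall>k<4. k \<noteq> i --> k \<noteq> j --> t k \<in> S')) \<or>
    (\<exists>x\<in>U. \<forall>i<4. \<forall>j<4. i \<noteq> j --> \<not> reach (U - {x}) (t i) (t j))"
proof -
  obtain y A B C where T: "leg A y (t 0)" "leg B y (t 1)" "leg C y (t 2)" "insert y (A \<union> B \<union> C) \<subseteq> U"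
    "A \<inter> B = {}" "A \<inter> C = {}" "B \<inter> C = {}"
    using tripod[of U "t 0" "t 1" "t 2"] inU re \<open>finite U\<close> by auto
  obtain D z where D: "z \<in> insert y (A \<union> B \<union> C)" "leg D z (t 3)" "D \<subseteq> U" "D \<inter> insert y (A \<union> B \<union> C) = {}"
    using comp_leg_outside[of U "t 3" "t 0" "insert y (A \<union> B \<union> C)"] inU re[of 3] reach_sym T leg_conn(2)[OF T(1)]
    by auto
  have key: "\<exists>S S'. conn S \<and> conn S' \<and> S \<inter> S' = {} \<and> S \<union> S' \<subseteq> U \<and> a \<in> S \<and> t 3 \<in> S \<and> b \<in> S' \<and> c \<in> S'"
    if "z \<in> Xa" "leg Xa y a" "leg Y y b" "leg Z y c" "Xa \<union> (Y \<union> Z) = A \<union> B \<union> C" "Xa \<inter> (Y \<union> Z) = {}"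
    for Xa Y Z a b c
  proof -
    have Xa: "conn Xa" "a \<in> Xa" "y \<notin> Xa" using that by (auto simp: leg_def)
    have "conn (Xa \<union> insert z D)" using conn_Un_meet[OF Xa(1) leg_conn(1)[OF D(2)] that(1)] by simp
    moreover have "conn (insert y Y \<union> insert y Z)"
      using conn_Un_meet[OF leg_conn(1)[OF that(3)] leg_conn(1)[OF that(4)], of y] by simp
    moreover have "(Xa \<union> insert z D) \<inter> (insert y Y \<union> insert y Z) = {}"
      using that(1,5,6) Xa(3) D(4) by blast
    moreover have "(Xa \<union> insert z D) \<union> (insert y Y \<union> insert y Z) \<subseteq> U"
      using that(1,5) T(4) D(3) by blast
    moreover have "t 3 \<in> Xa \<union> insert z D" "b \<in> insert y Y" "c \<in> insert y Z"
      using leg_conn(2)[OF D(2)] leg_conn(2)[OF that(3)] leg_conn(2)[OF that(4)] by auto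
    ultimately show ?thesis using Xa(2) by blast
  qed
  have lt4: "k < 4 \<longleftrightarrow> k = 0 \<or> k = 1 \<or> k = 2 \<or> k = 3" for k :: nat by auto
  consider "z = y" | "z \<in> A" | "z \<in> B" | "z \<in> C" using D(1) by blast
  then show ?thesis
  proof cases
    case 1
    define L where "L = (\<lambda>i::nat. if i = 0 then A else if i = 1 then B else if i = 2 then C else D)"
    show ?thesis
    proof (cases "\<exists>i<4. \<exists>j<4. i \<noteq> j \<and> reach (U - {y}) (t i) (t j)")
      case True
      then obtain i j where ij: "i < 4" "j < 4" "i \<noteq> j" "reach (U - {y}) (t i) (t j)" by blast
      have "t i \<noteq> t j" using inj ij by (auto simp: inj_on_def)
      have "y \<in> U" using T by simp
      have l: "leg (L i) y (t i)" "L i \<subseteq> U" if "i < 4" for i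
        using that T D 1 by (auto simp: L_def lt4)
      have d: "L i \<inter> L j = {}" if "i < 4" "j < 4" "i \<noteq> j" for i j
        using that T D by (auto simp: L_def lt4)
      show ?thesis
        by (rule disjI1, rule spider[OF l \<open>y \<in> U\<close> d ij(1,2,3) \<open>t i \<noteq> t j\<close> ij(4)]) 
    next
      case False
      then show ?thesis using T by (metis insert_subset)
    qed
  next
    case 2
    obtain S S' where S: "conn S" "conn S'" "S \<inter> S' = {}" "S \<union> S' \<subseteq> U" "t 0 \<in> S" "t 3 \<in> S" "t 1 \<in> S'" "t 2 \<in> S'"
      using key[OF 2 T(1,2,3)] T(5-7) by blast
    have "\<forall>k<4. k \<noteq> 0 --> k \<noteq> 3 --> t k \<in> S'" using S unfolding lt4 by auto
    then show ?thesis using S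
      by (intro disjI1 exI[of _ S] exI[of _ S'] exI[of _ 0] exI[of _ 3]) auto
  next
    case 3
    obtain S S' where S: "conn S" "conn S'" "S \<inter> S' = {}" "S \<union> S' \<subseteq> U" "t 1 \<in> S" "t 3 \<in> S" "t 0 \<in> S'" "t 2 \<in> S'"
      using key[OF 3 T(2,1,3)] T(5-7) by blast
    have "\<forall>k<4. k \<noteq> 1 --> k \<noteq> 3 --> t k \<in> S'" using S unfolding lt4 by auto
    then show ?thesis using S
      by (intro disjI1 exI[of _ S] exI[of _ S'] exI[of _ 1] exI[of _ 3]) auto
  next
    case 4
    obtain S S' where S: "conn S" "conn S'" "S \<inter> S' = {}" "S \<union> S' \<subseteq> U" "t 2 \<in> S" "t 3 \<in> S" "t 0 \<in> S'" "t 1 \<in> S'"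
      using key[OF 4 T(3,1,2)] T(5-7) by blast
    have "\<forall>k<4. k \<noteq> 2 --> k \<noteq> 3 --> t k \<in> S'" using S unfolding lt4 by auto
    then show ?thesis using S
      by (intro disjI1 exI[of _ S] exI[of _ S'] exI[of _ 2] exI[of _ 3]) auto
  qed
qed

end

section \<open>Odd systems of local forms\<close>

text \<open>The value of the form on the differences of unit vectors at \<open>a\<close>,
  \<open>b\<close> and at \<open>c\<close>, \<open>d\<close>. It is the contribution of a vertex to
  a pair of cycles that pass it along \<open>a\<close>, \<open>b\<close> and along \<open>c\<close>,
  \<open>d\<close>.\<close>

definition quad :: "(nat => nat => int) => nat => nat => nat => nat => int" where
  "quad G a b c d = G a c - G a d - G b c + G b d"

text \<open>The sign form of a linear order has no bad quadruples; they are what prevents an odd form from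
being congruent to one on a single component (see \<open>rank_at\<close>).\<close>

definition bad_quad :: "(nat => nat => int) => nat => nat => nat => nat => bool" where
  "bad_quad G a b c d \<longleftrightarrow>
     \<not> 4 dvd quad G a b c d \<and> \<not> 4 dvd quad G b c a d \<and> \<not> 4 dvd quad G c a b d"

definition sg :: "'a::linorder => 'a => int" where
  "sg a b = of_bool (a < b) - of_bool (b < a)"

lemma sg_swap: "sg b a = - sg a b"
  by (simp add: sg_def)

text \<open>The variables are the signs of the pairs \<open>rs\<close>, \<open>rt\<close>,
  \<open>ru\<close>, \<open>st\<close>, \<open>su\<close>, \<open>tu\<close> of four elements, and
  the four implications express transitivity on the four triples.\<close>

lemma sign_table:
  fixes a b c d e f :: int
  assumes "a = 1 \<or> a = -1" "b = 1 \<or> b = -1" "c = 1 \<or> c = -1" "d = 1 \<or> d = -1" "e = 1 \<or> e = -1" "f = 1 \<or> f = -1"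
    and "a = d ==> b = a" "a = e ==> c = a" "b = f ==> c = b" "d = f ==> e = d"
  shows "4 dvd b - c - d + e \<or> 4 dvd - a - e + b + f \<or> 4 dvd - d - f - a + c"
  using assms by (elim disjE) simp_all

text \<open>For an alternating form with odd values the three numbers are even and add up to 2
  modulo 4, so one or all of them fail to be divisible by 4. Transitivity excludes the second case;
  in a linear order only the interleaving pairing fails.\<close>

lemma sg_not_bad:
  assumes "r \<noteq> s" "r \<noteq> t" "r \<noteq> u" "s \<noteq> t" "s \<noteq> u" "t \<noteq> u"
  shows "\<not> bad_quad sg r s t u"
proof -
  have v: "sg p q = 1 \<or> sg p q = -1" if "p \<noteq> q" for p q :: nat
    using that by (auto simp: sg_def)
  have tr: "sg p q = sg q w ==> sg p w = sg p q" if "p \<noteq> q" for p q w :: nat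
    using that by (auto simp: sg_def of_bool_def split: if_splits)
  have "4 dvd sg r t - sg r u - sg s t + sg s u \<or> 4 dvd - sg r s - sg s u + sg r t + sg t u \<or>
    4 dvd - sg s t - sg t u - sg r s + sg r u"
    by (rule sign_table) (use v tr assms in blast)+
  then show ?thesis
    using sg_swap[of r s] sg_swap[of r t] sg_swap[of s t] by (auto simp: bad_quad_def quad_def)
qed

lemma sum_fibres_zero:
  fixes w :: "nat => 'r::comm_ring_1"
  assumes "\<And>r. (\<Sum>b\<in>{b. b < n \<and> k b = r}. w b) = 0"
  shows "(\<Sum>b<n. f (k b) * w b) = 0"
proof -
  have "(\<Sum>b<n. f (k b) * w b) = (\<Sum>r\<in>k ` {..<n}. \<Sum>b\<in>{b \<in> {..<n}. k b = r}. f (k b) * w b)"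
    by (rule sum.group[symmetric]) auto
  also have "\<dots> = (\<Sum>r\<in>k ` {..<n}. f r * (\<Sum>b\<in>{b. b < n \<and> k b = r}. w b))"
    by (intro sum.cong) (auto simp: sum_distrib_left)
  finally show ?thesis by (simp add: assms)
qed

section \<open>Local forms evaluated on pairs of cycles\<close>

context sgraph
begin

definition lf :: "(nat => nat => 'r::comm_ring_1) => (nat => 'r) => (nat => 'r) => 'r" where
  "lf G z w = (\<Sum>a<n. \<Sum>b<n. G a b * z a * w b)"

definition conserved :: "(nat => nat => nat => int) => bool" where
  "conserved F \<longleftrightarrow> (\<forall>z w. flow z --> flow w --> 4 dvd (\<Sum>v<n. lf (F v) (z v) (w v)))"

text \<open>Only \<open>conserved\<close> couples the vertices. Hence the forms may be changed by
  anything that cancels modulo 4 in the total over pairs of flows, and this freedom is what the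
  later corrections exploit.\<close>

definition oddsys :: "(nat => nat => nat => int) => bool" where
  "oddsys F \<longleftrightarrow> (\<forall>v a b. F v b a = - F v a b) \<and>
     (\<forall>v a b. adj v a --> adj v b --> a \<noteq> b --> odd (F v a b)) \<and> conserved F"

lemma sum_two_points:
  fixes f :: "nat => 'r::comm_ring_1"
  assumes "a < n" "b < n"
  shows "(\<Sum>x<n. f x * (of_bool (x = a) - of_bool (x = b))) = f a - f b"
  using assms by (simp add: algebra_simps sum_subtractf of_bool_def if_distrib[of "(*) _"] sum.delta cong: if_cong)

lemma lf_quad:
  assumes "a < n" "b < n" "c < n" "d < n"
    and "\<And>y. z y = of_bool (y = a) - of_bool (y = b)" "\<And>y. w y = of_bool (y = c) - of_bool (y = d)"
  shows "lf G z w = quad G a b c d"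
proof -
  have "lf G z w = (\<Sum>x<n. (\<Sum>y<n. G x y * w y) * z x)"
    unfolding lf_def by (simp add: sum_distrib_left sum_distrib_right mult_ac)
  also have "\<dots> = (\<Sum>x<n. (G x c - G x d) * z x)"
    unfolding assms(6) by (simp only: sum_two_points[OF assms(3,4)])
  also have "\<dots> = (G a c - G a d) - (G b c - G b d)"
    unfolding assms(5) by (rule sum_two_points[OF assms(1,2)])
  finally show ?thesis by (simp add: quad_def)
qed

lemma lf_zero: "(\<forall>y. z y = 0) \<or> (\<forall>y. w y = 0) ==> lf G z w = 0"
  by (auto simp: lf_def)

text \<open>Close \<open>a\<close>, \<open>b\<close> through \<open>S\<close> and \<open>c\<close>,
  \<open>d\<close> through \<open>S'\<close> to cycles. They meet only in \<open>v\<close>, so the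
  conserved total reduces to the value at \<open>v\<close>.\<close>

lemma linked_quad:
  assumes "oddsys F" "adj v a" "adj v b" "adj v c" "adj v d" "conn S" "conn S'" "S \<inter> S' = {}"
    "v \<notin> S" "v \<notin> S'" "a \<in> S" "b \<in> S" "c \<in> S'" "d \<in> S'"
  shows "4 dvd quad (F v) a b c d"
proof -
  obtain z where z: "flow z" "\<And>y. z v y = of_bool (y = a) - of_bool (y = b)"
    "\<And>p q. z p q \<noteq> 0 ==> p \<in> insert v S"
    using star_cycle[of v a b S] assms by blast
  obtain w where w: "flow w" "\<And>y. w v y = of_bool (y = c) - of_bool (y = d)"
    "\<And>p q. w p q \<noteq> 0 ==> p \<in> insert v S'"
    using star_cycle[of v c d S'] assms by blast
  have "lf (F u) (z u) (w u) = 0" if "u \<noteq> v" for u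
    using z(3)[of u] w(3)[of u] that assms(8) by (intro lf_zero) blast
  then have "(\<Sum>u<n. lf (F u) (z u) (w u)) = (\<Sum>u\<in>{v}. lf (F u) (z u) (w u))"
    using adj_less[OF assms(2)] by (intro sum.mono_neutral_right) auto
  also have "\<dots> = quad (F v) a b c d"
    using lf_quad[of a b c d "z v" "w v" "F v"] z w assms(2-5) adj_less2 by simp
  finally have "(\<Sum>u<n. lf (F u) (z u) (w u)) = quad (F v) a b c d" .
  moreover have "4 dvd (\<Sum>u<n. lf (F u) (z u) (w u))"
    using assms(1) z(1) w(1) unfolding oddsys_def conserved_def by blast
  ultimately show ?thesis by simp
qed

text \<open>The cycles made of strands \<open>A\<close>, \<open>B\<close> and of strands
  \<open>C\<close>, \<open>D\<close> meet only in the poles, so the values at the two poles cancel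
  modulo 4: the form at \<open>x\<close> mirrors the one at \<open>v\<close>.\<close>

lemma theta_quad:
  assumes "oddsys F" "v \<noteq> x" "linked v x A a a'" "linked v x B b b'" "linked v x C c c'" "linked v x D d d'"
    "(A \<union> B) \<inter> (C \<union> D) = {}"
  shows "4 dvd quad (F v) a b c d + quad (F x) a' b' c' d'"
proof -
  have nb: "adj v a" "adj v b" "adj v c" "adj v d" "adj x a'" "adj x b'" "adj x c'" "adj x d'"
    using assms(3-6) by (auto simp: linked_def)
  obtain zA where A: "antichain zA" "\<And>y. dvg zA y = of_bool (y = v) - of_bool (y = x)" "\<And>y. zA v y = of_bool (y = a)"
      "\<And>y. zA x y = - of_bool (y = a')" "\<And>p q. zA p q \<noteq> 0 ==> p \<in> insert v (insert x A)"
    using linked_chain[OF assms(3,2)] by blast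
  obtain zB where B: "antichain zB" "\<And>y. dvg zB y = of_bool (y = v) - of_bool (y = x)" "\<And>y. zB v y = of_bool (y = b)"
      "\<And>y. zB x y = - of_bool (y = b')" "\<And>p q. zB p q \<noteq> 0 ==> p \<in> insert v (insert x B)"
    using linked_chain[OF assms(4,2)] by blast
  obtain zC where C: "antichain zC" "\<And>y. dvg zC y = of_bool (y = v) - of_bool (y = x)" "\<And>y. zC v y = of_bool (y = c)"
      "\<And>y. zC x y = - of_bool (y = c')" "\<And>p q. zC p q \<noteq> 0 ==> p \<in> insert v (insert x C)"
    using linked_chain[OF assms(5,2)] by blast
  obtain zD where D: "antichain zD" "\<And>y. dvg zD y = of_bool (y = v) - of_bool (y = x)" "\<And>y. zD v y = of_bool (y = d)"
      "\<And>y. zD x y = - of_bool (y = d')" "\<And>p q. zD p q \<noteq> 0 ==> p \<in> insert v (insert x D)"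
    using linked_chain[OF assms(6,2)] by blast
  let ?z = "\<lambda>p q. zA p q - zB p q" and ?w = "\<lambda>p q. zC p q - zD p q"
  have fl: "flow ?z" "flow ?w"
    unfolding flow_def using A B C D by (simp_all add: antichain_diff dvg_diff)
  have "lf (F u) (?z u) (?w u) = 0" if "u \<noteq> v" "u \<noteq> x" for u
  proof (rule lf_zero)
    show "(\<forall>y. ?z u y = 0) \<or> (\<forall>y. ?w u y = 0)"
    proof (cases "u \<in> A \<union> B")
      case True
      then have "zC u y = 0" "zD u y = 0" for y using C(5)[of u y] D(5)[of u y] that assms(7) by blast+
      then show ?thesis by simp
    next
      case False
      then have "zA u y = 0" "zB u y = 0" for y using A(5)[of u y] B(5)[of u y] that by blast+
      then show ?thesis by simp
    qed
  qed
  then have "(\<Sum>u<n. lf (F u) (?z u) (?w u)) = (\<Sum>u\<in>{v, x}. lf (F u) (?z u) (?w u))"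
    using adj_less[OF nb(1)] adj_less[OF nb(5)] by (intro sum.mono_neutral_right) auto
  also have "\<dots> = lf (F v) (?z v) (?w v) + lf (F x) (?z x) (?w x)" using assms(2) by simp
  also have "lf (F v) (?z v) (?w v) = quad (F v) a b c d"
    using A B C D nb adj_less2 by (intro lf_quad) simp_all
  \<comment> \<open>At \<open>x\<close> both differences of unit vectors have the opposite sign,
    which swaps both pairs; the two swaps together leave the value unchanged.\<close>
  also have "lf (F x) (?z x) (?w x) = quad (F x) b' a' d' c'"
    using A B C D nb adj_less2 by (intro lf_quad) simp_all
  finally have "(\<Sum>u<n. lf (F u) (?z u) (?w u)) = quad (F v) a b c d + quad (F x) a' b' c' d'"
    by (simp add: quad_def)
  moreover have "4 dvd (\<Sum>u<n. lf (F u) (?z u) (?w u))"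
    using assms(1) fl unfolding oddsys_def conserved_def by blast
  ultimately show ?thesis by simp
qed

text \<open>Sum the conservation law over \<open>C\<close>: the terms inside \<open>C\<close> cancel
  in pairs and only the edges to \<open>U\<close> remain.\<close>

lemma flow_cut:
  assumes "flow z" "C \<subseteq> {..<n}" "U \<subseteq> {..<n}" "C \<inter> U = {}"
    and cl: "\<And>y b. y \<in> C ==> adj y b ==> b \<in> C \<union> U"
  shows "(\<Sum>y\<in>C. \<Sum>b\<in>U. z y b) = 0"
proof -
  have z: "antichain z" "\<And>v. v < n ==> dvg z v = 0" using assms(1) by (auto simp: flow_def)
  have fin: "finite C" "finite U" using assms finite_subset by blast+
  have "(\<Sum>y\<in>C. \<Sum>b\<in>C. z y b) = (\<Sum>y\<in>C. \<Sum>b\<in>C. - z b y)"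
    by (intro sum.cong refl antichain_swap[OF z(1)])
  also have "\<dots> = - (\<Sum>y\<in>C. \<Sum>b\<in>C. z y b)"
    by (simp add: sum_negf sum.swap[of "\<lambda>y b. z b y"])
  finally have "(\<Sum>y\<in>C. \<Sum>b\<in>C. z y b) = 0" by simp
  moreover have "(\<Sum>b\<in>C. z y b) + (\<Sum>b\<in>U. z y b) = 0" if "y \<in> C" for y
  proof -
    have "0 = (\<Sum>b<n. z y b)" using z(2)[of y] that assms(2) by (auto simp: dvg_def)
    also have "\<dots> = (\<Sum>b\<in>C \<union> U. z y b)"
      using assms cl[OF that] antichain_zero[OF z(1)] by (intro sum.mono_neutral_right) blast+
    also have "\<dots> = (\<Sum>b\<in>C. z y b) + (\<Sum>b\<in>U. z y b)"
      using fin assms(4) by (intro sum.union_disjoint) auto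
    finally show ?thesis by simp
  qed
  then have "(\<Sum>y\<in>C. (\<Sum>b\<in>C. z y b) + (\<Sum>b\<in>U. z y b)) = 0" by simp
  ultimately show ?thesis by (simp add: sum.distrib)
qed

end

section \<open>Cutting the graph along two vertices\<close>

context sgraph
begin

definition away :: "nat => nat => nat set" where
  "away v x = {..<n} - {v, x}"

text \<open>Labels the components of the graph minus \<open>{v, x}\<close> by their least elements; the
label \<open>n\<close> stands for the edge between \<open>v\<close> and \<open>x\<close>, seen from either end.\<close>

definition kap :: "nat => nat => nat => nat" where
  "kap v x a = (if a = v \<or> a = x then n else LEAST y. reach (away v x) a y)"

text \<open>For a neighbour \<open>a\<close> of \<open>v\<close> this says that the part containing
  \<open>a\<close> also touches \<open>x\<close>, so that it yields a strand between the two
  vertices.\<close>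

definition att :: "nat => nat => nat => bool" where
  "att v x a \<longleftrightarrow> a = x \<or> (\<exists>y. adj x y \<and> reach (away v x) a y)"

lemma away_swap: "away x v = away v x"
  by (auto simp: away_def)

lemma kap_swap: "kap x v = kap v x"
  by (auto simp: kap_def away_swap)

lemma kap_special: "kap v x v = n" "kap v x x = n"
  by (simp_all add: kap_def)

lemma reach_kap: "a \<in> away v x ==> reach (away v x) a (kap v x a)"
  using LeastI[of "reach (away v x) a" a] by (auto simp: kap_def away_def)

lemma kap_less: "a \<in> away v x ==> kap v x a < n"
  using reach_in[OF reach_kap[of a v x]] by (auto simp: away_def)

lemma kap_eq_iff:
  assumes "a \<in> away v x" "b \<in> away v x"
  shows "kap v x a = kap v x b \<longleftrightarrow> reach (away v x) a b"
proof
  assume "kap v x a = kap v x b"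
  then show "reach (away v x) a b"
    using reach_kap[OF assms(1)] reach_kap[OF assms(2)] reach_sym reach_trans by metis
next
  assume "reach (away v x) a b"
  then have "reach (away v x) a = reach (away v x) b"
    using reach_sym reach_trans by blast
  then show "kap v x a = kap v x b" using assms by (auto simp: kap_def away_def)
qed

lemma kap_eq_n: "a < n ==> kap v x a = n \<longleftrightarrow> a = v \<or> a = x"
  using kap_less[of a v x] by (cases "a = v \<or> a = x") (auto simp: kap_special away_def)

text \<open>For a component this is \<open>flow_cut\<close>. The label \<open>n\<close> collects
  \<open>v\<close> and \<open>x\<close> themselves, where the flows along the edge between them
  cancel by antisymmetry; larger labels do not occur.\<close>

lemma kap_cut:
  assumes "flow z" "v \<noteq> x" "v < n" "x < n"
  shows "(\<Sum>b\<in>{b. b < n \<and> kap v x b = r}. z v b + z x b) = 0"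
proof (cases "r < n")
  case True
  let ?C = "{b. b < n \<and> kap v x b = r}"
  have CK: "b \<in> away v x" if "b \<in> ?C" for b
    using that True kap_eq_n[of b v x] by (auto simp: away_def)
  have z: "z a b = - z b a" for a b using assms(1) antichain_swap by (auto simp: flow_def)
  have "(\<Sum>y\<in>?C. \<Sum>b\<in>{v, x}. z y b) = 0"
  proof (rule flow_cut[OF assms(1)])
    fix y b assume y: "y \<in> ?C" "adj y b"
    show "b \<in> ?C \<union> {v, x}"
    proof (rule ccontr)
      assume b: "b \<notin> ?C \<union> {v, x}"
      then have "b \<in> away v x" using adj_less2[OF y(2)] by (auto simp: away_def)
      then have "kap v x y = kap v x b"
        using CK[OF y(1)] y(2) by (simp add: kap_eq_iff reach_step)
      then show False using b y adj_less2 by auto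
    qed
  qed (use assms CK in \<open>auto simp: away_def\<close>)
  then have "(\<Sum>y\<in>?C. - z v y - z x y) = 0"
    using assms(2) z[of _ v] z[of _ x] by simp
  then show ?thesis by (simp add: sum_subtractf sum_negf sum.distrib)
next
  case False
  have z: "antichain z" using assms(1) by (simp add: flow_def)
  have "z v v = 0" "z x x = 0" using antichain_zero[OF z] adj_irrefl by blast+
  then have z0: "(\<Sum>b\<in>{v, x}. z v b + z x b) = 0"
    using assms(2) antichain_swap[OF z, of v x] by simp
  have "{b. b < n \<and> kap v x b = r} = (if r = n then {v, x} else {})"
  proof (cases "r = n")
    case True
    then show ?thesis using kap_eq_n assms(3,4) by auto
  next
    case ne: False
    have "kap v x b \<noteq> r" if "b < n" for b
      using that kap_eq_n[of b v x] kap_less[of b v x] False ne by (cases "b \<in> away v x") (auto simp: away_def)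
    then show ?thesis using ne by auto
  qed
  then show ?thesis using z0 by (simp del: sum.insert)
qed

text \<open>By \<open>kap_cut\<close> the flow from \<open>v\<close> into any part is minus the flow
  from \<open>x\<close> into it, and the two sign changes of a bilinear form cancel. Therefore a
  form in the labels may be added at \<open>v\<close> and subtracted at \<open>x\<close> while the
  system stays conserved.\<close>

lemma lf_kap_cancel:
  assumes "flow z" "flow w" "v \<noteq> x" "v < n" "x < n"
  shows "lf (\<lambda>a b. h (kap v x a) (kap v x b)) (z v) (w v) = lf (\<lambda>a b. h (kap v x a) (kap v x b)) (z x) (w x)"
proof -
  let ?k = "kap v x"
  have cancel: "(\<Sum>b<n. f (?k b) * u v b) = - (\<Sum>b<n. f (?k b) * u x b)" if "flow u" for f u
    using sum_fibres_zero[OF kap_cut[OF that assms(3-5)], of f]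
    by (simp add: distrib_left sum.distrib)
  have "lf (\<lambda>a b. h (?k a) (?k b)) (z v) (w v) = (\<Sum>a<n. (\<Sum>b<n. h (?k a) (?k b) * w v b) * z v a)"
    by (simp add: lf_def sum_distrib_left sum_distrib_right mult_ac)
  also have "\<dots> = - (\<Sum>a<n. \<Sum>b<n. h (?k a) (?k b) * z v a * w x b)"
    by (simp only: cancel[OF assms(2)]) (simp add: sum_negf sum_distrib_left sum_distrib_right mult_ac)
  also have "\<dots> = - (\<Sum>b<n. (\<Sum>a<n. h (?k a) (?k b) * z v a) * w x b)"
    by (subst sum.swap) (simp add: sum_distrib_right)
  also have "\<dots> = (\<Sum>b<n. (\<Sum>a<n. h (?k a) (?k b) * z x a) * w x b)"
  proof -
    have "(\<Sum>a<n. h (?k a) s * z v a) = - (\<Sum>a<n. h (?k a) s * z x a)" for s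
      by (rule cancel[OF assms(1)])
    then show ?thesis by (simp add: sum_negf)
  qed
  also have "\<dots> = lf (\<lambda>a b. h (?k a) (?k b)) (z x) (w x)"
    unfolding lf_def by (subst sum.swap) (simp add: sum_distrib_right)
  finally show ?thesis .
qed

text \<open>No bad quadruple at \<open>v\<close> has its members in four different parts of the graph cut out by
\<open>{v, x}\<close>.\<close>

definition nice :: "(nat => nat => nat => int) => nat => nat => bool" where
  "nice F v x \<longleftrightarrow> (\<forall>a b c d. (\<forall>y\<in>{a, b, c, d}. adj v y \<and> att v x y) -->
     kap v x a \<noteq> kap v x b --> kap v x a \<noteq> kap v x c --> kap v x a \<noteq> kap v x d -->
     kap v x b \<noteq> kap v x c --> kap v x b \<noteq> kap v x d --> kap v x c \<noteq> kap v x d -->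
     \<not> bad_quad (F v) a b c d)"

lemma att_kap:
  assumes "v \<noteq> x" "v < n" "adj v a" "adj v b" "kap v x a = kap v x b" "att v x a"
  shows "att v x b"
proof (cases "a = x")
  case True
  then show ?thesis using assms kap_eq_n[of b v x] adj_less2[OF assms(4)] adj_irrefl
    by (auto simp: kap_special att_def)
next
  case False
  then have a: "a \<in> away v x" using adj_less2[OF assms(3)] adj_irrefl assms(3) by (auto simp: away_def)
  then have b: "b \<in> away v x" using kap_less[OF a] assms(5) adj_less2[OF assms(4)] kap_special
    by (auto simp: away_def)
  have ba: "reach (away v x) b a" using kap_eq_iff[OF b a] assms(5) by simp
  show ?thesis using assms(6) False reach_trans[OF ba] by (auto simp: att_def)
qed

lemma nbr_away: "adj v a ==> a \<noteq> x ==> a \<in> away v x"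
  using adj_less2 adj_irrefl by (auto simp: away_def)

lemma comp_kap: "y \<in> comp (away v x) a ==> kap v x y = kap v x a"
  using kap_eq_iff[of a v x y] reach_in by (fastforce simp: comp_def)

lemma reach_join:
  assumes "v \<noteq> x" "v \<noteq> y" "x \<noteq> y" "y < n" "adj v a" "att v y a" "\<not> reach (away v y) a x"
  shows "reach (away v x) a y" "a \<in> away v x"
proof -
  have "a \<noteq> x" using assms(7) by auto
  then show ax: "a \<in> away v x" using nbr_away assms by blast
  show "reach (away v x) a y"
  proof (cases "a = y")
    case False
    then obtain q where q: "adj y q" "reach (away v y) a q" using assms(6) by (auto simp: att_def)
    have ay: "a \<in> away v y" using nbr_away False assms by blast
    have "comp (away v y) a \<subseteq> away v x"
      using assms(7) comp_subset[of "away v y" a] by (auto simp: comp_def away_def)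
    then have "reach (away v x) a q" and "q \<in> away v x"
      using reach_comp[OF q(2) ay] reach_mono q(2) ay by (auto simp: comp_def)
    moreover have "y \<in> away v x" using assms by (auto simp: away_def)
    ultimately show ?thesis using reach_step[of q "away v x" y] adj_sym[OF q(1)] reach_trans by blast
  qed simp
qed

text \<open>Another separating vertex \<open>y\<close> joins three of its four legs, so that the modification
along \<open>{v, x}\<close> does not change the quadruples separated by \<open>y\<close>.\<close>

lemma three_legs:
  assumes "v \<noteq> x" "v \<noteq> y" "x \<noteq> y" "x < n" "y < n" "\<forall>u\<in>{a, b, c, d}. adj v u \<and> att v y u"
    "kap v y a \<noteq> kap v y b" "kap v y a \<noteq> kap v y c" "kap v y a \<noteq> kap v y d"
    "kap v y b \<noteq> kap v y c" "kap v y b \<noteq> kap v y d" "kap v y c \<noteq> kap v y d"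
  shows "quad (\<lambda>a b. h (kap v x a) (kap v x b)) a b c d = 0"
proof -
  let ?in = "\<lambda>a. reach (away v y) a x"
  have xy: "x \<in> away v y" using assms by (auto simp: away_def)
  have one: "\<not> (?in p \<and> ?in q)" if "p \<in> {a, b, c, d}" "q \<in> {a, b, c, d}" "kap v y p \<noteq> kap v y q" for p q
  proof
    assume pq: "?in p \<and> ?in q"
    then have "p \<in> away v y" "q \<in> away v y" using reach_in[of "away v y"] xy by auto
    then show False using pq that(3) kap_eq_iff[of p v y q] reach_sym reach_trans by blast
  qed
  have eq: "kap v x p = kap v x q" if "p \<in> {a, b, c, d}" "q \<in> {a, b, c, d}" "\<not> ?in p" "\<not> ?in q" for p q
  proof -
    have "adj v p" "att v y p" "adj v q" "att v y q" using assms(6) that by blast+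
    note j = reach_join[OF assms(1-3,5) this(1,2) that(3)] reach_join[OF assms(1-3,5) this(3,4) that(4)]
    show ?thesis using kap_eq_iff[OF j(2,4)] j(1,3) reach_sym reach_trans by blast
  qed
  have "\<not> ?in a \<and> \<not> ?in b \<or> \<not> ?in c \<and> \<not> ?in d"
    using one[of a c] one[of a d] one[of b c] one[of b d] assms by blast
  then have "kap v x a = kap v x b \<or> kap v x c = kap v x d" using eq by blast
  then show ?thesis by (auto simp: quad_def)
qed

lemma quad_add: "quad (\<lambda>a b. G a b + H a b) a b c d = quad G a b c d + quad H a b c d"
  by (simp add: quad_def)

lemma nice_preserved:
  assumes "nice F v y" "v \<noteq> x" "v \<noteq> y" "x \<noteq> y" "x < n" "y < n"
    and F': "F' v = (\<lambda>a b. F v a b + h (kap v x a) (kap v x b))"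
  shows "nice F' v y"
  unfolding nice_def
proof (intro allI impI)
  fix a b c d
  assume *: "\<forall>y'\<in>{a, b, c, d}. adj v y' \<and> att v y y'"
    "kap v y a \<noteq> kap v y b" "kap v y a \<noteq> kap v y c" "kap v y a \<noteq> kap v y d"
    "kap v y b \<noteq> kap v y c" "kap v y b \<noteq> kap v y d" "kap v y c \<noteq> kap v y d"
  let ?h = "\<lambda>a b. h (kap v x a) (kap v x b)"
  have "quad ?h a b c d = 0" "quad ?h b c a d = 0" "quad ?h c a b d = 0"
    by (rule three_legs[OF assms(2-6)]; use * in auto)+
  then show "\<not> bad_quad (F' v) a b c d"
    using assms(1) * by (auto simp: bad_quad_def F' quad_add nice_def)
qed

lemma class_linked:
  assumes "v \<noteq> x" "adj v a" "adj x a'" "kap v x a = kap v x a'"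
  shows "linked v x (comp (away v x) a) a a'"
proof (cases "a = x")
  case True
  then have "a' = v" using kap_eq_n[of a' v x] adj_less2[OF assms(3)] assms adj_irrefl by (auto simp: kap_special)
  then show ?thesis using True assms comp_subset[of "away v x" a] by (auto simp: linked_def away_def)
next
  case False
  then have a: "a \<in> away v x" using nbr_away assms by blast
  then have "a' \<noteq> v" using kap_less[OF a] assms(4) kap_special by auto
  then have a': "a' \<in> away v x" using nbr_away[OF assms(3)] away_swap by blast
  have "a' \<in> comp (away v x) a" using kap_eq_iff[OF a a'] assms(4) a by (simp add: comp_def)
  then show ?thesis using assms comp_self[OF a] conn_comp comp_subset[of "away v x" a]
    by (auto simp: linked_def away_def)
qed

lemma comp_kap_disjoint: "kap v x a \<noteq> kap v x b ==> comp (away v x) a \<inter> comp (away v x) b = {}"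
  by (metis comp_kap disjoint_iff)

text \<open>Four parts touching both \<open>v\<close> and \<open>x\<close> provide four disjoint
  strands, and \<open>theta_quad\<close> carries each of the three pairings from one pole to the
  other.\<close>

lemma nice_other_end:
  assumes "oddsys F" "v \<noteq> x" "v < n" "x < n" "nice F v x"
  shows "nice F x v"
  unfolding nice_def
proof (intro allI impI notI)
  fix a b c d
  assume *: "\<forall>y'\<in>{a, b, c, d}. adj x y' \<and> att x v y'"
    "kap x v a \<noteq> kap x v b" "kap x v a \<noteq> kap x v c" "kap x v a \<noteq> kap x v d"
    "kap x v b \<noteq> kap x v c" "kap x v b \<noteq> kap x v d" "kap x v c \<noteq> kap x v d" "bad_quad (F x) a b c d"
  have ex: "\<exists>y. adj v y \<and> att v x y \<and> kap v x y = kap v x u" if "u \<in> {a, b, c, d}" for u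
  proof (cases "u = v")
    case True
    then have "adj v x" using that * adj_sym by blast
    then show ?thesis using True by (intro exI[of _ x]) (simp add: att_def kap_special)
  next
    case False
    have xu: "adj x u" "att x v u" using * that by blast+
    then obtain y where y: "adj v y" "reach (away x v) u y" using False by (auto simp: att_def)
    have u: "u \<in> away v x" using nbr_away[of x u v] * that False away_swap by blast
    then have "y \<in> away v x" "reach (away v x) u y" using y reach_in[OF y(2)] away_swap by metis+
    then have "att v x y" "kap v x y = kap v x u"
      using xu(1) reach_sym[of "away v x" u y] kap_eq_iff[OF _ u] by (auto simp: att_def)
    then show ?thesis using y(1) by blast
  qed
  obtain a' b' c' d' where n: "adj v a'" "att v x a'" "kap v x a' = kap v x a"
    "adj v b'" "att v x b'" "kap v x b' = kap v x b" "adj v c'" "att v x c'" "kap v x c' = kap v x c"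
    "adj v d'" "att v x d'" "kap v x d' = kap v x d"
    using ex[of a] ex[of b] ex[of c] ex[of d] by blast
  have d: "kap v x a' \<noteq> kap v x b'" "kap v x a' \<noteq> kap v x c'" "kap v x a' \<noteq> kap v x d'"
    "kap v x b' \<noteq> kap v x c'" "kap v x b' \<noteq> kap v x d'" "kap v x c' \<noteq> kap v x d'"
    using * n by (simp_all add: kap_swap)
  have l: "linked v x (comp (away v x) a') a' a" "linked v x (comp (away v x) b') b' b"
    "linked v x (comp (away v x) c') c' c" "linked v x (comp (away v x) d') d' d"
    using class_linked[OF assms(2)] n * by auto
  have "4 dvd quad (F v) a' b' c' d' + quad (F x) a b c d" "4 dvd quad (F v) b' c' a' d' + quad (F x) b c a d"
    "4 dvd quad (F v) c' a' b' d' + quad (F x) c a b d"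
    by (rule theta_quad[OF assms(1,2) l(1) l(2) l(3) l(4)] theta_quad[OF assms(1,2) l(2) l(3) l(1) l(4)]
      theta_quad[OF assms(1,2) l(3) l(1) l(2) l(4)];
      use d comp_kap_disjoint[of v x] in \<open>simp add: Int_Un_distrib Int_Un_distrib2\<close>)+
  moreover have "\<not> bad_quad (F v) a' b' c' d'" using assms(5) n d unfolding nice_def by blast
  ultimately show False using *(8) unfolding bad_quad_def by (metis dvd_add_right_iff)
qed

end

section \<open>Removing bad quadruples along 2-point cuts\<close>

context sgraph
begin

text \<open>The pair \<open>a\<close>, \<open>b\<close> is joined inside its own part, while
  \<open>c\<close> and \<open>d\<close> are joined through \<open>x\<close>, to which their parts
  are attached. The two connections are disjoint, and \<open>linked_quad\<close> applies.\<close>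

lemma class_quad:
  assumes "oddsys F" "v \<noteq> x" "v < n" "x < n" "adj v a" "adj v b" "kap v x a = kap v x b"
    "adj v c" "adj v d" "att v x c" "att v x d" "kap v x a \<noteq> kap v x c" "kap v x a \<noteq> kap v x d"
  shows "4 dvd quad (F v) a b c d"
proof (cases "a = x")
  case True
  then have "b = a" using kap_eq_n[of b v x] adj_less2[OF assms(6)] assms adj_irrefl by (auto simp: kap_special)
  then show ?thesis by (simp add: quad_def)
next
  case False
  have a: "a \<in> away v x" using nbr_away False assms by blast
  have b: "b \<in> away v x" using nbr_away[OF assms(6), of x] kap_less[OF a] assms kap_special by fastforce
  have ab: "b \<in> comp (away v x) a" using kap_eq_iff[OF a b] assms a by (simp add: comp_def)
  let ?C = "\<lambda>c. insert x (comp (away v x) c)"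
  have C: "conn (?C c) \<and> c \<in> ?C c" if ac: "att v x c" "adj v c" for c
  proof (cases "c = x")
    case True
    then have "comp (away v x) c = {}" by (auto simp: comp_def away_def)
    then show ?thesis using True by simp
  next
    case False
    then obtain y where "adj x y" "reach (away v x) c y" using ac by (auto simp: att_def)
    moreover have c: "c \<in> away v x" using nbr_away False ac by blast
    ultimately have "y \<in> comp (away v x) c" "adj y x" using adj_sym by (auto simp: comp_def)
    then show ?thesis using conn_Un_adj[OF conn_comp conn_single, of y "away v x" c x x] comp_self[OF c] by auto
  qed
  have S': "conn (?C c \<union> ?C d)" using conn_Un_meet[of "?C c" "?C d" x] C assms by blast
  have K: "v \<notin> comp (away v x) u" "x \<notin> comp (away v x) u" for u
    using comp_subset[of "away v x" u] by (auto simp: away_def)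
  have dis: "comp (away v x) a \<inter> (?C c \<union> ?C d) = {}"
    using comp_kap_disjoint[OF assms(12)] comp_kap_disjoint[OF assms(13)] K(2) by blast
  have "v \<notin> ?C c \<union> ?C d" using K(1) assms(2) by blast
  moreover have "c \<in> ?C c \<union> ?C d" "d \<in> ?C c \<union> ?C d" using C assms by blast+
  ultimately show ?thesis
    using linked_quad[OF assms(1,5,6,8,9) conn_comp S' dis K(1)] ab comp_self[OF a] by blast
qed

definition nb :: "nat => nat => nat => nat" where
  "nb v x r = (SOME y. adj v y \<and> kap v x y = r)"

lemma nb: "adj v a ==> adj v (nb v x (kap v x a)) \<and> kap v x (nb v x (kap v x a)) = kap v x a"
  unfolding nb_def by (rule someI[of _ a]) simp

text \<open>Between representatives of different parts at \<open>v\<close>, the form is replaced by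
  the sign form of the labels, which has no bad quadruple. The change \<open>h\<close> is a
  difference of odd numbers, hence even, so oddness survives; subtracting it again at
  \<open>x\<close> keeps the system conserved by \<open>lf_kap_cancel\<close>.\<close>

lemma make_nice:
  assumes F: "oddsys F" and vx: "v \<noteq> x" "v < n" "x < n"
  shows "\<exists>F'. oddsys F' \<and> nice F' v x \<and> nice F' x v \<and>
    (\<forall>u y. u \<noteq> y --> y < n --> {u, y} \<noteq> {v, x} --> nice F u y --> nice F' u y)"
proof -
  define has where "has = (\<lambda>r. \<exists>y. adj v y \<and> kap v x y = r)"
  define h where "h = (\<lambda>r s. if r \<noteq> s \<and> has r \<and> has s then sg r s - F v (nb v x r) (nb v x s) else 0)"
  define F' where "F' = (\<lambda>u a b. if u = v then F v a b + h (kap v x a) (kap v x b)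
    else if u = x then F x a b - h (kap v x a) (kap v x b) else F u a b)"
  have alt: "F v b a = - F v a b" for v a b
    using F unfolding oddsys_def by blast
  have oddF: "adj v a ==> adj v b ==> a \<noteq> b ==> odd (F v a b)" for v a b
    using F unfolding oddsys_def by blast
  have hs: "h s r = - h r s" for r s
    using alt[of v "nb v x s" "nb v x r"] sg_swap[of s r] by (auto simp: h_def)
  have he: "even (h r s)" for r s
  proof (cases "r \<noteq> s \<and> has r \<and> has s")
    case True
    then have "adj v (nb v x r)" "adj v (nb v x s)" "nb v x r \<noteq> nb v x s"
      using nb unfolding has_def by metis+
    then have "odd (F v (nb v x r) (nb v x s))" by (rule oddF)
    moreover have "odd (sg r s)" using True by (auto simp: sg_def)
    ultimately show ?thesis using True by (simp add: h_def)
  qed (auto simp: h_def)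
  have "oddsys F'"
    unfolding oddsys_def
  proof (intro conjI allI impI)
    fix u a b
    show "F' u b a = - F' u a b"
      using hs[of "kap v x b" "kap v x a"] alt[of u b a] alt[of v b a] alt[of x b a] by (auto simp: F'_def)
    show "odd (F' u a b)" if "adj u a" "adj u b" "a \<noteq> b"
      using he that oddF[of u a b] by (cases "u = v"; cases "u = x") (auto simp: F'_def)
  next
    show "conserved F'"
      unfolding conserved_def
    proof (intro allI impI)
      fix z w assume zw: "flow z" "flow w"
      let ?H = "\<lambda>a b. h (kap v x a) (kap v x b)"
      have "lf (F' u) (z u) (w u) = lf (F u) (z u) (w u) +
        (of_bool (u = v) * lf ?H (z v) (w v) - of_bool (u = x) * lf ?H (z x) (w x))" for u
        using vx(1) by (auto simp: F'_def lf_def algebra_simps sum.distrib sum_subtractf)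
      then have "(\<Sum>u<n. lf (F' u) (z u) (w u)) = (\<Sum>u<n. lf (F u) (z u) (w u)) +
         ((\<Sum>u<n. of_bool (u = v) * lf ?H (z v) (w v)) - (\<Sum>u<n. of_bool (u = x) * lf ?H (z x) (w x)))"
        by (simp add: sum.distrib sum_subtractf)
      also have "(\<Sum>u<n. of_bool (u = v) * lf ?H (z v) (w v)) = lf ?H (z v) (w v)"
        using vx by (simp add: of_bool_def if_distrib[of "\<lambda>t. t * _"] sum.delta cong: if_cong)
      also have "(\<Sum>u<n. of_bool (u = x) * lf ?H (z x) (w x)) = lf ?H (z x) (w x)"
        using vx by (simp add: of_bool_def if_distrib[of "\<lambda>t. t * _"] sum.delta cong: if_cong)
      finally show "4 dvd (\<Sum>u<n. lf (F' u) (z u) (w u))"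
        using lf_kap_cancel[OF zw vx, of h] F zw by (simp add: oddsys_def conserved_def)
    qed
  qed
  moreover have "nice F' v x"
    unfolding nice_def
  proof (intro allI impI)
    fix a b c d
    assume *: "\<forall>y'\<in>{a, b, c, d}. adj v y' \<and> att v x y'"
      "kap v x a \<noteq> kap v x b" "kap v x a \<noteq> kap v x c" "kap v x a \<noteq> kap v x d"
      "kap v x b \<noteq> kap v x c" "kap v x b \<noteq> kap v x d" "kap v x c \<noteq> kap v x d"
    let ?r = "\<lambda>a. nb v x (kap v x a)" and ?A = "\<lambda>a. adj v a \<and> att v x a" and ?k = "kap v x"
    have r: "?A (?r a)" "?k (?r a) = ?k a" if "?A a" for a
      using nb[of v a x] att_kap[of v x a "?r a"] that vx by auto
    have cq: "4 dvd quad (F' v) a (?r a) c d" if "?A a" "?A c" "?A d" "?k a \<noteq> ?k c" "?k a \<noteq> ?k d" for a c d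
      using class_quad[OF \<open>oddsys F'\<close> vx, of a "?r a" c d] that r[of a] by auto
    have sgn: "F' v (?r a) (?r b) = sg (?k a) (?k b)" if "?A a" "?A b" "?k a \<noteq> ?k b" for a b
    proof -
      have "has (?k a)" "has (?k b)" using that by (auto simp: has_def)
      then show ?thesis using that r[of a] r[of b] by (simp add: F'_def h_def)
    qed
    have main: "4 dvd quad (F' v) a b c d \<longleftrightarrow> 4 dvd quad sg (?k a) (?k b) (?k c) (?k d)"
      if A: "?A a" "?A b" "?A c" "?A d" and k: "?k a \<noteq> ?k b" "?k a \<noteq> ?k c" "?k a \<noteq> ?k d"
        "?k b \<noteq> ?k c" "?k b \<noteq> ?k d" "?k c \<noteq> ?k d" for a b c d
    proof -
      let ?q = "quad (F' v)"
      have sw: "F' v b a = - F' v a b" for a b using \<open>oddsys F'\<close> unfolding oddsys_def by blast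
      have 1: "4 dvd ?q a (?r a) c d" "4 dvd ?q b (?r b) c d"
        using cq[of a c d] cq[of b c d] A k by simp_all
      have 2: "4 dvd ?q c (?r c) (?r a) (?r b)" "4 dvd ?q d (?r d) (?r a) (?r b)"
        using cq[of c "?r a" "?r b"] cq[of d "?r a" "?r b"] A k r by simp_all
      \<comment> \<open>Move the four neighbours to the representatives of their parts one after
        another. Each move changes the value by a number that \<open>class_quad\<close> shows to be
        divisible by 4.\<close>
      have "?q a b c d = ?q (?r a) (?r b) (?r c) (?r d) + ?q a (?r a) c d - ?q b (?r b) c d
          - ?q c (?r c) (?r a) (?r b) + ?q d (?r d) (?r a) (?r b)"
        using sw[of c "?r a"] sw[of c "?r b"] sw[of "?r c" "?r a"] sw[of "?r c" "?r b"]
          sw[of d "?r a"] sw[of d "?r b"] sw[of "?r d" "?r a"] sw[of "?r d" "?r b"]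
        by (simp add: quad_def)
      moreover have "?q (?r a) (?r b) (?r c) (?r d) = quad sg (?k a) (?k b) (?k c) (?k d)"
        using sgn A k by (simp add: quad_def)
      ultimately show ?thesis using 1 2 by presburger
    qed
    have "\<not> bad_quad sg (?k a) (?k b) (?k c) (?k d)" using sg_not_bad * by blast
    moreover have "?A a" "?A b" "?A c" "?A d" using *(1) by auto
    ultimately show "\<not> bad_quad (F' v) a b c d"
      using main[of a b c d] main[of b c a d] main[of c a b d] *(2-) unfolding bad_quad_def by metis
  qed
  moreover have "nice F' x v" using nice_other_end[OF \<open>oddsys F'\<close> vx \<open>nice F' v x\<close>] .
  moreover have "nice F' u y" if "u \<noteq> y" "y < n" "{u, y} \<noteq> {v, x}" "nice F u y" for u y
  proof -
    consider "u = v" "y \<noteq> x" | "u = x" "y \<noteq> v" | "u \<noteq> v" "u \<noteq> x" using \<open>{u, y} \<noteq> {v, x}\<close> by blast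
    then show ?thesis
    proof cases
      case 1
      show ?thesis unfolding 1
        by (rule nice_preserved[where x = x and F = F and h = h]) (use 1 that vx in \<open>auto simp: F'_def\<close>)
    next
      case 2
      show ?thesis unfolding 2
        by (rule nice_preserved[where x = v and F = F and h = "\<lambda>r s. - h r s"])
          (use 2 that vx in \<open>auto simp: F'_def kap_swap\<close>)
    next
      case 3
      then show ?thesis using that(4) by (simp add: nice_def F'_def)
    qed
  qed
  ultimately show ?thesis by blast
qed

text \<open>Pairs are treated one at a time; a correction along one cut does not spoil the others,
  because it does not affect the quadruples separated there.\<close>

lemma all_nice:
  assumes "oddsys F"
  shows "\<exists>F'. oddsys F' \<and> (\<forall>v<n. \<forall>x<n. v \<noteq> x --> nice F' v x)"
proof -
  define P where "P = {(v, x). v < n \<and> x < n \<and> v \<noteq> x}"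
  have "finite P" by (rule finite_subset[of _ "{..<n} \<times> {..<n}"]) (auto simp: P_def)
  moreover have "\<exists>F'. oddsys F' \<and> (\<forall>(v, x)\<in>Q. nice F' v x)" if "finite Q" "Q \<subseteq> P" for Q
    using that
  proof (induction Q rule: finite_induct)
    case empty
    then show ?case using assms by blast
  next
    case (insert e Q)
    obtain v x where e: "e = (v, x)" by fastforce
    obtain F1 where F1: "oddsys F1" "\<And>v x. (v, x) \<in> Q ==> nice F1 v x" using insert by fastforce
    have vx: "v \<noteq> x" "v < n" "x < n" using insert e by (auto simp: P_def)
    obtain F2 where F2: "oddsys F2" "nice F2 v x" "nice F2 x v"
      "\<And>u y. u \<noteq> y ==> y < n ==> {u, y} \<noteq> {v, x} ==> nice F1 u y ==> nice F2 u y"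
      using make_nice[OF F1(1) vx] by blast
    have "nice F2 u y" if "(u, y) \<in> insert e Q" for u y
    proof (cases "{u, y} = {v, x}")
      case True
      then show ?thesis using F2(2,3) by (auto simp: doubleton_eq_iff)
    next
      case False
      then have "(u, y) \<in> Q" using that e by auto
      then show ?thesis using F2(4)[OF _ _ False F1(2)] insert by (auto simp: P_def)
    qed
    then show ?case using F2(1) by blast
  qed
  ultimately obtain F' where "oddsys F'" "\<forall>(v, x)\<in>P. nice F' v x" by blast
  then show ?thesis by (auto simp: P_def)
qed

text \<open>By \<open>four_terminals\<close> either two neighbours can be joined disjointly from the
  other two, and \<open>linked_quad\<close> makes that pairing divisible by 4, or one vertex
  \<open>x\<close> separates all four away from \<open>v\<close>, which is the case excluded by
  \<open>nice\<close>.\<close>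

lemma nice_good:
  assumes "oddsys F" "\<And>x. x < n ==> x \<noteq> v ==> nice F v x"
    and nbr: "adj v a" "adj v b" "adj v c" "adj v d"
    and d: "a \<noteq> b" "a \<noteq> c" "a \<noteq> d" "b \<noteq> c" "b \<noteq> d" "c \<noteq> d"
    and re: "reach ({..<n} - {v}) a b" "reach ({..<n} - {v}) a c" "reach ({..<n} - {v}) a d"
  shows "\<not> bad_quad (F v) a b c d"
proof -
  define t where "t = (\<lambda>i::nat. if i = 0 then a else if i = 1 then b else if i = 2 then c else d)"
  let ?U = "{..<n} - {v}"
  have lt4: "k < 4 \<longleftrightarrow> k = 0 \<or> k = 1 \<or> k = 2 \<or> k = 3" for k :: nat by auto
  have t: "t 0 = a" "t 1 = b" "t (Suc 0) = b" "t 2 = c" "t 3 = d" by (simp_all add: t_def)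
  have U: "y \<in> ?U" if "adj v y" for y using that adj_less2 adj_irrefl by auto
  have sw: "F v p q = - F v q p" for p q using assms(1) unfolding oddsys_def by blast
  have "inj_on t {..<4}" using d by (auto simp: inj_on_def lt4 t_def)
  moreover have "t i \<in> ?U" "reach ?U (t 0) (t i)" if "i < 4" for i
    using that U nbr re by (auto simp: lt4 t_def)
  ultimately consider S S' i j where "i < 4" "j < 4" "i \<noteq> j" "conn S" "conn S'" "S \<inter> S' = {}" "S \<union> S' \<subseteq> ?U"
      "t i \<in> S" "t j \<in> S" "\<And>k. k < 4 ==> k \<noteq> i ==> k \<noteq> j ==> t k \<in> S'"
    | x where "x \<in> ?U" "\<And>i j. i < 4 ==> j < 4 ==> i \<noteq> j ==> \<not> reach (?U - {x}) (t i) (t j)"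
    using four_terminals[of ?U t] by fastforce
  then show ?thesis
  proof cases
    case 1
    have tn: "adj v (t i)" if "i < 4" for i using that nbr by (auto simp: lt4 t)
    have vS: "v \<notin> S" "v \<notin> S'" using 1(7) by auto
    have *: "4 dvd quad (F v) (t i) (t j) (t k) (t l)" if "k < 4" "l < 4" "k \<noteq> i" "k \<noteq> j" "l \<noteq> i" "l \<noteq> j" for k l
      by (rule linked_quad[OF assms(1) tn[OF 1(1)] tn[OF 1(2)] tn[OF that(1)] tn[OF that(2)] 1(4,5,6) vS 1(8,9)
        1(10)[OF that(1,3,4)] 1(10)[OF that(2,5,6)]])
    have "4 dvd quad (F v) a b c d \<or> 4 dvd quad (F v) b c a d \<or> 4 dvd quad (F v) c a b d"
    proof -
      have perm: "quad (F v) q p r s = - quad (F v) p q r s" "quad (F v) r s p q = - quad (F v) p q r s" for p q r s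
        using sw[of r p] sw[of r q] sw[of s p] sw[of s q] by (simp_all add: quad_def)
      from 1(1-3) consider "{i, j} = {0, 1}" | "{i, j} = {1, 2}" | "{i, j} = {0, 2}" | "{i, j} = {2, 3}" | "{i, j} = {0, 3}" | "{i, j} = {1, 3}"
        unfolding lt4 by auto
      then show ?thesis
      proof cases
        case 1
        then have "i = 0 \<and> j = 1 \<or> i = 1 \<and> j = 0" by (auto simp: doubleton_eq_iff)
        then show ?thesis using *[of 2 3] perm(1)[of b a c d]  by (auto simp: t)
      next
        case 2
        then have "i = 1 \<and> j = 2 \<or> i = 2 \<and> j = 1" by (auto simp: doubleton_eq_iff)
        then show ?thesis using *[of 0 3] perm(1)[of c b a d]  by (auto simp: t)
      next
        case 3
        then have "i = 0 \<and> j = 2 \<or> i = 2 \<and> j = 0" by (auto simp: doubleton_eq_iff)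
        then show ?thesis using *[of 1 3] perm(1)[of a c b d]  by (auto simp: t)
      next
        case 4
        then have "i = 2 \<and> j = 3 \<or> i = 3 \<and> j = 2" by (auto simp: doubleton_eq_iff)
        then show ?thesis using *[of 0 1] perm(1)[of d c a b] perm(2)[of c d a b] by (auto simp: t)
      next
        case 5
        then have "i = 0 \<and> j = 3 \<or> i = 3 \<and> j = 0" by (auto simp: doubleton_eq_iff)
        then show ?thesis using *[of 1 2] perm(1)[of d a b c] perm(2)[of a d b c] by (auto simp: t)
      next
        case 6
        then have "i = 1 \<and> j = 3 \<or> i = 3 \<and> j = 1" by (auto simp: doubleton_eq_iff)
        then show ?thesis using *[of 2 0] perm(1)[of d b c a] perm(2)[of b d c a] by (auto simp: t)
      qed
    qed
    then show ?thesis by (auto simp: bad_quad_def)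
  next
    case 2
    have x: "x < n" "x \<noteq> v" using 2(1) by auto
    have aw: "?U - {x} = away v x" by (auto simp: away_def)
    have k: "kap v x p \<noteq> kap v x q" if "adj v p" "adj v q" "\<not> reach (away v x) p q" for p q
    proof
      assume e: "kap v x p = kap v x q"
      have "p = x \<longleftrightarrow> q = x"
        using e kap_eq_n[of p v x] kap_eq_n[of q v x] adj_less2 that adj_irrefl by auto
      then show False using that e kap_eq_iff[of p v x q] nbr_away reach_refl by metis
    qed
    have nr: "\<not> reach (away v x) a b" "\<not> reach (away v x) a c" "\<not> reach (away v x) a d"
      "\<not> reach (away v x) b c" "\<not> reach (away v x) b d" "\<not> reach (away v x) c d"
      using 2(2)[of 0 1] 2(2)[of 0 2] 2(2)[of 0 3] 2(2)[of 1 2] 2(2)[of 1 3] 2(2)[of 2 3] by (simp_all add: t aw)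
    \<comment> \<open>One of \<open>a\<close>, \<open>b\<close> is cut off from \<open>p\<close> by
      \<open>v\<close> and \<open>x\<close> but joined to it away from \<open>v\<close>. The
      connection must run through \<open>x\<close>, so the part of \<open>p\<close> touches
      \<open>x\<close>.\<close>
    have att: "att v x p" if p: "adj v p" "reach ?U a p" for p
    proof -
      obtain q where q: "adj v q" "reach ?U a q" "\<not> reach (away v x) p q"
      proof (cases "p = a")
        case True
        then show ?thesis using that[of b] nbr re nr by blast
      next
        case False
        show ?thesis
        proof (cases "reach (away v x) p a")
          case True
          then have "\<not> reach (away v x) p b" using nr(1) reach_sym reach_trans by blast
          then show ?thesis using that[of b] nbr re by blast
        next
          case False
          then show ?thesis using that[of a] nbr by simp
        qed
      qed
      have pq: "reach ?U p q" using p q reach_sym reach_trans by blast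
      show ?thesis
      proof (rule ccontr)
        assume na: "\<not> att v x p"
        then have "p \<noteq> x" by (simp add: att_def)
        have "reach (away v x) p q \<and> q \<noteq> x" using pq
        proof (induction rule: reach_induct)
          case refl
          then show ?case using \<open>p \<noteq> x\<close> by simp
        next
          case (step y z)
          then have "z \<noteq> x" using na adj_sym by (auto simp: att_def)
          then show ?case using step reach_step[of y "away v x" z] reach_trans by (auto simp: away_def)
        qed
        then show False using q by blast
      qed
    qed
    show ?thesis
      using assms(2)[OF x] nbr att[OF nbr(1)] att[OF nbr(2) re(1)] att[OF nbr(3) re(2)] att[OF nbr(4) re(3)]
        k[OF _ _ nr(1)] k[OF _ _ nr(2)] k[OF _ _ nr(3)] k[OF _ _ nr(4)] k[OF _ _ nr(5)] k[OF _ _ nr(6)]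
      unfolding nice_def by auto
  qed
qed

end

section \<open>From odd forms to linear orders\<close>

lemma total_order_rank:
  fixes lt :: "nat => nat => bool"
  assumes fin: "finite N" and irr: "\<And>a. \<not> lt a a"
    and trans: "\<And>a b c. a \<in> N ==> b \<in> N ==> c \<in> N ==> lt a b ==> lt b c ==> lt a c"
    and total: "\<And>a b. a \<in> N ==> b \<in> N ==> a \<noteq> b ==> lt a b \<or> lt b a"
  shows "\<exists>\<rho> :: nat => nat. \<forall>a\<in>N. \<forall>b\<in>N. \<rho> a < \<rho> b \<longleftrightarrow> lt a b"
proof -
  define \<rho> where "\<rho> = (\<lambda>a. card {c \<in> N. lt c a})"
  have *: "\<rho> a < \<rho> b" if "a \<in> N" "b \<in> N" "lt a b" for a b
    unfolding \<rho>_def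
  proof (rule psubset_card_mono)
    show "{c \<in> N. lt c a} \<subset> {c \<in> N. lt c b}"
      using trans[OF _ that(1,2) _ that(3)] that irr[of a] by blast
  qed (use fin in simp)
  have "lt a b" if "a \<in> N" "b \<in> N" "\<rho> a < \<rho> b" for a b
    using total[OF that(1,2)] *[OF that(2,1)] that by fastforce
  then show ?thesis using * by blast
qed

context sgraph
begin

text \<open>The components left after removing \<open>v\<close> are lined up one after another, each
  ordered cyclically and cut open at its representative. The resulting sign form differs from
  \<open>F v\<close> by multiples of 4 and by terms that see one argument only through its
  component; flows at \<open>v\<close> have sum zero on every component and do not notice the
  latter.\<close>

lemma rank_at:
  assumes F: "oddsys F" and nice: "\<And>x. x < n ==> x \<noteq> v ==> nice F v x" and v: "v < n"
  shows "\<exists>\<rho> :: nat => nat. inj_on \<rho> {a. adj v a} \<and> (\<forall>a. adj v a --> adj v p --> \<rho> p \<le> \<rho> a) \<and>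
    (\<forall>z w. flow z --> flow w --> 4 dvd lf (\<lambda>a b. sg (\<rho> a) (\<rho> b) - F v a b) (z v) (w v))"
proof -
  let ?U = "{..<n} - {v}"
  define N where "N = {a. adj v a}"
  define \<kappa> where "\<kappa> = (\<lambda>a. if a = v then n else LEAST y. reach ?U a y)"
  \<comment> \<open>Every component is cut open at its representative; in the component of
    \<open>p\<close> this has to be \<open>p\<close>, so that \<open>p\<close> can get the lowest
    rank.\<close>
  define r where "r = (\<lambda>k. if adj v p \<and> \<kappa> p = k then p else SOME a. adj v a \<and> \<kappa> a = k)"
  \<comment> \<open>The value 0 puts the component of \<open>p\<close> in front of all
    others.\<close>
  define key where "key = (\<lambda>k. if adj v p \<and> \<kappa> p = k then 0 else Suc k)"
  \<comment> \<open>The cyclic orientation of the triple \<open>r k\<close>, \<open>a\<close>,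
    \<open>b\<close>. For the sign form of a linear order starting at \<open>r k\<close> it is 1 if
    \<open>a\<close> precedes \<open>b\<close> and -1 otherwise, which suggests the test modulo
    4.\<close>
  define om where "om = (\<lambda>k a b. F v (r k) a + F v a b + F v b (r k))"
  define lt where "lt = (\<lambda>a b. key (\<kappa> a) < key (\<kappa> b) \<or>
    \<kappa> a = \<kappa> b \<and> a \<noteq> b \<and> b \<noteq> r (\<kappa> a) \<and> (a = r (\<kappa> a) \<or> om (\<kappa> a) a b mod 4 = 1))"
  have sw: "F v b a = - F v a b" for a b using F unfolding oddsys_def by blast
  have F0: "F v a a = 0" for a using sw[of a a] by simp
  have odd: "odd (F v a b)" if "a \<in> N" "b \<in> N" "a \<noteq> b" for a b
    using F that unfolding oddsys_def N_def by blast
  have NU: "a \<in> ?U" if "a \<in> N" for a using that adj_less2 adj_irrefl by (auto simp: N_def)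
  have finN: "finite N" using NU by (intro finite_subset[of N ?U]) auto
  have rk: "reach ?U a (\<kappa> a)" if "a \<in> ?U" for a
    using LeastI[of "reach ?U a" a] that by (auto simp: \<kappa>_def)
  have kn: "\<kappa> a < n" if "a \<in> ?U" for a using reach_in[OF rk[OF that]] that by auto
  have keq: "\<kappa> a = \<kappa> b \<longleftrightarrow> reach ?U a b" if "a \<in> ?U" "b \<in> ?U" for a b
  proof
    assume "\<kappa> a = \<kappa> b"
    then show "reach ?U a b" using rk[OF that(1)] rk[OF that(2)] reach_sym reach_trans by metis
  next
    assume "reach ?U a b"
    then have "reach ?U a = reach ?U b" using reach_sym reach_trans by blast
    then show "\<kappa> a = \<kappa> b" using that by (auto simp: \<kappa>_def)
  qed
  have r: "r (\<kappa> a) \<in> N \<and> \<kappa> (r (\<kappa> a)) = \<kappa> a" if "a \<in> N" for a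
  proof -
    have "adj v (SOME b. adj v b \<and> \<kappa> b = \<kappa> a) \<and> \<kappa> (SOME b. adj v b \<and> \<kappa> b = \<kappa> a) = \<kappa> a"
      by (rule someI[of _ a]) (use that in \<open>simp add: N_def\<close>)
    then show ?thesis by (auto simp: r_def N_def)
  qed
  have keyinj: "key k = key l \<longleftrightarrow> k = l" for k l by (auto simp: key_def)
  have omsw: "om k b a = - om k a b" for k a b
    using sw[of "r k" a] sw[of a b] sw[of b "r k"] by (simp add: om_def)
  have omodd: "odd (om (\<kappa> a) a b)" if "a \<in> N" "b \<in> N" "a \<noteq> b" "a \<noteq> r (\<kappa> a)" "b \<noteq> r (\<kappa> a)" for a b
    using odd[of "r (\<kappa> a)" a] odd[of a b] odd[of b "r (\<kappa> a)"] that r[of a] by (auto simp: om_def)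
  have ltsame: "lt a b \<longleftrightarrow> b \<noteq> r (\<kappa> a) \<and> (a = r (\<kappa> a) \<or> om (\<kappa> a) a b mod 4 = 1)" if "\<kappa> a = \<kappa> b" "a \<noteq> b" for a b
    using that by (auto simp: lt_def)
  have ltdiff: "lt a b \<longleftrightarrow> key (\<kappa> a) < key (\<kappa> b)" if "\<kappa> a \<noteq> \<kappa> b" for a b
    using that by (auto simp: lt_def)
  have irr: "\<not> lt a a" for a by (simp add: lt_def)
  have total: "lt a b \<or> lt b a" if "a \<in> N" "b \<in> N" "a \<noteq> b" for a b
  proof (cases "\<kappa> a = \<kappa> b")
    case True
    show ?thesis
    proof (cases "a = r (\<kappa> a) \<or> b = r (\<kappa> a)")
      case False
      then have "odd (om (\<kappa> a) a b)" using omodd that by blast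
      then have "om (\<kappa> a) a b mod 4 = 1 \<or> om (\<kappa> a) b a mod 4 = 1"
        unfolding omsw[of "\<kappa> a" b a] by presburger
      then show ?thesis using ltsame[of a b] ltsame[of b a] True that False by auto
    qed (use ltsame[of a b] ltsame[of b a] True that in auto)
  next
    case False
    then have "key (\<kappa> a) \<noteq> key (\<kappa> b)" using keyinj by simp
    then show ?thesis using ltdiff[of a b] ltdiff[of b a] False by auto
  qed
  have trans: "lt a c" if N: "a \<in> N" "b \<in> N" "c \<in> N" and l: "lt a b" "lt b c" for a b c
  proof (cases "\<kappa> a = \<kappa> b \<and> \<kappa> b = \<kappa> c")
    case True
    let ?r = "r (\<kappa> a)"
    have ne: "a \<noteq> b" "b \<noteq> c" using l irr by auto
    have b: "b \<noteq> ?r" "c \<noteq> ?r" "om (\<kappa> a) b c mod 4 = 1"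
      using l ltsame[of a b] ltsame[of b c] True ne by auto
    show ?thesis
    proof (cases "a = ?r")
      case True
      then show ?thesis using b ltsame[of a c] \<open>\<kappa> a = \<kappa> b \<and> \<kappa> b = \<kappa> c\<close> by auto
    next
      case False
      have A: "om (\<kappa> a) a b mod 4 = 1" using l ltsame[of a b] True ne False by auto
      have "a \<noteq> c"
      proof
        assume "a = c"
        then show False using A b(3) omsw[of "\<kappa> a" b a] by presburger
      qed
      have "om (\<kappa> a) a c mod 4 = 1"
      proof (rule ccontr)
        assume "om (\<kappa> a) a c mod 4 \<noteq> 1"
        moreover have "odd (om (\<kappa> a) a c)" using omodd N \<open>a \<noteq> c\<close> False b by blast
        ultimately have C: "om (\<kappa> a) a c mod 4 = 3" by presburger
        have rr: "reach ?U ?r a" "reach ?U ?r b" "reach ?U ?r c"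
          using keq[of ?r a] keq[of ?r b] keq[of ?r c] True r[OF N(1)] NU N by auto
        \<comment> \<open>With \<open>om\<close> equal to 1, 1, 3 modulo 4 on \<open>ab\<close>,
          \<open>bc\<close>, \<open>ac\<close>, all three pairings of the representative with
          \<open>a\<close>, \<open>b\<close>, \<open>c\<close> would be 2 modulo 4.\<close>
        have "\<not> bad_quad (F v) ?r a b c"
          by (rule nice_good[OF F nice]) (use r[OF N(1)] N rr ne \<open>a \<noteq> c\<close> False b in \<open>auto simp: N_def\<close>)
        moreover have "quad (F v) ?r a b c = om (\<kappa> a) a c - om (\<kappa> a) a b"
          "quad (F v) a b ?r c = om (\<kappa> a) b c - om (\<kappa> a) a c"
          "quad (F v) b ?r a c = - om (\<kappa> a) a b - om (\<kappa> a) b c"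
          using sw[of ?r a] sw[of ?r b] sw[of ?r c] sw[of a b] sw[of b c] sw[of a c]
          by (simp_all add: quad_def om_def)
        ultimately show False using A b(3) C unfolding bad_quad_def by presburger
      qed
      then show ?thesis using ltsame[of a c] True \<open>a \<noteq> c\<close> b by auto
    qed
  next
    case False
    have le: "key (\<kappa> a) \<le> key (\<kappa> b)" "key (\<kappa> b) \<le> key (\<kappa> c)" using l by (auto simp: lt_def)
    have "key (\<kappa> a) < key (\<kappa> c)"
    proof (rule ccontr)
      assume "\<not> key (\<kappa> a) < key (\<kappa> c)"
      then have "key (\<kappa> a) = key (\<kappa> b)" "key (\<kappa> b) = key (\<kappa> c)" using le by auto
      then show False using False keyinj by blast
    qed
    then show ?thesis by (simp add: lt_def)
  qed
  have "\<exists>\<rho> :: nat => nat. \<forall>a\<in>N. \<forall>b\<in>N. \<rho> a < \<rho> b \<longleftrightarrow> lt a b"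
    by (rule total_order_rank[where lt = lt]) (fact finN irr trans total)+
  then obtain \<rho> :: "nat => nat" where \<rho>: "\<And>a b. a \<in> N ==> b \<in> N ==> \<rho> a < \<rho> b \<longleftrightarrow> lt a b"
    by blast
  have inj: "inj_on \<rho> N"
    using \<rho> total unfolding inj_on_def by (metis less_irrefl)
  have least: "\<rho> p \<le> \<rho> a" if "adj v a" "adj v p" for a
  proof -
    have "\<not> lt a p"
      using that by (auto simp: lt_def key_def r_def)
    then show ?thesis using \<rho>[of a p] that by (simp add: N_def)
  qed
  let ?G = "\<lambda>a b. sg (\<rho> a) (\<rho> b) - F v a b" and ?R = "\<lambda>a. r (\<kappa> a)"
  have Gsw: "?G b a = - ?G a b" for a b using sw[of a b] by (simp add: sg_swap[of "\<rho> b"])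
  \<comment> \<open>Normalised by rows and columns at the representatives, the difference is
    divisible by 4. Across components the signs drop out and \<open>linked_quad\<close> remains;
    inside a component it is the sign minus \<open>om\<close>, which agree modulo 4.\<close>
  have D: "4 dvd ?G a b - ?G a (?R b) - ?G (?R a) b + ?G (?R a) (?R b)" if N: "a \<in> N" "b \<in> N" for a b
  proof (cases "\<kappa> a = \<kappa> b")
    case False
    have s: "sg (\<rho> a') (\<rho> b') = sg (key (\<kappa> a)) (key (\<kappa> b))"
      if "a' \<in> N" "b' \<in> N" "\<kappa> a' = \<kappa> a" "\<kappa> b' = \<kappa> b" for a' b'
      using \<rho>[OF that(1,2)] \<rho>[OF that(2,1)] ltdiff[of a' b'] ltdiff[of b' a'] that False by (simp add: sg_def)
    have "4 dvd quad (F v) a (?R a) b (?R b)"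
    proof (rule linked_quad[OF F _ _ _ _ conn_comp conn_comp])
      show "comp ?U a \<inter> comp ?U b = {}"
        using keq[of a b] False NU N reach_trans[OF _ reach_sym] unfolding comp_def by blast
      show "v \<notin> comp ?U a" "v \<notin> comp ?U b" using comp_subset by blast+
      show "a \<in> comp ?U a" "b \<in> comp ?U b" using NU N by (auto intro!: comp_self)
      show "?R a \<in> comp ?U a" "?R b \<in> comp ?U b"
        using keq[of a "?R a"] keq[of b "?R b"] r[OF N(1)] r[OF N(2)] NU N by (auto simp: comp_def)
    qed (use r[OF N(1)] r[OF N(2)] N in \<open>auto simp: N_def\<close>)
    moreover have "?G a b - ?G a (?R b) - ?G (?R a) b + ?G (?R a) (?R b) = - quad (F v) a (?R a) b (?R b)"
      using s[of a b] s[of a "?R b"] s[of "?R a" b] s[of "?R a" "?R b"] r[OF N(1)] r[OF N(2)] N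
      by (simp add: quad_def)
    ultimately show ?thesis by simp
  next
    case True
    let ?r = "?R a"
    have rb: "?R b = ?r" using True by simp
    have G0: "?G ?r ?r = 0" by (simp add: F0 sg_def)
    show ?thesis
    proof (cases "a = ?r \<or> b = ?r \<or> a = b")
      case True
      then consider "a = ?r" | "b = ?r" | "a = b" by blast
      then show ?thesis
      proof cases
        case 1
        then have "?G a b = ?G ?r b" "?G a (?R b) = ?G ?r ?r" using rb by simp_all
        then show ?thesis using rb by simp
      next
        case 2
        then have "?G a b = ?G a (?R b)" "?G (?R a) b = ?G (?R a) (?R b)" using rb by simp_all
        then show ?thesis by simp
      next
        case 3
        have "?G b b = 0" by (simp add: F0 sg_def)
        then have "?G a b - ?G a (?R b) - ?G (?R a) b + ?G (?R a) (?R b) = 0"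
          using Gsw[of ?r b] G0 unfolding rb unfolding 3 by linarith
        then show ?thesis by simp
      qed
    next
      case False
      have rN: "?r \<in> N" "\<kappa> ?r = \<kappa> a" using r[OF N(1)] by auto
      have "lt ?r b" "lt ?r a" using False True ltsame[of ?r a] ltsame[of ?r b] rN by auto
      then have s: "sg (\<rho> ?r) (\<rho> b) = 1" "sg (\<rho> a) (\<rho> ?r) = -1"
        using \<rho>[OF rN(1) N(2)] \<rho>[OF rN(1) N(1)] by (simp_all add: sg_def)
      have o: "odd (om (\<kappa> a) a b)" using omodd N False by blast
      have "sg (\<rho> a) (\<rho> b) = (if om (\<kappa> a) a b mod 4 = 1 then 1 else -1)"
        using \<rho>[OF N] \<rho>[OF N(2,1)] ltsame[of a b] total[OF N] True False irr trans[OF N N(1)]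
        by (auto simp: sg_def)
      moreover have "4 dvd (if m mod 4 = 1 then 1 else -1) - m" if "odd m" for m :: int
        using that by presburger
      moreover have "?G a b - ?G a (?R b) - ?G (?R a) b + ?G (?R a) (?R b) = sg (\<rho> a) (\<rho> b) - om (\<kappa> a) a b"
        using s G0 sw[of a ?r] sw[of b ?r] rb by (simp add: om_def)
      ultimately show ?thesis using o by (simp only:)
    qed
  qed
  have fib: "(\<Sum>b\<in>{b. b < n \<and> \<kappa> b = k}. w v b) = 0" if w: "flow w" for w k
  proof -
    let ?C = "{b \<in> ?U. \<kappa> b = k}"
    have "(\<Sum>y\<in>?C. \<Sum>b\<in>{v}. w y b) = 0"
    proof (rule flow_cut[OF w])
      fix y b assume y: "y \<in> ?C" "adj y b"
      show "b \<in> ?C \<union> {v}"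
        using y adj_less2[OF y(2)] keq[of y b] reach_step[of y ?U b] by (cases "b = v") auto
    qed (use v in auto)
    moreover have "w y v = - w v y" for y using w antichain_swap unfolding flow_def by blast
    ultimately have *: "(\<Sum>y\<in>?C. w v y) = 0" by (simp add: sum_negf)
    have "w v v = 0" using w antichain_zero adj_irrefl unfolding flow_def by blast
    then have "(\<Sum>b\<in>{b. b < n \<and> \<kappa> b = k}. w v b) = (\<Sum>y\<in>?C. w v y)"
      by (intro sum.mono_neutral_right) auto
    then show ?thesis using * by simp
  qed
  have "4 dvd lf ?G (z v) (w v)" if zw: "flow z" "flow w" for z w
  proof -
    let ?D = "\<lambda>a b. ?G a b - ?G a (?R b) - ?G (?R a) b + ?G (?R a) (?R b)"
    \<comment> \<open>The subtracted rows and columns see one argument only through its component,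
      so by \<open>fib\<close> they vanish on flows.\<close>
    have 1: "(\<Sum>a<n. \<Sum>b<n. H a (?R b) * z v a * w v b) = 0" for H
    proof -
      have "(\<Sum>b<n. (H a (r (\<kappa> b)) * z v a) * w v b) = 0" for a
        by (rule sum_fibres_zero[where k = \<kappa>]) (rule fib[OF zw(2)])
      then show ?thesis by simp
    qed
    have 2: "(\<Sum>a<n. \<Sum>b<n. H (?R a) b * z v a * w v b) = 0" for H
    proof -
      have "(\<Sum>a<n. (H (r (\<kappa> a)) b * w v b) * z v a) = 0" for b
        by (rule sum_fibres_zero[where k = \<kappa>]) (rule fib[OF zw(1)])
      then show ?thesis by (subst sum.swap) (simp add: mult_ac)
    qed
    have "lf ?D (z v) (w v) = lf ?G (z v) (w v)
        - (\<Sum>a<n. \<Sum>b<n. ?G a (?R b) * z v a * w v b)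
        - (\<Sum>a<n. \<Sum>b<n. ?G (?R a) b * z v a * w v b)
        + (\<Sum>a<n. \<Sum>b<n. ?G (?R a) (?R b) * z v a * w v b)"
      unfolding lf_def by (simp only: left_diff_distrib distrib_right sum.distrib sum_subtractf)
    then have "lf ?G (z v) (w v) = lf ?D (z v) (w v)"
      using 1[of ?G] 2[of ?G] 2[of "\<lambda>a b. ?G a (?R b)"] by simp
    also have "4 dvd \<dots>"
      unfolding lf_def
    proof (intro dvd_sum)
      fix a b
      have "z v a = 0 \<or> w v b = 0 \<or> a \<in> N \<and> b \<in> N"
        using zw antichain_zero unfolding flow_def N_def by blast
      then show "4 dvd ?D a b * z v a * w v b" using D[of a b] by (auto intro: dvd_mult2)
    qed
    finally show ?thesis .
  qed
  then show ?thesis using inj least unfolding N_def by blast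
qed

theorem rank_system:
  assumes "oddsys F"
  shows "\<exists>\<rho> :: nat => nat => nat. (\<forall>v<n. inj_on (\<rho> v) {a. adj v a}) \<and>
    (\<forall>v<n. \<forall>a. adj v a --> adj v (p v) --> \<rho> v (p v) \<le> \<rho> v a) \<and> conserved (\<lambda>v a b. sg (\<rho> v a) (\<rho> v b))"
proof -
  obtain G where G: "oddsys G" "\<And>v x. v < n ==> x < n ==> v \<noteq> x ==> nice G v x"
    using all_nice[OF assms] by blast
  have "\<forall>v. \<exists>\<rho> :: nat => nat. v < n --> inj_on \<rho> {a. adj v a} \<and> (\<forall>a. adj v a --> adj v (p v) --> \<rho> (p v) \<le> \<rho> a) \<and>
    (\<forall>z w. flow z --> flow w --> 4 dvd lf (\<lambda>a b. sg (\<rho> a) (\<rho> b) - G v a b) (z v) (w v))"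
    using rank_at[OF G(1)] G(2) by simp
  from choice[OF this] obtain \<rho> :: "nat => nat => nat" where "\<forall>v. v < n --> inj_on (\<rho> v) {a. adj v a} \<and>
    (\<forall>a. adj v a --> adj v (p v) --> \<rho> v (p v) \<le> \<rho> v a) \<and>
    (\<forall>z w. flow z --> flow w --> 4 dvd lf (\<lambda>a b. sg (\<rho> v a) (\<rho> v b) - G v a b) (z v) (w v))" ..
  then have \<rho>: "\<And>v. v < n ==> inj_on (\<rho> v) {a. adj v a}"
    "\<And>v a. v < n ==> adj v a ==> adj v (p v) ==> \<rho> v (p v) \<le> \<rho> v a"
    "\<And>v z w. v < n ==> flow z ==> flow w ==> 4 dvd lf (\<lambda>a b. sg (\<rho> v a) (\<rho> v b) - G v a b) (z v) (w v)"
    by simp_all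
  have "conserved (\<lambda>v a b. sg (\<rho> v a) (\<rho> v b))"
    unfolding conserved_def
  proof (intro allI impI)
    fix z w assume zw: "flow z" "flow w"
    have "(\<Sum>v<n. lf (\<lambda>a b. sg (\<rho> v a) (\<rho> v b)) (z v) (w v)) =
      (\<Sum>v<n. lf (\<lambda>a b. sg (\<rho> v a) (\<rho> v b) - G v a b) (z v) (w v)) + (\<Sum>v<n. lf (G v) (z v) (w v))"
      unfolding sum.distrib[symmetric]
      by (intro sum.cong refl) (simp add: lf_def left_diff_distrib sum_subtractf)
    moreover have "4 dvd (\<Sum>v<n. lf (\<lambda>a b. sg (\<rho> v a) (\<rho> v b) - G v a b) (z v) (w v))"
      using \<rho>(3)[OF _ zw] by (intro dvd_sum) auto
    moreover have "4 dvd (\<Sum>v<n. lf (G v) (z v) (w v))"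
      using G(1) zw unfolding oddsys_def conserved_def by blast
    ultimately show "4 dvd (\<Sum>v<n. lf (\<lambda>a b. sg (\<rho> v a) (\<rho> v b)) (z v) (w v))" by simp
  qed
  then show ?thesis using \<rho>(1,2) by blast
qed

end

section \<open>Ranked trees\<close>

text \<open>Cyclic orders may be cut anywhere; cutting them at the parent edge makes the parent the
  first neighbour, so that the children and chords of every vertex appear from left to
  right.\<close>

locale ranked_tree = sgraph +
  fixes rt :: nat and par :: "nat => nat" and dep :: "nat => nat" and \<rho> :: "nat => nat => nat"
  assumes rt_less: "rt < n" and dep_rt: "dep rt = 0"
    and par: "v < n ==> v \<noteq> rt ==> adj v (par v) \<and> dep v = Suc (dep (par v))"
    and rank_inj: "v < n ==> inj_on (\<rho> v) {a. adj v a}"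
    and rank_par: "v < n ==> v \<noteq> rt ==> adj v a ==> \<rho> v (par v) \<le> \<rho> v a"
    and rank_conserved: "conserved (\<lambda>v a b. sg (\<rho> v a) (\<rho> v b))"
begin

definition chd :: "nat => nat => bool" where
  "chd v a \<longleftrightarrow> a < n \<and> a \<noteq> rt \<and> par a = v"

definition dn :: "nat => nat set" where
  "dn v = {a. adj v a \<and> \<not> (v \<noteq> rt \<and> a = par v)}"

definition nt :: "nat => nat => bool" where
  "nt v a \<longleftrightarrow> adj v a \<and> \<not> chd v a \<and> \<not> chd a v"

lemma chd_adj: "chd v a ==> adj v a"
  using par adj_sym by (auto simp: chd_def)

lemma chd_dep: "chd v a ==> dep a = Suc (dep v)"
  using par by (auto simp: chd_def)

lemma chd_less: "chd v a ==> v < n" "chd v a ==> a < n"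
  using chd_adj adj_less adj_less2 by blast+

lemma chd_dn: "chd v a ==> a \<in> dn v"
  using chd_adj chd_dep[of v a] par[of v] chd_less by (force simp: dn_def)

lemma dn_iff: "a \<in> dn v \<longleftrightarrow> adj v a \<and> \<not> chd a v"
  using adj_less by (auto simp: dn_def chd_def)

lemma dn_cases: "a \<in> dn v ==> chd v a \<or> nt v a"
  by (auto simp: dn_iff nt_def)

lemma nt_dn: "nt v a ==> a \<in> dn v"
  by (auto simp: dn_iff nt_def)

lemma nt_sym: "nt v a ==> nt a v"
  using adj_sym by (auto simp: nt_def)

lemma dn_less: "a \<in> dn v ==> v < n" "a \<in> dn v ==> a < n"
  using adj_less adj_less2 by (auto simp: dn_iff)

lemma finite_dn: "finite (dn v)"
  using dn_less by (intro finite_subset[of "dn v" "{..<n}"]) auto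

lemma down_induct [consumes 1, case_names node]:
  assumes "v < n" "\<And>v. v < n ==> (\<And>a. chd v a ==> P a) ==> P v"
  shows "P v"
  using assms(1)
proof (induction "(\<Sum>u<n. dep u) - dep v" arbitrary: v rule: less_induct)
  case less
  show ?case
  proof (rule assms(2)[OF less.prems])
    fix a assume a: "chd v a"
    have "dep a \<le> (\<Sum>u<n. dep u)" using chd_less[OF a] by (intro member_le_sum) auto
    then show "P a" using chd_dep[OF a] chd_less[OF a] by (intro less.hyps) auto
  qed
qed

lemma up_induct [consumes 1, case_names root child]:
  assumes "v < n" "P rt" "\<And>v a. chd v a ==> P v ==> P a"
  shows "P v"
  using assms(1)
proof (induction "dep v" arbitrary: v rule: less_induct)
  case less
  show ?case
  proof (cases "v = rt")
    case False
    then have "chd (par v) v" using less.prems by (simp add: chd_def)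
    then show ?thesis using chd_dep chd_less less.hyps[of "par v"] assms(3) by (metis lessI)
  qed (simp add: assms(2))
qed

inductive_set ST :: "nat => nat set" for v where
  ST_self: "v \<in> ST v"
| ST_chd: "w \<in> ST v ==> chd w u ==> u \<in> ST v"

lemma ST_trans: "w \<in> ST u ==> u \<in> ST v ==> w \<in> ST v"
  by (induction rule: ST.induct) (auto intro: ST_chd)

lemma ST_cases: "w \<in> ST v ==> w = v \<or> (\<exists>a. chd v a \<and> w \<in> ST a)"
  by (induction rule: ST.induct) (auto intro: ST_self ST_chd)

lemma ST_unfold: "ST v = insert v (\<Union>a\<in>{a. chd v a}. ST a)"
  using ST_cases ST_self ST_trans[OF _ ST_chd[OF ST_self]] by fastforce

lemma ST_dep: "w \<in> ST v ==> dep v \<le> dep w"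
  by (induction rule: ST.induct) (auto simp: chd_dep)

lemma ST_less: "w \<in> ST v ==> v < n ==> w < n"
  by (induction rule: ST.induct) (auto simp: chd_less)

lemma ST_root: "v < n ==> v \<in> ST rt"
  by (induction rule: up_induct) (auto intro: ST_self ST_chd)

text \<open>A strict bound for all ranks. Cutting an interval into \<open>2 * RB + 1\<close> equal
  pieces and using every second one leaves a gap on both sides of each used piece.\<close>

definition RB :: nat where "RB = Suc (\<Sum>v<n. \<Sum>a<n. \<rho> v a)"

lemma rank_less: assumes "adj v a" shows "\<rho> v a < RB"
proof -
  have va: "v < n" "a < n" using assms adj_less adj_less2 by auto
  have "\<rho> v a \<le> (\<Sum>a<n. \<rho> v a)" using va by (intro member_le_sum) auto
  also have "\<dots> \<le> (\<Sum>v<n. \<Sum>a<n. \<rho> v a)"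
    using va by (intro member_le_sum[where f = "\<lambda>v. \<Sum>a<n. \<rho> v a"]) auto
  finally show ?thesis by (simp add: RB_def)
qed

text \<open>The subtree at \<open>v\<close> lives over the interval from \<open>lo v\<close> to \<open>hi v\<close>; the neighbour \<open>a\<close> below \<open>v\<close>
gets the subinterval from \<open>dlo v a\<close> to \<open>dhi v a\<close> whose position is given by its rank, with
positive gaps between the subintervals.\<close>

definition sub :: "real \<times> real => nat => real \<times> real" where
  "sub I r = (fst I + (snd I - fst I) * (real (2 * r + 1) / real (2 * RB + 1)),
              fst I + (snd I - fst I) * (real (2 * r + 2) / real (2 * RB + 1)))"

primrec ivf :: "nat => nat => real \<times> real" where
  "ivf 0 v = (0, 1)"
| "ivf (Suc k) v = sub (ivf k (par v)) (\<rho> (par v) v)"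

definition lo :: "nat => real" where "lo v = fst (ivf (dep v) v)"
definition hi :: "nat => real" where "hi v = snd (ivf (dep v) v)"
definition dlo :: "nat => nat => real" where "dlo v a = fst (sub (lo v, hi v) (\<rho> v a))"
definition dhi :: "nat => nat => real" where "dhi v a = snd (sub (lo v, hi v) (\<rho> v a))"
definition ctr :: "nat => nat => real" where "ctr v a = (dlo v a + dhi v a) / 2"

lemma chd_interval: "chd v a ==> lo a = dlo v a \<and> hi a = dhi v a"
  by (auto simp: lo_def hi_def dlo_def dhi_def chd_dep chd_def)

lemma root_interval: "lo rt = 0" "hi rt = 1"
  by (simp_all add: lo_def hi_def dep_rt)

lemma sub_less:
  assumes "l < h" shows "r < RB ==> l < fst (sub (l, h) r)" "fst (sub (l, h) r) < snd (sub (l, h) r)"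
    "r < RB ==> snd (sub (l, h) r) < h" "r < s ==> snd (sub (l, h) r) < fst (sub (l, h) s)"
proof -
  have mono: "l + (h - l) * x < l + (h - l) * y" if "x < y" for x y
    using assms that by simp
  show "r < RB ==> l < fst (sub (l, h) r)"
    using mono[of 0 "real (2 * r + 1) / real (2 * RB + 1)"] by (simp add: sub_def)
  show "fst (sub (l, h) r) < snd (sub (l, h) r)"
    unfolding sub_def fst_conv snd_conv by (intro mono divide_strict_right_mono) auto
  show "r < RB ==> snd (sub (l, h) r) < h"
    using mono[of "real (2 * r + 2) / real (2 * RB + 1)" 1] by (simp add: sub_def)
  show "r < s ==> snd (sub (l, h) r) < fst (sub (l, h) s)"
    unfolding sub_def fst_conv snd_conv by (intro mono divide_strict_right_mono) auto
qed

lemma lo_less_hi: "v < n ==> lo v < hi v"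
proof (induction rule: up_induct)
  case root
  then show ?case by (simp add: root_interval)
next
  case (child v a)
  then show ?case using chd_interval[of v a] sub_less(2)[of "lo v" "hi v"] by (simp add: dlo_def dhi_def)
qed

lemma dn_interval:
  assumes "a \<in> dn v" shows "lo v < dlo v a" "dlo v a < dhi v a" "dhi v a < hi v" "dlo v a < ctr v a" "ctr v a < dhi v a"
proof -
  have v: "v < n" "\<rho> v a < RB" using assms dn_less rank_less by (auto simp: dn_iff)
  note s = sub_less[OF lo_less_hi[OF v(1)]]
  show "lo v < dlo v a" "dlo v a < dhi v a" "dhi v a < hi v"
    using s(1,3)[OF v(2)] s(2) by (simp_all add: dlo_def dhi_def)
  then show "dlo v a < ctr v a" "ctr v a < dhi v a" by (simp_all add: ctr_def)
qed

lemma dn_rank: "a \<in> dn v ==> b \<in> dn v ==> \<rho> v a = \<rho> v b ==> a = b"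
  using rank_inj[of v] dn_less(1)[of a v] by (auto simp: inj_on_def dn_iff)

lemma dn_sep: "a \<in> dn v ==> \<rho> v a < \<rho> v b ==> dhi v a < dlo v b"
  using sub_less(4)[OF lo_less_hi[OF dn_less(1)]] by (auto simp: dlo_def dhi_def)

lemma dn_disjoint:
  assumes "a \<in> dn v" "b \<in> dn v" "a \<noteq> b"
  shows "dhi v a < dlo v b \<or> dhi v b < dlo v a"
  using dn_rank[OF assms(1,2)] dn_sep assms by (metis linorder_neqE_nat)

lemma ST_interval: "w \<in> ST v ==> v < n ==> lo v \<le> lo w \<and> hi w \<le> hi v"
proof (induction rule: ST.induct)
  case (ST_chd w u)
  then show ?case using dn_interval(1,3)[OF chd_dn[OF ST_chd(2)]] chd_interval[OF ST_chd(2)] by auto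
qed simp

lemma ST_disjoint:
  assumes "chd v a" "chd v b" "a \<noteq> b" shows "ST a \<inter> ST b = {}"
proof (rule ccontr)
  assume "ST a \<inter> ST b \<noteq> {}"
  then obtain w where w: "w \<in> ST a" "w \<in> ST b" by blast
  have "lo a \<le> lo w" "hi w \<le> hi a" "lo b \<le> lo w" "hi w \<le> hi b" "lo w < hi w"
    using ST_interval[OF w(1)] ST_interval[OF w(2)] lo_less_hi[OF ST_less[OF w(1)]] chd_less assms by auto
  then show False
    using dn_disjoint[OF chd_dn[OF assms(1)] chd_dn[OF assms(2)] assms(3)]
      chd_interval[OF assms(1)] chd_interval[OF assms(2)] by linarith
qed

lemma finite_ST: "v < n ==> finite (ST v)"
  using ST_less by (intro finite_subset[of "ST v" "{..<n}"]) auto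

text \<open>The darts of chords (non-tree edges, \<open>nt\<close>) that start in the subtree at \<open>v\<close>.\<close>

definition D :: "nat => (nat \<times> nat) set" where
  "D v = {(w, b). w \<in> ST v \<and> nt w b}"

text \<open>The darts in the branch entered from \<open>v\<close> through \<open>a\<close>. A chord
  is a branch of its own and contributes only its end at \<open>v\<close>.\<close>

definition Dd :: "nat => nat => (nat \<times> nat) set" where
  "Dd v a = (if chd v a then D a else {(v, a)})"

abbreviation ct :: "nat \<times> nat => real" where "ct e \<equiv> ctr (fst e) (snd e)"

lemma D_unfold: "D v = (\<Union>a\<in>dn v. Dd v a)"
proof -
  have "D v = {(w, b). w = v \<and> nt w b} \<union> (\<Union>a\<in>{a. chd v a}. D a)"
    unfolding D_def by (subst ST_unfold) blast
  also have "\<dots> = (\<Union>a\<in>dn v. Dd v a)"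
    using dn_cases nt_dn chd_dn by (fastforce simp: Dd_def nt_def split: if_splits)
  finally show ?thesis .
qed

lemma D_interval:
  assumes "v < n" "(w, b) \<in> D v" shows "lo v < ctr w b" "ctr w b < hi v"
proof -
  have w: "w \<in> ST v" "b \<in> dn w" using assms nt_dn by (auto simp: D_def)
  then show "lo v < ctr w b" "ctr w b < hi v"
    using ST_interval[OF w(1) assms(1)] dn_interval[OF w(2)] by linarith+
qed

lemma Dd_interval:
  assumes "a \<in> dn v" "(w, b) \<in> Dd v a" shows "dlo v a < ctr w b" "ctr w b < dhi v a"
  using assms D_interval[of a w b] chd_interval[of v a] dn_interval[OF assms(1)] chd_less
  by (auto simp: Dd_def split: if_splits)

lemma Dd_disjoint: "a \<in> dn v ==> b \<in> dn v ==> a \<noteq> b ==> Dd v a \<inter> Dd v b = {}"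
  using dn_disjoint[of a v b] Dd_interval by (fastforce)

lemma finite_D: "v < n ==> finite (D v)"
  using ST_less adj_less2 by (intro finite_subset[of "D v" "{..<n} \<times> {..<n}"]) (auto simp: D_def nt_def)

lemma finite_Dd: "a \<in> dn v ==> finite (Dd v a)"
  using finite_D dn_less by (auto simp: Dd_def)

lemma sum_D_unfold: "(\<Sum>e\<in>D v. g e) = (\<Sum>a\<in>dn v. \<Sum>e\<in>Dd v a. g e)"
  unfolding D_unfold by (rule sum.UNION_disjoint) (use finite_dn finite_Dd Dd_disjoint in auto)

lemma sum_nbrs:
  assumes "flow z" "v < n" shows "(\<Sum>a\<in>dn v. z v a) = (if v = rt then 0 else z (par v) v)"
proof -
  have z: "antichain z" "dvg z v = 0" using assms by (auto simp: flow_def)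
  have "0 = (\<Sum>a<n. z v a)" using z(2) by (simp add: dvg_def)
  also have "\<dots> = (\<Sum>a\<in>{a. adj v a}. z v a)"
    using antichain_zero[OF z(1)] adj_less2 by (intro sum.mono_neutral_right) auto
  finally have *: "(\<Sum>a\<in>{a. adj v a}. z v a) = 0" by simp
  show ?thesis
  proof (cases "v = rt")
    case False
    have "{a. adj v a} = insert (par v) (dn v)" "par v \<notin> dn v"
      using par[OF assms(2) False] False by (auto simp: dn_def)
    then show ?thesis using * False finite_dn antichain_swap[OF z(1), of v "par v"] by simp
  qed (use * in \<open>simp add: dn_def\<close>)
qed

text \<open>What enters a subtree through its tree edge has to leave it through chords; chords with
  both ends in the subtree cancel.\<close>

lemma sum_Dd:
  assumes "flow z" shows "v < n ==> (\<Sum>e\<in>D v. z (fst e) (snd e)) = (if v = rt then 0 else z (par v) v)"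
    and "a \<in> dn v ==> (\<Sum>e\<in>Dd v a. z (fst e) (snd e)) = z v a"
proof -
  show *: "v < n ==> (\<Sum>e\<in>D v. z (fst e) (snd e)) = (if v = rt then 0 else z (par v) v)" for v
  proof (induction rule: down_induct)
    case (node v)
    have "(\<Sum>e\<in>Dd v a. z (fst e) (snd e)) = z v a" if "a \<in> dn v" for a
      using node(2)[of a] by (auto simp: Dd_def chd_def)
    then show ?case using sum_nbrs[OF assms node(1)] by (simp add: sum_D_unfold)
  qed
  show "a \<in> dn v ==> (\<Sum>e\<in>Dd v a. z (fst e) (snd e)) = z v a"
    using *[of a] by (auto simp: Dd_def chd_def)
qed

text \<open>The parent comes first in the order, so its row and column contain constant signs.
  Conservation at \<open>v\<close> turns them into two products of parent flows with opposite
  signs.\<close>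

lemma lf_cut_open:
  assumes "flow z" "flow w" "v < n"
  shows "lf (\<lambda>a b. sg (\<rho> v a) (\<rho> v b)) (z v) (w v) = (\<Sum>a\<in>dn v. \<Sum>b\<in>dn v. sg (\<rho> v a) (\<rho> v b) * z v a * w v b)"
proof -
  let ?s = "\<lambda>a b. sg (\<rho> v a) (\<rho> v b) * z v a * w v b"
  have z: "antichain z" "antichain w" using assms by (auto simp: flow_def)
  have "lf (\<lambda>a b. sg (\<rho> v a) (\<rho> v b)) (z v) (w v) = (\<Sum>a\<in>{a. adj v a}. \<Sum>b<n. ?s a b)"
    unfolding lf_def using antichain_zero[OF z(1)] adj_less2 by (intro sum.mono_neutral_right) auto
  also have "\<dots> = (\<Sum>a\<in>{a. adj v a}. \<Sum>b\<in>{b. adj v b}. ?s a b)"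
    using antichain_zero[OF z(2)] adj_less2 by (intro sum.cong refl sum.mono_neutral_right) auto
  also have "\<dots> = (\<Sum>a\<in>dn v. \<Sum>b\<in>dn v. ?s a b)"
  proof (cases "v = rt")
    case True
    then have "dn v = {a. adj v a}" by (auto simp: dn_def)
    then show ?thesis by simp
  next
    case False
    let ?p = "par v"
    have nb: "{a. adj v a} = insert ?p (dn v)" "?p \<notin> dn v"
      using par[OF assms(3) False] False by (auto simp: dn_def)
    have "sg (\<rho> v ?p) (\<rho> v b) = 1 \<and> sg (\<rho> v b) (\<rho> v ?p) = -1" if "b \<in> dn v" for b
    proof -
      have "\<rho> v ?p \<noteq> \<rho> v b"
        using rank_inj[OF assms(3)] nb that by (auto simp: inj_on_def)
      moreover have "\<rho> v ?p \<le> \<rho> v b" using rank_par[OF assms(3) False] that by (simp add: dn_def)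
      ultimately show ?thesis by (simp add: sg_def)
    qed
    then have "(\<Sum>b\<in>dn v. ?s ?p b) = z v ?p * (\<Sum>b\<in>dn v. w v b)"
      "(\<Sum>a\<in>dn v. ?s a ?p) = - (\<Sum>a\<in>dn v. z v a) * w v ?p"
      by (simp_all add: sum_distrib_left sum_distrib_right sum_negf)
    moreover have "?s ?p ?p = 0" by (simp add: sg_def)
    moreover have "(\<Sum>b\<in>dn v. w v b) = - w v ?p" "(\<Sum>b\<in>dn v. z v b) = - z v ?p"
      using sum_nbrs[OF assms(1,3)] sum_nbrs[OF assms(2,3)] antichain_swap[OF z(1), of v ?p]
        antichain_swap[OF z(2), of v ?p] False by auto
    ultimately show ?thesis
      unfolding nb(1) using nb(2) finite_dn by (simp add: sum.distrib)
  qed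
  finally show ?thesis .
qed

lemma sum_ST_unfold:
  assumes "v < n"
  shows "(\<Sum>u\<in>ST v. g u) = g v + (\<Sum>a\<in>dn v. if chd v a then \<Sum>u\<in>ST a. g u else 0)"
proof -
  have v: "v \<notin> (\<Union>a\<in>{a. chd v a}. ST a)" using ST_dep chd_dep by fastforce
  have fin: "finite {a. chd v a}" using finite_subset[of "{a. chd v a}" "dn v"] chd_dn finite_dn by blast
  have "(\<Sum>u\<in>ST v. g u) = g v + (\<Sum>u\<in>(\<Union>a\<in>{a. chd v a}. ST a). g u)"
    using v fin finite_ST chd_less by (subst ST_unfold) (simp add: sum.insert)
  also have "(\<Sum>u\<in>(\<Union>a\<in>{a. chd v a}. ST a). g u) = (\<Sum>a\<in>{a. chd v a}. \<Sum>u\<in>ST a. g u)"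
    using fin finite_ST chd_less ST_disjoint by (intro sum.UNION_disjoint) auto
  also have "\<dots> = (\<Sum>a\<in>dn v. if chd v a then \<Sum>u\<in>ST a. g u else 0)"
    using finite_dn chd_dn by (intro sum.mono_neutral_cong_left) auto
  finally show ?thesis .
qed

lemma Dd_sg:
  assumes "a \<in> dn v" "b \<in> dn v" "a \<noteq> b" "e \<in> Dd v a" "f \<in> Dd v b"
  shows "sg (ct e) (ct f) = sg (\<rho> v a) (\<rho> v b)"
proof -
  have "dlo v a < ct e" "ct e < dhi v a" "dlo v b < ct f" "ct f < dhi v b"
    using Dd_interval[OF assms(1), of "fst e" "snd e"] Dd_interval[OF assms(2), of "fst f" "snd f"] assms by simp_all
  moreover have "\<rho> v a < \<rho> v b \<and> dhi v a < dlo v b \<or> \<rho> v b < \<rho> v a \<and> dhi v b < dlo v a"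
    using dn_rank[OF assms(1,2)] dn_sep assms by (metis linorder_neqE_nat)
  ultimately show ?thesis by (auto simp: sg_def)
qed

text \<open>All darts of one branch lie on the same side of all darts of another, so the sign at
  \<open>v\<close> can be read off the positions, and \<open>sum_Dd\<close> turns the branch totals
  into the flows at \<open>v\<close>. The pairs inside one branch are handled by induction. At the
  root, the total of all local forms becomes the sign form of the chord ends on a line.\<close>

lemma position_form:
  assumes zw: "flow z" "flow w" and "v < n"
  shows "(\<Sum>e\<in>D v. \<Sum>f\<in>D v. sg (ct e) (ct f) * z (fst e) (snd e) * w (fst f) (snd f)) =
    (\<Sum>u\<in>ST v. lf (\<lambda>a b. sg (\<rho> u a) (\<rho> u b)) (z u) (w u))"
  using assms(3)
proof (induction rule: down_induct)
  case (node v)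
  let ?L = "\<lambda>u. lf (\<lambda>a b. sg (\<rho> u a) (\<rho> u b)) (z u) (w u)"
  let ?t = "\<lambda>e f. sg (ct e) (ct f) * z (fst e) (snd e) * w (fst f) (snd f)"
  let ?X = "\<lambda>a. if chd v a then \<Sum>u\<in>ST a. ?L u else 0"
  have "(\<Sum>e\<in>Dd v a. \<Sum>f\<in>Dd v b. ?t e f) = sg (\<rho> v a) (\<rho> v b) * z v a * w v b + (if a = b then ?X a else 0)"
    if ab: "a \<in> dn v" "b \<in> dn v" for a b
  proof (cases "a = b")
    case True
    show ?thesis
    proof (cases "chd v a")
      case c: True
      then show ?thesis using node(2)[OF c] True by (simp add: Dd_def sg_def)
    qed (use True in \<open>simp add: Dd_def sg_def\<close>)
  next
    case False
    have "(\<Sum>e\<in>Dd v a. \<Sum>f\<in>Dd v b. ?t e f) =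
      (\<Sum>e\<in>Dd v a. \<Sum>f\<in>Dd v b. sg (\<rho> v a) (\<rho> v b) * z (fst e) (snd e) * w (fst f) (snd f))"
      using Dd_sg[OF ab False] by (intro sum.cong refl) auto
    also have "\<dots> = sg (\<rho> v a) (\<rho> v b) * (\<Sum>e\<in>Dd v a. z (fst e) (snd e)) * (\<Sum>f\<in>Dd v b. w (fst f) (snd f))"
      by (simp add: sum_distrib_left sum_distrib_right mult_ac)
    finally show ?thesis using sum_Dd(2)[OF zw(1) ab(1)] sum_Dd(2)[OF zw(2) ab(2)] False by simp
  qed
  then have "(\<Sum>a\<in>dn v. \<Sum>b\<in>dn v. \<Sum>e\<in>Dd v a. \<Sum>f\<in>Dd v b. ?t e f) =
    (\<Sum>a\<in>dn v. \<Sum>b\<in>dn v. sg (\<rho> v a) (\<rho> v b) * z v a * w v b + (if a = b then ?X a else 0))"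
    by (intro sum.cong refl) auto
  also have "\<dots> = ?L v + (\<Sum>a\<in>dn v. ?X a)"
    using lf_cut_open[OF zw node(1)] finite_dn by (simp add: sum.distrib sum.delta' cong: sum.cong)
  also have "\<dots> = (\<Sum>u\<in>ST v. ?L u)" using sum_ST_unfold[OF node(1), of ?L] by simp
  also have "(\<Sum>a\<in>dn v. \<Sum>b\<in>dn v. \<Sum>e\<in>Dd v a. \<Sum>f\<in>Dd v b. ?t e f) = (\<Sum>e\<in>D v. \<Sum>f\<in>D v. ?t e f)"
  proof -
    have "(\<Sum>b\<in>dn v. \<Sum>e\<in>Dd v a. \<Sum>f\<in>Dd v b. ?t e f) = (\<Sum>e\<in>Dd v a. \<Sum>f\<in>D v. ?t e f)" for a
      by (subst sum.swap) (simp add: sum_D_unfold)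
    then show ?thesis by (simp add: sum_D_unfold[of _ v])
  qed
  finally show ?case .
qed

lemma ctr_inj:
  assumes "v < n" "e \<in> D v" "f \<in> D v" "e \<noteq> f" shows "ct e \<noteq> ct f"
  using assms
proof (induction arbitrary: e f rule: down_induct)
  case (node v)
  obtain a b where ab: "a \<in> dn v" "b \<in> dn v" "e \<in> Dd v a" "f \<in> Dd v b"
    using node(3,4) by (auto simp: D_unfold[of v])
  show ?case
  proof (cases "a = b")
    case True
    show ?thesis
    proof (cases "chd v a")
      case c: True
      then show ?thesis using node(2)[OF c] ab True node(5) by (simp add: Dd_def)
    qed (use ab True node in \<open>simp add: Dd_def\<close>)
  next
    case False
    then show ?thesis
      using dn_disjoint[OF ab(1,2) False] Dd_interval[OF ab(1), of "fst e" "snd e"]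
        Dd_interval[OF ab(2), of "fst f" "snd f"] ab by auto
  qed
qed

section \<open>Fundamental cycles of the chords\<close>

primrec tchf :: "nat => nat => nat => nat => int" where
  "tchf 0 v = (\<lambda>x y. 0)"
| "tchf (Suc k) v = (\<lambda>x y. tchf k (par v) x y + arrow v (par v) x y)"

definition tch :: "nat => nat => nat => int" where
  "tch v = tchf (dep v) v"

lemma tch_chd: "chd v a ==> tch a = (\<lambda>x y. tch v x y + arrow a v x y)"
  by (auto simp: tch_def chd_dep chd_def)

lemma tch_root: "tch rt = (\<lambda>x y. 0)"
  by (simp add: tch_def dep_rt)

lemma tch:
  assumes "v < n"
  shows "antichain (tch v)" "dvg (tch v) y = of_bool (y = v) - of_bool (y = rt)" "nt p q ==> tch v p q = 0"
proof -
  have "antichain (tch v) \<and> (\<forall>y. dvg (tch v) y = of_bool (y = v) - of_bool (y = rt)) \<and> (\<forall>p q. nt p q --> tch v p q = 0)"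
    using assms
  proof (induction rule: up_induct)
    case root
    then show ?case by (simp add: tch_root antichain_0 dvg_def)
  next
    case (child v a)
    have "adj a v" using chd_adj child adj_sym by blast
    moreover have "arrow a v p q = 0" if "nt p q" for p q
      using that child by (auto simp: arrow_def nt_def)
    ultimately show ?case using child
      by (simp add: tch_chd antichain_add antichain_arrow dvg_add dvg_arrow)
  qed
  then show "antichain (tch v)" "dvg (tch v) y = of_bool (y = v) - of_bool (y = rt)" "nt p q ==> tch v p q = 0"
    by auto
qed

text \<open>The chord closed up by tree paths to the root: the tree paths carry no chord darts, so
  sums over darts see just the two ends of the chord.\<close>

lemma chord_cycle:
  assumes "nt v a"
  shows "\<exists>z. flow z \<and> (\<forall>g. (\<Sum>e\<in>D rt. g e * z (fst e) (snd e)) = g (v, a) - g (a, v))"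
proof -
  have va: "v < n" "a < n" "adj v a" "v \<noteq> a" using assms adj_less adj_less2 adj_irrefl by (auto simp: nt_def)
  let ?z = "\<lambda>x y. (arrow v a x y + tch a x y) - tch v x y"
  have "flow ?z"
    unfolding flow_def using va tch antichain_arrow
    by (simp add: antichain_add antichain_diff dvg_add dvg_diff dvg_arrow)
  moreover have "(\<Sum>e\<in>D rt. g e * ?z (fst e) (snd e)) = g (v, a) - g (a, v)" for g
  proof -
    have "(\<Sum>e\<in>D rt. g e * ?z (fst e) (snd e)) = (\<Sum>e\<in>D rt. g e * arrow v a (fst e) (snd e))"
      using tch(3)[OF va(1)] tch(3)[OF va(2)] by (intro sum.cong) (auto simp: D_def)
    also have "\<dots> = (\<Sum>e\<in>{(v, a), (a, v)}. g e * arrow v a (fst e) (snd e))"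
      using assms nt_sym[OF assms] va ST_root finite_D[OF rt_less]
      by (intro sum.mono_neutral_right) (auto simp: D_def arrow_def)
    also have "\<dots> = g (v, a) - g (a, v)" using va by (simp add: arrow_def)
    finally show ?thesis .
  qed
  ultimately show ?thesis by blast
qed

text \<open>On two chords with interleaved ends the sign form of positions takes the value 2, which
  is not divisible by 4.\<close>

theorem chords_do_not_cross:
  assumes "nt v a" "nt w b"
  shows "\<not> (ctr v a < ctr w b \<and> ctr w b < ctr a v \<and> ctr a v < ctr b w)"
proof
  assume c: "ctr v a < ctr w b \<and> ctr w b < ctr a v \<and> ctr a v < ctr b w"
  obtain z where z: "flow z" "\<And>g. (\<Sum>e\<in>D rt. g e * z (fst e) (snd e)) = g (v, a) - g (a, v)"
    using chord_cycle[OF assms(1)] by blast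
  obtain u where u: "flow u" "\<And>g. (\<Sum>e\<in>D rt. g e * u (fst e) (snd e)) = g (w, b) - g (b, w)"
    using chord_cycle[OF assms(2)] by blast
  have "(\<Sum>e\<in>D rt. \<Sum>f\<in>D rt. sg (ct e) (ct f) * z (fst e) (snd e) * u (fst f) (snd f)) =
    (\<Sum>e\<in>D rt. (\<Sum>f\<in>D rt. sg (ct e) (ct f) * u (fst f) (snd f)) * z (fst e) (snd e))"
    by (simp add: sum_distrib_left sum_distrib_right mult_ac)
  also have "\<dots> = 2" using c by (simp add: u z sg_def)
  finally have "(\<Sum>x\<in>ST rt. lf (\<lambda>a b. sg (\<rho> x a) (\<rho> x b)) (z x) (u x)) = 2"
    using position_form[OF z(1) u(1) rt_less] by simp
  moreover have "ST rt = {..<n}" using ST_root ST_less[OF _ rt_less] by auto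
  ultimately show False using rank_conserved z(1) u(1) unfolding conserved_def by fastforce
qed

end

section \<open>Cochains on pairs of cells\<close>

text \<open>A cochain \<open>c\<close> assigns the number \<open>c v a b\<close> to the motion in which one token rests at
\<open>v\<close> and the other moves from \<open>a\<close> to \<open>b\<close>; \<open>dcf c (p, q) (a, b)\<close> is its coboundary on the square of
the edges \<open>pq\<close> and \<open>ab\<close>.\<close>

definition dcf :: "(nat => nat => nat => 'r::comm_ring_1) => nat \<times> nat => nat \<times> nat => 'r" where
  "dcf c x y = c (snd x) (fst y) (snd y) - c (fst x) (fst y) (snd y)
     - c (snd y) (fst x) (snd x) + c (fst y) (fst x) (snd x)"

lemma dcf_alt: "dcf c y x = - dcf c x y"
  by (simp add: dcf_def)

context sgraph
begin

definition bil :: "(nat \<times> nat => nat \<times> nat => 'r::comm_ring_1) => (nat => nat => int) => (nat => nat => int) => 'r" where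
  "bil M z w = (\<Sum>p<n. \<Sum>q<n. \<Sum>a<n. \<Sum>b<n. M (p, q) (a, b) * of_int (z p q) * of_int (w a b))"

definition disj_edges :: "nat \<times> nat => nat \<times> nat => bool" where
  "disj_edges x y \<longleftrightarrow> adj (fst x) (snd x) \<and> adj (fst y) (snd y) \<and>
     fst x \<noteq> fst y \<and> fst x \<noteq> snd y \<and> snd x \<noteq> fst y \<and> snd x \<noteq> snd y"

lemma disj_edges_sym: "disj_edges x y \<longleftrightarrow> disj_edges y x"
  by (auto simp: disj_edges_def)

lemma flow_sums:
  assumes "flow z"
  shows "(\<Sum>q<n. of_int (z p q) :: 'r::comm_ring_1) = 0" "(\<Sum>p<n. of_int (z p q) :: 'r) = 0"
proof -
  have z: "antichain z" using assms by (simp add: flow_def)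
  show *: "(\<Sum>q<n. of_int (z p q) :: 'r) = 0" for p
  proof (cases "p < n")
    case True
    then have "(\<Sum>q<n. z p q) = 0" using assms by (simp add: flow_def dvg_def)
    then show ?thesis by (metis of_int_0 of_int_sum)
  next
    case False
    then have "z p q = 0" for q using antichain_zero[OF z] adj_less by blast
    then show ?thesis by simp
  qed
  have "(\<Sum>p<n. of_int (z p q) :: 'r) = - (\<Sum>p<n. of_int (z q p))"
    unfolding sum_negf[symmetric] by (intro sum.cong refl) (metis antichain_swap[OF z] of_int_minus)
  then show "(\<Sum>p<n. of_int (z p q) :: 'r) = 0" using * by simp
qed

text \<open>Every term of the coboundary is independent of one endpoint of one of its two edges, and
  summing a flow over that endpoint gives zero.\<close>

lemma bil_dcf:
  assumes "flow z" "flow w" shows "bil (dcf c) z w = 0"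
proof -
  let ?z = "\<lambda>p q. of_int (z p q)" and ?w = "\<lambda>p q. of_int (w p q)"
  have 1: "(\<Sum>p<n. \<Sum>q<n. \<Sum>a<n. \<Sum>b<n. c q a b * ?z p q * ?w a b) = 0"
    "(\<Sum>p<n. \<Sum>q<n. \<Sum>a<n. \<Sum>b<n. c p a b * ?z p q * ?w a b) = 0"
  proof -
    let ?C = "\<lambda>q. \<Sum>a<n. \<Sum>b<n. c q a b * ?w a b"
    have i: "(\<Sum>a<n. \<Sum>b<n. c r a b * ?z p q * ?w a b) = ?C r * ?z p q" for p q r
      by (simp add: sum_distrib_left sum_distrib_right mult_ac)
    have "(\<Sum>p<n. \<Sum>q<n. ?C q * ?z p q) = (\<Sum>q<n. \<Sum>p<n. ?C q * ?z p q)" by (rule sum.swap)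
    also have "\<dots> = (\<Sum>q<n. ?C q * (\<Sum>p<n. ?z p q))" by (simp only: sum_distrib_left)
    finally show "(\<Sum>p<n. \<Sum>q<n. \<Sum>a<n. \<Sum>b<n. c q a b * ?z p q * ?w a b) = 0"
      by (simp add: i flow_sums[OF assms(1)])
    have "(\<Sum>p<n. \<Sum>q<n. ?C p * ?z p q) = (\<Sum>p<n. ?C p * (\<Sum>q<n. ?z p q))" by (simp only: sum_distrib_left)
    then show "(\<Sum>p<n. \<Sum>q<n. \<Sum>a<n. \<Sum>b<n. c p a b * ?z p q * ?w a b) = 0"
      by (simp add: i flow_sums[OF assms(1)])
  qed
  have 2: "(\<Sum>p<n. \<Sum>q<n. \<Sum>a<n. \<Sum>b<n. c b p q * ?z p q * ?w a b) = 0"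
    "(\<Sum>p<n. \<Sum>q<n. \<Sum>a<n. \<Sum>b<n. c a p q * ?z p q * ?w a b) = 0"
  proof -
    have "(\<Sum>a<n. \<Sum>b<n. c b p q * ?z p q * ?w a b) = (\<Sum>b<n. (c b p q * ?z p q) * (\<Sum>a<n. ?w a b))" for p q
      by (subst sum.swap) (simp add: sum_distrib_left)
    then show "(\<Sum>p<n. \<Sum>q<n. \<Sum>a<n. \<Sum>b<n. c b p q * ?z p q * ?w a b) = 0"
      by (simp add: flow_sums[OF assms(2)])
    have "(\<Sum>a<n. \<Sum>b<n. c a p q * ?z p q * ?w a b) = (\<Sum>a<n. (c a p q * ?z p q) * (\<Sum>b<n. ?w a b))" for p q
      by (simp add: sum_distrib_left)
    then show "(\<Sum>p<n. \<Sum>q<n. \<Sum>a<n. \<Sum>b<n. c a p q * ?z p q * ?w a b) = 0"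
      by (simp add: flow_sums[OF assms(2)])
  qed
  show ?thesis
    unfolding bil_def dcf_def fst_conv snd_conv
    by (simp only: left_diff_distrib distrib_right sum.distrib sum_subtractf 1 2) simp
qed

lemma sum_delta4:
  fixes f :: "nat => nat => nat => nat => 'r::comm_ring_1"
  shows "(\<Sum>p<n. \<Sum>q<n. \<Sum>a<n. \<Sum>b<n. of_bool (p = a) * f p q a b) = (\<Sum>v<n. \<Sum>q<n. \<Sum>b<n. f v q v b)"
    and "(\<Sum>p<n. \<Sum>q<n. \<Sum>a<n. \<Sum>b<n. of_bool (p = b) * f p q a b) = (\<Sum>v<n. \<Sum>q<n. \<Sum>a<n. f v q a v)"
    and "(\<Sum>p<n. \<Sum>q<n. \<Sum>a<n. \<Sum>b<n. of_bool (q = a) * f p q a b) = (\<Sum>v<n. \<Sum>p<n. \<Sum>b<n. f p v v b)"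
    and "(\<Sum>p<n. \<Sum>q<n. \<Sum>a<n. \<Sum>b<n. of_bool (q = b) * f p q a b) = (\<Sum>v<n. \<Sum>p<n. \<Sum>a<n. f p v a v)"
proof -
  have d: "(\<Sum>a<n. of_bool (p = a) * g a) = g p" if "p < n" for p and g :: "nat => 'r"
    using that by (simp add: of_bool_def if_distrib[of "\<lambda>t. t * _"] sum.delta' cong: if_cong)
  have 1: "(\<Sum>a<n. \<Sum>b<n. of_bool (p = a) * g a b) = (\<Sum>b<n. g p b)" if "p < n" for p and g :: "nat => nat => 'r"
    using d[OF that, of "\<lambda>a. \<Sum>b<n. g a b"] by (simp add: sum_distrib_left)
  have 2: "(\<Sum>a<n. \<Sum>b<n. of_bool (p = b) * g a b) = (\<Sum>a<n. g a p)" if "p < n" for p and g :: "nat => nat => 'r"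
    using d[OF that] by simp
  show "(\<Sum>p<n. \<Sum>q<n. \<Sum>a<n. \<Sum>b<n. of_bool (p = a) * f p q a b) = (\<Sum>v<n. \<Sum>q<n. \<Sum>b<n. f v q v b)"
    by (rule sum.cong[OF refl], rule sum.cong[OF refl], rule 1) simp
  show "(\<Sum>p<n. \<Sum>q<n. \<Sum>a<n. \<Sum>b<n. of_bool (p = b) * f p q a b) = (\<Sum>v<n. \<Sum>q<n. \<Sum>a<n. f v q a v)"
    by (rule sum.cong[OF refl], rule sum.cong[OF refl], rule 2) simp
  have "(\<Sum>p<n. \<Sum>q<n. \<Sum>a<n. \<Sum>b<n. of_bool (q = a) * f p q a b) = (\<Sum>p<n. \<Sum>v<n. \<Sum>b<n. f p v v b)"
    by (rule sum.cong[OF refl], rule sum.cong[OF refl], rule 1) simp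
  then show "(\<Sum>p<n. \<Sum>q<n. \<Sum>a<n. \<Sum>b<n. of_bool (q = a) * f p q a b) = (\<Sum>v<n. \<Sum>p<n. \<Sum>b<n. f p v v b)"
    by (simp only: sum.swap[of "\<lambda>p v. \<Sum>b<n. f p v v b"])
  have "(\<Sum>p<n. \<Sum>q<n. \<Sum>a<n. \<Sum>b<n. of_bool (q = b) * f p q a b) = (\<Sum>p<n. \<Sum>v<n. \<Sum>a<n. f p v a v)"
    by (rule sum.cong[OF refl], rule sum.cong[OF refl], rule 2) simp
  then show "(\<Sum>p<n. \<Sum>q<n. \<Sum>a<n. \<Sum>b<n. of_bool (q = b) * f p q a b) = (\<Sum>v<n. \<Sum>p<n. \<Sum>a<n. f p v a v)"
    by (simp only: sum.swap[of "\<lambda>p v. \<Sum>a<n. f p v a v"])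
qed

text \<open>Edges sharing one vertex are met in four ways, according to which of their ends
  coincide. Reversing edges makes the four sums equal, and pairs with both ends in common contribute
  nothing.\<close>

lemma bil_shared:
  fixes M :: "nat \<times> nat => nat \<times> nat => 'r::comm_ring_1"
  assumes zw: "antichain z" "antichain w"
    and sw: "\<And>p q y. M (q, p) y = - M (p, q) y" "\<And>a b x. M x (b, a) = - M x (a, b)"
    and diag: "\<And>x. M x x = 0"
  shows "bil (\<lambda>x y. if disj_edges x y then 0 else M x y) z w =
    4 * (\<Sum>v<n. lf (\<lambda>a b. M (v, a) (v, b)) (\<lambda>a. of_int (z v a)) (\<lambda>b. of_int (w v b)))"
proof -
  let ?t = "\<lambda>p q a b. M (p, q) (a, b) * of_int (z p q) * of_int (w a b)"
  have z: "of_int (z q p) = - (of_int (z p q) :: 'r)" "of_int (w q p) = - (of_int (w p q) :: 'r)" for p q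
    using antichain_swap[OF zw(1), of q p] antichain_swap[OF zw(2), of q p] by simp_all
  have t: "?t q p a b = ?t p q a b" "?t p q b a = ?t p q a b" for p q a b
    using sw(1)[of q p "(a, b)"] sw(2)[of "(p, q)" b a] z(1)[of q p] z(2)[of b a] by simp_all
  have pt: "(if disj_edges (p, q) (a, b) then 0 else M (p, q) (a, b)) * of_int (z p q) * of_int (w a b) =
      of_bool (p = a) * ?t p q a b + of_bool (p = b) * ?t p q a b
    + of_bool (q = a) * ?t p q a b + of_bool (q = b) * ?t p q a b" for p q a b
  proof (cases "adj p q \<and> adj a b")
    case True
    then have ne: "p \<noteq> q" "a \<noteq> b" using adj_irrefl by auto
    have "?t p q a b = 0" if "{p, q} = {a, b}"
      using that diag[of "(p, q)"] sw(2)[of "(p, q)" q p] by (auto simp: doubleton_eq_iff)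
    then show ?thesis using True ne by (auto simp: disj_edges_def)
  next
    case False
    then have "z p q = 0 \<or> w a b = 0" using antichain_zero zw by blast
    then show ?thesis by auto
  qed
  have L: "(\<Sum>v<n. \<Sum>q<n. \<Sum>b<n. ?t v q v b) = (\<Sum>v<n. lf (\<lambda>a b. M (v, a) (v, b)) (\<lambda>a. of_int (z v a)) (\<lambda>b. of_int (w v b)))"
    by (simp add: lf_def)
  have "bil (\<lambda>x y. if disj_edges x y then 0 else M x y) z w =
    (\<Sum>v<n. \<Sum>q<n. \<Sum>b<n. ?t v q v b) + (\<Sum>v<n. \<Sum>q<n. \<Sum>b<n. ?t v q b v)
    + (\<Sum>v<n. \<Sum>q<n. \<Sum>b<n. ?t q v v b) + (\<Sum>v<n. \<Sum>q<n. \<Sum>b<n. ?t q v b v)"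
    unfolding bil_def pt sum.distrib by (simp only: sum_delta4)
  also have "\<dots> = 4 * (\<Sum>v<n. \<Sum>q<n. \<Sum>b<n. ?t v q v b)"
    by (simp add: t(2)[of _ _ _ "_::nat"] t sum_distrib_left)
  finally show ?thesis unfolding L .
qed

text \<open>Every pair of edges occurs in \<open>bil\<close> with four choices of direction. Keeping
  one of them amounts to dividing by 4 without leaving the integers, so that a divisibility by 4 of
  the coefficients is not lost.\<close>

definition half :: "(nat \<times> nat => nat \<times> nat => 'r::comm_ring_1) => nat \<times> nat => nat \<times> nat => 'r" where
  "half M x y = (if fst x < snd x \<and> fst y < snd y then M x y else 0)"

lemma sum_half:
  fixes f :: "nat => nat => 'r::comm_ring_1"
  assumes "\<And>p q. f q p = f p q" "\<And>p. f p p = 0"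
  shows "(\<Sum>p<n. \<Sum>q<n. f p q) = 2 * (\<Sum>p<n. \<Sum>q<n. if p < q then f p q else 0)"
proof -
  have "(\<Sum>p<n. \<Sum>q<n. f p q) = (\<Sum>p<n. \<Sum>q<n. (if p < q then f p q else 0) + (if q < p then f q p else 0))"
    using assms by (intro sum.cong refl) (auto simp: not_less_iff_gr_or_eq)
  also have "\<dots> = (\<Sum>p<n. \<Sum>q<n. if p < q then f p q else 0) + (\<Sum>q<n. \<Sum>p<n. if q < p then f q p else 0)"
    by (simp add: sum.distrib) (rule sum.swap)
  finally show ?thesis by simp
qed

lemma bil_half:
  fixes M :: "nat \<times> nat => nat \<times> nat => 'r::comm_ring_1"
  assumes zw: "antichain z" "antichain w"
    and sw: "\<And>p q y. M (q, p) y = - M (p, q) y" "\<And>a b x. M x (b, a) = - M x (a, b)"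
  shows "bil M z w = 4 * bil (half M) z w"
proof -
  let ?t = "\<lambda>p q a b. M (p, q) (a, b) * of_int (z p q) * of_int (w a b)"
  have z: "of_int (z q p) = - (of_int (z p q) :: 'r)" "of_int (w q p) = - (of_int (w p q) :: 'r)" for p q
    using antichain_swap[OF zw(1), of q p] antichain_swap[OF zw(2), of q p] by simp_all
  have z0: "z p p = 0" "w p p = 0" for p using antichain_zero[OF zw(1)] antichain_zero[OF zw(2)] adj_irrefl by auto
  have t: "?t q p a b = ?t p q a b" "?t p q b a = ?t p q a b" for p q a b
    using sw(1)[of q p "(a, b)"] sw(2)[of "(p, q)" b a] z(1)[of q p] z(2)[of b a] by simp_all
  have 1: "(\<Sum>a<n. \<Sum>b<n. ?t p q a b) = 2 * (\<Sum>a<n. \<Sum>b<n. if a < b then ?t p q a b else 0)" for p q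
    by (rule sum_half) (use t(2) z0 in auto)
  have "bil M z w = (\<Sum>p<n. \<Sum>q<n. \<Sum>a<n. \<Sum>b<n. ?t p q a b)" by (simp add: bil_def)
  also have "\<dots> = 2 * (\<Sum>p<n. \<Sum>q<n. if p < q then \<Sum>a<n. \<Sum>b<n. ?t p q a b else 0)"
    by (rule sum_half) (use t(1) z0 in auto)
  also have "\<dots> = 4 * (\<Sum>p<n. \<Sum>q<n. if p < q then \<Sum>a<n. \<Sum>b<n. if a < b then ?t p q a b else 0 else 0)"
    unfolding 1 by (simp add: sum_distrib_left if_distrib[of "(*) _"] cong: if_cong) 
  also have "\<dots> = 4 * bil (half M) z w"
    unfolding bil_def half_def fst_conv snd_conv
    by (intro arg_cong[where f = "(*) 4"] sum.cong refl) (auto intro!: sum.cong)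
  finally show ?thesis .
qed

definition alt_cochain :: "(nat => nat => nat => 'r::comm_ring_1) => bool" where
  "alt_cochain c \<longleftrightarrow> (\<forall>v a b. c v b a = - c v a b)"

lemma dcf_swap:
  assumes "alt_cochain c" shows "dcf c (q, p) y = - dcf c (p, q) y" "dcf c x (b, a) = - dcf c x (a, b)"
proof -
  have s: "c v b a = - c v a b" for v a b using assms unfolding alt_cochain_def by blast
  show "dcf c (q, p) y = - dcf c (p, q) y"
    using s[of "fst y" q p] s[of "snd y" q p] by (simp add: dcf_def)
  show "dcf c x (b, a) = - dcf c x (a, b)"
    using s[of "fst x" b a] s[of "snd x" b a] by (simp add: dcf_def)
qed

lemma dcf_diag: "dcf c x x = 0"
  by (simp add: dcf_def)

lemma bil_split:
  "bil M z w = bil (\<lambda>x y. if disj_edges x y then M x y else 0) z w + bil (\<lambda>x y. if disj_edges x y then 0 else M x y) z w"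
  unfolding bil_def sum.distrib[symmetric] by (intro sum.cong refl) auto

text \<open>A coboundary vanishes on pairs of cycles, so its parts on disjoint and on touching edges
  are opposite; both carry the multiplicity 4. The factor is kept because the ring is arbitrary, and
  it is cancelled later in the integers and the reals.\<close>

lemma local_form_of_cochain:
  fixes c :: "nat => nat => nat => 'r::comm_ring_1"
  assumes "alt_cochain c" "flow z" "flow w"
  shows "4 * bil (half (\<lambda>x y. if disj_edges x y then dcf c x y else 0)) z w =
    - 4 * (\<Sum>v<n. lf (\<lambda>a b. dcf c (v, a) (v, b)) (\<lambda>a. of_int (z v a)) (\<lambda>b. of_int (w v b)))"
proof -
  let ?M = "\<lambda>x y. if disj_edges x y then dcf c x y else 0"
  have zw: "antichain z" "antichain w" using assms by (auto simp: flow_def)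
  have de: "disj_edges (q, p) y \<longleftrightarrow> disj_edges (p, q) y" "disj_edges x (q, p) \<longleftrightarrow> disj_edges x (p, q)" for p q x y
    using adj_sym by (auto simp: disj_edges_def)
  have "bil ?M z w = 4 * bil (half ?M) z w"
  proof (rule bil_half[OF zw])
    show "?M (q, p) y = - ?M (p, q) y" for p q y
      using dcf_swap(1)[OF assms(1), of q p y] de(1)[of q p y] by simp
    show "?M x (b, a) = - ?M x (a, b)" for a b x
      using dcf_swap(2)[OF assms(1), of x b a] de(2)[of x b a] by simp
  qed
  moreover have "bil ?M z w + bil (\<lambda>x y. if disj_edges x y then 0 else dcf c x y) z w = 0"
    using bil_split[of "dcf c" z w] bil_dcf[OF assms(2,3), of c] by simp
  ultimately show ?thesis
    using bil_shared[of z w "dcf c", OF zw dcf_swap[OF assms(1)] dcf_diag] by (simp add: add_eq_0_iff)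
qed

definition odd_cochain :: "(nat => nat => nat => int) => bool" where
  "odd_cochain c \<longleftrightarrow> alt_cochain c \<and>
     (\<forall>v a b. adj a b --> (odd (c v a b) \<longleftrightarrow> (v < a) \<noteq> (v < b))) \<and>
     (\<forall>x y. disj_edges x y --> 4 dvd dcf c x y)"

lemma oddsys_of_odd_cochain:
  assumes "odd_cochain c" shows "oddsys (\<lambda>v a b. dcf c (v, a) (v, b))"
  unfolding oddsys_def
proof (intro conjI allI impI)
  have alt: "alt_cochain c" and par: "\<And>v a b. adj a b ==> odd (c v a b) \<longleftrightarrow> (v < a) \<noteq> (v < b)"
    using assms by (auto simp: odd_cochain_def)
  fix v a b
  show "dcf c (v, b) (v, a) = - dcf c (v, a) (v, b)" by (rule dcf_alt)
  assume *: "adj v a" "adj v b" "a \<noteq> b"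
  then have ne: "v \<noteq> a" "v \<noteq> b" using adj_irrefl by auto
  \<comment> \<open>Modulo 2 the coboundary counts, for each of the three pairs among
    \<open>v\<close>, \<open>a\<close>, \<open>b\<close>, both comparisons; exactly one of them
    holds, which adds up to 3.\<close>
  show "odd (dcf c (v, a) (v, b))"
    using par[OF *(1), of v] par[OF *(2), of v] par[OF *(1), of b] par[OF *(2), of a] ne *(3)
    by (auto simp: dcf_def)
next
  have alt: "alt_cochain c" using assms by (simp add: odd_cochain_def)
  show "conserved (\<lambda>v a b. dcf c (v, a) (v, b))"
    unfolding conserved_def
  proof (intro allI impI)
    fix z w assume zw: "flow z" "flow w"
    have "4 dvd bil (half (\<lambda>x y. if disj_edges x y then dcf c x y else 0)) z w"
      unfolding bil_def half_def
      by (intro dvd_sum dvd_mult2) (use assms in \<open>auto simp: odd_cochain_def\<close>)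
    then show "4 dvd (\<Sum>v<n. lf (\<lambda>a b. dcf c (v, a) (v, b)) (z v) (w v))"
      using local_form_of_cochain[OF alt zw] by simp
  qed
qed

end

section \<open>Integral forms that vanish on pairs of cycles\<close>

context sgraph
begin

lemma bil_add:
  "bil M (\<lambda>a b. z a b + z' a b) w = bil M z w + bil M z' w"
  "bil M z (\<lambda>a b. w a b + w' a b) = bil M z w + bil M z w'"
  by (simp_all add: bil_def algebra_simps sum.distrib)

lemma bil_diff:
  "bil M (\<lambda>a b. z a b - z' a b) w = bil M z w - bil M z' w"
  "bil M z (\<lambda>a b. w a b - w' a b) = bil M z w - bil M z w'"
  by (simp_all add: bil_def algebra_simps sum_subtractf)

lemma lf_add:
  "lf G (\<lambda>a. z a + z' a) w = lf G z w + lf G z' w"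
  "lf G z (\<lambda>a. w a + w' a) = lf G z w + lf G z w'"
  by (simp_all add: lf_def algebra_simps sum.distrib)

lemma lf_diff:
  "lf G (\<lambda>a. z a - z' a) w = lf G z w - lf G z' w"
  "lf G z (\<lambda>a. w a - w' a) = lf G z w - lf G z w'"
  by (simp_all add: lf_def algebra_simps sum_subtractf)

lemma bil_alt:
  assumes "\<And>x y. M y x = - M x y" shows "bil M w z = - bil M z w"
proof -
  have e: "M (p, q) (a, b) * of_int (w p q) * of_int (z a b) = - (M (a, b) (p, q) * of_int (z a b) * of_int (w p q))" for p q a b
    using assms[of "(a, b)" "(p, q)"] by (simp add: mult_ac)
  have "bil M w z = (\<Sum>p<n. \<Sum>a<n. \<Sum>q<n. \<Sum>b<n. M (p, q) (a, b) * of_int (w p q) * of_int (z a b))"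
    unfolding bil_def by (rule sum.cong[OF refl], rule sum.swap)
  also have "\<dots> = (\<Sum>a<n. \<Sum>p<n. \<Sum>q<n. \<Sum>b<n. M (p, q) (a, b) * of_int (w p q) * of_int (z a b))"
    by (rule sum.swap)
  also have "\<dots> = (\<Sum>a<n. \<Sum>p<n. \<Sum>b<n. \<Sum>q<n. M (p, q) (a, b) * of_int (w p q) * of_int (z a b))"
    by (rule sum.cong[OF refl], rule sum.cong[OF refl], rule sum.swap)
  also have "\<dots> = (\<Sum>a<n. \<Sum>b<n. \<Sum>p<n. \<Sum>q<n. M (p, q) (a, b) * of_int (w p q) * of_int (z a b))"
    by (rule sum.cong[OF refl], rule sum.swap)
  also have "\<dots> = (\<Sum>a<n. \<Sum>b<n. \<Sum>p<n. \<Sum>q<n. - (M (a, b) (p, q) * of_int (z a b) * of_int (w p q)))"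
    by (simp only: e)
  finally show ?thesis by (simp add: bil_def sum_negf)
qed

lemma lf_alt: assumes "\<And>a b. G b a = - G a b" shows "lf G w z = - lf G z w"
proof -
  have e: "G a b * w a * z b = - (G b a * z b * w a)" for a b
    using assms[of b a] by (simp add: mult_ac)
  have "lf G w z = (\<Sum>b<n. \<Sum>a<n. G a b * w a * z b)" unfolding lf_def by (rule sum.swap)
  also have "\<dots> = (\<Sum>b<n. \<Sum>a<n. - (G b a * z b * w a))"
    by (simp only: e)
  finally show ?thesis by (simp add: lf_def sum_negf)
qed

end

context ranked_tree
begin

text \<open>Each edge is closed to a cycle by tree paths to the root. Expanding the vanishing of
  \<open>B\<close> on two such cycles expresses its value on two edges by terms with a tree path in
  one or both places. Grouping these terms by the vertex where the tree path starts gives the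
  cochain \<open>k\<close>.\<close>

theorem isotropic_exact:
  fixes M :: "nat \<times> nat => nat \<times> nat => int"
  assumes M: "\<And>x y. M y x = - M x y" and N: "\<And>v a b. N v b a = - N v a b"
    and iso: "\<And>z w. flow z ==> flow w ==> bil M z w = (\<Sum>v<n. lf (N v) (z v) (w v))"
  shows "\<exists>k. alt_cochain k \<and> (\<forall>p q a b. adj p q --> adj a b --> dcf k (p, q) (a, b) =
    bil M (arrow p q) (arrow a b) - (\<Sum>v<n. lf (N v) (arrow p q v) (arrow a b v)))"
proof -
  define B where "B = (\<lambda>z w. bil M z w - (\<Sum>v<n. lf (N v) (z v) (w v)))"
  have add: "B (\<lambda>a b. z a b + z' a b) w = B z w + B z' w" "B z (\<lambda>a b. w a b + w' a b) = B z w + B z w'" for z z' w w'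
    by (simp_all add: B_def bil_add lf_add sum.distrib)
  have diff: "B (\<lambda>a b. z a b - z' a b) w = B z w - B z' w" "B z (\<lambda>a b. w a b - w' a b) = B z w - B z w'" for z z' w w'
    by (simp_all add: B_def bil_diff lf_diff sum_subtractf)
  have alt: "B w z = - B z w" for z w
  proof -
    have "lf (N v) (w v) (z v) = - lf (N v) (z v) (w v)" for v by (rule lf_alt) (rule N)
    moreover have "bil M w z = - bil M z w" by (rule bil_alt) (rule M)
    ultimately show ?thesis by (simp add: B_def sum_negf)
  qed
  have arr: "arrow q p = (\<lambda>x y. (arrow p q x y - arrow p q x y) - arrow p q x y)" for p q
    by (auto simp: arrow_def fun_eq_iff)
  \<comment> \<open>The terms with two tree paths are antisymmetric and have to be distributed over
    two values of \<open>k\<close>. Halving them would leave the integers, so the numbering of the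
    vertices decides which side gets all.\<close>
  define th where "th = (\<lambda>u w. if u < w then B (tch u) (tch w) else 0)"
  have th: "th u w - th w u = B (tch u) (tch w)" for u w
    using alt[of "tch u" "tch w"] alt[of "tch u" "tch u"] by (cases u w rule: linorder_cases) (simp_all add: th_def)
  define k where "k = (\<lambda>v a b. - (B (tch v) (arrow a b) + th v b - th v a))"
  have "alt_cochain k"
    unfolding alt_cochain_def
  proof (intro allI)
    fix v a b
    have "B (tch v) (arrow b a) = B (tch v) (\<lambda>x y. (arrow a b x y - arrow a b x y) - arrow a b x y)"
      by (rule arg_cong[OF arr])
    also have "\<dots> = - B (tch v) (arrow a b)" unfolding diff by simp
    finally have "B (tch v) (arrow b a) = - B (tch v) (arrow a b)" .
    then show "k v b a = - k v a b" by (simp add: k_def)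
  qed
  moreover have "dcf k (p, q) (a, b) = B (arrow p q) (arrow a b)" if e: "adj p q" "adj a b" for p q a b
  proof -
    have f: "flow (\<lambda>x y. (arrow p q x y + tch q x y) - tch p x y)" if "adj p q" for p q
      unfolding flow_def using that adj_less[OF that] adj_less2[OF that] tch
      by (simp add: antichain_add antichain_diff antichain_arrow dvg_add dvg_diff dvg_arrow)
    have "B (\<lambda>x y. (arrow p q x y + tch q x y) - tch p x y) (\<lambda>x y. (arrow a b x y + tch b x y) - tch a x y) = 0"
      using iso[OF f[OF e(1)] f[OF e(2)]] by (simp add: B_def)
    then show ?thesis
      using th[of q b] th[of q a] th[of p b] th[of p a]
        alt[of "tch b" "arrow p q"] alt[of "tch a" "arrow p q"]
      by (simp add: add diff dcf_def k_def)
  qed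
  ultimately show ?thesis unfolding B_def by blast
qed

end

context sgraph
begin

text \<open>The tree is built by distance from the vertex 0. It is chosen before the orders, since
  \<open>rank_system\<close> can put any prescribed neighbour first, here the parent.\<close>

theorem ranked_tree_exists:
  assumes "0 < n" "conn {..<n}" "oddsys F"
  shows "\<exists>par dep \<rho>. ranked_tree n adj 0 par dep \<rho>"
proof -
  define reachk where "reachk = (\<lambda>k v. (adj ^^ k) 0 v)"
  define dep where "dep = (\<lambda>v. LEAST k. (adj ^^ k) 0 v)"
  have ex: "\<exists>k. (adj ^^ k) 0 v" if "v < n" for v
  proof -
    have "reach {..<n} 0 v" using assms that by (simp add: conn_def)
    then show ?thesis
    proof (induction rule: reach_induct)
      case refl
      then show ?case by (intro exI[of _ 0]) simp
    next
      case (step y z)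
      then obtain k where "(adj ^^ k) 0 y" by blast
      then have "(adj ^^ Suc k) 0 z" using step(4) by auto
      then show ?case by blast
    qed
  qed
  have dep: "(adj ^^ dep v) 0 v" if "v < n" for v
    using ex[OF that] unfolding dep_def by (rule LeastI_ex)
  have depl: "dep v \<le> k" if "(adj ^^ k) 0 v" for v k
    unfolding dep_def by (rule Least_le[where P = "\<lambda>k. (adj ^^ k) 0 v", OF that])
  have dep0: "dep 0 = 0" using depl[of 0 0] by simp
  have "\<exists>u. adj v u \<and> dep v = Suc (dep u)" if v: "v < n" "v \<noteq> 0" for v
  proof -
    obtain k where k: "dep v = Suc k"
      using dep[OF v(1)] v(2) by (cases "dep v") auto
    then obtain u where u: "(adj ^^ k) 0 u" "adj u v" using dep[OF v(1)] by auto
    have "dep v \<le> Suc (dep u)"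
      using depl[of "Suc (dep u)" v] dep[OF adj_less[OF u(2)]] u(2) by auto
    then show ?thesis using depl[OF u(1)] k u(2) adj_sym by (intro exI[of _ u]) auto
  qed
  then obtain par where par: "\<And>v. v < n ==> v \<noteq> 0 ==> adj v (par v) \<and> dep v = Suc (dep (par v))" by metis
  obtain \<rho> :: "nat => nat => nat" where \<rho>: "\<forall>v<n. inj_on (\<rho> v) {a. adj v a}"
    "\<forall>v<n. \<forall>a. adj v a --> adj v (par v) --> \<rho> v (par v) \<le> \<rho> v a" "conserved (\<lambda>v a b. sg (\<rho> v a) (\<rho> v b))"
    using rank_system[OF assms(3), of par] by blast
  have "ranked_tree n adj 0 par dep \<rho>"
    by unfold_locales (use assms(1) dep0 par \<rho> in auto)
  then show ?thesis by blast
qed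

end

section \<open>Faces\<close>

context ranked_tree
begin

text \<open>The face above the abscissa \<open>t\<close>, encoded by the chords that pass over \<open>t\<close>.\<close>

definition Sf :: "real => (nat \<times> nat) set" where
  "Sf t = {e \<in> D rt. ct e < t \<and> t < ctr (snd e) (fst e)}"

text \<open>On the faces given by \<open>Sf\<close> this is a stream function of the flow: crossing
  a dart changes it by the flow along that dart, see \<open>psi_dart\<close>.\<close>

definition psi :: "(nat => nat => int) => (nat \<times> nat) set => int" where
  "psi z A = (\<Sum>e\<in>A. z (fst e) (snd e))"

definition offc :: "real => bool" where "offc t \<longleftrightarrow> (\<forall>e\<in>D rt. ct e \<noteq> t)"

definition gap :: "real => real => bool" where
  "gap t t' \<longleftrightarrow> t \<le> t' \<and> (\<forall>e\<in>D rt. \<not> (t \<le> ct e \<and> ct e \<le> t'))"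

lemma D_rt: "(w, b) \<in> D rt \<longleftrightarrow> nt w b"
  using ST_root adj_less by (auto simp: D_def nt_def)

lemma D_rt_swap: "e \<in> D rt ==> prod.swap e \<in> D rt"
  using nt_sym by (cases e) (auto simp: D_rt)

text \<open>Chords with both ends to the left of \<open>t\<close> contribute two opposite terms, so
  counting all darts to the left gives the same as counting the chords over
  \<open>t\<close>.\<close>

lemma psi_positions:
  assumes "antichain z" "offc t"
  shows "psi z (Sf t) = (\<Sum>e\<in>{e \<in> D rt. ct e < t}. z (fst e) (snd e))"
proof -
  let ?Q = "{e \<in> D rt. ct e < t \<and> ctr (snd e) (fst e) < t}"
  have "(\<Sum>e\<in>?Q. z (fst e) (snd e)) = (\<Sum>e\<in>?Q. z (snd e) (fst e))"
    by (rule sum.reindex_bij_witness[of _ prod.swap prod.swap]) (use D_rt_swap in auto)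
  also have "\<dots> = - (\<Sum>e\<in>?Q. z (fst e) (snd e))"
    unfolding sum_negf[symmetric] by (intro sum.cong refl) (rule antichain_swap[OF assms(1)])
  finally have Q: "(\<Sum>e\<in>?Q. z (fst e) (snd e)) = 0" by simp
  have "{e \<in> D rt. ct e < t} = Sf t \<union> ?Q" "Sf t \<inter> ?Q = {}"
    using assms(2) D_rt_swap by (fastforce simp: Sf_def offc_def)+
  then have "(\<Sum>e\<in>{e \<in> D rt. ct e < t}. z (fst e) (snd e)) = psi z (Sf t) + (\<Sum>e\<in>?Q. z (fst e) (snd e))"
    using finite_D[OF rt_less] by (simp add: sum.union_disjoint psi_def Sf_def)
  then show ?thesis using Q by simp
qed

lemma laminar:
  assumes "v < n" "e \<in> D rt"
  shows "e \<in> D v \<and> lo v < ct e \<and> ct e < hi v \<or> e \<notin> D v \<and> (ct e < lo v \<or> hi v < ct e)"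
proof (cases "e \<in> D v")
  case True
  then show ?thesis using D_interval[OF assms(1), of "fst e" "snd e"] by simp
next
  case False
  have "\<forall>e\<in>D rt. e \<notin> D v --> ct e < lo v \<or> hi v < ct e"
    using assms(1)
  proof (induction rule: up_induct)
    case (child v a)
    have v: "v < n" and a: "a \<in> dn v" using chd_less chd_dn child by auto
    show ?case
    proof (intro ballI impI)
      fix e assume e: "e \<in> D rt" "e \<notin> D a"
      show "ct e < lo a \<or> hi a < ct e"
      proof (cases "e \<in> D v")
        case True
        then obtain b where b: "b \<in> dn v" "e \<in> Dd v b" by (auto simp: D_unfold[of v])
        then have "b \<noteq> a" using e(2) child(1) by (auto simp: Dd_def)
        then show ?thesis using dn_disjoint[OF a b(1)] Dd_interval[OF b(1), of "fst e" "snd e"] b(2)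
            chd_interval[OF child(1)] by auto
      next
        case False
        then show ?thesis using child(2) e dn_interval(1,2,3)[OF a] chd_interval[OF child(1)] by fastforce
      qed
    qed
  qed simp
  then show ?thesis using False assms(2) by blast
qed

lemma laminar_dn:
  assumes "a \<in> dn v" "e \<in> D rt"
  shows "e \<in> Dd v a \<and> dlo v a < ct e \<and> ct e < dhi v a \<or> e \<notin> Dd v a \<and> (ct e < dlo v a \<or> dhi v a < ct e)"
proof (cases "chd v a")
  case True
  then show ?thesis using laminar[of a e] chd_interval[OF True] chd_less assms by (auto simp: Dd_def)
next
  case False
  then have Dd: "Dd v a = {(v, a)}" by (simp add: Dd_def)
  show ?thesis
  proof (cases "e \<in> D v")
    case True
    then obtain b where b: "b \<in> dn v" "e \<in> Dd v b" by (auto simp: D_unfold[of v])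
    show ?thesis
    proof (cases "b = a")
      case True
      then show ?thesis using b Dd_interval[OF b(1), of "fst e" "snd e"] by auto
    next
      case False
      then show ?thesis using b dn_disjoint[OF assms(1) b(1)] Dd_interval[OF b(1), of "fst e" "snd e"]
          Dd_disjoint[OF assms(1) b(1)] by auto
    qed
  next
    case False
    then have "ct e < lo v \<or> hi v < ct e" using laminar[OF dn_less(1)[OF assms(1)] assms(2)] by blast
    moreover have "e \<notin> Dd v a" using False assms(1) by (auto simp: D_unfold[of v])
    ultimately show ?thesis using dn_interval(1,2,3)[OF assms(1)] by auto
  qed
qed

lemma offc_dart: "a \<in> dn v ==> offc (dlo v a)" "a \<in> dn v ==> offc (dhi v a)"
  using laminar_dn dn_interval(2) unfolding offc_def by (metis less_asym less_irrefl)+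

lemma Sf_gap: "gap t t' ==> Sf t = Sf t'"
proof -
  assume g: "gap t t'"
  have *: "ct e < t \<longleftrightarrow> ct e < t'" "t < ct e \<longleftrightarrow> t' < ct e" if "e \<in> D rt" for e
    using g that by (force simp: gap_def)+
  show "Sf t = Sf t'"
    unfolding Sf_def using * D_rt_swap by fastforce
qed

text \<open>An induction principle: walk from the left to the right end of the interval of
  \<open>v\<close>, passing the darts at \<open>v\<close> in the order of their ranks. The set
  argument of \<open>P\<close> collects the darts already passed.\<close>

lemma sweep:
  assumes v: "v < n" and base: "P (lo v) {}"
    and gap: "\<And>t t' A. P t A ==> gap t t' ==> P t' A"
    and dart: "\<And>a A. a \<in> dn v ==> A \<subseteq> dn v ==> a \<notin> A ==> P (dlo v a) A ==> P (dhi v a) (insert a A)"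
  shows "P (hi v) (dn v)" and "\<And>a. a \<in> dn v ==> \<exists>A. P (dlo v a) A \<and> P (dhi v a) (insert a A)"
proof -
  define N where "N = (\<lambda>k. {b \<in> dn v. \<rho> v b < k})"
  \<comment> \<open>The invariant after all ranks below \<open>k\<close>: some abscissa
    \<open>t\<close> has been reached that lies to the right of the passed darts and strictly to the
    left of the others.\<close>
  define iv where "iv = (\<lambda>k t. P t (N k) \<and> lo v \<le> t \<and> t \<le> hi v \<and> (\<forall>b\<in>N k. dhi v b \<le> t) \<and> (\<forall>b\<in>dn v - N k. t < dlo v b))"
  have gap1: "gap t t'" if t: "iv k t" and t': "t \<le> t'" "t' \<le> hi v" and b: "\<forall>b\<in>dn v - N k. t' \<le> dlo v b" for k t t'
    unfolding gap_def
  proof (intro conjI ballI notI)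
    fix e assume e: "e \<in> D rt" "t \<le> ct e \<and> ct e \<le> t'"
    then have "e \<in> D v" "lo v < ct e" "ct e < hi v" using laminar[OF v e(1)] t t' by (auto simp: iv_def)
    then obtain c where c: "c \<in> dn v" "e \<in> Dd v c" by (auto simp: D_unfold[of v])
    then have "dlo v c < ct e" "ct e < dhi v c" using Dd_interval[OF c(1), of "fst e" "snd e"] by auto
    moreover have "dhi v c \<le> t \<or> t' \<le> dlo v c" using b t c(1) unfolding iv_def by blast
    ultimately show False using e(2) by linarith
  qed (use t' in simp)
  have step: "P (dlo v a) (N k) \<and> P (dhi v a) (insert a (N k)) \<and> iv (Suc k) (dhi v a)"
    if t: "iv k t" and a: "a \<in> dn v" "\<rho> v a = k" for k t a
  proof -
    have b: "\<forall>b\<in>dn v - N k. dlo v a \<le> dlo v b"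
    proof
      fix b assume b: "b \<in> dn v - N k"
      show "dlo v a \<le> dlo v b"
      proof (cases "b = a")
        case False
        then have "\<rho> v a < \<rho> v b" using b a dn_rank[of a v b] by (fastforce simp: N_def)
        then show ?thesis using dn_sep[OF a(1)] dn_interval(2)[OF a(1)] by fastforce
      qed simp
    qed
    have aN: "a \<in> dn v - N k" using a by (simp add: N_def)
    have "gap t (dlo v a)"
      by (rule gap1[OF t _ _ b]) (use t aN dn_interval[OF a(1)] in \<open>force simp: iv_def\<close>)+
    then have 1: "P (dlo v a) (N k)" using gap t by (auto simp: iv_def)
    have 2: "P (dhi v a) (insert a (N k))" by (rule dart[OF a(1) _ _ 1]) (use aN in \<open>auto simp: N_def\<close>)
    have N: "N (Suc k) = insert a (N k)" using a dn_rank by (fastforce simp: N_def less_Suc_eq)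
    have "iv (Suc k) (dhi v a)"
      unfolding iv_def
    proof (intro conjI ballI)
      show "P (dhi v a) (N (Suc k))" using 2 N by simp
      show "lo v \<le> dhi v a" "dhi v a \<le> hi v" using dn_interval[OF a(1)] by auto
      show "dhi v b \<le> dhi v a" if "b \<in> N (Suc k)" for b
      proof (cases "b = a")
        case False
        then have "b \<in> dn v" "\<rho> v b < \<rho> v a" using that N a by (auto simp: N_def)
        then show ?thesis using dn_sep[of b v a] dn_interval(2)[OF a(1)] by fastforce
      qed simp
      show "dhi v a < dlo v b" if "b \<in> dn v - N (Suc k)" for b
        using that a by (intro dn_sep) (auto simp: N_def)
    qed
    then show ?thesis using 1 2 by blast
  qed
  have iv: "\<exists>t. iv k t" for k
  proof (induction k)
    case 0
    have "iv 0 (lo v)" using base lo_less_hi[OF v] dn_interval(1) by (auto simp: iv_def N_def)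
    then show ?case by blast
  next
    case (Suc k)
    then obtain t where t: "iv k t" by blast
    show ?case
    proof (cases "\<exists>a\<in>dn v. \<rho> v a = k")
      case True
      then show ?thesis using step[OF t] by blast
    next
      case False
      then have "N (Suc k) = N k" by (auto simp: N_def less_Suc_eq)
      then show ?thesis using t by (auto simp: iv_def)
    qed
  qed
  show "\<exists>A. P (dlo v a) A \<and> P (dhi v a) (insert a A)" if "a \<in> dn v" for a
    using iv[of "\<rho> v a"] step[OF _ that refl] by blast
  obtain t where t: "iv RB t" using iv by blast
  have N: "N RB = dn v" using rank_less by (auto simp: N_def dn_iff)
  then have "gap t (hi v)" by (intro gap1[OF t]) (use t in \<open>auto simp: iv_def\<close>)
  then show "P (hi v) (dn v)" using gap t N by (auto simp: iv_def)
qed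

lemma psi_dart:
  assumes "flow z" "a \<in> dn v" shows "psi z (Sf (dhi v a)) = psi z (Sf (dlo v a)) + z v a"
proof -
  have z: "antichain z" using assms by (simp add: flow_def)
  have "{e \<in> D rt. ct e < dhi v a} = {e \<in> D rt. ct e < dlo v a} \<union> Dd v a"
  proof -
    have "Dd v a \<subseteq> D rt"
      using dn_cases[OF assms(2)] dn_less[OF assms(2)] ST_root[of v] ST_trans[OF _ ST_root[of a]] by (auto simp: Dd_def D_def D_rt)
    then show ?thesis using laminar_dn[OF assms(2)] dn_interval(2)[OF assms(2)] by fastforce
  qed
  moreover have "{e \<in> D rt. ct e < dlo v a} \<inter> Dd v a = {}"
    using Dd_interval[OF assms(2)] by fastforce
  ultimately show ?thesis
    using finite_D[OF rt_less] finite_Dd[OF assms(2)] sum_Dd(2)[OF assms]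
    by (simp add: psi_positions[OF z] offc_dart[OF assms(2)] sum.union_disjoint)
qed

section \<open>Alternating forms built from faces\<close>

definition K :: "nat => (nat \<times> nat) set set" where
  "K v = {Sf (lo v), Sf (hi v)} \<union> (\<lambda>a. Sf (dlo v a)) ` dn v \<union> (\<lambda>a. Sf (dhi v a)) ` dn v"

lemma K_sweep:
  assumes v: "v < n" and base: "Q (Sf (lo v))"
    and dart: "\<And>a. a \<in> dn v ==> Q (Sf (dlo v a)) ==> Q (Sf (dhi v a))"
  shows "\<forall>A\<in>K v. Q A"
proof -
  have g: "Q (Sf t) ==> gap t t' ==> Q (Sf t')" for t t' using Sf_gap by metis
  note s = sweep[OF v, of "\<lambda>t _. Q (Sf t)"]
  have 1: "Q (Sf (hi v))" by (rule s(1)) (use base g dart in blast)+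
  have 2: "Q (Sf (dlo v a)) \<and> Q (Sf (dhi v a))" if "a \<in> dn v" for a
    using s(2)[OF base g dart that] by simp
  show ?thesis using base 1 2 by (auto simp: K_def)
qed

text \<open>Going round \<open>v\<close>, every crossed dart adds its own flow, so the stream
  function at two corners of \<open>v\<close> differs by an integral functional of the flow at
  \<open>v\<close>.\<close>

lemma corner_functional:
  assumes "v < n" "A \<in> K v"
  shows "\<exists>c :: nat => int. \<forall>z. flow z --> psi z A = psi z (Sf (lo v)) + (\<Sum>a<n. c a * z v a)"
proof -
  have "\<forall>A\<in>K v. \<exists>c :: nat => int. \<forall>z. flow z --> psi z A = psi z (Sf (lo v)) + (\<Sum>a<n. c a * z v a)"
  proof (rule K_sweep[OF assms(1)])
    show "\<exists>c :: nat => int. \<forall>z. flow z --> psi z (Sf (lo v)) = psi z (Sf (lo v)) + (\<Sum>a<n. c a * z v a)"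
      by (intro exI[of _ "\<lambda>_. 0"]) simp
  next
    fix a assume a: "a \<in> dn v"
    assume "\<exists>c :: nat => int. \<forall>z. flow z --> psi z (Sf (dlo v a)) = psi z (Sf (lo v)) + (\<Sum>b<n. c b * z v b)"
    then obtain c :: "nat => int" where c: "\<And>z. flow z ==> psi z (Sf (dlo v a)) = psi z (Sf (lo v)) + (\<Sum>b<n. c b * z v b)"
      by blast
    have "(\<Sum>b<n. (c b + of_bool (b = a)) * z v b) = (\<Sum>b<n. c b * z v b) + z v a" for z
      using dn_less[OF a] by (simp add: distrib_right sum.distrib of_bool_def if_distrib[of "\<lambda>t. t * _"] sum.delta cong: if_cong)
    then show "\<exists>c :: nat => int. \<forall>z. flow z --> psi z (Sf (dhi v a)) = psi z (Sf (lo v)) + (\<Sum>b<n. c b * z v b)"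
      using c psi_dart[OF _ a] by (intro exI[of _ "\<lambda>b. c b + of_bool (b = a)"]) simp
  qed
  then show ?thesis using assms(2) by blast
qed

text \<open>The wedge product of the values of the stream function at two faces. These products span
  the alternating forms met below, because the face values determine a flow.\<close>

definition Ef :: "(nat \<times> nat) set => (nat \<times> nat) set => (nat => nat => int) => (nat => nat => int) => int" where
  "Ef A B z w = psi z A * psi w B - psi z B * psi w A"

text \<open>\<open>Lc J\<close>: the form \<open>J\<close> on flows is a sum of alternating integral forms at the vertices.\<close>

definition Lc :: "((nat => nat => int) => (nat => nat => int) => int) => bool" where
  "Lc J \<longleftrightarrow> (\<exists>N. (\<forall>v a b. N v b a = - N v a b) \<and>
     (\<forall>z w. flow z --> flow w --> J z w = (\<Sum>v<n. lf (N v) (z v) (w v))))"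

lemma Lc_cong: "Lc J ==> (\<And>z w. flow z ==> flow w ==> J' z w = J z w) ==> Lc J'"
  by (fastforce simp: Lc_def)

lemma Lc_0: "Lc (\<lambda>z w. 0)"
  unfolding Lc_def by (intro exI[of _ "\<lambda>v a b. 0"]) (simp add: lf_def)

lemma Lc_add: assumes "Lc J" "Lc J'" shows "Lc (\<lambda>z w. J z w + J' z w)"
proof -
  obtain N where N: "\<And>v a b. N v b a = - N v a b"
    "\<And>z w. flow z ==> flow w ==> J z w = (\<Sum>v<n. lf (N v) (z v) (w v))" using assms(1) unfolding Lc_def by blast
  obtain N' where N': "\<And>v a b. N' v b a = - N' v a b"
    "\<And>z w. flow z ==> flow w ==> J' z w = (\<Sum>v<n. lf (N' v) (z v) (w v))" using assms(2) unfolding Lc_def by blast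
  show ?thesis unfolding Lc_def
  proof (intro exI[of _ "\<lambda>v a b. N v a b + N' v a b"] conjI allI impI)
    fix v a b show "N v b a + N' v b a = - (N v a b + N' v a b)" using N(1)[of v b a] N'(1)[of v b a] by simp
  next
    fix z w assume "flow z" "flow w"
    then show "J z w + J' z w = (\<Sum>v<n. lf (\<lambda>a b. N v a b + N' v a b) (z v) (w v))"
      by (simp add: N(2) N'(2) lf_def distrib_right sum.distrib)
  qed
qed

lemma Lc_scale: assumes "Lc J" shows "Lc (\<lambda>z w. c * J z w)"
proof -
  obtain N where N: "\<And>v a b. N v b a = - N v a b"
    "\<And>z w. flow z ==> flow w ==> J z w = (\<Sum>v<n. lf (N v) (z v) (w v))" using assms(1) unfolding Lc_def by blast
  show ?thesis unfolding Lc_def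
  proof (intro exI[of _ "\<lambda>v a b. c * N v a b"] conjI allI impI)
    fix v a b show "c * N v b a = - (c * N v a b)" using N(1)[of v b a] by simp
  next
    fix z w assume "flow z" "flow w"
    then show "c * J z w = (\<Sum>v<n. lf (\<lambda>a b. c * N v a b) (z v) (w v))"
      by (simp add: N(2) lf_def sum_distrib_left mult.assoc)
  qed
qed

lemma Lc_sum: "(\<And>x. x \<in> I ==> Lc (J x)) ==> Lc (\<lambda>z w. \<Sum>x\<in>I. J x z w)"
  by (induction I rule: infinite_finite_induct) (simp_all add: Lc_0 Lc_add)

text \<open>The sum is the wedge product of the differences of the stream function between
  \<open>A\<close> and \<open>C\<close> and between \<open>B\<close> and \<open>C\<close>; by
  \<open>corner_functional\<close> both depend only on the flow at \<open>v\<close>.\<close>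

lemma corner_triangle:
  assumes v: "v < n" and "A \<in> K v" "B \<in> K v" "C \<in> K v"
  shows "Lc (\<lambda>z w. Ef A B z w + Ef B C z w + Ef C A z w)"
proof -
  obtain a b c where abc: "\<And>z. flow z ==> psi z A = psi z (Sf (lo v)) + (\<Sum>i<n. a i * z v i)"
    "\<And>z. flow z ==> psi z B = psi z (Sf (lo v)) + (\<Sum>i<n. b i * z v i)"
    "\<And>z. flow z ==> psi z C = psi z (Sf (lo v)) + (\<Sum>i<n. c i * z v i)"
    using corner_functional[OF v] assms by fastforce
  define l m where "l = (\<lambda>i. a i - c i)" and "m = (\<lambda>i. b i - c i)"
  define N where "N = (\<lambda>u i j. if u = v then l i * m j - m i * l j else 0)"
  have "Ef A B z w + Ef B C z w + Ef C A z w = (\<Sum>u<n. lf (N u) (z u) (w u))" if zw: "flow z" "flow w" for z w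
  proof -
    let ?s = "\<lambda>k z. \<Sum>i<n. k i * z v i"
    have d: "psi z A - psi z C = ?s l z" "psi z B - psi z C = ?s m z" if "flow z" for z
      using abc that by (simp_all add: l_def m_def left_diff_distrib sum_subtractf)
    have "(\<Sum>u<n. lf (N u) (z u) (w u)) = lf (N v) (z v) (w v)"
      using v by (subst sum.remove[of _ v]) (auto simp: N_def lf_def)
    also have "\<dots> = (\<Sum>i<n. \<Sum>j<n. (l i * z v i) * (m j * w v j) - (m i * z v i) * (l j * w v j))"
      unfolding lf_def by (intro sum.cong refl) (simp add: N_def algebra_simps)
    also have "\<dots> = ?s l z * ?s m w - ?s m z * ?s l w"
      by (simp add: sum_subtractf sum_product)
    also have "\<dots> = Ef A B z w + Ef B C z w + Ef C A z w"
      unfolding d[OF zw(1), symmetric] d[OF zw(2), symmetric] by (simp add: Ef_def algebra_simps)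
    finally show ?thesis by simp
  qed
  moreover have "N u j i = - N u i j" for u i j by (simp add: N_def)
  ultimately show ?thesis unfolding Lc_def by blast
qed

lemma near_center:
  assumes "nt v a" "f \<in> D rt" "f \<noteq> (v, a)"
  shows "ct f < dlo v a \<longleftrightarrow> ct f < ctr v a" "ct f < dhi v a \<longleftrightarrow> ct f < ctr v a"
    "dlo v a < ct f \<longleftrightarrow> ctr v a < ct f" "dhi v a < ct f \<longleftrightarrow> ctr v a < ct f"
  using laminar_dn[OF nt_dn[OF assms(1)] assms(2)] dn_interval[OF nt_dn[OF assms(1)]] assms
  by (auto simp: Dd_def nt_def)

text \<open>Within the interval of a chord end there is no other dart, so passing the left end only
  adds the chord. As chords do not cross, any other chord covers both ends or neither, which
  identifies the faces at the right end with those at the left.\<close>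

lemma chord_face:
  assumes "nt v a" "ctr v a < ctr a v"
  shows "Sf (dhi v a) = insert (v, a) (Sf (dlo v a))" "(v, a) \<notin> Sf (dlo v a)"
    "Sf (dlo a v) = Sf (dhi v a)" "Sf (dhi a v) = Sf (dlo v a)"
proof -
  note i = dn_interval(4,5)[OF nt_dn[OF assms(1)]] dn_interval(4,5)[OF nt_dn[OF nt_sym[OF assms(1)]]]
  have ne: "(a, v) \<noteq> (v, a)" using assms(2) by auto
  have rD: "(v, a) \<in> D rt" "(a, v) \<in> D rt" using assms(1) nt_sym by (auto simp: D_rt)
  note e = near_center[OF assms(1) rD(2) ne] near_center[OF nt_sym[OF assms(1)] rD(1)] 
  have e1: "(v, a) \<in> Sf (dhi v a)" "(v, a) \<in> Sf (dlo a v)" "(v, a) \<notin> Sf (dlo v a)" "(v, a) \<notin> Sf (dhi a v)"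
    "(a, v) \<notin> Sf (dhi v a)" "(a, v) \<notin> Sf (dlo a v)" "(a, v) \<notin> Sf (dlo v a)" "(a, v) \<notin> Sf (dhi a v)"
    using e i rD ne assms(2) by (auto simp: Sf_def)
  have mem: "f \<in> Sf (dhi v a) \<longleftrightarrow> ct f < ctr v a \<and> ctr v a < ctr (snd f) (fst f)"
     "f \<in> Sf (dlo v a) \<longleftrightarrow> ct f < ctr v a \<and> ctr v a < ctr (snd f) (fst f)"
     "f \<in> Sf (dhi a v) \<longleftrightarrow> ct f < ctr a v \<and> ctr a v < ctr (snd f) (fst f)"
     "f \<in> Sf (dlo a v) \<longleftrightarrow> ct f < ctr a v \<and> ctr a v < ctr (snd f) (fst f)"
    if f: "f \<in> D rt" "f \<noteq> (v, a)" "f \<noteq> (a, v)" for f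
  proof -
    have s: "prod.swap f \<in> D rt" "prod.swap f \<noteq> (v, a)" "prod.swap f \<noteq> (a, v)"
      using f D_rt_swap by (cases f; auto)+
    note m = near_center[OF assms(1) f(1,2)] near_center[OF assms(1) s(1,2)]
      near_center[OF nt_sym[OF assms(1)] f(1,3)] near_center[OF nt_sym[OF assms(1)] s(1,3)]
    show "f \<in> Sf (dhi v a) \<longleftrightarrow> ct f < ctr v a \<and> ctr v a < ctr (snd f) (fst f)"
     "f \<in> Sf (dlo v a) \<longleftrightarrow> ct f < ctr v a \<and> ctr v a < ctr (snd f) (fst f)"
     "f \<in> Sf (dhi a v) \<longleftrightarrow> ct f < ctr a v \<and> ctr a v < ctr (snd f) (fst f)"
     "f \<in> Sf (dlo a v) \<longleftrightarrow> ct f < ctr a v \<and> ctr a v < ctr (snd f) (fst f)"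
      using m f(1) by (auto simp: Sf_def)
  qed
  have nest: "ct f < ctr v a \<and> ctr v a < ctr (snd f) (fst f) \<longleftrightarrow> ct f < ctr a v \<and> ctr a v < ctr (snd f) (fst f)"
    if f: "f \<in> D rt" "f \<noteq> (v, a)" "f \<noteq> (a, v)" for f
  proof -
    obtain w b where wb: "f = (w, b)" "nt w b" using f(1) by (cases f) (auto simp: D_rt)
    have "(b, w) \<in> D rt" "(b, w) \<noteq> (a, v)" "(b, w) \<noteq> (v, a)" using wb f nt_sym D_rt by auto
    then have "ctr b w \<noteq> ctr a v" "ctr w b \<noteq> ctr v a"
      using ctr_inj[OF rt_less, of "(b, w)" "(a, v)"] ctr_inj[OF rt_less, of "(w, b)" "(v, a)"] rD f wb by auto
    then show ?thesis
      using chords_do_not_cross[OF wb(2) assms(1)] chords_do_not_cross[OF assms(1) wb(2)] assms(2) wb(1) by auto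
  qed
  have sub: "Sf t \<subseteq> D rt" for t by (auto simp: Sf_def)
  have ext: "A = B" if "A \<subseteq> D rt" "B \<subseteq> D rt" "(v, a) \<in> A \<longleftrightarrow> (v, a) \<in> B" "(a, v) \<in> A \<longleftrightarrow> (a, v) \<in> B"
    "\<And>f. f \<in> D rt ==> f \<noteq> (v, a) ==> f \<noteq> (a, v) ==> f \<in> A \<longleftrightarrow> f \<in> B" for A B
    using that by auto
  show "Sf (dhi v a) = insert (v, a) (Sf (dlo v a))"
    by (rule ext) (use sub rD e1 ne mem in auto)
  show "Sf (dlo a v) = Sf (dhi v a)" "Sf (dhi a v) = Sf (dlo v a)"
    by (rule ext; use sub e1 mem nest in auto)+
  show "(v, a) \<notin> Sf (dlo v a)" by (fact e1)
qed

lemma chord_sides: assumes "nt v a" shows "Sf (dhi v a) = Sf (dlo a v)"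
proof -
  have "ctr v a \<noteq> ctr a v"
    using ctr_inj[OF rt_less, of "(v, a)" "(a, v)"] assms nt_sym adj_irrefl by (auto simp: D_rt nt_def)
  then consider "ctr v a < ctr a v" | "ctr a v < ctr v a" by linarith
  then show ?thesis
  proof cases
    case 1
    then show ?thesis using chord_face(3)[OF assms 1] by simp
  next
    case 2
    then show ?thesis using chord_face(4)[OF nt_sym[OF assms] 2] by simp
  qed
qed

text \<open>A primitive for \<open>Ef\<close> on the faces: each chord over the abscissa contributes
  the wedge product of its own two sides. Crossing a chord then changes it by exactly that
  product.\<close>

definition Pf :: "(nat \<times> nat) set => (nat => nat => int) => (nat => nat => int) => int" where
  "Pf A z w = (\<Sum>e\<in>A. Ef (Sf (dlo (fst e) (snd e))) (Sf (dhi (fst e) (snd e))) z w)"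

lemma Pf_chord:
  assumes "nt v a"
  shows "Pf (Sf (dhi v a)) z w - Pf (Sf (dlo v a)) z w = Ef (Sf (dlo v a)) (Sf (dhi v a)) z w"
proof -
  have fin: "finite (Sf t)" for t using finite_D[OF rt_less] by (simp add: Sf_def)
  have "ctr v a \<noteq> ctr a v"
    using ctr_inj[OF rt_less, of "(v, a)" "(a, v)"] assms nt_sym adj_irrefl by (auto simp: D_rt nt_def)
  then consider "ctr v a < ctr a v" | "ctr a v < ctr v a" by linarith
  then show ?thesis
  proof cases
    case 1
    then show ?thesis using chord_face(1,2)[OF assms 1] fin[of "dlo v a"] by (simp add: Pf_def)
  next
    case 2
    note c = chord_face[OF nt_sym[OF assms] 2]
    have "Pf (Sf (dlo v a)) z w = Pf (Sf (dhi v a)) z w + Ef (Sf (dlo a v)) (Sf (dhi a v)) z w"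
      using c fin[of "dlo a v"] by (simp add: Pf_def)
    then show ?thesis using c by (simp add: Ef_def)
  qed
qed

text \<open>For the two sides of a chord this is an identity, for those of a tree edge it is the
  statement at the child. The triangles at \<open>v\<close> compose such steps around the vertex, at
  the cost of a form supported at \<open>v\<close>.\<close>

theorem face_potential:
  assumes "v < n" "A \<in> K v" "B \<in> K v"
  shows "Lc (\<lambda>z w. Ef A B z w - (Pf B z w - Pf A z w))"
proof -
  have *: "\<forall>A\<in>K v. Lc (\<lambda>z w. Ef (Sf (lo v)) A z w - (Pf A z w - Pf (Sf (lo v)) z w))"
    using assms(1)
  proof (induction rule: down_induct)
    case (node v)
    show ?case
    proof (rule K_sweep[OF node(1)])
      show "Lc (\<lambda>z w. Ef (Sf (lo v)) (Sf (lo v)) z w - (Pf (Sf (lo v)) z w - Pf (Sf (lo v)) z w))"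
        by (rule Lc_cong[OF Lc_0]) (simp add: Ef_def)
    next
      fix a assume a: "a \<in> dn v"
      let ?l = "Sf (dlo v a)" and ?h = "Sf (dhi v a)" and ?r = "Sf (lo v)"
      assume 1: "Lc (\<lambda>z w. Ef ?r ?l z w - (Pf ?l z w - Pf ?r z w))"
      have 2: "Lc (\<lambda>z w. Ef ?l ?h z w - (Pf ?h z w - Pf ?l z w))"
      proof (cases "chd v a")
        case True
        then show ?thesis using node(2)[OF True] chd_interval[OF True] by (simp add: K_def)
      next
        case False
        then show ?thesis using Pf_chord dn_cases[OF a] by (intro Lc_cong[OF Lc_0]) simp
      qed
      have "Lc (\<lambda>z w. Ef ?r ?l z w + Ef ?l ?h z w + Ef ?h ?r z w)"
        by (rule corner_triangle[OF node(1)]) (use a in \<open>auto simp: K_def\<close>)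
      from Lc_add[OF Lc_add[OF 1 2] Lc_scale[OF this, of "-1"]]
      show "Lc (\<lambda>z w. Ef ?r ?h z w - (Pf ?h z w - Pf ?r z w))"
        by (rule Lc_cong) (simp add: Ef_def)
    qed
  qed
  let ?r = "Sf (lo v)"
  have "Lc (\<lambda>z w. Ef ?r A z w + Ef A B z w + Ef B ?r z w)"
    by (rule corner_triangle[OF assms(1)]) (use assms in \<open>auto simp: K_def\<close>)
  from Lc_add[OF this Lc_add[OF bspec[OF * assms(3)] Lc_scale[OF bspec[OF * assms(2)], of "-1"]]]
  show ?thesis by (rule Lc_cong) (simp add: Ef_def)
qed

end

section \<open>Lifting circle-valued cocycles\<close>

lemma sum_antisymmetric_pairs:
  fixes Om :: "'a => 'a => int" and g :: "'a => nat"
  assumes "finite S" "inj_on g S" "\<And>A B. Om B A = - Om A B"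
  shows "(\<Sum>A\<in>S. \<Sum>B\<in>S. Om A B * x A * y B) =
    (\<Sum>A\<in>S. \<Sum>B\<in>S. if g A < g B then Om A B * (x A * y B - x B * y A) else 0)"
proof -
  let ?f = "\<lambda>A B. if g A < g B then Om A B * x A * y B else 0"
  let ?h = "\<lambda>A B. if g B < g A then Om A B * x A * y B else 0"
  have O0: "Om A A = 0" for A using assms(3)[of A A] by simp
  have "(\<Sum>A\<in>S. \<Sum>B\<in>S. Om A B * x A * y B) = (\<Sum>A\<in>S. \<Sum>B\<in>S. ?f A B + ?h A B)"
  proof (intro sum.cong refl)
    fix A B assume "A \<in> S" "B \<in> S"
    then have "g A = g B ==> A = B" using assms(2) by (auto simp: inj_on_def)
    then show "Om A B * x A * y B = ?f A B + ?h A B" using O0 by (cases "g A" "g B" rule: linorder_cases) auto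
  qed
  also have "\<dots> = (\<Sum>A\<in>S. \<Sum>B\<in>S. ?f A B) + (\<Sum>A\<in>S. \<Sum>B\<in>S. ?h A B)"
    by (simp add: sum.distrib)
  also have "(\<Sum>A\<in>S. \<Sum>B\<in>S. ?h A B) = (\<Sum>A\<in>S. \<Sum>B\<in>S. ?h B A)" by (rule sum.swap)
  also have "(\<Sum>A\<in>S. \<Sum>B\<in>S. ?f A B) + \<dots> = (\<Sum>A\<in>S. \<Sum>B\<in>S. ?f A B + ?h B A)"
    by (simp add: sum.distrib)
  also have "\<dots> = (\<Sum>A\<in>S. \<Sum>B\<in>S. if g A < g B then Om A B * (x A * y B - x B * y A) else 0)"
  proof (intro sum.cong refl)
    fix A B
    show "?f A B + ?h B A = (if g A < g B then Om A B * (x A * y B - x B * y A) else 0)"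
      using assms(3)[of A B] by (simp add: right_diff_distrib mult.assoc)
  qed
  finally show ?thesis .
qed

context sgraph
begin

lemma bil_scale: fixes M :: "nat \<times> nat => nat \<times> nat => int"
  shows "bil M (\<lambda>p q. c * z p q) w = c * bil M z w" "bil M z (\<lambda>p q. c * w p q) = c * bil M z w"
  by (simp_all add: bil_def sum_distrib_left mult_ac)

lemma bil_sum: fixes M :: "nat \<times> nat => nat \<times> nat => int"
  shows "bil M (\<lambda>p q. \<Sum>k\<in>I. c k * z k p q) w = (\<Sum>k\<in>I. c k * bil M (z k) w)"
    "bil M w (\<lambda>p q. \<Sum>k\<in>I. c k * z k p q) = (\<Sum>k\<in>I. c k * bil M w (z k))"
proof -
  have 0: "bil M (\<lambda>p q. 0) w = 0" "bil M w (\<lambda>p q. 0) = 0" by (simp_all add: bil_def)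
  show "bil M (\<lambda>p q. \<Sum>k\<in>I. c k * z k p q) w = (\<Sum>k\<in>I. c k * bil M (z k) w)"
    by (induction I rule: infinite_finite_induct) (simp_all add: 0 bil_add bil_scale)
  show "bil M w (\<lambda>p q. \<Sum>k\<in>I. c k * z k p q) = (\<Sum>k\<in>I. c k * bil M w (z k))"
    by (induction I rule: infinite_finite_induct) (simp_all add: 0 bil_add bil_scale)
qed

lemma bil_of_int: "of_int (bil M z w) = bil (\<lambda>x y. of_int (M x y) :: real) z w"
  by (simp add: bil_def)

lemma arrow_sum:
  fixes f :: "nat => nat => 'r::comm_ring_1"
  assumes "p < n" "q < n"
  shows "(\<Sum>x<n. \<Sum>y<n. f x y * of_int (arrow p q x y)) = f p q - f q p"
proof -
  have "of_int (arrow p q x y) = (of_bool (x = p) * of_bool (y = q) - of_bool (x = q) * of_bool (y = p) :: 'r)" for x y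
    by (simp only: arrow_def of_int_diff of_int_mult of_int_of_bool of_bool_conj)
  moreover have d: "(\<Sum>x<n. of_bool (x = p) * g x) = g p" if "p < n" for g :: "nat => 'r" and p
    using that by (simp add: of_bool_def if_distrib[of "\<lambda>t. t * _"] sum.delta cong: if_cong)
  moreover have "(\<Sum>x<n. \<Sum>y<n. f x y * (of_bool (x = p) * of_bool (y = q) - of_bool (x = q) * of_bool (y = p)))
    = (\<Sum>x<n. of_bool (x = p) * (\<Sum>y<n. of_bool (y = q) * f x y)) - (\<Sum>x<n. of_bool (x = q) * (\<Sum>y<n. of_bool (y = p) * f x y))"
    by (simp only: right_diff_distrib sum_subtractf sum_distrib_left mult_ac)
  ultimately show ?thesis using assms by (simp add: d)
qed

lemma bil_arrow:
  assumes "p < n" "q < n" "a < n" "b < n"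
  shows "bil M (arrow p q) (arrow a b) = M (p, q) (a, b) - M (q, p) (a, b) - M (p, q) (b, a) + M (q, p) (b, a)"
proof -
  have "(\<Sum>c<n. \<Sum>d<n. M (x, y) (c, d) * of_int (arrow p q x y) * of_int (arrow a b c d)) =
    (M (x, y) (a, b) - M (x, y) (b, a)) * of_int (arrow p q x y)" for x y
    using arrow_sum[OF assms(3,4), of "\<lambda>c d. M (x, y) (c, d) * of_int (arrow p q x y)"]
    by (simp add: left_diff_distrib)
  then show ?thesis
    using arrow_sum[OF assms(1,2), of "\<lambda>x y. M (x, y) (a, b) - M (x, y) (b, a)"] by (simp add: bil_def)
qed

end

section \<open>Face cycles and the lift of local forms\<close>

context ranked_tree
begin

text \<open>The boundary cycle of the face \<open>A\<close>: a dart counts with +1 if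
  \<open>A\<close> is on its right and with -1 if \<open>A\<close> is on its left. For a chord both
  of its ends could be consulted; \<open>chord_sides\<close> shows that they agree.\<close>

definition Yf :: "(nat \<times> nat) set => nat => nat => int" where
  "Yf A v a = (if a \<in> dn v then of_bool (Sf (dhi v a) = A) - of_bool (Sf (dlo v a) = A)
     else if v \<in> dn a then of_bool (Sf (dlo a v) = A) - of_bool (Sf (dhi a v) = A) else 0)"

lemma Yf_antichain: "antichain (Yf A)"
  unfolding antichain_def
proof (intro allI conjI impI)
  fix v a
  show "Yf A v a = - Yf A a v"
  proof (cases "a \<in> dn v \<and> v \<in> dn a")
    case True
    then have "nt v a" by (auto simp: dn_iff nt_def)
    then show ?thesis using True chord_sides[of v a] chord_sides[of a v] nt_sym by (simp add: Yf_def)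
  qed (auto simp: Yf_def)
  show "adj v a" if "Yf A v a \<noteq> 0"
  proof -
    have "a \<in> dn v \<or> v \<in> dn a" by (rule ccontr) (use that in \<open>simp add: Yf_def\<close>)
    then show ?thesis using adj_sym[of a v] dn_iff by blast
  qed
qed

text \<open>The contributions around a vertex telescope from \<open>lo v\<close> to
  \<open>hi v\<close> and are balanced by the parent edge. At the root both ends belong to the outer
  face, encoded by the empty set.\<close>

lemma Yf_flow: "flow (Yf A)"
  unfolding flow_def
proof (intro conjI Yf_antichain allI impI)
  fix v assume v: "v < n"
  let ?g = "\<lambda>t. of_bool (Sf t = A) :: int"
  have s: "(\<Sum>a\<in>dn v. ?g (dhi v a) - ?g (dlo v a)) = ?g (hi v) - ?g (lo v)"
  proof (rule sweep(1)[OF v, of "\<lambda>t B. (\<Sum>a\<in>B. ?g (dhi v a) - ?g (dlo v a)) = ?g t - ?g (lo v)"])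
    fix t t' B assume "(\<Sum>a\<in>B. ?g (dhi v a) - ?g (dlo v a)) = ?g t - ?g (lo v)" "gap t t'"
    then show "(\<Sum>a\<in>B. ?g (dhi v a) - ?g (dlo v a)) = ?g t' - ?g (lo v)" using Sf_gap by simp
  next
    fix a B assume "B \<subseteq> dn v" "a \<notin> B" "(\<Sum>a\<in>B. ?g (dhi v a) - ?g (dlo v a)) = ?g (dlo v a) - ?g (lo v)"
    then show "(\<Sum>a\<in>insert a B. ?g (dhi v a) - ?g (dlo v a)) = ?g (dhi v a) - ?g (lo v)"
      using finite_subset[OF _ finite_dn] by (simp add: sum.insert)
  qed simp
  have "dvg (Yf A) v = (\<Sum>a\<in>{a. adj v a}. Yf A v a)"
    unfolding dvg_def using antichain_zero[OF Yf_antichain] adj_less2 by (intro sum.mono_neutral_right) auto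
  also have "\<dots> = 0"
  proof (cases "v = rt")
    case True
    have b: "lo rt < ct e \<and> ct e < hi rt" if "e \<in> D rt" for e
      using D_interval[OF rt_less, of "fst e" "snd e"] that by simp
    have "Sf (lo rt) = {}" using b by (force simp: Sf_def)
    moreover have "Sf (hi rt) = {}" using b[OF D_rt_swap] by (force simp: Sf_def)
    moreover have "{a. adj v a} = dn v" using True by (auto simp: dn_def)
    ultimately show ?thesis using s True by (simp add: Yf_def)
  next
    case False
    let ?p = "par v"
    have c: "chd ?p v" using v False by (simp add: chd_def)
    have nb: "{a. adj v a} = insert ?p (dn v)" "?p \<notin> dn v"
      using par[OF v False] False by (auto simp: dn_def)
    have "Yf A v ?p = ?g (lo v) - ?g (hi v)"
      using nb(2) chd_dn[OF c] chd_interval[OF c] by (simp add: Yf_def)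
    moreover have "(\<Sum>a\<in>dn v. Yf A v a) = ?g (hi v) - ?g (lo v)"
      using s by (simp add: Yf_def)
    ultimately show ?thesis using nb finite_dn by simp
  qed
  finally show "dvg (Yf A) v = 0" .
qed

lemma Yf_corner: assumes "Yf A v a \<noteq> 0" shows "A \<in> K v"
proof (cases "a \<in> dn v")
  case True
  then show ?thesis using assms by (auto simp: Yf_def K_def of_bool_def split: if_splits)
next
  case False
  then have v: "v \<in> dn a" using assms by (auto simp: Yf_def split: if_splits)
  then have "chd a v" using False dn_cases[OF v] nt_dn nt_sym by blast
  then show ?thesis using assms False v chd_interval[of a v]
    by (auto simp: Yf_def K_def of_bool_def split: if_splits)
qed

text \<open>All sets of darts, a finite supply containing every face. Sets that are not faces have
  the zero cycle as boundary and drop out of the sums.\<close>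

definition Fa :: "(nat \<times> nat) set set" where "Fa = Pow (D rt)"

lemma finite_Fa: "finite Fa"
  using finite_D[OF rt_less] by (simp add: Fa_def)

lemma Sf_Fa: "Sf t \<in> Fa"
  by (auto simp: Sf_def Fa_def)

text \<open>Two uses of one computation: weighted by the stream function, the face cycles recover
  the flow; unweighted they add up to zero, as every edge has a face on either side.\<close>

lemma Yf_sum: assumes "f = (\<lambda>A. psi z A) \<and> flow z \<and> r = z v a \<or> f = (\<lambda>A. 1) \<and> r = 0"
  shows "(\<Sum>A\<in>Fa. f A * Yf A v a) = r"
proof -
  have d: "(\<Sum>A\<in>Fa. f A * of_bool (Sf t = A)) = f (Sf t)" for t and f :: "(nat \<times> nat) set => int"
    using finite_Fa Sf_Fa[of t]
    by (simp add: of_bool_def if_distrib[of "(*) _"] sum.delta' cong: if_cong)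
  have dart: "(\<Sum>A\<in>Fa. f A * (of_bool (Sf (dhi v a) = A) - of_bool (Sf (dlo v a) = A))) = f (Sf (dhi v a)) - f (Sf (dlo v a))" for v a
    by (simp add: right_diff_distrib sum_subtractf d)
  show ?thesis
  proof (cases "a \<in> dn v")
    case True
    then show ?thesis using assms dart[of v a] psi_dart[OF _ True] by (auto simp: Yf_def)
  next
    case False
    show ?thesis
    proof (cases "v \<in> dn a")
      case True
      have "(\<Sum>A\<in>Fa. f A * Yf A v a) = - (\<Sum>A\<in>Fa. f A * (of_bool (Sf (dhi a v) = A) - of_bool (Sf (dlo a v) = A)))"
        unfolding sum_negf[symmetric] by (intro sum.cong refl) (use True False in \<open>simp add: Yf_def algebra_simps\<close>)
      then show ?thesis using assms dart[of a v] psi_dart[OF _ True] antichain_swap[of z v a]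
        by (auto simp: flow_def)
    next
      case f2: False
      then have "\<not> adj v a"
        using False adj_sym[of v a] chd_dep[of a v] chd_dep[of v a] unfolding dn_iff by (auto simp del: dn_iff)
      then have "r = 0" using assms antichain_zero by (auto simp: flow_def)
      then show ?thesis using False f2 by (simp add: Yf_def)
    qed
  qed
qed

text \<open>Expand both flows in face cycles. The coefficient \<open>Om A B\<close> vanishes unless
  the faces share a vertex, since the form is a sum of real forms at vertices. For such faces
  \<open>face_potential\<close> replaces \<open>Ef\<close> by a difference of values of
  \<open>Pf\<close> up to integral local forms, and these differences cancel because the rows of
  \<open>Om\<close> have sum zero.\<close>

theorem local_lift:
  fixes M :: "nat \<times> nat => nat \<times> nat => int" and R :: "nat => nat => nat => real"
  assumes M: "\<And>x y. M y x = - M x y"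
    and R: "\<And>z w. flow z ==> flow w ==> of_int (bil M z w) =
      (\<Sum>v<n. lf (R v) (\<lambda>a. of_int (z v a)) (\<lambda>b. of_int (w v b)))"
  shows "Lc (bil M)"
proof -
  define Om where "Om = (\<lambda>A B. bil M (Yf A) (Yf B))"
  have Omalt: "Om B A = - Om A B" for A B unfolding Om_def by (rule bil_alt) (rule M)
  have rep: "z = (\<lambda>p q. \<Sum>A\<in>Fa. psi z A * Yf A p q)" if "flow z" for z
    using Yf_sum[of "psi z" z] that by fastforce
  have row: "(\<Sum>A\<in>Fa. Om A B) = 0" for B
  proof -
    have "(\<Sum>A\<in>Fa. 1 * Om A B) = bil M (\<lambda>p q. \<Sum>A\<in>Fa. 1 * Yf A p q) (Yf B)"
      unfolding Om_def by (rule bil_sum(1)[symmetric])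
    also have "(\<lambda>p q. \<Sum>A\<in>Fa. 1 * Yf A p q) = (\<lambda>p q. 0)"
      using Yf_sum[of "\<lambda>_. 1" undefined 0] by (auto simp: fun_eq_iff)
    finally show ?thesis by (simp add: bil_def)
  qed
  have share: "\<exists>v<n. A \<in> K v \<and> B \<in> K v" if "Om A B \<noteq> 0" for A B
  proof (rule ccontr)
    assume *: "\<not> ?thesis"
    have "real_of_int (Om A B) = (\<Sum>v<n. lf (R v) (\<lambda>a. of_int (Yf A v a)) (\<lambda>b. of_int (Yf B v b)))"
      unfolding Om_def by (rule R[OF Yf_flow Yf_flow])
    also have "\<dots> = 0"
    proof (intro sum.neutral ballI lf_zero)
      fix v assume "v \<in> {..<n}"
      then have "A \<notin> K v \<or> B \<notin> K v" using * by auto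
      then show "(\<forall>y. real_of_int (Yf A v y) = 0) \<or> (\<forall>y. real_of_int (Yf B v y) = 0)"
        using Yf_corner of_int_0 by metis
    qed
    finally show False using that by simp
  qed
  obtain g :: "(nat \<times> nat) set => nat" where g: "inj_on g Fa"
    using finite_imp_inj_to_nat_seg[OF finite_Fa] by blast
  have form: "bil M z w = (\<Sum>A\<in>Fa. \<Sum>B\<in>Fa. if g A < g B then Om A B * Ef A B z w else 0)"
    if zw: "flow z" "flow w" for z w
  proof -
    have "bil M z w = bil M (\<lambda>p q. \<Sum>A\<in>Fa. psi z A * Yf A p q) (\<lambda>p q. \<Sum>B\<in>Fa. psi w B * Yf B p q)"
      using rep[OF zw(1)] rep[OF zw(2)] by simp
    also have "\<dots> = (\<Sum>A\<in>Fa. \<Sum>B\<in>Fa. Om A B * psi z A * psi w B)"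
      unfolding bil_sum by (simp add: Om_def sum_distrib_left mult_ac)
    also have "\<dots> = (\<Sum>A\<in>Fa. \<Sum>B\<in>Fa. if g A < g B then Om A B * Ef A B z w else 0)"
      unfolding Ef_def by (rule sum_antisymmetric_pairs[where Om = Om, OF finite_Fa g Omalt])
    finally show ?thesis .
  qed
  \<comment> \<open>Read backwards, the sum over pairs is the full double sum of
    \<open>Om A B\<close> against \<open>Pf B\<close>, in which \<open>Pf\<close> multiplies a row
    sum.\<close>
  have zero: "(\<Sum>A\<in>Fa. \<Sum>B\<in>Fa. if g A < g B then Om A B * (Pf B z w - Pf A z w) else 0) = 0" for z w
  proof -
    have "(\<Sum>A\<in>Fa. \<Sum>B\<in>Fa. if g A < g B then Om A B * (Pf B z w - Pf A z w) else 0) =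
      (\<Sum>A\<in>Fa. \<Sum>B\<in>Fa. Om A B * 1 * Pf B z w)"
      using sum_antisymmetric_pairs[where Om = Om, OF finite_Fa g Omalt, of "\<lambda>_. 1" "\<lambda>B. Pf B z w"]
      by (simp only: mult_1_left)
    also have "\<dots> = (\<Sum>B\<in>Fa. (\<Sum>A\<in>Fa. Om A B) * Pf B z w)"
      by (subst sum.swap) (simp add: sum_distrib_right)
    finally show ?thesis by (simp add: row)
  qed
  have "Lc (\<lambda>z w. \<Sum>A\<in>Fa. \<Sum>B\<in>Fa. if g A < g B then Om A B * (Ef A B z w - (Pf B z w - Pf A z w)) else 0)"
  proof (intro Lc_sum)
    fix A B
    show "Lc (\<lambda>z w. if g A < g B then Om A B * (Ef A B z w - (Pf B z w - Pf A z w)) else 0)"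
    proof (cases "g A < g B \<and> Om A B \<noteq> 0")
      case True
      then obtain v where "v < n" "A \<in> K v" "B \<in> K v" using share by blast
      from Lc_scale[OF face_potential[OF this], of "Om A B"] show ?thesis using True by simp
    next
      case False
      then show ?thesis by (intro Lc_cong[OF Lc_0]) auto
    qed
  qed
  then show ?thesis
  proof (rule Lc_cong)
    fix z w assume zw: "flow z" "flow w"
    have "(\<Sum>A\<in>Fa. \<Sum>B\<in>Fa. if g A < g B then Om A B * (Ef A B z w - (Pf B z w - Pf A z w)) else 0) =
      (\<Sum>A\<in>Fa. \<Sum>B\<in>Fa. (if g A < g B then Om A B * Ef A B z w else 0) - (if g A < g B then Om A B * (Pf B z w - Pf A z w) else 0))"
      by (intro sum.cong refl) (simp add: right_diff_distrib)
    also have "\<dots> = (\<Sum>A\<in>Fa. \<Sum>B\<in>Fa. if g A < g B then Om A B * Ef A B z w else 0)"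
      by (simp only: sum_subtractf zero diff_zero)
    finally show "bil M z w = (\<Sum>A\<in>Fa. \<Sum>B\<in>Fa. if g A < g B then Om A B * (Ef A B z w - (Pf B z w - Pf A z w)) else 0)"
      by (simp only: form[OF zw])
  qed
qed

text \<open>The integral values of the coboundary on disjoint edges form a bilinear form that is
  minus a sum of real local forms. \<open>local_lift\<close> makes the local forms integral, and
  \<open>isotropic_exact\<close> then exhibits the difference as an integral coboundary; on disjoint
  edges the local forms vanish.\<close>

theorem cochain_lift:
  fixes c :: "nat => nat => nat => real"
  assumes c: "alt_cochain c" and int: "\<And>x y. disj_edges x y ==> dcf c x y \<in> \<int>"
  shows "\<exists>k :: nat => nat => nat => int. alt_cochain k \<and> (\<forall>x y. disj_edges x y --> dcf c x y = of_int (dcf k x y))"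
proof -
  define Mi where "Mi = (\<lambda>x y. if disj_edges x y then \<lfloor>dcf c x y\<rfloor> else 0)"
  have Mi: "real_of_int (Mi x y) = (if disj_edges x y then dcf c x y else 0)" for x y
    using int by (auto simp: Mi_def)
  have de: "disj_edges (q, p) y \<longleftrightarrow> disj_edges (p, q) y" "disj_edges x (q, p) \<longleftrightarrow> disj_edges x (p, q)" for p q x y
    using adj_sym by (auto simp: disj_edges_def)
  have inj: "a = - b" if "real_of_int a = - real_of_int b" for a b
    using that by linarith
  have Mialt: "Mi y x = - Mi x y" for x y
    by (rule inj) (use disj_edges_sym[of x y] dcf_alt[of c y x] in \<open>auto simp: Mi\<close>)
  have Misw: "Mi (q, p) y = - Mi (p, q) y" "Mi x (b, a) = - Mi x (a, b)" for p q a b x y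
  proof -
    show "Mi (q, p) y = - Mi (p, q) y"
      by (rule inj) (use dcf_swap(1)[OF c, of q p y] de(1)[of q p y] in \<open>simp add: Mi\<close>)
    show "Mi x (b, a) = - Mi x (a, b)"
      by (rule inj) (use dcf_swap(2)[OF c, of x b a] de(2)[of x b a] in \<open>simp add: Mi\<close>)
  qed
  have halt: "half Mi y x = - half Mi x y" for x y
    using Mialt[of y x] by (auto simp: half_def)
  have "Lc (bil (half Mi))"
  proof (rule local_lift, rule halt)
    fix z w assume zw: "flow z" "flow w"
    have h: "(\<lambda>x y. real_of_int (half Mi x y)) = half (\<lambda>x y. if disj_edges x y then dcf c x y else 0)"
      by (auto simp: half_def Mi fun_eq_iff)
    have "4 * real_of_int (bil (half Mi) z w) =
      - 4 * (\<Sum>v<n. lf (\<lambda>a b. dcf c (v, a) (v, b)) (\<lambda>a. of_int (z v a)) (\<lambda>b. of_int (w v b)))"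
      unfolding bil_of_int h by (rule local_form_of_cochain[OF c zw])
    then show "real_of_int (bil (half Mi) z w) =
      (\<Sum>v<n. lf (\<lambda>a b. - dcf c (v, a) (v, b)) (\<lambda>a. of_int (z v a)) (\<lambda>b. of_int (w v b)))"
      by (simp add: lf_def sum_negf)
  qed
  then obtain N where N: "\<And>v a b. N v b a = - N v a b"
    "\<And>z w. flow z ==> flow w ==> bil (half Mi) z w = (\<Sum>v<n. lf (N v) (z v) (w v))"
    unfolding Lc_def by blast
  obtain k where k: "alt_cochain k" "\<And>p q a b. adj p q ==> adj a b ==> dcf k (p, q) (a, b) =
    bil (half Mi) (arrow p q) (arrow a b) - (\<Sum>v<n. lf (N v) (arrow p q v) (arrow a b v))"
    using isotropic_exact[where M = "half Mi" and N = N, OF halt N] by blast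
  have "dcf c x y = of_int (dcf k x y)" if d: "disj_edges x y" for x y
  proof -
    obtain p q a b where xy: "x = (p, q)" "y = (a, b)" by fastforce
    have e: "adj p q" "adj a b" "{p, q} \<inter> {a, b} = {}" using d by (auto simp: xy disj_edges_def)
    have "lf (N v) (arrow p q v) (arrow a b v) = 0" for v
      by (rule lf_zero) (use e(3) arrow_zero in blast)
    moreover have "4 * bil (half Mi) (arrow p q) (arrow a b) = bil Mi (arrow p q) (arrow a b)"
      by (rule bil_half[where M = Mi, symmetric, OF antichain_arrow[OF e(1)] antichain_arrow[OF e(2)] Misw])
    moreover have "bil Mi (arrow p q) (arrow a b) = 4 * Mi x y"
      using bil_arrow[of p q a b Mi] Misw(1)[of q p "(a, b)"] Misw(2)[of "(p, q)" b a] Misw(1)[of q p "(b, a)"]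
        e adj_less adj_less2 by (simp add: xy)
    ultimately have "dcf k x y = Mi x y" using k(2)[OF e(1,2)] by (simp add: xy)
    then show ?thesis using Mi[of x y] d by simp
  qed
  then show ?thesis using k(1) by blast
qed

end

section \<open>Drawing a ranked tree in the plane\<close>

text \<open>The target is an arbitrary space because the notion serves twice: for drawings in the
  plane and for the parametrisation of the given graph by its subdivided edges. Edges are stored in
  both directions.\<close>

definition (in sgraph) drawing :: "'b topology => (nat => 'b) => (nat => nat => real => 'b) => bool" where
  "drawing T q P \<longleftrightarrow> inj_on q {..<n} \<and> (\<forall>v<n. q v \<in> topspace T) \<and>
    (\<forall>a b. adj a b --> continuous_map (top_of_set {0..1}) T (P a b) \<and> P a b 0 = q a \<and> P a b 1 = q b) \<and>
    (\<forall>a b s. adj a b --> 0 \<le> s --> s \<le> 1 --> P b a (1 - s) = P a b s) \<and>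
    (\<forall>a b v s. adj a b --> v < n --> 0 < s --> s < 1 --> P a b s \<noteq> q v) \<and>
    (\<forall>a b c d s t. adj a b --> adj c d --> 0 < s --> s < 1 --> 0 < t --> t < 1 --> P a b s = P c d t -->
      c = a \<and> d = b \<and> t = s \<or> c = b \<and> d = a \<and> t = 1 - s)"

lemma (in sgraph) drawingD:
  assumes "drawing T q P"
  shows "inj_on q {..<n}" "\<And>v. v < n ==> q v \<in> topspace T"
    "\<And>a b. adj a b ==> continuous_map (top_of_set {0..1}) T (P a b) \<and> P a b 0 = q a \<and> P a b 1 = q b"
    "\<And>a b s. adj a b ==> 0 \<le> s ==> s \<le> 1 ==> P b a (1 - s) = P a b s"
    "\<And>a b v s. adj a b ==> v < n ==> 0 < s ==> s < 1 ==> P a b s \<noteq> q v"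
    "\<And>a b c d s t. adj a b ==> adj c d ==> 0 < s ==> s < 1 ==> 0 < t ==> t < 1 ==> P a b s = P c d t ==>
      c = a \<and> d = b \<and> t = s \<or> c = b \<and> d = a \<and> t = 1 - s"
  using assms unfolding drawing_def by auto

context ranked_tree
begin

definition mid :: "nat => real" where "mid v = (lo v + hi v) / 2"
definition top :: real where "top = real (2 + (\<Sum>v<n. dep v))"
definition pos :: "nat => real \<times> real" where "pos v = (mid v, real (dep v))"

text \<open>The dart \<open>a\<close> at \<open>v\<close> leaves \<open>v\<close> upwards, reaches the abscissa \<open>ctr v a\<close> one level higher
and goes on vertically; \<open>xs v a y\<close> is its abscissa at height \<open>y\<close>. The two darts of a chord are
joined by a tent above the height \<open>top\<close>.\<close>

definition xs :: "nat => nat => real => real" where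
  "xs v a y = mid v + (ctr v a - mid v) * min 1 (y - real (dep v))"

definition st :: "nat => nat => real => real \<times> real" where
  "st v a y = (xs v a y, y)"

definition tp :: "nat => nat => real => real \<times> real" where
  "tp v a \<tau> = (ctr v a + \<tau> * (ctr a v - ctr v a), top + \<bar>ctr a v - ctr v a\<bar> * min \<tau> (1 - \<tau>))"

text \<open>Stem up, tent, stem down, one third of the time each. Clamping the parameter in each
  summand replaces the gluing of three paths, so continuity is immediate; \<open>pn_pieces\<close>
  recovers the three parts.\<close>

definition pn :: "nat => nat => real => real \<times> real" where
  "pn v a s = (let y1 = real (dep v) + (top - real (dep v)) * min (3 * s) 1;
      y3 = real (dep a) + (top - real (dep a)) * min (3 - 3 * s) 1 in
    (xs v a y1 + max 0 (min (3 * s - 1) 1) * (ctr a v - ctr v a) + (xs a v y3 - ctr a v),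
     y1 + \<bar>ctr a v - ctr v a\<bar> * max 0 (min (3 * s - 1) (2 - 3 * s)) + (y3 - top)))"

definition drw :: "nat => nat => real => real \<times> real" where
  "drw v a s = (if chd v a then st v a (real (dep v) + s)
     else if chd a v then st a v (real (dep a) + (1 - s)) else pn v a s)"

lemma top_dep: "v < n ==> real (dep v) + 2 \<le> top"
proof -
  assume "v < n"
  then have "dep v \<le> (\<Sum>v<n. dep v)" by (intro member_le_sum) auto
  then show ?thesis unfolding top_def by linarith
qed

lemma mid_interval: "v < n ==> lo v < mid v \<and> mid v < hi v"
  using lo_less_hi[of v] by (simp add: mid_def)

lemma xs_interval:
  assumes "a \<in> dn v" "real (dep v) \<le> y" shows "lo v < xs v a y" "xs v a y < hi v"
proof -
  define k where "k = min 1 (y - real (dep v))"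
  have k: "0 \<le> k" "k \<le> 1" using assms by (auto simp: k_def)
  have x: "xs v a y = (1 - k) * mid v + k * ctr v a" by (simp add: xs_def k_def algebra_simps)
  note i = mid_interval[OF dn_less(1)[OF assms(1)]] dn_interval[OF assms(1)]
  have "lo v < (1 - k) * mid v + k * ctr v a"
    using convex_bound_lt[of "- mid v" "- lo v" "- ctr v a" "1 - k" k] i k by simp
  moreover have "(1 - k) * mid v + k * ctr v a < hi v"
    using convex_bound_lt[of "mid v" "hi v" "ctr v a" "1 - k" k] i k by simp
  ultimately show "lo v < xs v a y" "xs v a y < hi v" by (simp_all add: x)
qed

lemma vertex_laminar:
  assumes "v < n" "w < n" "v \<noteq> w"
  shows "hi v < lo w \<or> hi w < lo v \<or> (\<exists>c. chd v c \<and> w \<in> ST c) \<or> (\<exists>c. chd w c \<and> v \<in> ST c)"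
proof -
  have "v \<noteq> w --> hi v < lo w \<or> hi w < lo v \<or> (\<exists>c. chd v c \<and> w \<in> ST c) \<or> (\<exists>c. chd w c \<and> v \<in> ST c)"
    using assms(1)
  proof (induction rule: up_induct)
    case root
    then show ?case using ST_cases[OF ST_root[OF assms(2)]] by blast
  next
    case (child v a)
    have va: "v < n" "a < n" "a \<in> dn v" using chd_less chd_dn child(1) by auto
    note ia = chd_interval[OF child(1)] dn_interval(1-3)[OF va(3)]
    consider "v = w" | "hi v < lo w" | "hi w < lo v" | c where "chd v c" "w \<in> ST c" | c where "chd w c" "v \<in> ST c"
      using child(2) by blast
    then show ?case
    proof cases
      case 1
      then show ?thesis using child(1) ST_self by blast
    next
      case 2 then show ?thesis using ia by linarith
    next
      case 3 then show ?thesis using ia by linarith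
    next
      case (4 c)
      show ?thesis
      proof (cases "c = a")
        case True
        then show ?thesis using ST_cases 4 by blast
      next
        case False
        have "lo c \<le> lo w" "hi w \<le> hi c" using ST_interval[OF 4(2)] chd_less[OF 4(1)] by auto
        moreover have "hi a < lo c \<or> hi c < lo a"
          using dn_disjoint[OF va(3) chd_dn[OF 4(1)]] False chd_interval[OF 4(1)] ia(1) by auto
        ultimately show ?thesis by linarith
      qed
    next
      case (5 c)
      then show ?thesis using ST_chd child(1) by blast
    qed
  qed
  then show ?thesis using assms(3) by blast
qed

text \<open>One level above \<open>v\<close> the stem is vertical over the interior of the interval
  of \<open>a\<close>, which is disjoint from the interval of the child \<open>c\<close>.\<close>

lemma stem_above:
  assumes a: "a \<in> dn v" "real (dep v) + 1 \<le> y" "chd v a --> y < real (dep v) + 1"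
    and c: "chd v c" "w \<in> ST c" "lo w \<le> x" "x \<le> hi w"
  shows "xs v a y \<noteq> x"
proof -
  have "a \<noteq> c" using a c by auto
  have x: "xs v a y = ctr v a" using a(2) by (simp add: xs_def)
  have "lo c \<le> lo w" "hi w \<le> hi c" using ST_interval[OF c(2)] chd_less[OF c(1)] by auto
  then show ?thesis
    using dn_disjoint[OF a(1) chd_dn[OF c(1)] \<open>a \<noteq> c\<close>] chd_interval[OF c(1)] dn_interval(4,5)[OF a(1)] c x by auto
qed

lemma below_dep: "chd v c ==> w \<in> ST c ==> real (dep v) + 1 \<le> real (dep w)"
  using ST_dep[of w c] chd_dep[of v c] by simp

text \<open>The intervals of the two lower ends must overlap, so one is an ancestor of the other
  unless they coincide. In the first case the stem of the ancestor is already vertical and outside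
  that branch by \<open>stem_above\<close>. At the same vertex, two stems fan out towards different
  abscissae.\<close>

lemma stem_eq:
  assumes a: "a \<in> dn v" "real (dep v) < y" "chd v a --> y < real (dep v) + 1"
    and b: "b \<in> dn w" "real (dep w) < y" "chd w b --> y < real (dep w) + 1"
    and eq: "xs v a y = xs w b y"
  shows "v = w \<and> a = b"
proof -
  have vw: "v < n" "w < n" using a(1) b(1) dn_less by auto
  have i: "lo v < xs v a y" "xs v a y < hi v" "lo w < xs w b y" "xs w b y < hi w"
    using xs_interval[OF a(1)] xs_interval[OF b(1)] a(2) b(2) by auto
  have "v = w"
  proof (rule ccontr)
    assume "v \<noteq> w"
    then consider "hi v < lo w" | "hi w < lo v" | c where "chd v c" "w \<in> ST c" | c where "chd w c" "v \<in> ST c"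
      using vertex_laminar vw by blast
    then show False
    proof cases
      case (3 c)
      have "real (dep v) + 1 \<le> y" using below_dep[OF 3] b(2) by simp
      then show False using stem_above[OF a(1) _ a(3) 3, of "xs w b y"] i eq by simp
    next
      case (4 c)
      have "real (dep w) + 1 \<le> y" using below_dep[OF 4] a(2) by simp
      then show False using stem_above[OF b(1) _ b(3) 4, of "xs v a y"] i eq by simp
    qed (use i eq in auto)
  qed
  moreover have "a = b"
  proof (rule ccontr)
    assume "a \<noteq> b"
    then have "ctr v a \<noteq> ctr v b"
      using dn_disjoint[of a v b] dn_interval(4,5)[of a v] dn_interval(4,5)[of b v] a(1) b(1) \<open>v = w\<close> by auto
    moreover have "(ctr v a - mid v) * min 1 (y - real (dep v)) = (ctr v b - mid v) * min 1 (y - real (dep v))"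
      using eq \<open>v = w\<close> by (simp add: xs_def)
    moreover have "min 1 (y - real (dep v)) \<noteq> 0" using a(2) by (simp add: min_def)
    ultimately show False by simp
  qed
  ultimately show ?thesis by blast
qed

lemma stem_not_vertex:
  assumes a: "a \<in> dn v" "real (dep v) < y" "chd v a --> y < real (dep v) + 1" and w: "w < n"
  shows "st v a y \<noteq> pos w"
proof
  assume eq: "st v a y = pos w"
  then have y: "y = real (dep w)" and x: "xs v a y = mid w" by (auto simp: st_def pos_def)
  have v: "v < n" "v \<noteq> w" using a y dn_less by auto
  have i: "lo v < xs v a y" "xs v a y < hi v" "lo w < mid w" "mid w < hi w"
    using xs_interval[OF a(1)] mid_interval[OF w] a(2) by auto
  consider "hi v < lo w" | "hi w < lo v" | c where "chd v c" "w \<in> ST c" | c where "chd w c" "v \<in> ST c"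
    using vertex_laminar[OF v(1) w v(2)] by blast
  then show False
  proof cases
    case (3 c)
    then show False using stem_above[OF a(1) _ a(3) 3, of "mid w"] below_dep[OF 3] i x y by simp
  next
    case (4 c)
    then show False using below_dep[OF 4] a(2) y by simp
  qed (use i x in auto)
qed

lemma pos_inj: "inj_on pos {..<n}"
proof (rule inj_onI)
  fix v w assume vw: "v \<in> {..<n}" "w \<in> {..<n}" "pos v = pos w"
  show "v = w"
  proof (rule ccontr)
    assume "v \<noteq> w"
    then consider "hi v < lo w" | "hi w < lo v" | c where "chd v c" "w \<in> ST c" | c where "chd w c" "v \<in> ST c"
      using vertex_laminar[of v w] vw by blast
    then show False
    proof cases
      case (3 c) then show False using below_dep[OF 3] vw by (simp add: pos_def)
    next
      case (4 c) then show False using below_dep[OF 4] vw by (simp add: pos_def)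
    qed (use mid_interval[of v] mid_interval[of w] vw in \<open>auto simp: pos_def\<close>)
  qed
qed

lemma nt_facts:
  assumes "nt v a" shows "v < n" "a < n" "a \<in> dn v" "v \<in> dn a" "ctr v a \<noteq> ctr a v" "\<not> chd v a" "\<not> chd a v"
proof -
  have "(v, a) \<noteq> (a, v)" using assms adj_irrefl by (auto simp: nt_def)
  then show "ctr v a \<noteq> ctr a v"
    using ctr_inj[OF rt_less, of "(v, a)" "(a, v)"] assms nt_sym by (auto simp: D_rt)
qed (use assms adj_less[of v a] adj_less2[of v a] nt_dn[OF assms] nt_dn[OF nt_sym[OF assms]] in \<open>auto simp: nt_def\<close>)

text \<open>After flipping, both tents run from left to right. All sides have slope 1 or -1, so the
  height above a point is its distance to the nearer end of the chord; for nested chords with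
  different ends these distances differ, and disjoint chords have no common abscissa.\<close>

lemma tent_eq:
  assumes "nt v a" "nt w b" "0 < \<tau>" "\<tau> < 1" "0 < \<sigma>" "\<sigma> < 1" "tp v a \<tau> = tp w b \<sigma>"
  shows "w = v \<and> b = a \<and> \<sigma> = \<tau> \<or> w = a \<and> b = v \<and> \<sigma> = 1 - \<tau>"
proof -
  have main: "w = v \<and> b = a \<and> \<sigma> = \<tau>"
    if nt: "nt v a" "nt w b" and c: "ctr v a < ctr a v" "ctr w b < ctr b w" and s: "0 < \<tau>" "\<tau> < 1" "0 < \<sigma>" "\<sigma> < 1"
      and eq: "tp v a \<tau> = tp w b \<sigma>" for v a w b \<tau> \<sigma>
  proof -
    define x y where "x = ctr v a + \<tau> * (ctr a v - ctr v a)" and "y = ctr w b + \<sigma> * (ctr b w - ctr w b)"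
    have xy: "x = y" using eq by (simp add: tp_def x_def y_def)
    have d: "0 < \<tau> * (ctr a v - ctr v a)" "0 < (1 - \<tau>) * (ctr a v - ctr v a)"
      "0 < \<sigma> * (ctr b w - ctr w b)" "0 < (1 - \<sigma>) * (ctr b w - ctr w b)" using s c by simp_all
    have r: "ctr v a < x" "x < ctr a v" "ctr w b < y" "y < ctr b w"
      using d by (simp_all add: x_def y_def algebra_simps)
    have h0: "\<bar>q - p\<bar> * min t (1 - t) = min (p + t * (q - p) - p) (q - (p + t * (q - p)))" if "p < q" for p q t :: real
    proof -
      have e: "q - (p + t * (q - p)) = (1 - t) * (q - p)" by (simp add: algebra_simps)
      show ?thesis unfolding e using that by (auto simp: min_def mult_le_cancel_right)
    qed
    have hx: "\<bar>ctr a v - ctr v a\<bar> * min \<tau> (1 - \<tau>) = min (x - ctr v a) (ctr a v - x)"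
      unfolding x_def by (rule h0[OF c(1)])
    have hy: "\<bar>ctr b w - ctr w b\<bar> * min \<sigma> (1 - \<sigma>) = min (y - ctr w b) (ctr b w - y)"
      unfolding y_def by (rule h0[OF c(2)])
    have h: "min (x - ctr v a) (ctr a v - x) = min (x - ctr w b) (ctr b w - x)"
      using eq hx hy xy by (simp add: tp_def)
    have vw: "(v, a) = (w, b)"
    proof (rule ccontr)
      assume ne: "(v, a) \<noteq> (w, b)"
      have n2: "(v, a) \<noteq> (b, w)" using c by auto
      have D: "(v, a) \<in> D rt" "(a, v) \<in> D rt" "(w, b) \<in> D rt" "(b, w) \<in> D rt" using nt nt_sym by (auto simp: D_rt)
      have "ctr v a \<noteq> ctr w b" "ctr v a \<noteq> ctr b w" "ctr a v \<noteq> ctr w b" "ctr a v \<noteq> ctr b w"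
        using ctr_inj[OF rt_less D(1) D(3)] ctr_inj[OF rt_less D(1) D(4)] ctr_inj[OF rt_less D(2) D(3)]
          ctr_inj[OF rt_less D(2) D(4)] ne n2 by auto
      then show False
        using chords_do_not_cross[OF nt] chords_do_not_cross[OF nt(2,1)] c r h xy by (auto simp: min_def split: if_splits)
    qed
    then have "\<tau> * (ctr a v - ctr v a) = \<sigma> * (ctr a v - ctr v a)" using xy by (simp add: x_def y_def)
    then show ?thesis using vw c by auto
  qed
  have flip: "tp a v (1 - \<tau>) = tp v a \<tau>" for v a \<tau>
    by (simp add: tp_def algebra_simps min.commute abs_minus_commute)
  note c = nt_facts(5)[OF assms(1)] nt_facts(5)[OF assms(2)]
  consider "ctr v a < ctr a v" "ctr w b < ctr b w" | "ctr v a < ctr a v" "ctr b w < ctr w b"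
    | "ctr a v < ctr v a" "ctr w b < ctr b w" | "ctr a v < ctr v a" "ctr b w < ctr w b" using c by linarith
  then show ?thesis
  proof cases
    case 1
    then show ?thesis using main[OF assms(1,2) 1 assms(3-7)] by auto
  next
    case 2
    then show ?thesis using main[OF assms(1) nt_sym[OF assms(2)] 2, of \<tau> "1 - \<sigma>"] assms flip[of b w "\<sigma>"] by auto
  next
    case 3
    have "tp a v (1 - \<tau>) = tp w b \<sigma>" using assms(7) flip[of a v \<tau>] by simp
    from main[OF nt_sym[OF assms(1)] assms(2) 3 _ _ assms(5,6) this] show ?thesis using assms by simp
  next
    case 4
    have "tp a v (1 - \<tau>) = tp b w (1 - \<sigma>)" using assms(7) flip[of a v \<tau>] flip[of b w \<sigma>] by simp
    from main[OF nt_sym[OF assms(1)] nt_sym[OF assms(2)] 4 _ _ _ _ this] show ?thesis using assms by simp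
  qed
qed

lemma pn_pieces:
  assumes "nt v a"
  shows "0 \<le> s ==> s \<le> 1/3 ==> pn v a s = st v a (real (dep v) + (top - real (dep v)) * (3 * s))"
    and "1/3 \<le> s ==> s \<le> 2/3 ==> pn v a s = tp v a (3 * s - 1)"
    and "2/3 \<le> s ==> s \<le> 1 ==> pn v a s = st a v (real (dep a) + (top - real (dep a)) * (3 - 3 * s))"
proof -
  have x: "xs v a top = ctr v a" "xs a v top = ctr a v"
    using top_dep[of v] top_dep[of a] nt_facts[OF assms] by (simp_all add: xs_def)
  show "0 \<le> s ==> s \<le> 1/3 ==> pn v a s = st v a (real (dep v) + (top - real (dep v)) * (3 * s))"
    using x by (simp add: pn_def st_def Let_def max_def min_def)
  show "1/3 \<le> s ==> s \<le> 2/3 ==> pn v a s = tp v a (3 * s - 1)"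
  proof -
    assume "1/3 \<le> s" "s \<le> 2/3"
    then have m: "min (3 * s) 1 = 1" "min (3 - 3 * s) 1 = 1" "max 0 (min (3 * s - 1) 1) = 3 * s - 1"
      "max 0 (min (3 * s - 1) (2 - 3 * s)) = min (3 * s - 1) (1 - (3 * s - 1))" by (auto simp: min_def)
    show "pn v a s = tp v a (3 * s - 1)" unfolding pn_def tp_def Let_def m using x by simp
  qed
  show "2/3 \<le> s ==> s \<le> 1 ==> pn v a s = st a v (real (dep a) + (top - real (dep a)) * (3 - 3 * s))"
  proof -
    assume "2/3 \<le> s" "s \<le> 1"
    then have m: "min (3 * s) 1 = 1" "min (3 - 3 * s) 1 = 3 - 3 * s" "max 0 (min (3 * s - 1) 1) = 1"
      "max 0 (min (3 * s - 1) (2 - 3 * s)) = 0" by auto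
    show "pn v a s = st a v (real (dep a) + (top - real (dep a)) * (3 - 3 * s))"
      unfolding pn_def st_def Let_def m using x by simp
  qed
qed

lemma pn_flip: assumes "nt v a" "0 \<le> s" "s \<le> 1" shows "pn a v (1 - s) = pn v a s"
proof -
  consider "s \<le> 1/3" | "1/3 \<le> s" "s \<le> 2/3" | "2/3 \<le> s" by linarith
  then show ?thesis
  proof cases
    case 1
    then show ?thesis using pn_pieces(1)[OF assms(1), of s] pn_pieces(3)[OF nt_sym[OF assms(1)], of "1 - s"] assms by simp
  next
    case 2
    have "tp a v (3 * (1 - s) - 1) = tp v a (3 * s - 1)"
      by (simp add: tp_def algebra_simps min.commute abs_minus_commute)
    then show ?thesis using pn_pieces(2)[OF assms(1), of s] pn_pieces(2)[OF nt_sym[OF assms(1)], of "1 - s"] 2 by simp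
  next
    case 3
    then show ?thesis using pn_pieces(3)[OF assms(1), of s] pn_pieces(1)[OF nt_sym[OF assms(1)], of "1 - s"] assms by simp
  qed
qed

lemma chd_asym: "chd v a ==> \<not> chd a v"
  using chd_dep[of v a] chd_dep[of a v] by auto

lemma drw_flip: assumes "adj v a" "0 \<le> s" "s \<le> 1" shows "drw a v (1 - s) = drw v a s"
  using chd_asym[of v a] pn_flip[of v a s] assms by (auto simp: drw_def nt_def)

definition stem_point where
  "stem_point v a s \<longleftrightarrow> (\<exists>y. drw v a s = st v a y \<and> a \<in> dn v \<and> real (dep v) < y \<and> y \<le> top \<and>
       (chd v a \<and> y = real (dep v) + s \<and> y < real (dep v) + 1 \<or>
        nt v a \<and> y = real (dep v) + (top - real (dep v)) * (3 * s)))"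

definition tent_point where
  "tent_point v a s \<longleftrightarrow> nt v a \<and> 1/3 < s \<and> s < 2/3 \<and> drw v a s = tp v a (3 * s - 1)"

text \<open>Every interior point of an edge, read in one of the two directions, is a stem point or a
point of the first half of a tent.\<close>

lemma drw_point:
  assumes "adj v a" "0 < s" "s < 1"
  shows "\<exists>v' a' s'. (v' = v \<and> a' = a \<and> s' = s \<or> v' = a \<and> a' = v \<and> s' = 1 - s) \<and> drw v' a' s' = drw v a s \<and>
    (stem_point v' a' s' \<or> tent_point v' a' s')"
proof -
  have tree: ?thesis if "chd v' a'" "v' = v \<and> a' = a \<and> s' = s \<or> v' = a \<and> a' = v \<and> s' = 1 - s" for v' a' s'
  proof -
    have s': "0 < s'" "s' < 1" using that assms by auto
    have "real (dep v') + 2 \<le> top" using top_dep chd_less[OF that(1)] by blast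
    moreover have "drw v' a' s' = drw v a s" using that(2) drw_flip[OF assms(1), of s] assms by auto
    moreover have "drw v' a' s' = st v' a' (real (dep v') + s')" using that(1) by (simp add: drw_def)
    moreover have "real (dep v') < real (dep v') + s'" "real (dep v') + s' \<le> top" "real (dep v') + s' < real (dep v') + 1"
      using s' calculation(1) by auto
    ultimately show ?thesis using that chd_dn[OF that(1)] unfolding stem_point_def by blast
  qed
  have nontree: ?thesis if nt: "nt v' a'" and e: "v' = v \<and> a' = a \<and> s' = s \<or> v' = a \<and> a' = v \<and> s' = 1 - s"
    and s: "0 < s'" "s' < 2/3" for v' a' s'
  proof -
    have eq: "drw v' a' s' = drw v a s" using e drw_flip[OF assms(1), of s] assms by auto
    have d: "drw v' a' s' = pn v' a' s'" using nt by (simp add: drw_def nt_def)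
    have t: "real (dep v') + 2 \<le> top" using top_dep nt_facts[OF nt] by blast
    show ?thesis
    proof (cases "s' \<le> 1/3")
      case True
      have "0 < (top - real (dep v')) * (3 * s')" using t s by simp
      moreover have "(top - real (dep v')) * (3 * s') \<le> (top - real (dep v')) * 1"
        using t True by (intro mult_left_mono) auto
      ultimately have "real (dep v') < real (dep v') + (top - real (dep v')) * (3 * s')"
        "real (dep v') + (top - real (dep v')) * (3 * s') \<le> top" by auto
      moreover have "drw v' a' s' = st v' a' (real (dep v') + (top - real (dep v')) * (3 * s'))"
        using d pn_pieces(1)[OF nt, of s'] True s by simp
      ultimately show ?thesis using e eq nt nt_dn[OF nt] unfolding stem_point_def by blast
    next
      case False
      then have "1/3 < s'" "drw v' a' s' = tp v' a' (3 * s' - 1)" using d pn_pieces(2)[OF nt, of s'] s by auto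
      then show ?thesis using e eq nt s(2) unfolding tent_point_def by blast
    qed
  qed
  consider "chd v a" | "chd a v" | "nt v a" "s < 2/3" | "nt a v" "1 - s < 2/3"
    using assms(1) adj_sym by (fastforce simp: nt_def)
  then show ?thesis
  proof cases
    case 1 then show ?thesis using tree[of v a s] by blast
  next
    case 2 then show ?thesis using tree[of a v "1 - s"] by blast
  next
    case 3 then show ?thesis using nontree[of v a s] assms by blast
  next
    case 4 then show ?thesis using nontree[of a v "1 - s"] assms by auto
  qed
qed

lemma tent_above: "nt v a ==> 0 < \<tau> ==> \<tau> < 1 ==> top < snd (tp v a \<tau>)"
  using nt_facts(5)[of v a] by (simp add: tp_def)

theorem plane_drawing_of_ranks: "drawing euclidean pos drw"
  unfolding drawing_def
proof (intro conjI allI impI pos_inj)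
  show "pos v \<in> topspace euclidean" for v by simp
next
  fix a b assume ab: "adj a b"
  have xc: "continuous_on A f ==> continuous_on A (\<lambda>s. xs v a (f s))" for A f v a
    unfolding xs_def by (intro continuous_intros)
  have lt: "a < n" "b < n" using adj_less adj_less2 ab by auto
  show "continuous_map (top_of_set {0..1}) euclidean (drw a b)"
    unfolding drw_def continuous_map_iff_continuous2 by (cases "chd a b"; cases "chd b a") (auto simp: st_def pn_def Let_def intro!: continuous_intros xc)
  have 0: "drw a b 0 = pos a" if "adj a b" for a b
  proof -
    consider "chd a b" | "chd b a" | "nt a b" using \<open>adj a b\<close> by (auto simp: nt_def)
    then show ?thesis
    proof cases
      case 1
      then show ?thesis by (simp add: drw_def st_def xs_def pos_def)
    next
      case 2
      then show ?thesis using chd_asym[OF 2] chd_dep[OF 2] chd_interval[OF 2]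
        by (simp add: drw_def st_def xs_def pos_def ctr_def mid_def)
    next
      case 3
      then show ?thesis using pn_pieces(1)[OF 3, of 0]
        by (simp add: drw_def nt_def st_def xs_def pos_def)
    qed
  qed
  show "drw a b 0 = pos a" using 0[OF ab] .
  show "drw a b 1 = pos b" using drw_flip[OF adj_sym[OF ab], of 0] 0[OF adj_sym[OF ab]] by simp
next
  fix a b and s :: real assume "adj a b" "0 \<le> s" "s \<le> 1"
  then show "drw b a (1 - s) = drw a b s" by (rule drw_flip)
next
  fix a b v and s :: real assume *: "adj a b" "v < n" "0 < s" "s < 1"
  have "snd (pos v) < top" using top_dep[OF *(2)] by (simp add: pos_def)
  moreover obtain v' a' s' where d: "drw v' a' s' = drw a b s"
    "stem_point v' a' s' \<or> tent_point v' a' s'"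
    using drw_point[OF *(1,3,4)] by blast
  ultimately show "drw a b s \<noteq> pos v"
    using stem_not_vertex[of a' v' _ v] tent_above[of v' a' "3 * s' - 1"] *(2)
    unfolding stem_point_def tent_point_def by (fastforce simp: nt_def)
next
  fix a b c d and s t :: real
  assume *: "adj a b" "adj c d" "0 < s" "s < 1" "0 < t" "t < 1" "drw a b s = drw c d t"
  obtain v1 a1 s1 where 1: "v1 = a \<and> a1 = b \<and> s1 = s \<or> v1 = b \<and> a1 = a \<and> s1 = 1 - s"
    "drw v1 a1 s1 = drw a b s" "stem_point v1 a1 s1 \<or> tent_point v1 a1 s1" using drw_point[OF *(1,3,4)] by blast
  obtain v2 a2 s2 where 2: "v2 = c \<and> a2 = d \<and> s2 = t \<or> v2 = d \<and> a2 = c \<and> s2 = 1 - t"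
    "drw v2 a2 s2 = drw c d t" "stem_point v2 a2 s2 \<or> tent_point v2 a2 s2" using drw_point[OF *(2,5,6)] by blast
  have eq: "drw v1 a1 s1 = drw v2 a2 s2" using 1 2 * by simp
  have "v2 = v1 \<and> a2 = a1 \<and> s2 = s1 \<or> v2 = a1 \<and> a2 = v1 \<and> s2 = 1 - s1"
    using 1(3)
  proof
    assume "stem_point v1 a1 s1"
    then obtain y where y: "drw v1 a1 s1 = st v1 a1 y" "a1 \<in> dn v1" "real (dep v1) < y" "y \<le> top"
      "chd v1 a1 \<and> y = real (dep v1) + s1 \<and> y < real (dep v1) + 1 \<or>
        nt v1 a1 \<and> y = real (dep v1) + (top - real (dep v1)) * (3 * s1)"
      unfolding stem_point_def by blast
    show ?thesis using 2(3)
    proof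
      assume "stem_point v2 a2 s2"
      then obtain y' where y': "drw v2 a2 s2 = st v2 a2 y'" "a2 \<in> dn v2" "real (dep v2) < y'" "y' \<le> top"
        "chd v2 a2 \<and> y' = real (dep v2) + s2 \<and> y' < real (dep v2) + 1 \<or>
        nt v2 a2 \<and> y' = real (dep v2) + (top - real (dep v2)) * (3 * s2)"
        unfolding stem_point_def by blast
      have yy: "y' = y" "xs v1 a1 y = xs v2 a2 y" using eq y(1) y'(1) by (auto simp: st_def)
      have va: "v1 = v2 \<and> a1 = a2"
        by (rule stem_eq[OF y(2,3) _ y'(2)]) (use y y' yy in \<open>auto simp: nt_def\<close>)
      have "real (dep v1) + 2 \<le> top" using top_dep y(2) dn_less by blast
      then show ?thesis using va y(5) y'(5) yy(1) by (auto simp: nt_def)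
    next
      assume "tent_point v2 a2 s2"
      then have "top < snd (drw v2 a2 s2)" using tent_above[of v2 a2 "3 * s2 - 1"] by (simp add: tent_point_def)
      moreover have "snd (drw v1 a1 s1) \<le> top" using y(1,4) by (simp add: st_def)
      ultimately show ?thesis using eq by simp
    qed
  next
    assume t1: "tent_point v1 a1 s1"
    show ?thesis using 2(3)
    proof
      assume "stem_point v2 a2 s2"
      then show ?thesis using tent_above[of v1 a1 "3 * s1 - 1"] eq t1
        by (auto simp: st_def stem_point_def tent_point_def)
    next
      assume "tent_point v2 a2 s2"
      then show ?thesis using tent_eq[of v1 a1 v2 a2 "3 * s1 - 1" "3 * s2 - 1"] t1 eq by (auto simp: tent_point_def)
    qed
  qed
  then show "c = a \<and> d = b \<and> t = s \<or> c = b \<and> d = a \<and> t = 1 - s" using 1(1) 2(1) by auto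
qed

end

section \<open>Paths and loops in topological spaces\<close>

definition pth :: "'a topology => 'a => 'a => (real => 'a) => bool" where
  "pth Z x y p \<longleftrightarrow> continuous_map (top_of_set {0..1}) Z p \<and> p 0 = x \<and> p 1 = y"

definition phom :: "'a topology => 'a => 'a => (real => 'a) => (real => 'a) => bool" where
  "phom Z x y p q \<longleftrightarrow> homotopic_with (\<lambda>h. h 0 = x \<and> h 1 = y) (top_of_set {0..1}) Z p q"

definition loop_rev :: "(real => 'a) => real => 'a" where
  "loop_rev p = (\<lambda>t. p (1 - t))"

lemma sub_map:
  assumes "continuous_map (top_of_set T) Z Q" "continuous_on S f" "\<And>x. x \<in> S ==> f x \<in> T"
  shows "continuous_map (top_of_set S) Z (\<lambda>x. Q (f x))"
proof -
  have "continuous_map (top_of_set S) (top_of_set T) f" using assms(2,3) by auto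
  from continuous_map_compose[OF this assms(1)] show ?thesis by (simp add: o_def)
qed

lemma paste_le:
  fixes p :: "'b::topological_space => real"
  assumes "continuous_on S p" "continuous_map (top_of_set {x \<in> S. p x \<le> c}) Z f"
    "continuous_map (top_of_set {x \<in> S. c \<le> p x}) Z g" "\<And>x. x \<in> S ==> p x = c ==> f x = g x"
  shows "continuous_map (top_of_set S) Z (\<lambda>x. if p x \<le> c then f x else g x)"
proof (rule continuous_map_cases_le)
  have "S \<inter> {x \<in> S. p x \<le> c} = {x \<in> S. p x \<le> c}" "S \<inter> {x \<in> S. c \<le> p x} = {x \<in> S. c \<le> p x}" by auto
  then show "continuous_map (subtopology (top_of_set S) {x \<in> topspace (top_of_set S). p x \<le> c}) Z f"
    "continuous_map (subtopology (top_of_set S) {x \<in> topspace (top_of_set S). c \<le> p x}) Z g"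
    using assms(2,3) by (simp_all add: subtopology_subtopology)
qed (use assms(1,4) in auto)

lemma pth_in: "pth Z x y p ==> t \<in> {0..1} ==> p t \<in> topspace Z"
  unfolding pth_def continuous_map_def by auto

lemma pth_ends: "pth Z x y p ==> x \<in> topspace Z" "pth Z x y p ==> y \<in> topspace Z"
  using pth_in[of Z x y p 0] pth_in[of Z x y p 1] by (auto simp: pth_def)

lemma phom_refl: "pth Z x y p ==> phom Z x y p p"
  by (simp add: phom_def pth_def)

lemma phom_sym: "phom Z x y p q ==> phom Z x y q p"
  unfolding phom_def by (rule homotopic_with_symD)

lemma phom_trans: "phom Z x y p q ==> phom Z x y q r ==> phom Z x y p r"
  unfolding phom_def by (rule homotopic_with_trans)

lemma phom_pth: "phom Z x y p q ==> pth Z x y p" "phom Z x y p q ==> pth Z x y q"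
  using homotopic_with_imp_continuous_maps homotopic_with_imp_property unfolding phom_def pth_def by blast+

lemma phom_cong:
  assumes "pth Z x y p" "\<And>t. t \<in> {0..1} ==> p t = q t" shows "phom Z x y p q"
  unfolding phom_def
proof (rule homotopic_with_equal)
  show "p 0 = x \<and> p 1 = y" "q 0 = x \<and> q 1 = y" using assms(1) assms(2)[of 0] assms(2)[of 1] by (auto simp: pth_def)
qed (use assms in \<open>auto simp: pth_def\<close>)

lemma phom_square_map:
  fixes p q :: "real => 'a"
  shows "phom Z x y p q \<longleftrightarrow> (\<exists>H. continuous_map (top_of_set ({0..1} \<times> {0..1} :: (real \<times> real) set)) Z H \<and>
     (\<forall>t\<in>{0..1}. H (0, t) = p t \<and> H (1, t) = q t) \<and> (\<forall>s\<in>{0..1}. H (s, 0) = x \<and> H (s, 1) = y))"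
  unfolding phom_def
  by (subst homotopic_with) auto

lemma phom_of_square:
  fixes H :: "real \<times> real => 'a"
  assumes "continuous_map (top_of_set ({0..1} \<times> {0..1})) Z H"
    "\<And>t. t \<in> {0..1} ==> H (0, t) = p t" "\<And>t. t \<in> {0..1} ==> H (1, t) = q t"
    "\<And>s. s \<in> {0..1} ==> H (s, 0) = x" "\<And>s. s \<in> {0..1} ==> H (s, 1) = y"
  shows "phom Z x y p q"
  using assms unfolding phom_square_map by blast

text \<open>The straight-line homotopy between the parameter curves, pushed forward by
  \<open>Q\<close>.\<close>

lemma phom_convex:
  fixes C :: "'b::real_normed_vector set"
  assumes Q: "continuous_map (top_of_set C) Z Q" and C: "convex C"
    and f: "continuous_on {0..1} f" "\<And>t. t \<in> {0..1} ==> f t \<in> C"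
    and g: "continuous_on {0..1} g" "\<And>t. t \<in> {0..1} ==> g t \<in> C"
    and e: "g 0 = f 0" "g 1 = f 1"
  shows "phom Z (Q (f 0)) (Q (f 1)) (\<lambda>t. Q (f t)) (\<lambda>t. Q (g t))"
proof (rule phom_of_square)
  let ?h = "\<lambda>z. (1 - fst z) *\<^sub>R f (snd z) + fst z *\<^sub>R g (snd z)"
  show "continuous_map (top_of_set ({0..1} \<times> {0..1})) Z (\<lambda>z. Q (?h z))"
  proof (rule sub_map[OF Q])
    have "continuous_on ({0..1} \<times> {0..1}) (\<lambda>z :: real \<times> real. f (snd z))"
      "continuous_on ({0..1} \<times> {0..1}) (\<lambda>z :: real \<times> real. g (snd z))"
      by (rule continuous_on_compose2[OF f(1)] continuous_on_compose2[OF g(1)]; auto intro!: continuous_intros)+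
    then show "continuous_on ({0..1} \<times> {0..1}) ?h" by (intro continuous_intros)
    show "?h z \<in> C" if "z \<in> {0..1} \<times> {0..1}" for z
      using that f(2) g(2) by (intro convexD[OF C]) auto
  qed
qed (use e in \<open>auto simp: algebra_simps simp flip: scaleR_left_distrib\<close>)

lemma phom_reparam:
  assumes P: "continuous_map (top_of_set {0..1}) Z P"
    and f: "continuous_on {0..1} f" "\<And>t. t \<in> {0..1} ==> f t \<in> {0..1::real}"
    and g: "continuous_on {0..1} g" "\<And>t. t \<in> {0..1} ==> g t \<in> {0..1}"
    and e: "g 0 = f 0" "g 1 = f 1" "x = P (f 0)" "y = P (f 1)"
    and p: "\<And>t. t \<in> {0..1} ==> p t = P (f t)" and q: "\<And>t. t \<in> {0..1} ==> q t = P (g t)"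
  shows "phom Z x y p q"
proof -
  have h: "phom Z x y (\<lambda>t. P (f t)) (\<lambda>t. P (g t))"
    unfolding e(3,4) by (rule phom_convex[OF P _ f g e(1,2)]) simp
  have "phom Z x y (\<lambda>t. P (f t)) p" "phom Z x y (\<lambda>t. P (g t)) q"
    using phom_cong[OF phom_pth(1)[OF h], of p] phom_cong[OF phom_pth(2)[OF h], of q] p q by auto
  from phom_trans[OF phom_trans[OF phom_sym[OF this(1)] h] this(2)] show ?thesis .
qed

text \<open>Lifting a path along the tracks of the contraction deforms it into one that follows the
  track of its start to \<open>c\<close>, rests there, and comes back along the track of its end.
  The result depends on the endpoints only.\<close>

lemma contraction_phom:
  assumes H: "continuous_map (prod_topology Y (top_of_set {0..1})) Z H"
    and H0: "\<And>x. x \<in> topspace Y ==> H (x, 0) = x" and H1: "\<And>x. x \<in> topspace Y ==> H (x, 1 :: real) = c"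
    and p: "pth Y x y p" and q: "pth Y x y q"
  shows "phom Z x y p q"
proof -
  let ?I = "{0..1::real}"
  \<comment> \<open>A curve along three sides of the unit square of path parameter and contraction
    time; it is homotopic to the remaining side.\<close>
  define g where "g = (\<lambda>t::real. (max 0 (min 1 (3 * t - 1)), max 0 (min 1 (min (3 * t) (3 - 3 * t)))))"
  have Q: "continuous_map (top_of_set (?I \<times> ?I)) Z (\<lambda>z. H (r (fst z), snd z))" if "pth Y x y r" for r
  proof -
    have 1: "continuous_map (top_of_set (?I \<times> ?I)) Y (\<lambda>z. r (fst z))"
      by (rule sub_map[of ?I]) (use that in \<open>auto simp: pth_def intro!: continuous_intros\<close>)
    have 2: "continuous_map (top_of_set (?I \<times> ?I)) (top_of_set ?I) snd"
      by (auto intro!: continuous_intros)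
    have "continuous_map (top_of_set (?I \<times> ?I)) (prod_topology Y (top_of_set ?I)) (\<lambda>z. (r (fst z), snd z))"
      unfolding continuous_map_paired using 1 2 by simp
    from continuous_map_compose[OF this H] show ?thesis by (simp add: o_def)
  qed
  have gI: "g t \<in> ?I \<times> ?I" for t by (auto simp: g_def)
  have gc: "continuous_on ?I g" unfolding g_def by (intro continuous_intros)
  have key: "phom Z x y r (\<lambda>t. H (r (fst (g t)), snd (g t)))" if r: "pth Y x y r" for r
  proof -
    have Hr: "H (r t, 0) = r t" if "t \<in> ?I" for t using H0 pth_in[OF r that] .
    have g01: "g 0 = (0, 0)" "g 1 = (1, 0)" by (simp_all add: g_def)
    have "phom Z (H (r 0, 0)) (H (r 1, 0)) (\<lambda>t. H (r t, 0)) (\<lambda>t. H (r (fst (g t)), snd (g t)))"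
      by (rule phom_convex[OF Q[OF r] _ _ _ gc gI, of "\<lambda>t. (t, 0)", unfolded fst_conv snd_conv])
        (use g01 in \<open>auto intro!: convex_Times continuous_intros\<close>)
    moreover have "H (r 0, 0) = x" "H (r 1, 0) = y" using r Hr[of 0] Hr[of 1] by (auto simp: pth_def)
    ultimately have h: "phom Z x y (\<lambda>t. H (r t, 0)) (\<lambda>t. H (r (fst (g t)), snd (g t)))" by simp
    have "phom Z x y (\<lambda>t. H (r t, 0)) r" by (rule phom_cong[OF phom_pth(1)[OF h]]) (use Hr in auto)
    from phom_trans[OF phom_sym[OF this] h] show ?thesis .
  qed
  have "H (p (fst (g t)), snd (g t)) = H (q (fst (g t)), snd (g t))" if "t \<in> ?I" for t
  proof -
    consider "t \<le> 1/3" | "2/3 \<le> t" | "1/3 \<le> t" "t \<le> 2/3" by linarith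
    then show ?thesis
    proof cases
      case 1
      then have "fst (g t) = 0" by (simp add: g_def)
      then show ?thesis using p q by (simp add: pth_def)
    next
      case 2
      then have "fst (g t) = 1" by (simp add: g_def)
      then show ?thesis using p q by (simp add: pth_def)
    next
      case 3
      then have "snd (g t) = 1" by (simp add: g_def)
      moreover have "p (fst (g t)) \<in> topspace Y" "q (fst (g t)) \<in> topspace Y"
        using pth_in[OF p, of "fst (g t)"] pth_in[OF q, of "fst (g t)"] gI[of t] by auto
      ultimately show ?thesis using H1 by simp
    qed
  qed
  then have "phom Z x y (\<lambda>t. H (p (fst (g t)), snd (g t))) (\<lambda>t. H (q (fst (g t)), snd (g t)))"
    by (rule phom_cong[OF phom_pth(2)[OF key[OF p]]])
  from phom_trans[OF phom_trans[OF key[OF p] this] phom_sym[OF key[OF q]]] show ?thesis .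
qed

lemma pth_const: "x \<in> topspace Z ==> pth Z x x (\<lambda>t. x)"
  by (simp add: pth_def)

lemma pth_rev: "pth Z x y p ==> pth Z y x (loop_rev p)"
  unfolding pth_def loop_rev_def by (auto intro!: sub_map[of "{0..1}"] continuous_intros)

lemma join_map:
  fixes p q :: "real \<times> real => 'a"
  assumes p: "continuous_map (top_of_set ({0..1} \<times> {0..1})) Z p" and q: "continuous_map (top_of_set ({0..1} \<times> {0..1})) Z q"
    and e: "\<And>s. s \<in> {0..1} ==> p (s, 1) = q (s, 0)"
  shows "continuous_map (top_of_set ({0..1} \<times> {0..1})) Z (\<lambda>z. loop_join (\<lambda>t. p (fst z, t)) (\<lambda>t. q (fst z, t)) (snd z))"
  unfolding loop_join_def
proof (rule paste_le)
  show "continuous_map (top_of_set {z \<in> {0..1} \<times> {0..1}. snd z \<le> 1/2}) Z (\<lambda>z. p (fst z, 2 * snd z))"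
    by (rule sub_map[OF p]) (auto intro!: continuous_intros)
  show "continuous_map (top_of_set {z \<in> {0..1} \<times> {0..1}. 1/2 \<le> snd z}) Z (\<lambda>z. q (fst z, 2 * snd z - 1))"
    by (rule sub_map[OF q]) (auto intro!: continuous_intros)
  show "p (fst z, 2 * snd z) = q (fst z, 2 * snd z - 1)" if "z \<in> {0..1} \<times> {0..1}" "snd z = 1/2" for z
    unfolding that(2) using e[of "fst z"] that(1) by auto
qed (intro continuous_intros)

lemma pth_join: assumes "pth Z x y p" "pth Z y z q" shows "pth Z x z (loop_join p q)"
proof -
  have "continuous_map (top_of_set {0..1}) Z (\<lambda>t. if t \<le> 1/2 then p (2 * t) else q (2 * t - 1))"
  proof (rule paste_le)
    show "p (2 * t) = q (2 * t - 1)" if "t = 1/2" for t :: real unfolding that using assms by (simp add: pth_def)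
  qed (use assms in \<open>auto simp: pth_def intro!: continuous_intros sub_map[of "{0..1}"]\<close>)
  then show ?thesis using assms by (simp add: pth_def loop_join_def)
qed

lemma phom_join:
  assumes "phom Z x y p p'" "phom Z y z q q'" shows "phom Z x z (loop_join p q) (loop_join p' q')"
proof -
  obtain H where H: "continuous_map (top_of_set ({0..1} \<times> {0..1} :: (real \<times> real) set)) Z H"
    "\<And>t. t \<in> {0..1} ==> H (0, t) = p t \<and> H (1, t) = p' t" "\<And>s. s \<in> {0..1} ==> H (s, 0) = x \<and> H (s, 1) = y"
    using assms(1) unfolding phom_square_map by blast
  obtain K where K: "continuous_map (top_of_set ({0..1} \<times> {0..1} :: (real \<times> real) set)) Z K"
    "\<And>t. t \<in> {0..1} ==> K (0, t) = q t \<and> K (1, t) = q' t" "\<And>s. s \<in> {0..1} ==> K (s, 0) = y \<and> K (s, 1) = z"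
    using assms(2) unfolding phom_square_map by blast
  have "continuous_map (top_of_set ({0..1} \<times> {0..1})) Z (\<lambda>z. loop_join (\<lambda>t. H (fst z, t)) (\<lambda>t. K (fst z, t)) (snd z))"
    by (rule join_map[OF H(1) K(1)]) (use H K in auto)
  then show ?thesis
    by (rule phom_of_square) (use H(2,3) K(2,3) in \<open>auto simp: loop_join_def\<close>)
qed

lemma phom_assoc:
  assumes "pth Z x y p" "pth Z y z q" "pth Z z w r"
  shows "phom Z x w (loop_join (loop_join p q) r) (loop_join p (loop_join q r))"
proof -
  have P: "pth Z x w (loop_join p (loop_join q r))" by (rule pth_join[OF assms(1) pth_join[OF assms(2,3)]])
  show ?thesis
  proof (rule phom_reparam[where P = "loop_join p (loop_join q r)" and f = "\<lambda>t. min (2 * t) (min (t + 1/4) ((t + 1) / 2))" and g = "\<lambda>t. t"])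
    fix t :: real assume "t \<in> {0..1}"
    consider "t \<le> 1/4" | "1/4 < t" "t \<le> 1/2" | "1/2 < t" by linarith
    then show "loop_join (loop_join p q) r t = loop_join p (loop_join q r) (min (2 * t) (min (t + 1/4) ((t + 1) / 2)))"
    proof cases
      case 1
      then have "min (2 * t) (min (t + 1/4) ((t + 1) / 2)) = 2 * t" by simp
      then show ?thesis using 1 by (simp add: loop_join_def)
    next
      case 2
      then have "min (2 * t) (min (t + 1/4) ((t + 1) / 2)) = t + 1/4" by simp
      then show ?thesis using 2 by (simp add: loop_join_def algebra_simps)
    next
      case 3
      then have m: "min (2 * t) (min (t + 1/4) ((t + 1) / 2)) = (t + 1) / 2" by simp
      have e: "2 * ((t + 1) / 2) - 1 = t" by (simp add: field_simps)
      show ?thesis unfolding m loop_join_def e using 3 by simp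
    qed
  qed (use P in \<open>auto simp: pth_def min_le_iff_disj intro!: continuous_intros\<close>)
qed

lemma phom_const_join: assumes "pth Z x y p"
  shows "phom Z x y (loop_join (\<lambda>t. x) p) p" "phom Z x y (loop_join p (\<lambda>t. y)) p"
proof -
  show "phom Z x y (loop_join (\<lambda>t. x) p) p"
    by (rule phom_reparam[where P = p and f = "\<lambda>t. max 0 (2 * t - 1)" and g = "\<lambda>t. t"])
      (use assms in \<open>auto simp: pth_def loop_join_def max_absorb1 max_absorb2 intro!: continuous_intros\<close>)
  show "phom Z x y (loop_join p (\<lambda>t. y)) p"
    by (rule phom_reparam[where P = p and f = "\<lambda>t. min 1 (2 * t)" and g = "\<lambda>t. t"])
      (use assms in \<open>auto simp: pth_def loop_join_def min_absorb1 min_absorb2 intro!: continuous_intros\<close>)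
qed

lemma phom_rev_join: assumes "pth Z x y p"
  shows "phom Z y y (loop_join (loop_rev p) p) (\<lambda>t. y)" "phom Z x x (loop_join p (loop_rev p)) (\<lambda>t. x)"
proof -
  show "phom Z y y (loop_join (loop_rev p) p) (\<lambda>t. y)"
    by (rule phom_reparam[where P = p and f = "\<lambda>t. \<bar>1 - 2 * t\<bar>" and g = "\<lambda>t. 1"])
      (use assms in \<open>auto simp: pth_def loop_join_def loop_rev_def abs_of_nonneg abs_of_nonpos abs_le_iff intro!: continuous_intros\<close>)
  show "phom Z x x (loop_join p (loop_rev p)) (\<lambda>t. x)"
    by (rule phom_reparam[where P = p and f = "\<lambda>t. 1 - \<bar>1 - 2 * t\<bar>" and g = "\<lambda>t. 0"])
      (use assms in \<open>auto simp: pth_def loop_join_def loop_rev_def abs_of_nonneg abs_of_nonpos abs_le_iff intro!: continuous_intros\<close>)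
qed

section \<open>The fundamental group\<close>

lemma loops_pth: "p \<in> loops_at Z b \<longleftrightarrow> pth Z b b p"
  by (simp add: loops_at_def pth_def)

lemma loop_class_mem: "q \<in> loop_class Z b p \<longleftrightarrow> phom Z b b p q"
  using phom_pth(2)[of Z b b p q] by (auto simp: loop_class_def phom_def loops_pth)

lemma loop_class_eq: assumes "pth Z b b p" "pth Z b b q"
  shows "loop_class Z b p = loop_class Z b q \<longleftrightarrow> phom Z b b p q"
proof
  assume "loop_class Z b p = loop_class Z b q"
  then show "phom Z b b p q" using phom_refl[OF assms(2)] by (simp add: set_eq_iff loop_class_mem)
next
  assume h: "phom Z b b p q"
  then show "loop_class Z b p = loop_class Z b q"
    using phom_trans[OF h] phom_trans[OF phom_sym[OF h]] by (auto simp: set_eq_iff loop_class_mem)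
qed

lemma fundamental_group_simps:
  "carrier (fundamental_group Z b) = loop_class Z b ` {p. pth Z b b p}"
  "\<one>\<^bsub>fundamental_group Z b\<^esub> = loop_class Z b (\<lambda>t. b)"
  by (simp_all add: fundamental_group_def loops_pth[symmetric])

text \<open>The product is defined with representatives picked by choice; since joining respects
  homotopy, any representatives give the same class.\<close>

lemma fundamental_group_mult:
  assumes "pth Z b b p" "pth Z b b q"
  shows "loop_class Z b p \<otimes>\<^bsub>fundamental_group Z b\<^esub> loop_class Z b q = loop_class Z b (loop_join p q)"
proof -
  have s: "phom Z b b p (SOME p'. p' \<in> loop_class Z b p)" if "pth Z b b p" for p
    using someI[of "\<lambda>p'. p' \<in> loop_class Z b p" p] phom_refl[OF that] by (simp add: loop_class_mem)
  have "phom Z b b (loop_join p q) (loop_join (SOME p'. p' \<in> loop_class Z b p) (SOME q'. q' \<in> loop_class Z b q))"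
    by (rule phom_join[OF s[OF assms(1)] s[OF assms(2)]])
  from loop_class_eq[THEN iffD2, OF phom_pth(1)[OF this] phom_pth(2)[OF this] this]
  show ?thesis by (simp add: fundamental_group_def)
qed

theorem group_fundamental_group:
  assumes "b \<in> topspace Z" shows "group (fundamental_group Z b)"
proof (rule groupI)
  let ?G = "fundamental_group Z b" and ?c = "loop_class Z b"
  note s = fundamental_group_simps fundamental_group_mult
  have k: "pth Z b b (\<lambda>t. b)" by (rule pth_const[OF assms])
  show "\<one>\<^bsub>?G\<^esub> \<in> carrier ?G" using k by (simp add: s)
  fix P assume "P \<in> carrier ?G"
  then obtain p where p: "P = ?c p" "pth Z b b p" by (auto simp: s)
  show "\<one>\<^bsub>?G\<^esub> \<otimes>\<^bsub>?G\<^esub> P = P"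
    unfolding p s(2) s(3)[OF k p(2)]
    by (rule loop_class_eq[THEN iffD2, OF pth_join[OF k p(2)] p(2) phom_const_join(1)[OF p(2)]])
  show "\<exists>Q\<in>carrier ?G. Q \<otimes>\<^bsub>?G\<^esub> P = \<one>\<^bsub>?G\<^esub>"
  proof
    have r: "pth Z b b (loop_rev p)" by (rule pth_rev[OF p(2)])
    then show "?c (loop_rev p) \<in> carrier ?G" by (simp add: s)
    show "?c (loop_rev p) \<otimes>\<^bsub>?G\<^esub> P = \<one>\<^bsub>?G\<^esub>"
      unfolding p s(2) s(3)[OF r p(2)]
      by (rule loop_class_eq[THEN iffD2, OF pth_join[OF r p(2)] k phom_rev_join(1)[OF p(2)]])
  qed
  fix Q assume "Q \<in> carrier ?G"
  then obtain q where q: "Q = ?c q" "pth Z b b q" by (auto simp: s)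
  show "P \<otimes>\<^bsub>?G\<^esub> Q \<in> carrier ?G" using p q pth_join[OF p(2) q(2)] by (simp add: s)
  fix R assume "R \<in> carrier ?G"
  then obtain r where r: "R = ?c r" "pth Z b b r" by (auto simp: s)
  show "P \<otimes>\<^bsub>?G\<^esub> Q \<otimes>\<^bsub>?G\<^esub> R = P \<otimes>\<^bsub>?G\<^esub> (Q \<otimes>\<^bsub>?G\<^esub> R)"
    unfolding p(1) q(1) r(1) s(3)[OF p(2) q(2)] s(3)[OF q(2) r(2)] s(3)[OF pth_join[OF p(2) q(2)] r(2)]
      s(3)[OF p(2) pth_join[OF q(2) r(2)]]
    by (rule loop_class_eq[THEN iffD2, OF pth_join[OF pth_join[OF p(2) q(2)] r(2)]
      pth_join[OF p(2) pth_join[OF q(2) r(2)]] phom_assoc[OF p(2) q(2) r(2)]])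
qed

section \<open>Cech cocycles and their holonomy\<close>

text \<open>Congruence of reals modulo \<open>d\<close>, with \<open>d = 0\<close> meaning equality.
  Working with real representatives lets one development cover cocycles and homomorphisms with
  values in R, in the circle, and modulo 2 or 4.\<close>

definition cg :: "real => real => real => bool" where
  "cg d a b \<longleftrightarrow> (\<exists>k::int. a - b = of_int k * d)"

lemma cg_refl [simp]: "cg d a a"
  by (auto simp: cg_def intro!: exI[of _ 0])

lemma cg_sym: "cg d a b ==> cg d b a"
  unfolding cg_def by (elim exE, rule_tac x = "- k" in exI) simp

lemma cg_add: assumes "cg d a b" "cg d a' b'" shows "cg d (a + a') (b + b')"
proof -
  obtain k l :: int where "a - b = of_int k * d" "a' - b' = of_int l * d" using assms unfolding cg_def by blast
  then show ?thesis unfolding cg_def by (intro exI[of _ "k + l"]) (simp add: distrib_right)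
qed

lemma cg_diff: assumes "cg d a b" "cg d a' b'" shows "cg d (a - a') (b - b')"
proof -
  obtain k l :: int where "a - b = of_int k * d" "a' - b' = of_int l * d" using assms unfolding cg_def by blast
  then show ?thesis unfolding cg_def by (intro exI[of _ "k - l"]) (simp add: left_diff_distrib)
qed

lemma cg_trans: "cg d a b ==> cg d b c ==> cg d a c"
  using cg_add[of d a b b c] unfolding cg_def by auto

lemma cg_0: "cg 0 a b \<longleftrightarrow> a = b"
  by (simp add: cg_def)

lemma cg_1_Ints: "cg 1 a b \<longleftrightarrow> a - b \<in> \<int>"
  by (auto simp: cg_def Ints_def)

lemma cg_eq_diff: "cg d a b ==> a' - b' = a - b ==> cg d a' b'"
  by (simp add: cg_def)

lemma cg_lin2: "cg d a1 b1 ==> cg d a2 b2 ==> a - b = (a1 - b1) + (a2 - b2) ==> cg d a b"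
  by (rule cg_eq_diff[OF cg_add[of d a1 b1 a2 b2]]) simp_all

lemma cg_lin3: "cg d a1 b1 ==> cg d a2 b2 ==> cg d a3 b3 ==>
    a - b = (a1 - b1) + (a2 - b2) + (a3 - b3) ==> cg d a b"
  by (rule cg_eq_diff[OF cg_add[OF cg_add[of d a1 b1 a2 b2], of a3 b3]]) simp_all

lemma cg_neg: "cg d a b ==> cg d (- a) (- b)"
  using cg_diff[of d 0 0 a b] by simp

locale open_cover =
  fixes Z :: "'a topology" and U :: "'i => 'a set"
  assumes U_open: "openin Z (U i)" and U_cover: "x \<in> topspace Z ==> \<exists>i. x \<in> U i"
begin

definition cocycle :: "real => ('i => 'i => real) => bool" where
  "cocycle d g \<longleftrightarrow> (\<forall>i j k. U i \<inter> U j \<inter> U k \<noteq> {} --> cg d (g i j + g j k) (g i k))"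

definition chain :: "(real => 'a) => nat => (nat => 'i) => bool" where
  "chain p m k \<longleftrightarrow> 0 < m \<and> (\<forall>l<m. \<forall>t. real l / real m \<le> t --> t \<le> real (Suc l) / real m --> p t \<in> U (k l))"

primrec wv :: "('i => 'i => real) => 'i => (nat => 'i) => nat => real" where
  "wv g i k 0 = g i (k 0)"
| "wv g i k (Suc l) = wv g i k l + g (k l) (k (Suc l))"

definition val :: "('i => 'i => real) => nat => (nat => 'i) => 'i => 'i => real" where
  "val g m k i j = wv g i k (m - 1) + g (k (m - 1)) j"

text \<open>The value of the cocycle \<open>g\<close> along the path \<open>p\<close>, whose ends lie in \<open>U i\<close> and \<open>U j\<close>; it is
well defined modulo \<open>d\<close> for a cocycle modulo \<open>d\<close>.\<close>

definition hol :: "('i => 'i => real) => (real => 'a) => 'i => 'i => real" where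
  "hol g p i j = (SOME r. \<exists>m k. chain p m k \<and> r = val g m k i j)"

lemma cocycleD: "cocycle d g ==> x \<in> U i ==> x \<in> U j ==> x \<in> U k ==> cg d (g i j + g j k) (g i k)"
  unfolding cocycle_def by blast

lemma cocycle_self: "cocycle d g ==> x \<in> U i ==> cg d (g i i) 0"
  using cocycleD[of d g x i i i] by (simp add: cg_def)

lemma chain_point: "chain p m k ==> l < m ==> p (real l / real m) \<in> U (k l) \<and> p (real (Suc l) / real m) \<in> U (k l)"
  unfolding chain_def by (auto simp: divide_simps)

lemma chain_first: "chain p m k ==> p 0 \<in> U (k 0)"
  using chain_point[of p m k 0] by (simp add: chain_def)

lemma chain_last: "chain p m k ==> p 1 \<in> U (k (m - 1))"
  using chain_point[of p m k "m - 1"] by (simp add: chain_def)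

text \<open>A ladder argument: at each subdivision point four cover sets meet, and two applications
  of the cocycle rule exchange the rung from \<open>k l\<close> to \<open>k' l\<close> for the next
  one.\<close>

lemma same_length:
  assumes g: "cocycle d g" and k: "chain p m k" "chain p m k'" and "p 0 \<in> U i" "p 1 \<in> U j"
  shows "cg d (val g m k i j) (val g m k' i j)"
proof -
  have "cg d (wv g i k l + g (k l) (k' l)) (wv g i k' l)" if "l < m" for l
    using that
  proof (induction l)
    case 0
    show ?case using cocycleD[OF g assms(4) chain_first[OF k(1)] chain_first[OF k(2)]] by simp
  next
    case (Suc l)
    let ?x = "p (real (Suc l) / real m)"
    have x: "?x \<in> U (k l)" "?x \<in> U (k' l)" "?x \<in> U (k (Suc l))" "?x \<in> U (k' (Suc l))"
      using chain_point[OF k(1), of l] chain_point[OF k(1), of "Suc l"] chain_point[OF k(2), of l]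
        chain_point[OF k(2), of "Suc l"] Suc.prems by auto
    have IH: "cg d (wv g i k l + g (k l) (k' l)) (wv g i k' l)" using Suc by simp
    show ?case
      by (rule cg_lin3[OF IH cocycleD[OF g x(1,3,4)] cg_sym[OF cocycleD[OF g x(1,2,4)]]]) simp
  qed
  from this[of "m - 1"] have 1: "cg d (wv g i k (m - 1) + g (k (m - 1)) (k' (m - 1))) (wv g i k' (m - 1))"
    using k(1) by (simp add: chain_def)
  show ?thesis unfolding val_def
    by (rule cg_lin2[OF 1 cg_sym[OF cocycleD[OF g chain_last[OF k(1)] chain_last[OF k(2)] assms(5)]]]) simp
qed

lemma chain_refine:
  assumes k: "chain p m k" and r: "0 < r" shows "chain p (m * r) (\<lambda>l. k (l div r))"
  unfolding chain_def
proof (intro conjI allI impI)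
  show "0 < m * r" using k r by (simp add: chain_def)
  fix l t assume l: "l < m * r" and t: "real l / real (m * r) \<le> t" "t \<le> real (Suc l) / real (m * r)"
  have m: "0 < m" using k by (simp add: chain_def)
  have ld: "l div r < m" using l by (simp add: less_mult_imp_div_less)
  have "real (l div r) / real m \<le> real l / real (m * r)"
  proof -
    have "real ((l div r) * r) \<le> real l" by (simp only: of_nat_le_iff) (simp add: div_times_less_eq_dividend)
    then show ?thesis using m r by (simp add: divide_simps mult_ac)
  qed
  moreover have "real (Suc l) / real (m * r) \<le> real (Suc (l div r)) / real m"
  proof -
    have "Suc l \<le> Suc (l div r) * r" using dividend_less_div_times[OF r, of l] by simp
    then have "real (Suc l) \<le> real (Suc (l div r)) * real r" by (metis of_nat_le_iff of_nat_mult)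
    then show ?thesis using m r by (simp add: divide_simps mult_ac)
  qed
  ultimately show "p t \<in> U (k (l div r))" using k ld t unfolding chain_def by (meson order_trans)
qed

text \<open>Refinement repeats indices, and each repetition inserts a term \<open>g i i\<close>,
  which is congruent to 0.\<close>

lemma val_refine:
  assumes g: "cocycle d g" and k: "chain p m k" and r: "0 < r"
  shows "cg d (val g (m * r) (\<lambda>l. k (l div r)) i j) (val g m k i j)"
proof -
  have m: "0 < m" using k by (simp add: chain_def)
  have "cg d (wv g i (\<lambda>l. k (l div r)) l) (wv g i k (l div r))" if "l < m * r" for l
    using that
  proof (induction l)
    case (Suc l)
    have IH: "cg d (wv g i (\<lambda>l. k (l div r)) l) (wv g i k (l div r))" using Suc by simp
    show ?case
    proof (cases "Suc l mod r = 0")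
      case True
      then have "Suc l div r = Suc (l div r)" by (simp add: div_Suc)
      then show ?thesis using cg_add[OF IH cg_refl] by simp
    next
      case False
      then have e: "Suc l div r = l div r" by (simp add: div_Suc)
      have "l div r < m" using Suc.prems less_mult_imp_div_less[of l m r] by simp
      then have "cg d (g (k (l div r)) (k (l div r))) 0" using cocycle_self[OF g] chain_point[OF k] by blast
      from cg_add[OF IH this] show ?thesis by (simp add: e)
    qed
  qed simp
  from this[of "m * r - 1"] have 1: "cg d (wv g i (\<lambda>l. k (l div r)) (m * r - 1)) (wv g i k ((m * r - 1) div r))"
    using m r by simp
  have "(m * r - 1) div r = m - 1"
    by (rule div_nat_eqI; cases m) (use m r in \<open>auto simp: algebra_simps\<close>)
  then show ?thesis using cg_add[OF 1 cg_refl] by (simp add: val_def)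
qed

lemma val_unique:
  assumes g: "cocycle d g" and k: "chain p m k" "chain p m' k'" and "p 0 \<in> U i" "p 1 \<in> U j"
  shows "cg d (val g m k i j) (val g m' k' i j)"
proof -
  have m: "0 < m" "0 < m'" using k by (auto simp: chain_def)
  have c: "chain p (m * m') (\<lambda>l. k (l div m'))" "chain p (m * m') (\<lambda>l. k' (l div m))"
    using chain_refine[OF k(1) m(2)] chain_refine[OF k(2) m(1)] by (simp_all add: mult.commute)
  have "cg d (val g (m * m') (\<lambda>l. k (l div m')) i j) (val g m k i j)"
    "cg d (val g (m * m') (\<lambda>l. k' (l div m)) i j) (val g m' k' i j)"
    using val_refine[OF g k(1) m(2)] val_refine[OF g k(2) m(1)] by (simp_all add: mult.commute)
  then show ?thesis using same_length[OF g c assms(4,5)] cg_sym cg_trans by metis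
qed

text \<open>A Lebesgue number for the preimages of the cover sets in the unit square.\<close>

lemma grid:
  assumes H: "continuous_map (top_of_set ({0..1} \<times> {0..1})) Z H"
  shows "\<exists>m k. 0 < m \<and> (\<forall>a<m. \<forall>b<m. \<forall>s t. real a / real m \<le> s --> s \<le> real (Suc a) / real m -->
    real b / real m \<le> t --> t \<le> real (Suc b) / real m --> H (s, t) \<in> U (k a b))"
proof -
  let ?S = "{0..1::real} \<times> {0..1::real}"
  have "\<exists>G. open G \<and> {z \<in> ?S. H z \<in> U i} = ?S \<inter> G" for i
    using H U_open[of i] unfolding continuous_map_def openin_open by auto
  then obtain G where G: "\<And>i. open (G i)" "\<And>i. {z \<in> ?S. H z \<in> U i} = ?S \<inter> G i" by metis
  have "?S \<subseteq> \<Union> (range G)"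
  proof
    fix z assume z: "z \<in> ?S"
    then have "H z \<in> topspace Z" using H by (auto simp: continuous_map_def)
    then obtain i where "H z \<in> U i" using U_cover by blast
    then show "z \<in> \<Union> (range G)" using G(2)[of i] z by auto
  qed
  then have "\<exists>e>0. \<forall>z\<in>?S. \<exists>A\<in>range G. ball z e \<subseteq> A"
  proof (rule Heine_Borel_lemma[OF compact_Times[OF compact_Icc compact_Icc]])
    show "open A" if "A \<in> range G" for A using that G(1) by auto
  qed blast
  then obtain e where e: "0 < e" "\<And>z. z \<in> ?S ==> \<exists>A\<in>range G. ball z e \<subseteq> A" by blast
  \<comment> \<open>Inside a grid cell each coordinate differs from that of the corner by at most
    \<open>1 / m\<close>, so the distance to the corner is at most \<open>2 / m\<close>.\<close>
  obtain m where m: "0 < m" "2 / real m < e"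
  proof -
    obtain m where "2 / e < real m" using reals_Archimedean2 by blast
    moreover from this have "0 < real m" using e(1) by (meson divide_pos_pos less_trans zero_less_numeral)
    ultimately show ?thesis using that[of m] e(1) by (simp add: divide_simps mult.commute)
  qed
  have "\<exists>i. \<forall>s t. real a / real m \<le> s --> s \<le> real (Suc a) / real m -->
    real b / real m \<le> t --> t \<le> real (Suc b) / real m --> H (s, t) \<in> U i" if ab: "a < m" "b < m" for a b
  proof -
    let ?z = "(real a / real m, real b / real m)"
    have "?z \<in> ?S" using ab m by (auto simp: divide_simps)
    then obtain i where i: "ball ?z e \<subseteq> G i" using e(2) by blast
    have "H (s, t) \<in> U i" if st: "real a / real m \<le> s" "s \<le> real (Suc a) / real m" "real b / real m \<le> t" "t \<le> real (Suc b) / real m" for s t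
    proof -
      have top: "real (Suc a) / real m \<le> 1" "real (Suc b) / real m \<le> 1" "0 \<le> real a / real m" "0 \<le> real b / real m"
        using ab m by (auto simp: divide_simps)
      then have "0 \<le> s" "s \<le> 1" "0 \<le> t" "t \<le> 1" using st by linarith+
      then have S: "(s, t) \<in> ?S" by simp
      have "\<bar>real a / real m - s\<bar> \<le> 1 / real m" "\<bar>real b / real m - t\<bar> \<le> 1 / real m"
        using st by (auto simp: add_divide_distrib)
      moreover have "dist ?z (s, t) \<le> \<bar>real a / real m - s\<bar> + \<bar>real b / real m - t\<bar>"
        unfolding dist_Pair_Pair dist_real_def by (rule order_trans[OF sqrt_sum_squares_le_sum_abs]) simp
      ultimately have "dist ?z (s, t) < e" using m(2) by linarith
      then have "(s, t) \<in> ?S \<inter> G i" using i S by auto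
      then show ?thesis using G(2)[of i] by fastforce
    qed
    then show ?thesis by blast
  qed
  then have "\<forall>a b. \<exists>i. a < m --> b < m --> (\<forall>s t. real a / real m \<le> s --> s \<le> real (Suc a) / real m -->
    real b / real m \<le> t --> t \<le> real (Suc b) / real m --> H (s, t) \<in> U i)" by blast
  then obtain k where "\<forall>a b. a < m --> b < m --> (\<forall>s t. real a / real m \<le> s --> s \<le> real (Suc a) / real m -->
    real b / real m \<le> t --> t \<le> real (Suc b) / real m --> H (s, t) \<in> U (k a b))" by metis
  then show ?thesis using m(1) by blast
qed

lemma chain_exists: assumes "pth Z x y p" shows "\<exists>m k. chain p m k"
proof -
  have "continuous_map (top_of_set ({0..1} \<times> {0..1})) Z (\<lambda>z :: real \<times> real. p (snd z))"
    by (rule sub_map[of "{0..1}"]) (use assms in \<open>auto simp: pth_def intro!: continuous_intros\<close>)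
  from grid[OF this] obtain m k where m: "0 < m" "\<forall>a<m. \<forall>b<m. \<forall>s t. real a / real m \<le> s --> s \<le> real (Suc a) / real m -->
    real b / real m \<le> t --> t \<le> real (Suc b) / real m --> p t \<in> U (k a b)" by auto
  have "chain p m (k 0)"
    unfolding chain_def using m(1) m(2)[rule_format, of 0 _ 0] by auto
  then show ?thesis by blast
qed

lemma hol_val:
  assumes "cocycle d g" "chain p m k" "p 0 \<in> U i" "p 1 \<in> U j"
  shows "cg d (hol g p i j) (val g m k i j)"
proof -
  have "\<exists>m k. chain p m k \<and> hol g p i j = val g m k i j"
    unfolding hol_def by (rule someI_ex) (use assms(2) in blast)
  then show ?thesis using val_unique[OF assms(1) _ assms(2-4)] by metis
qed

lemma chain_cong: "chain p m k ==> (\<And>t. t \<in> {0..1} ==> p t = q t) ==> chain q m k"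
  unfolding chain_def
proof (intro conjI allI impI)
  fix l t assume *: "0 < m \<and> (\<forall>l<m. \<forall>t. real l / real m \<le> t --> t \<le> real (Suc l) / real m --> p t \<in> U (k l))"
    "\<And>t. t \<in> {0..1} ==> p t = q t" "l < m" "real l / real m \<le> t" "t \<le> real (Suc l) / real m"
  have "0 \<le> real l / real m" "real (Suc l) / real m \<le> 1" using *(3) by (auto simp: divide_simps)
  then have "0 \<le> t" "t \<le> 1" using *(4,5) by linarith+
  then have "t \<in> {0..1}" by simp
  then show "q t \<in> U (k l)" using * by metis
qed auto

text \<open>In the grid of the homotopy, the cells of one row form a chain for the path below the
  row and for the path above it. Neighbouring paths therefore have congruent values.\<close>

lemma hol_phom:
  assumes g: "cocycle d g" and h: "phom Z x y p q" and xy: "x \<in> U i" "y \<in> U j"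
  shows "cg d (hol g p i j) (hol g q i j)"
proof -
  obtain H where H: "continuous_map (top_of_set ({0..1} \<times> {0..1} :: (real \<times> real) set)) Z H"
    "\<And>t. t \<in> {0..1} ==> H (0, t) = p t \<and> H (1, t) = q t" "\<And>s. s \<in> {0..1} ==> H (s, 0) = x \<and> H (s, 1) = y"
    using h unfolding phom_square_map by blast
  obtain m k where m: "0 < m" and k: "\<And>a b s t. a < m ==> b < m ==> real a / real m \<le> s ==> s \<le> real (Suc a) / real m ==>
    real b / real m \<le> t ==> t \<le> real (Suc b) / real m ==> H (s, t) \<in> U (k a b)"
    using grid[OF H(1)] by blast
  define r where "r = (\<lambda>a t. H (real a / real m, t))"
  have ends: "r a 0 = x" "r a 1 = y" if "a \<le> m" for a
    using H(3)[of "real a / real m"] that m by (auto simp: r_def divide_simps)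
  have c: "chain (r a) m (k a)" "chain (r (Suc a)) m (k a)" if "a < m" for a
    unfolding chain_def r_def using m that by (auto intro!: k simp: divide_right_mono)
  have "cg d (hol g (r 0) i j) (hol g (r a) i j)" if "a \<le> m" for a
    using that
  proof (induction a)
    case (Suc a)
    have "cg d (hol g (r a) i j) (val g m (k a) i j)" "cg d (hol g (r (Suc a)) i j) (val g m (k a) i j)"
      using hol_val[OF g c(1)] hol_val[OF g c(2)] ends[of a] ends[of "Suc a"] xy Suc.prems by auto
    then show ?case using Suc cg_sym cg_trans by (metis Suc_leD)
  qed simp
  from this[of m] have 1: "cg d (hol g (r 0) i j) (hol g (r m) i j)" by simp
  have 2: "cg d (hol g p i j) (hol g (r 0) i j)" "cg d (hol g q i j) (hol g (r m) i j)"
  proof -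
    note pp = phom_pth[OF h]
    obtain m1 k1 where c1: "chain p m1 k1" using chain_exists[OF pp(1)] by blast
    obtain m2 k2 where c2: "chain q m2 k2" using chain_exists[OF pp(2)] by blast
    have d1: "chain (r 0) m1 k1" by (rule chain_cong[OF c1]) (use H(2) in \<open>simp add: r_def\<close>)
    have d2: "chain (r m) m2 k2" by (rule chain_cong[OF c2]) (use H(2) m in \<open>simp add: r_def\<close>)
    have e: "p 0 \<in> U i" "p 1 \<in> U j" "q 0 \<in> U i" "q 1 \<in> U j" using pp xy by (auto simp: pth_def)
    show "cg d (hol g p i j) (hol g (r 0) i j)"
      using hol_val[OF g c1 e(1,2)] hol_val[OF g d1, of i j] ends[of 0] xy cg_sym cg_trans by (metis le0)
    show "cg d (hol g q i j) (hol g (r m) i j)"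
      using hol_val[OF g c2 e(3,4)] hol_val[OF g d2, of i j] ends[of m] xy cg_sym cg_trans by (metis order_refl)
  qed
  show ?thesis using 1 2 cg_sym cg_trans by metis
qed

text \<open>Both paths are cut into the same number \<open>m\<close> of pieces, so that the join is
  cut into \<open>2 * m\<close> equal ones. The passage through \<open>y\<close> may insert
  \<open>U j\<close> by the cocycle rule.\<close>

lemma hol_join:
  assumes g: "cocycle d g" and p: "pth Z x y p" and q: "pth Z y z q" and "x \<in> U i" "y \<in> U j" "z \<in> U l"
  shows "cg d (hol g (loop_join p q) i l) (hol g p i j + hol g q j l)"
proof -
  obtain m1 k1 where c1: "chain p m1 k1" using chain_exists[OF p] by blast
  obtain m2 k2 where c2: "chain q m2 k2" using chain_exists[OF q] by blast
  define m where "m = m1 * m2"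
  have m0: "0 < m1" "0 < m2" using c1 c2 by (auto simp: chain_def)
  obtain k k' where k: "chain p m k" "chain q m k'"
    using chain_refine[OF c1 m0(2)] chain_refine[OF c2 m0(1)] by (auto simp: m_def mult.commute)
  have m: "0 < m" using m0 by (simp add: m_def)
  define K where "K = (\<lambda>l. if l < m then k l else k' (l - m))"
  have cK: "chain (loop_join p q) (2 * m) K"
    unfolding chain_def
  proof (intro conjI allI impI)
    fix s t assume s: "s < 2 * m" "real s / real (2 * m) \<le> t" "t \<le> real (Suc s) / real (2 * m)"
    show "loop_join p q t \<in> U (K s)"
    proof (cases "s < m")
      case True
      have t: "real s / real m \<le> 2 * t" "2 * t \<le> real (Suc s) / real m" using s m by (auto simp: divide_simps mult_ac)
      moreover have "real (Suc s) / real m \<le> 1" using True by (simp add: divide_simps)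
      ultimately have "t \<le> 1/2" by linarith
      then show ?thesis using k(1) True t unfolding chain_def by (auto simp: loop_join_def K_def)
    next
      case False
      then obtain l where l: "s = m + l" "l < m" using s(1) by (metis add_diff_inverse_nat add_less_cancel_left mult_2)
      have t: "real l / real m \<le> 2 * t - 1" "2 * t - 1 \<le> real (Suc l) / real m"
        using s m by (auto simp: l divide_simps algebra_simps)
      show ?thesis
      proof (cases "t \<le> 1/2")
        case True
        have "0 \<le> real l / real m" by simp
        then have t1: "t = 1/2" and "real l / real m = 0" using t True by linarith+
        then have "l = 0" using m by simp
        moreover have "q 0 = p 1" using p q by (simp add: pth_def)
        ultimately show ?thesis using chain_first[OF k(2)] unfolding t1 by (simp add: loop_join_def K_def l)
      next
        case f: False
        then show ?thesis using k(2) t l False unfolding chain_def by (auto simp: loop_join_def K_def)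
      qed
    qed
  qed (use m in simp)
  have w1: "wv g i K s = wv g i k s" if "s < m" for s
    using that by (induction s) (auto simp: K_def)
  have yj: "y \<in> U (k (m - 1))" "y \<in> U (k' 0)"
    using chain_last[OF k(1)] chain_first[OF k(2)] p q by (auto simp: pth_def)
  have "cg d (wv g i K (m + s)) (val g m k i j + wv g j k' s)" if "s < m" for s
    using that
  proof (induction s)
    case 0
    obtain m' where m': "m = Suc m'" using m by (cases m) auto
    have "wv g i K m = wv g i k (m - 1) + g (k (m - 1)) (k' 0)"
      using w1[of m'] by (simp add: m' K_def)
    then show ?case
      using cg_add[OF cg_refl cg_sym[OF cocycleD[OF g yj(1) assms(5) yj(2)]], of "wv g i k (m - 1)"]
      by (simp add: val_def add_ac)
  next
    case (Suc s)
    then have "cg d (wv g i K (m + s)) (val g m k i j + wv g j k' s)" by simp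
    from cg_add[OF this cg_refl, of "g (k' s) (k' (Suc s))"] show ?case using Suc.prems by (simp add: K_def add_ac)
  qed
  from this[of "m - 1"] have "cg d (wv g i K (2 * m - 1)) (val g m k i j + wv g j k' (m - 1))"
    using m by (simp add: mult_2)
  from cg_add[OF this cg_refl, of "g (k' (m - 1)) l"]
  have "cg d (wv g i K (2 * m - 1) + g (k' (m - 1)) l) (val g m k i j + wv g j k' (m - 1) + g (k' (m - 1)) l)" .
  moreover have Kl: "K (2 * m - 1) = k' (m - 1)" using m by (auto simp: K_def)
  ultimately have 1: "cg d (val g (2 * m) K i l) (val g m k i j + val g m k' j l)"
    unfolding val_def[of g "2 * m"] val_def[of g m k' j] Kl by (simp add: add_ac)
  have 2: "cg d (hol g (loop_join p q) i l) (val g (2 * m) K i l)"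
    by (rule hol_val[OF g cK]) (use assms pth_join[OF p q] in \<open>auto simp: pth_def\<close>)
  have 3: "cg d (hol g p i j) (val g m k i j)" "cg d (hol g q j l) (val g m k' j l)"
    using hol_val[OF g k(1), of i j] hol_val[OF g k(2), of j l] assms by (auto simp: pth_def)
  show ?thesis using cg_trans[OF 2 cg_trans[OF 1 cg_sym[OF cg_add[OF 3]]]] .
qed

lemma hol_inside:
  assumes g: "cocycle d g" and p: "pth Z x y p" "\<And>t. t \<in> {0..1} ==> p t \<in> U k" and "x \<in> U i" "y \<in> U j"
  shows "cg d (hol g p i j) (g i k + g k j)"
proof -
  have "chain p 1 (\<lambda>_. k)" using p(2) by (auto simp: chain_def)
  from hol_val[OF g this, of i j] show ?thesis using p(1) assms(4,5) by (simp add: pth_def val_def)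
qed

lemma hol_rev:
  assumes g: "cocycle d g" and p: "pth Z x y p" and xy: "x \<in> U i" "y \<in> U j"
  shows "cg d (hol g (loop_rev p) j i) (- hol g p i j)"
proof -
  have 1: "cg d (hol g (loop_join p (loop_rev p)) i i) (hol g p i j + hol g (loop_rev p) j i)"
    by (rule hol_join[OF g p pth_rev[OF p] xy xy(1)])
  have 2: "cg d (hol g (loop_join p (loop_rev p)) i i) (hol g (\<lambda>t. x) i i)"
    by (rule hol_phom[OF g phom_rev_join(2)[OF p] xy(1) xy(1)])
  have 3: "cg d (hol g (\<lambda>t. x) i i) (g i i + g i i)"
    by (rule hol_inside[OF g pth_const[OF pth_ends(1)[OF p]] _ xy(1) xy(1)]) (rule xy(1))
  have 4: "cg d (g i i) 0" by (rule cocycle_self[OF g xy(1)])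
  have "cg d (hol g p i j + hol g (loop_rev p) j i) 0"
    using cg_trans[OF cg_sym[OF 1] cg_trans[OF 2 cg_trans[OF 3 cg_add[OF 4 4]]]] by simp
  then show ?thesis by (simp add: cg_def add.commute)
qed

end

section \<open>Characters of the abelianization\<close>

text \<open>\<open>cgraph H S\<close>: \<open>S\<close> is the graph of a homomorphism from a subgroup of \<open>H\<close> to the circle
group, lifted to the reals.\<close>

definition cgraph :: "('a, 'b) monoid_scheme => ('a \<times> real) set => bool" where
  "cgraph H S \<longleftrightarrow> S \<subseteq> carrier H \<times> UNIV \<and> (\<one>\<^bsub>H\<^esub>, 0) \<in> S \<and>
     (\<forall>x r y s. (x, r) \<in> S --> (y, s) \<in> S --> (x \<otimes>\<^bsub>H\<^esub> y, r + s) \<in> S) \<and>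
     (\<forall>x r. (x, r) \<in> S --> (inv\<^bsub>H\<^esub> x, - r) \<in> S) \<and> (\<forall>r. (\<one>\<^bsub>H\<^esub>, r) \<in> S --> r \<in> \<int>)"

definition mhom :: "('a, 'b) monoid_scheme => real => ('a => real) => bool" where
  "mhom G d f \<longleftrightarrow> (\<forall>x\<in>carrier G. \<forall>y\<in>carrier G. cg d (f (x \<otimes>\<^bsub>G\<^esub> y)) (f x + f y))"

lemma (in group) cgraph_pow:
  assumes "cgraph G S" "(x, r) \<in> S" shows "(x [^] (k::int), of_int k * r) \<in> S"
proof -
  have x: "x \<in> carrier G" using assms by (auto simp: cgraph_def)
  have nat: "(x [^] (m::nat), of_nat m * r) \<in> S" for m
  proof (induction m)
    case (Suc m)
    then have "(x [^] m \<otimes> x, of_nat m * r + r) \<in> S" using assms unfolding cgraph_def by blast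
    then show ?case by (simp add: algebra_simps)
  qed (use assms in \<open>simp add: cgraph_def\<close>)
  show ?thesis
  proof (cases "k \<ge> 0")
    case True
    then show ?thesis using nat[of "nat k"] by simp
  next
    case False
    have "(inv (x [^] nat (- k)), - (of_nat (nat (- k)) * r)) \<in> S"
      using nat[of "nat (- k)"] assms(1) unfolding cgraph_def by blast
    moreover have "x [^] k = inv (x [^] nat (- k))" using False by (simp only: int_pow_def2 not_le if_True)
    moreover have "of_int k * r = - (of_nat (nat (- k)) * r)" using False by simp
    ultimately show ?thesis by (simp only:)
  qed
qed

text \<open>Divisibility of the circle: if \<open>d\<close> is the least positive exponent for which
  the power of \<open>x\<close> lies in the domain, with value \<open>s\<close>, then
  \<open>s / d\<close> is an admissible value at \<open>x\<close>. If there is no such exponent, 0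
  is admissible.\<close>

lemma (in comm_group) cgraph_extend_one:
  assumes S: "cgraph G S" and x: "x \<in> carrier G"
  shows "\<exists>T. cgraph G T \<and> S \<subseteq> T \<and> x \<in> fst ` T"
proof -
  have Smul: "\<And>y r z s. (y, r) \<in> S ==> (z, s) \<in> S ==> (y \<otimes> z, r + s) \<in> S"
    and Sinv: "\<And>y r. (y, r) \<in> S ==> (inv y, - r) \<in> S" and S1: "\<And>r. (\<one>, r) \<in> S ==> r \<in> \<int>"
    and Sc: "\<And>y r. (y, r) \<in> S ==> y \<in> carrier G" and S0: "(\<one>, 0) \<in> S"
    using S unfolding cgraph_def by blast+
  have "\<exists>r. \<forall>k::int. \<forall>s. (x [^] k, s) \<in> S --> s - of_int k * r \<in> \<int>"
  proof (cases "\<exists>d::nat. 0 < d \<and> (\<exists>s. (x [^] d, s) \<in> S)")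
    case True
    define d where "d = (LEAST d::nat. 0 < d \<and> (\<exists>s. (x [^] d, s) \<in> S))"
    have "0 < d \<and> (\<exists>s. (x [^] d, s) \<in> S)" unfolding d_def by (rule LeastI_ex[OF True])
    then obtain s where d: "0 < d" "(x [^] d, s) \<in> S" by blast
    have dmin: "d \<le> e" if "0 < e" "(x [^] e, t) \<in> S" for e t
      unfolding d_def by (rule Least_le) (use that in blast)
    show ?thesis
    proof (intro exI allI impI)
      fix k :: int and t assume k: "(x [^] k, t) \<in> S"
      define q e where "q = k div int d" and "e = k mod int d"
      have e: "0 \<le> e" "e < int d" "k = int d * q + e" using d(1) by (auto simp: q_def e_def)
      have "((x [^] d) [^] (- q), of_int (- q) * s) \<in> S" by (rule cgraph_pow[OF S d(2)])
      from Smul[OF k this] have "(x [^] k \<otimes> (x [^] d) [^] (- q), t - of_int q * s) \<in> S" by simp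
      moreover have "x [^] k \<otimes> (x [^] d) [^] (- q) = x [^] e"
      proof -
        have "(x [^] d) [^] (- q) = x [^] (int d * (- q))"
          using int_pow_pow[OF x, of "int d" "- q"] by (simp add: int_pow_int mult.commute)
        then have "x [^] k \<otimes> (x [^] d) [^] (- q) = x [^] (k + int d * (- q))"
          using int_pow_mult[OF x, of k "int d * (- q)"] by simp
        then show ?thesis using e(3) by simp
      qed
      ultimately have xe: "(x [^] e, t - of_int q * s) \<in> S" by simp
      have "e = 0"
      proof (rule ccontr)
        assume "e \<noteq> 0"
        then have "0 < nat e" using e(1) by simp
        moreover have "(x [^] nat e, t - of_int q * s) \<in> S" using xe e(1) by (metis int_pow_int nat_0_le)
        ultimately have "d \<le> nat e" by (rule dmin)
        then show False using e by linarith
      qed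
      then have "t - of_int q * s \<in> \<int>" using xe S1 by simp
      moreover have "of_int k * (s / of_nat d) = of_int q * s"
        using e(3) \<open>e = 0\<close> d(1) by simp
      ultimately show "t - of_int k * (s / of_nat d) \<in> \<int>" by simp
    qed
  next
    case False
    have "s - of_int k * 0 \<in> \<int>" if k: "(x [^] k, s) \<in> S" for k :: int and s
    proof -
      have "k = 0"
      proof (rule ccontr)
        assume "k \<noteq> 0"
        then consider "0 < k" | "k < 0" by linarith
        then show False
        proof cases
          case 1
          then have "(x [^] nat k, s) \<in> S" using k by (metis int_pow_int nat_0_le less_imp_le)
          moreover have "0 < nat k" using 1 by simp
          ultimately show False using False by blast
        next
          case 2
          have "(x [^] (- k), - s) \<in> S" using Sinv[OF k] int_pow_neg[OF x] by simp
          then have "(x [^] nat (- k), - s) \<in> S" using 2 by (metis int_pow_int nat_0_le less_imp_le neg_0_less_iff_less)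
          moreover have "0 < nat (- k)" using 2 by simp
          ultimately show False using False by blast
        qed
      qed
      then show ?thesis using k S1 by simp
    qed
    then show ?thesis by blast
  qed
  then obtain r where r: "\<And>k::int. \<And>s. (x [^] k, s) \<in> S ==> s - of_int k * r \<in> \<int>" by blast
  define T where "T = {(y \<otimes> x [^] k, s + of_int k * r) | y s k. (y, s) \<in> S} "
  have T: "(y \<otimes> x [^] k, s + of_int k * r) \<in> T" if "(y, s) \<in> S" for y s and k :: int
    using that unfolding T_def by blast
  have "cgraph G T"
    unfolding cgraph_def
  proof (intro conjI allI impI)
    show "T \<subseteq> carrier G \<times> UNIV" using Sc x by (auto simp: T_def)
    show "(\<one>, 0) \<in> T" using T[OF S0, of 0] by simp
  next
    fix a t b u assume "(a, t) \<in> T" "(b, u) \<in> T"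
    then obtain y s k z v l where e: "a = y \<otimes> x [^] (k::int)" "t = s + of_int k * r" "(y, s) \<in> S"
      "b = z \<otimes> x [^] (l::int)" "u = v + of_int l * r" "(z, v) \<in> S" unfolding T_def by blast
    have c: "y \<in> carrier G" "z \<in> carrier G" using e Sc by auto
    have "a \<otimes> b = (y \<otimes> z) \<otimes> x [^] (k + l)"
      using c x by (simp add: e int_pow_mult m_ac)
    then show "(a \<otimes> b, t + u) \<in> T" using T[OF Smul[OF e(3,6)], of "k + l"] by (simp add: e algebra_simps)
  next
    fix a t assume "(a, t) \<in> T"
    then obtain y s k where e: "a = y \<otimes> x [^] (k::int)" "t = s + of_int k * r" "(y, s) \<in> S" unfolding T_def by blast
    have "inv a = inv y \<otimes> x [^] (- k)" using Sc[OF e(3)] x by (simp add: e inv_mult int_pow_neg)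
    then show "(inv a, - t) \<in> T" using T[OF Sinv[OF e(3)], of "- k"] by (simp add: e)
  next
    fix t assume "(\<one>, t) \<in> T"
    then obtain y s k where e: "\<one> = y \<otimes> x [^] (k::int)" "t = s + of_int k * r" "(y, s) \<in> S" unfolding T_def by blast
    have "x [^] k = inv y" using e(1) Sc[OF e(3)] x by (metis inv_equality inv_inv int_pow_closed m_comm inv_closed)
    then have "- s - of_int k * r \<in> \<int>" using r[of k "- s"] Sinv[OF e(3)] by simp
    then have "- (- s - of_int k * r) \<in> \<int>" by (rule Ints_minus)
    moreover have "- (- s - of_int k * r) = t" by (simp add: e(2))
    ultimately show "t \<in> \<int>" by (simp only:)
  qed
  moreover have "S \<subseteq> T"
  proof
    fix z assume "z \<in> S"
    then show "z \<in> T" using T[of "fst z" "snd z" 0] Sc[of "fst z" "snd z"] by simp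
  qed
  moreover have "x \<in> fst ` T" using T[OF S0, of 1] x by (force simp: int_pow_1)
  ultimately show ?thesis by blast
qed

text \<open>The circle group is injective: a maximal partial character is total by
  \<open>cgraph_extend_one\<close>. Maximality is taken among graphs, which are closed under unions
  of chains.\<close>

theorem (in comm_group) character_extension:
  assumes S: "cgraph G S"
  shows "\<exists>\<xi>. mhom G 1 \<xi> \<and> (\<forall>(x, r)\<in>S. cg 1 (\<xi> x) r)"
proof -
  let ?A = "{T. cgraph G T \<and> S \<subseteq> T}"
  have "\<exists>M\<in>?A. \<forall>T\<in>?A. M \<subseteq> T --> T = M"
  proof (rule subset_Zorn_nonempty)
    show "?A \<noteq> {}" using S by blast
    fix C assume C: "C \<noteq> {}" "subset.chain ?A C"
    then have CA: "\<And>T. T \<in> C ==> cgraph G T \<and> S \<subseteq> T" and Ch: "\<And>T T'. T \<in> C ==> T' \<in> C ==> T \<subseteq> T' \<or> T' \<subseteq> T"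
      unfolding subset_chain_def by blast+
    have c: "T \<subseteq> carrier G \<times> UNIV" "(\<one>, 0) \<in> T" "\<And>x r. (x, r) \<in> T ==> (inv x, - r) \<in> T"
      "\<And>r. (\<one>, r) \<in> T ==> r \<in> \<int>" if "T \<in> C" for T
      using CA[OF that] unfolding cgraph_def by blast+
    have "cgraph G (\<Union> C)"
      unfolding cgraph_def
    proof (intro conjI allI impI)
      fix x r y s assume "(x, r) \<in> \<Union> C" "(y, s) \<in> \<Union> C"
      then obtain T T' where T: "T \<in> C" "T' \<in> C" "(x, r) \<in> T" "(y, s) \<in> T'" by blast
      then obtain T'' where "T'' \<in> C" "(x, r) \<in> T''" "(y, s) \<in> T''" using Ch[OF T(1,2)] by blast
      then show "(x \<otimes> y, r + s) \<in> \<Union> C" using CA[of T''] unfolding cgraph_def by blast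
    next
      show "\<Union> C \<subseteq> carrier G \<times> UNIV" using c(1) by blast
      show "(\<one>, 0) \<in> \<Union> C" using c(2) C(1) by blast
      show "(inv x, - r) \<in> \<Union> C" if "(x, r) \<in> \<Union> C" for x r using c(3) that by blast
      show "r \<in> \<int>" if "(\<one>, r) \<in> \<Union> C" for r using c(4) that by blast
    qed
    then show "\<Union> C \<in> ?A" using CA C(1) by blast
  qed
  then obtain M where M: "cgraph G M" "S \<subseteq> M" "\<And>T. cgraph G T ==> M \<subseteq> T ==> T = M" by auto
  have tot: "\<exists>r. (x, r) \<in> M" if "x \<in> carrier G" for x
    using cgraph_extend_one[OF M(1) that] M(3) by force
  define \<xi> where "\<xi> = (\<lambda>x. SOME r. (x, r) \<in> M)"
  have \<xi>: "(x, \<xi> x) \<in> M" if "x \<in> carrier G" for x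
    unfolding \<xi>_def by (rule someI_ex[OF tot[OF that]])
  have uniq: "cg 1 r s" if "(x, r) \<in> M" "(x, s) \<in> M" for x r s
  proof -
    have x: "x \<in> carrier G" using that(1) M(1) unfolding cgraph_def by blast
    have "(inv x, - s) \<in> M" using that(2) M(1) unfolding cgraph_def by blast
    then have "(x \<otimes> inv x, r + - s) \<in> M" using that(1) M(1) unfolding cgraph_def by blast
    then have "r - s \<in> \<int>" using M(1) x unfolding cgraph_def by simp
    then show ?thesis by (simp add: cg_1_Ints)
  qed
  have "mhom G 1 \<xi>"
    unfolding mhom_def
  proof (intro ballI)
    fix x y assume xy: "x \<in> carrier G" "y \<in> carrier G"
    have "(x \<otimes> y, \<xi> x + \<xi> y) \<in> M" using \<xi>[OF xy(1)] \<xi>[OF xy(2)] M(1) unfolding cgraph_def by blast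
    then show "cg 1 (\<xi> (x \<otimes> y)) (\<xi> x + \<xi> y)" using uniq \<xi> xy by blast
  qed
  moreover have "cg 1 (\<xi> x) r" if "(x, r) \<in> S" for x r
    using uniq[of x "\<xi> x" r] \<xi>[of x] that M(1,2) unfolding cgraph_def by blast
  ultimately show ?thesis by blast
qed

section \<open>Homomorphisms modulo a number on the abelianization\<close>

context group
begin

lemma mhom_one: "mhom G d f ==> cg d (f \<one>) 0"
proof -
  assume "mhom G d f"
  then have "cg d (f (\<one> \<otimes> \<one>)) (f \<one> + f \<one>)" unfolding mhom_def by blast
  from cg_diff[OF cg_sym[OF this] cg_refl[of d "f \<one>"]] show "cg d (f \<one>) 0" by simp
qed

lemma mhom_inv: assumes "mhom G d f" "x \<in> carrier G" shows "cg d (f (inv x)) (- f x)"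
proof -
  have "cg d (f (x \<otimes> inv x)) (f x + f (inv x))" using assms unfolding mhom_def by blast
  then have 1: "cg d (f \<one>) (f x + f (inv x))" using assms(2) by simp
  show ?thesis by (rule cg_lin2[OF cg_sym[OF 1] mhom_one[OF assms(1)]]) simp
qed

lemma mhom_pow: assumes "mhom G d f" "x \<in> carrier G" shows "cg d (f (x [^] (k::nat))) (real k * f x)"
proof (induction k)
  case 0
  then show ?case using mhom_one[OF assms(1)] by simp
next
  case (Suc k)
  have 1: "cg d (f (x [^] k \<otimes> x)) (f (x [^] k) + f x)" using assms unfolding mhom_def by blast
  show ?case by (rule cg_lin2[OF 1[folded nat_pow_Suc] Suc]) (simp add: algebra_simps)
qed

lemma mhom_derived: assumes f: "mhom G d f" and "x \<in> derived G (carrier G)" shows "cg d (f x) 0"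
proof -
  let ?K = "{x \<in> carrier G. cg d (f x) 0}"
  have mul: "cg d (f (x \<otimes> y)) (f x + f y)" if "x \<in> carrier G" "y \<in> carrier G" for x y
    using f that unfolding mhom_def by blast
  have K: "subgroup ?K G"
  proof (rule subgroupI)
    show "?K \<subseteq> carrier G" by auto
    show "?K \<noteq> {}" using mhom_one[OF f] by blast
    fix a assume a: "a \<in> ?K"
    then have 1: "cg d (f (inv a)) (- f a)" "cg d (f a) 0" using mhom_inv[OF f] by auto
    show "inv a \<in> ?K" using cg_trans[OF 1(1), of 0] cg_neg[OF 1(2)] a by simp
    fix b assume b: "b \<in> ?K"
    have "cg d (f (a \<otimes> b)) 0" by (rule cg_lin3[OF mul 1(2), of a b "f b" 0]) (use a b in auto)
    then show "a \<otimes> b \<in> ?K" using a b by simp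
  qed
  have "derived_set G (carrier G) \<subseteq> ?K"
  proof
    fix z assume "z \<in> derived_set G (carrier G)"
    then obtain a b where z: "z = a \<otimes> b \<otimes> inv a \<otimes> inv b" and ab: "a \<in> carrier G" "b \<in> carrier G" by blast
    have 1: "cg d (f z) (f (a \<otimes> b \<otimes> inv a) + f (inv b))" unfolding z using ab by (intro mul) auto
    have 2: "cg d (f (a \<otimes> b \<otimes> inv a)) (f (a \<otimes> b) + f (inv a))" using ab by (intro mul) auto
    have 3: "cg d (f z) (f (a \<otimes> b) + f (inv a) + f (inv b))" by (rule cg_lin2[OF 1 2]) simp
    have 4: "cg d (f z) (f a + f b + f (inv a) + f (inv b))" by (rule cg_lin2[OF 3 mul[OF ab]]) simp
    have "cg d (f z) 0" by (rule cg_lin3[OF 4 mhom_inv[OF f ab(1)] mhom_inv[OF f ab(2)]]) simp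
    then show "z \<in> ?K" using ab by (simp add: z)
  qed
  then have "derived G (carrier G) \<subseteq> ?K"
    unfolding derived_def by (rule generate_subgroup_incl[OF _ K])
  then show ?thesis using assms(2) by blast
qed

abbreviation "dG \<equiv> derived G (carrier G)"

lemma abelianization_facts:
  shows "comm_group (abelianization G)" "carrier (abelianization G) = (\<lambda>x. dG #> x) ` carrier G"
    "\<one>\<^bsub>abelianization G\<^esub> = dG"
    "x \<in> carrier G ==> y \<in> carrier G ==> (dG #> x) \<otimes>\<^bsub>abelianization G\<^esub> (dG #> y) = dG #> (x \<otimes> y)"
    "x \<in> carrier G ==> dG #> x = dG \<longleftrightarrow> x \<in> dG"
proof -
  have n: "dG \<lhd> G" by (rule derived_self_is_normal)
  show "comm_group (abelianization G)" unfolding abelianization_def by (rule derived_quot_is_comm_group)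
  show "carrier (abelianization G) = (\<lambda>x. dG #> x) ` carrier G"
    by (auto simp: abelianization_def FactGroup_def RCOSETS_def)
  show "\<one>\<^bsub>abelianization G\<^esub> = dG" by (simp add: abelianization_def FactGroup_def)
  show "x \<in> carrier G ==> y \<in> carrier G ==> (dG #> x) \<otimes>\<^bsub>abelianization G\<^esub> (dG #> y) = dG #> (x \<otimes> y)"
    using normal.rcos_sum[OF n] by (simp add: abelianization_def FactGroup_def)
  show "x \<in> carrier G ==> dG #> x = dG \<longleftrightarrow> x \<in> dG"
    using coset_join1[OF _ _ normal_imp_subgroup[OF n]] coset_join2[OF _ normal_imp_subgroup[OF n]]
      subgroup.subset[OF normal_imp_subgroup[OF n]] by auto
qed

lemma abelianization_pow:
  "x \<in> carrier G ==> (dG #> x) [^]\<^bsub>abelianization G\<^esub> (k::nat) = dG #> (x [^] k)"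
proof (induction k)
  case 0
  have "\<one> \<in> dG" using derived_is_subgroup[of "carrier G"] subgroup.one_closed by blast
  then show ?case using abelianization_facts(3,5) by auto
next
  case (Suc k)
  then show ?case using abelianization_facts(4)[of "x [^] k" x] by simp
qed

lemma mhom_of_abelianization:
  "mhom (abelianization G) d \<xi> ==> mhom G d (\<lambda>x. \<xi> (dG #> x))"
  unfolding mhom_def using abelianization_facts(2,4) by auto

text \<open>A torsion element of order \<open>o'\<close> admits a character with value
  \<open>1 / o'\<close> on it, extended to the whole group. A real homomorphism kills torsion, so if
  it lifts this character, \<open>1 / o'\<close> is an integer.\<close>

theorem torsion_free_if_characters_lift:
  assumes lift: "\<And>f. mhom G 1 f ==> \<exists>f'. mhom G 0 f' \<and> (\<forall>x\<in>carrier G. cg 1 (f x) (f' x))"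
  shows "torsion_free_group (abelianization G)"
  unfolding torsion_free_group_def
proof (intro ballI allI impI)
  let ?H = "abelianization G"
  interpret H: comm_group ?H by (rule abelianization_facts)
  fix a and k :: nat assume a: "a \<in> carrier ?H" "0 < k" "a [^]\<^bsub>?H\<^esub> k = \<one>\<^bsub>?H\<^esub>"
  define o' where "o' = (LEAST o'::nat. 0 < o' \<and> a [^]\<^bsub>?H\<^esub> o' = \<one>\<^bsub>?H\<^esub>)"
  have o': "0 < o' \<and> a [^]\<^bsub>?H\<^esub> o' = \<one>\<^bsub>?H\<^esub>" unfolding o'_def by (rule LeastI[of _ k]) (use a in blast)
  define S where "S = {(a [^]\<^bsub>?H\<^esub> (l::int), of_int l / real o' + of_int m) | l m::int. True}"
  have S: "(a [^]\<^bsub>?H\<^esub> (l::int), of_int l / real o' + of_int m) \<in> S" for l m :: int unfolding S_def by blast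
  have "cgraph ?H S"
    unfolding cgraph_def
  proof (intro conjI allI impI)
    show "S \<subseteq> carrier ?H \<times> UNIV" using a(1) by (auto simp: S_def)
    show "(\<one>\<^bsub>?H\<^esub>, 0) \<in> S" using S[of 0 0] by simp
  next
    fix x r y s assume "(x, r) \<in> S" "(y, s) \<in> S"
    then obtain l m l' m' :: int where e: "x = a [^]\<^bsub>?H\<^esub> l" "r = of_int l / real o' + of_int m"
      "y = a [^]\<^bsub>?H\<^esub> l'" "s = of_int l' / real o' + of_int m'" unfolding S_def by blast
    have "x \<otimes>\<^bsub>?H\<^esub> y = a [^]\<^bsub>?H\<^esub> (l + l')" using a(1) by (simp add: e H.int_pow_mult)
    moreover have "r + s = of_int (l + l') / real o' + of_int (m + m')" by (simp add: e add_divide_distrib)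
    ultimately show "(x \<otimes>\<^bsub>?H\<^esub> y, r + s) \<in> S" using S[of "l + l'" "m + m'"] by (simp only:)
  next
    fix x r assume "(x, r) \<in> S"
    then obtain l m :: int where e: "x = a [^]\<^bsub>?H\<^esub> l" "r = of_int l / real o' + of_int m" unfolding S_def by blast
    show "(inv\<^bsub>?H\<^esub> x, - r) \<in> S" using S[of "- l" "- m"] a(1) by (simp add: e H.int_pow_neg)
  next
    fix r assume "(\<one>\<^bsub>?H\<^esub>, r) \<in> S"
    then obtain l m :: int where e: "\<one>\<^bsub>?H\<^esub> = a [^]\<^bsub>?H\<^esub> l" "r = of_int l / real o' + of_int m" unfolding S_def by blast
    define q t where "q = l div int o'" and "t = l mod int o'"
    have t: "0 \<le> t" "t < int o'" "l = int o' * q + t" using o' by (auto simp: q_def t_def)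
    have "a [^]\<^bsub>?H\<^esub> (int o' * q) = \<one>\<^bsub>?H\<^esub>"
      using H.int_pow_pow[OF a(1), of "int o'" q] o' by (simp add: int_pow_int mult.commute)
    then have "a [^]\<^bsub>?H\<^esub> t = \<one>\<^bsub>?H\<^esub>" using e(1) H.int_pow_mult[OF a(1), of "int o' * q" t] t(3) a(1) by (auto simp: algebra_simps)
    then have nt: "a [^]\<^bsub>?H\<^esub> nat t = \<one>\<^bsub>?H\<^esub>" using t(1) by (metis int_pow_int nat_0_le)
    have "\<not> 0 < nat t"
    proof
      assume "0 < nat t"
      then have "o' \<le> nat t" unfolding o'_def using nt by (intro Least_le conjI)
      then show False using t(1,2) by linarith
    qed
    then have "l = int o' * q" using t by simp
    then have "r = of_int (q + m)" using o' e(2) by simp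
    then show "r \<in> \<int>" by simp
  qed
  from H.character_extension[OF this] obtain \<xi> where \<xi>: "mhom ?H 1 \<xi>" "\<forall>(x, r)\<in>S. cg 1 (\<xi> x) r" by blast
  have \<xi>a: "cg 1 (\<xi> a) (1 / real o')" using bspec[OF \<xi>(2) S[of 1 0]] a(1) by simp
  obtain x where x: "x \<in> carrier G" "a = dG #> x" using a(1) abelianization_facts(2) by auto
  obtain f' where f': "mhom G 0 f'" "\<And>y. y \<in> carrier G ==> cg 1 (\<xi> (dG #> y)) (f' y)"
    using lift[OF mhom_of_abelianization[OF \<xi>(1)]] by blast
  have "x [^] k \<in> dG"
    using a(3) x abelianization_pow[OF x(1)] abelianization_facts(3) abelianization_facts(5)[of "x [^] k"] by simp
  then have "f' (x [^] k) = 0" using mhom_derived[OF f'(1)] cg_0 by blast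
  then have "real k * f' x = 0" using mhom_pow[OF f'(1) x(1), of k] cg_0 by simp
  then have "f' x = 0" using a(2) by simp
  then have "cg 1 (1 / real o') 0" using f'(2)[OF x(1)] x(2) cg_trans[OF cg_sym[OF \<xi>a]] by simp
  then have "1 / real o' \<in> \<int>" by (simp add: cg_1_Ints)
  then obtain i :: int where i: "1 / real o' = of_int i" by (auto simp: Ints_def)
  have "o' = 1"
  proof (rule ccontr)
    assume "o' \<noteq> 1"
    then have "1 / real o' < 1" "0 < 1 / real o'" using o' by auto
    then show False using i by (metis of_int_0_less_iff of_int_less_1_iff zless_imp_add1_zle not_less add_0)
  qed
  then show "a = \<one>\<^bsub>?H\<^esub>" using o' a(1) by simp
qed

text \<open>Prescribe the value \<open>s x / 2\<close> modulo 1 on the square of \<open>x\<close> in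
  the abelianization and extend. Without 2-torsion a square determines its root, so the prescription
  is consistent; the extension \<open>f\<close> has \<open>2 * f\<close> congruent to
  \<open>s / 2\<close> modulo 1.\<close>

theorem quarter_character:
  assumes tf: "torsion_free_group (abelianization G)" and s: "mhom G 2 s"
  shows "\<exists>f. mhom G 1 f \<and> (\<forall>x\<in>carrier G. cg 2 (4 * f x) (s x))"
proof -
  let ?H = "abelianization G"
  interpret H: comm_group ?H by (rule abelianization_facts)
  note A = abelianization_facts
  define S where "S = {(dG #> (x \<otimes> x), s x / 2 + of_int m) | x m::int. x \<in> carrier G}"
  have S: "(dG #> (x \<otimes> x), r) \<in> S" if xr: "x \<in> carrier G" "cg 1 r (s x / 2)" for x r
  proof -
    obtain m :: int where "r - s x / 2 = of_int m" using xr(2) by (auto simp: cg_def)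
    then have "r = s x / 2 + of_int m" by simp
    then show ?thesis using xr(1) unfolding S_def by blast
  qed
  have SE: "\<exists>x. x \<in> carrier G \<and> a = dG #> (x \<otimes> x) \<and> cg 1 r (s x / 2)" if "(a, r) \<in> S" for a r
    using that unfolding S_def cg_def by auto
  have c2: "cg 1 (a / 2) (b / 2)" if "cg 2 a b" for a b
    using that unfolding cg_def by (auto simp: algebra_simps)
  have "cgraph ?H S"
    unfolding cgraph_def
  proof (intro conjI allI impI)
    show "S \<subseteq> carrier ?H \<times> UNIV" by (auto simp: S_def A(2))
    have "dG #> (\<one> \<otimes> \<one>) = \<one>\<^bsub>?H\<^esub>"
      using A(3,5) derived_is_subgroup[of "carrier G"] subgroup.one_closed by fastforce
    then show "(\<one>\<^bsub>?H\<^esub>, 0) \<in> S" using S[of \<one> 0] c2[OF mhom_one[OF s]] cg_sym by simp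
  next
    fix a r b t assume "(a, r) \<in> S" "(b, t) \<in> S"
    then obtain x y where e: "x \<in> carrier G" "a = dG #> (x \<otimes> x)" "cg 1 r (s x / 2)"
      "y \<in> carrier G" "b = dG #> (y \<otimes> y)" "cg 1 t (s y / 2)" using SE by blast
    have "a \<otimes>\<^bsub>?H\<^esub> b = dG #> ((x \<otimes> y) \<otimes> (x \<otimes> y))"
    proof -
      have h: "dG #> x \<in> carrier ?H" "dG #> y \<in> carrier ?H" using e A(2) by auto
      have "a = (dG #> x) \<otimes>\<^bsub>?H\<^esub> (dG #> x)" "b = (dG #> y) \<otimes>\<^bsub>?H\<^esub> (dG #> y)"
        "dG #> ((x \<otimes> y) \<otimes> (x \<otimes> y)) = ((dG #> x) \<otimes>\<^bsub>?H\<^esub> (dG #> y)) \<otimes>\<^bsub>?H\<^esub> ((dG #> x) \<otimes>\<^bsub>?H\<^esub> (dG #> y))"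
        using e by (simp_all add: A(4))
      then show ?thesis using h by (simp add: H.m_ac)
    qed
    moreover have "cg 1 (r + t) (s (x \<otimes> y) / 2)"
    proof -
      have "cg 2 (s (x \<otimes> y)) (s x + s y)" using s e unfolding mhom_def by blast
      from cg_add[OF e(3,6)] cg_sym[OF c2[OF this]] show ?thesis
        by (rule cg_lin2) (simp add: add_divide_distrib)
    qed
    ultimately show "(a \<otimes>\<^bsub>?H\<^esub> b, r + t) \<in> S" using S[of "x \<otimes> y" "r + t"] e by simp
  next
    fix a r assume "(a, r) \<in> S"
    then obtain x where e: "x \<in> carrier G" "a = dG #> (x \<otimes> x)" "cg 1 r (s x / 2)" using SE by blast
    have "inv\<^bsub>?H\<^esub> a = dG #> (inv x \<otimes> inv x)"
    proof (rule H.inv_equality)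
      show "(dG #> (inv x \<otimes> inv x)) \<otimes>\<^bsub>?H\<^esub> a = \<one>\<^bsub>?H\<^esub>"
      proof -
        have "(inv x \<otimes> inv x) \<otimes> (x \<otimes> x) = \<one>" using e(1) by (simp add: m_assoc[symmetric]) (simp add: m_assoc)
        moreover have "dG #> \<one> = dG" using A(5) derived_is_subgroup[of "carrier G"] subgroup.one_closed by fastforce
        ultimately show ?thesis using e by (simp add: A(3,4))
      qed
    qed (use e A(2) in auto)
    moreover have "cg 1 (- r) (s (inv x) / 2)"
      by (rule cg_lin2[OF cg_neg[OF e(3)] cg_sym[OF c2[OF mhom_inv[OF s e(1)]]]]) simp
    ultimately show "(inv\<^bsub>?H\<^esub> a, - r) \<in> S" using S[of "inv x" "- r"] e by simp
  next
    fix r assume "(\<one>\<^bsub>?H\<^esub>, r) \<in> S"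
    then obtain x where e: "x \<in> carrier G" "\<one>\<^bsub>?H\<^esub> = dG #> (x \<otimes> x)" "cg 1 r (s x / 2)" using SE by blast
    \<comment> \<open>This is where torsion-freeness enters: if the square of \<open>x\<close> is
      trivial in the abelianization, so is \<open>x\<close>, and then \<open>s x\<close> is
      congruent to 0.\<close>
    have "(dG #> x) [^]\<^bsub>?H\<^esub> (2::nat) = \<one>\<^bsub>?H\<^esub>"
      using abelianization_pow[OF e(1), of 2] e by (simp add: numeral_2_eq_2)
    moreover have "dG #> x \<in> carrier ?H" using e A(2) by auto
    ultimately have "dG #> x = \<one>\<^bsub>?H\<^esub>" using tf unfolding torsion_free_group_def by (metis zero_less_numeral)
    then have "x \<in> dG" using A(3,5) e(1) by simp
    then have "cg 1 (s x / 2) 0" using c2[OF mhom_derived[OF s]] by fastforce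
    then have "cg 1 r 0" using e(3) cg_trans by blast
    then show "r \<in> \<int>" by (simp add: cg_1_Ints)
  qed
  from H.character_extension[OF this] obtain \<xi> where \<xi>: "mhom ?H 1 \<xi>" "\<forall>(x, r)\<in>S. cg 1 (\<xi> x) r" by blast
  have "cg 2 (4 * \<xi> (dG #> x)) (s x)" if x: "x \<in> carrier G" for x
  proof -
    have "cg 1 (\<xi> (dG #> (x \<otimes> x))) (s x / 2)" using bspec[OF \<xi>(2) S[OF x cg_refl]] by simp
    moreover have "cg 1 (\<xi> (dG #> (x \<otimes> x))) (\<xi> (dG #> x) + \<xi> (dG #> x))"
      using mhom_of_abelianization[OF \<xi>(1)] x unfolding mhom_def by blast
    ultimately have "cg 1 (\<xi> (dG #> x) + \<xi> (dG #> x)) (s x / 2)" using cg_sym cg_trans by blast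
    then obtain m :: int where "2 * \<xi> (dG #> x) - s x / 2 = of_int m" by (auto simp: cg_def)
    then show ?thesis unfolding cg_def by (intro exI[of _ m]) simp
  qed
  then show ?thesis using mhom_of_abelianization[OF \<xi>(1)] by blast
qed

end

section \<open>Good covers\<close>

definition charac :: "'a topology => real => 'a => ((real => 'a) => real) => bool" where
  "charac Z d b \<xi> \<longleftrightarrow> (\<forall>p q. phom Z b b p q --> cg d (\<xi> p) (\<xi> q)) \<and>
     (\<forall>p q. pth Z b b p --> pth Z b b q --> cg d (\<xi> (loop_join p q)) (\<xi> p + \<xi> q))"

lemma charac_of_mhom:
  assumes "mhom (fundamental_group Z b) d f" shows "charac Z d b (\<lambda>p. f (loop_class Z b p))"
  unfolding charac_def
proof (intro conjI allI impI)
  fix p q assume "phom Z b b p q"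
  then have "loop_class Z b p = loop_class Z b q" using loop_class_eq phom_pth by metis
  then show "cg d (f (loop_class Z b p)) (f (loop_class Z b q))" by simp
next
  fix p q assume "pth Z b b p" "pth Z b b q"
  then show "cg d (f (loop_class Z b (loop_join p q))) (f (loop_class Z b p) + f (loop_class Z b q))"
    using assms unfolding mhom_def by (force simp: fundamental_group_simps simp flip: fundamental_group_mult)
qed

lemma mhom_of_charac:
  assumes "charac Z d b \<xi>"
  shows "\<exists>f. mhom (fundamental_group Z b) d f \<and> (\<forall>p. pth Z b b p --> cg d (f (loop_class Z b p)) (\<xi> p))"
proof -
  define f where "f = (\<lambda>A. \<xi> (SOME p. p \<in> A))"
  have f: "cg d (f (loop_class Z b p)) (\<xi> p)" if "pth Z b b p" for p
  proof -
    have "(SOME q. q \<in> loop_class Z b p) \<in> loop_class Z b p"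
      by (rule someI[of _ p]) (simp add: loop_class_mem phom_refl that)
    then have "phom Z b b (SOME q. q \<in> loop_class Z b p) p" by (simp add: loop_class_mem phom_sym)
    then show ?thesis using assms unfolding f_def charac_def by blast
  qed
  have "mhom (fundamental_group Z b) d f"
    unfolding mhom_def
  proof (intro ballI)
    fix P Q assume "P \<in> carrier (fundamental_group Z b)" "Q \<in> carrier (fundamental_group Z b)"
    then obtain p q where p: "P = loop_class Z b p" "pth Z b b p" and q: "Q = loop_class Z b q" "pth Z b b q"
      by (auto simp: fundamental_group_simps)
    have "cg d (\<xi> (loop_join p q)) (\<xi> p + \<xi> q)" using assms p q unfolding charac_def by blast
    then show "cg d (f (P \<otimes>\<^bsub>fundamental_group Z b\<^esub> Q)) (f P + f Q)"
      using cg_trans[OF f[OF pth_join[OF p(2) q(2)]]] cg_sym[OF cg_add[OF f[OF p(2)] f[OF q(2)]]] cg_trans p q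
      by (metis fundamental_group_mult)
  qed
  then show ?thesis using f by blast
qed

lemma charac_const: assumes "charac Z d b \<xi>" "b \<in> topspace Z" shows "cg d (\<xi> (\<lambda>t. b)) 0"
proof -
  have k: "pth Z b b (\<lambda>t. b)" by (rule pth_const[OF assms(2)])
  have "cg d (\<xi> (loop_join (\<lambda>t. b) (\<lambda>t. b))) (\<xi> (\<lambda>t. b) + \<xi> (\<lambda>t. b))"
    "cg d (\<xi> (loop_join (\<lambda>t. b) (\<lambda>t. b))) (\<xi> (\<lambda>t. b))"
    using assms(1) k phom_const_join(1)[OF k] unfolding charac_def by blast+
  from cg_diff[OF cg_trans[OF cg_sym[OF this(1)] this(2)] cg_refl[of d "\<xi> (\<lambda>t. b)"]] show ?thesis by simp
qed

text \<open>One base point in each path component; the space need not be path-connected, and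
  cocycles live on all of it.\<close>

definition good_base :: "'a topology => ('a => 'a) => bool" where
  "good_base Z B \<longleftrightarrow> (\<forall>x\<in>topspace Z. \<exists>p. pth Z (B x) x p) \<and> (\<forall>x y p. pth Z x y p --> B x = B y)"

lemma good_base_exists:
  assumes "b \<in> topspace Z" shows "\<exists>B. good_base Z B \<and> B b = b"
proof -
  let ?r = "\<lambda>x y. \<exists>p. pth Z x y p"
  define B where "B = (\<lambda>x. if ?r b x then b else SOME y. ?r y x)"
  have r: "?r x x" if "x \<in> topspace Z" for x using pth_const[OF that] by blast
  have tr: "?r x y ==> ?r y z ==> ?r x z" for x y z using pth_join by fastforce
  have sy: "?r x y ==> ?r y x" for x y using pth_rev by fastforce
  have "B b = b" using r[OF assms] by (simp add: B_def)
  moreover have "?r (B x) x" if x: "x \<in> topspace Z" for x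
    using someI[of "\<lambda>y. ?r y x", OF r[OF x]] by (simp add: B_def)
  moreover have "B x = B y" if "?r x y" for x y
  proof -
    have "?r z x \<longleftrightarrow> ?r z y" for z using that tr sy by blast
    then show ?thesis by (simp add: B_def)
  qed
  ultimately show ?thesis unfolding good_base_def by blast
qed

text \<open>Exactly what is used to pass between homomorphisms and cocycles: loops inside a cover
  set are trivial in the whole space, and overlaps of two sets are path-connected.\<close>

locale good_cover = open_cover +
  assumes in_path: "x \<in> U i ==> y \<in> U i ==> \<exists>p. pth Z x y p \<and> (\<forall>t\<in>{0..1}. p t \<in> U i)"
    and in_hom: "pth Z x y p ==> pth Z x y q ==> (\<And>t. t \<in> {0..1} ==> p t \<in> U i) ==>
      (\<And>t. t \<in> {0..1} ==> q t \<in> U i) ==> phom Z x y p q"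
    and inter_path: "x \<in> U i \<inter> U j ==> y \<in> U i \<inter> U j ==> \<exists>p. pth Z x y p \<and> (\<forall>t\<in>{0..1}. p t \<in> U i \<inter> U j)"

locale cover_character = good_cover +
  fixes B and \<xi>
  assumes B: "good_base Z B" and \<xi>: "x \<in> topspace Z ==> charac Z 1 (B x) (\<xi> (B x))"
begin

definition gam where "gam x = (SOME p. pth Z (B x) x p)"

text \<open>Extends the characters at the base points to a homomorphism of the fundamental groupoid.\<close>

definition Xv where "Xv p = \<xi> (B (p 0)) (loop_join (loop_join (gam (p 0)) p) (loop_rev (gam (p 1))))"

lemma gam: "x \<in> topspace Z ==> pth Z (B x) x (gam x)"
  unfolding gam_def using B unfolding good_base_def by (metis someI_ex)

lemma B_eq: "pth Z x y p ==> B x = B y"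
  using B unfolding good_base_def by blast

lemma closed_up:
  assumes "pth Z x y p" shows "pth Z (B x) (B x) (loop_join (loop_join (gam x) p) (loop_rev (gam y)))"
  using pth_join[OF pth_join[OF gam[OF pth_ends(1)[OF assms]] assms] pth_rev[OF gam[OF pth_ends(2)[OF assms]]]]
    B_eq[OF assms] by simp

lemma Xv_phom: assumes "phom Z x y p q" shows "cg 1 (Xv p) (Xv q)"
proof -
  note p = phom_pth(1)[OF assms] and q = phom_pth(2)[OF assms]
  note g = gam[OF pth_ends(1)[OF p]] gam[OF pth_ends(2)[OF p]]
  have "phom Z (B x) (B y) (loop_join (loop_join (gam x) p) (loop_rev (gam y))) (loop_join (loop_join (gam x) q) (loop_rev (gam y)))"
    by (rule phom_join[OF phom_join[OF phom_refl[OF g(1)] assms] phom_refl[OF pth_rev[OF g(2)]]])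
  then have "phom Z (B x) (B x) (loop_join (loop_join (gam x) p) (loop_rev (gam y))) (loop_join (loop_join (gam x) q) (loop_rev (gam y)))"
    using B_eq[OF p] by simp
  then show ?thesis using \<xi>[OF pth_ends(1)[OF p]] p q unfolding charac_def Xv_def by (simp add: pth_def)
qed

text \<open>Insert the path from the base point to \<open>y\<close> and its reverse between
  \<open>p\<close> and \<open>q\<close>; this splits the closed-up join into two loops.\<close>

lemma Xv_join:
  assumes p: "pth Z x y p" and q: "pth Z y z q" shows "cg 1 (Xv (loop_join p q)) (Xv p + Xv q)"
proof -
  let ?a = "gam x" and ?b = "gam y" and ?c = "loop_rev (gam z)" and ?B = "B x"
  have Beq: "B y = ?B" "B z = ?B" using B_eq[OF p] B_eq[OF q] by auto
  have a: "pth Z ?B x ?a" using gam pth_ends p by metis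
  have b: "pth Z ?B y ?b" using gam[of y] pth_ends p Beq by metis
  have c: "pth Z z ?B ?c" using pth_rev[OF gam[of z]] pth_ends q Beq by metis
  note j = pth_join
  note r = pth_rev[OF b]
  have pq: "pth Z x z (loop_join p q)" by (rule j[OF p q])
  have ap: "pth Z ?B y (loop_join ?a p)" by (rule j[OF a p])
  have qc: "pth Z y ?B (loop_join q c)" if "pth Z z ?B c" for c by (rule j[OF q that])
  have L: "phom Z ?B ?B (loop_join (loop_join ?a (loop_join p q)) ?c) (loop_join (loop_join ?a p) (loop_join q ?c))"
    by (rule phom_trans[OF phom_join[OF phom_sym[OF phom_assoc[OF a p q]] phom_refl[OF c]] phom_assoc[OF ap q c]])
  have m1: "phom Z ?B ?B (loop_join (loop_join ?b q) ?c) (loop_join ?b (loop_join q ?c))" by (rule phom_assoc[OF b q c])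
  have m2: "phom Z y ?B (loop_join (loop_rev ?b) (loop_join ?b (loop_join q ?c))) (loop_join q ?c)"
    by (rule phom_trans[OF phom_sym[OF phom_assoc[OF r b qc[OF c]]]
      phom_trans[OF phom_join[OF phom_rev_join(1)[OF b] phom_refl[OF qc[OF c]]] phom_const_join(1)[OF qc[OF c]]]])
  have m3: "phom Z y ?B (loop_join (loop_rev ?b) (loop_join (loop_join ?b q) ?c)) (loop_join q ?c)"
    by (rule phom_trans[OF phom_join[OF phom_refl[OF r] m1] m2])
  have R: "phom Z ?B ?B (loop_join (loop_join (loop_join ?a p) (loop_rev ?b)) (loop_join (loop_join ?b q) ?c))
     (loop_join (loop_join ?a p) (loop_join q ?c))"
    by (rule phom_trans[OF phom_assoc[OF ap r j[OF j[OF b q] c]] phom_join[OF phom_refl[OF ap] m3]])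
  have h: "phom Z ?B ?B (loop_join (loop_join ?a (loop_join p q)) ?c)
     (loop_join (loop_join (loop_join ?a p) (loop_rev ?b)) (loop_join (loop_join ?b q) ?c))"
    by (rule phom_trans[OF L phom_sym[OF R]])
  have ch: "charac Z 1 ?B (\<xi> ?B)" by (rule \<xi>[OF pth_ends(1)[OF p]])
  have 1: "cg 1 (\<xi> ?B (loop_join (loop_join ?a (loop_join p q)) ?c))
     (\<xi> ?B (loop_join (loop_join (loop_join ?a p) (loop_rev ?b)) (loop_join (loop_join ?b q) ?c)))"
    using ch h unfolding charac_def by blast
  have 2: "cg 1 (\<xi> ?B (loop_join (loop_join (loop_join ?a p) (loop_rev ?b)) (loop_join (loop_join ?b q) ?c)))
     (\<xi> ?B (loop_join (loop_join ?a p) (loop_rev ?b)) + \<xi> ?B (loop_join (loop_join ?b q) ?c))"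
    using ch j[OF ap r] j[OF j[OF b q] c] unfolding charac_def by blast
  have e: "p 0 = x" "p 1 = y" "q 0 = y" "q 1 = z" "loop_join p q 0 = x" "loop_join p q 1 = z"
    using p q pq by (auto simp: pth_def)
  show ?thesis using cg_trans[OF 1 2] unfolding Xv_def e Beq .
qed

lemma Xv_const: assumes "x \<in> topspace Z" shows "cg 1 (Xv (\<lambda>t. x)) 0"
proof -
  have k: "pth Z x x (\<lambda>t. x)" by (rule pth_const[OF assms])
  from cg_diff[OF cg_trans[OF cg_sym[OF Xv_join[OF k k]] Xv_phom[OF phom_const_join(1)[OF k]]] cg_refl[of 1 "Xv (\<lambda>t. x)"]]
  show ?thesis by simp
qed

definition pt where "pt i = (SOME x. x \<in> U i)"
definition lam where "lam i x = Xv (SOME p. pth Z (pt i) x p \<and> (\<forall>t\<in>{0..1}. p t \<in> U i))"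
definition gc where "gc i j = (let x = (SOME x. x \<in> U i \<inter> U j) in lam i x - lam j x)"

lemma U_top: "x \<in> U i ==> x \<in> topspace Z"
  using openin_subset[OF U_open] by blast

lemma lam_path:
  assumes q: "pth Z x y q" "\<And>t. t \<in> {0..1} ==> q t \<in> U i"
  shows "cg 1 (Xv q) (lam i y - lam i x)"
proof -
  have xy: "x \<in> U i" "y \<in> U i" using q(2)[of 0] q(2)[of 1] q(1) by (auto simp: pth_def)
  have pt: "pt i \<in> U i" unfolding pt_def by (rule someI[of _ x]) (rule xy)
  let ?s = "\<lambda>x. SOME p. pth Z (pt i) x p \<and> (\<forall>t\<in>{0..1}. p t \<in> U i)"
  have s: "pth Z (pt i) x (?s x) \<and> (\<forall>t\<in>{0..1}. ?s x t \<in> U i)" if "x \<in> U i" for x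
    by (rule someI_ex[OF in_path[OF pt that]])
  have j: "pth Z (pt i) y (loop_join (?s x) q)" using pth_join s[OF xy(1)] q(1) by fastforce
  have "phom Z (pt i) y (loop_join (?s x) q) (?s y)"
  proof (rule in_hom[where i = i])
    fix t :: real assume "t \<in> {0..1}"
    then show "loop_join (?s x) q t \<in> U i" using s[OF xy(1)] q(2) by (auto simp: loop_join_def)
  qed (use j s[OF xy(2)] in auto)
  then have "cg 1 (Xv (loop_join (?s x) q)) (lam i y)" unfolding lam_def by (rule Xv_phom)
  moreover have "cg 1 (Xv (loop_join (?s x) q)) (lam i x + Xv q)"
    unfolding lam_def using Xv_join s[OF xy(1)] q(1) by blast
  ultimately have "cg 1 (lam i x + Xv q) (lam i y)" using cg_sym cg_trans by blast
  from cg_diff[OF this cg_refl[of 1 "lam i x"]] show ?thesis by simp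
qed

text \<open>The transition value is defined at one chosen point of the overlap. Inside either set
  the change of \<open>lam\<close> along a path is the value of the character on the path, so on a
  path-connected overlap the difference is constant.\<close>

lemma gc_lam: assumes "x \<in> U i" "x \<in> U j" shows "cg 1 (gc i j) (lam i x - lam j x)"
proof -
  define y where "y = (SOME y. y \<in> U i \<inter> U j)"
  have y: "y \<in> U i \<inter> U j" unfolding y_def by (rule someI[of _ x]) (use assms in simp)
  obtain q where q: "pth Z y x q" "\<And>t. t \<in> {0..1} ==> q t \<in> U i \<inter> U j"
    using inter_path[OF y, of x] assms by auto
  have 1: "cg 1 (Xv q) (lam i x - lam i y)" "cg 1 (Xv q) (lam j x - lam j y)"
    using lam_path[OF q(1)] q(2) by auto
  have "gc i j = lam i y - lam j y" by (simp add: gc_def y_def Let_def)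
  then show ?thesis by (intro cg_lin2[OF 1(1) cg_sym[OF 1(2)]]) simp
qed

lemma cocycle_gc: "cocycle 1 gc"
  unfolding cocycle_def
proof (intro allI impI)
  fix i j k assume "U i \<inter> U j \<inter> U k \<noteq> {}"
  then obtain x where "x \<in> U i" "x \<in> U j" "x \<in> U k" by blast
  then show "cg 1 (gc i j + gc j k) (gc i k)"
    by (intro cg_lin3[OF gc_lam[of x i j] gc_lam[of x j k] cg_sym[OF gc_lam[of x i k]]]) simp_all
qed

lemma pth_part: "pth Z x y p ==> 0 \<le> s ==> s \<le> 1 ==> pth Z x (p s) (\<lambda>t. p (s * t))"
  unfolding pth_def by (auto intro!: sub_map[of "{0..1}"] continuous_intros mult_le_one)

lemma Xv_part:
  assumes p: "pth Z x y p" and s: "0 \<le> s" "s \<le> s'" "s' \<le> 1"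
  shows "cg 1 (Xv (\<lambda>t. p (s' * t))) (Xv (\<lambda>t. p (s * t)) + Xv (\<lambda>t. p (s + (s' - s) * t)))"
    "pth Z (p s) (p s') (\<lambda>t. p (s + (s' - s) * t))"
proof -
  have b: "0 \<le> s + (s' - s) * t" "s + (s' - s) * t \<le> s'" if "t \<in> {0..1}" for t
  proof -
    show "0 \<le> s + (s' - s) * t" using that s by simp
    have "(s' - s) * t \<le> (s' - s) * 1" using that s by (intro mult_left_mono) auto
    then show "s + (s' - s) * t \<le> s'" by simp
  qed
  show q: "pth Z (p s) (p s') (\<lambda>t. p (s + (s' - s) * t))"
    unfolding pth_def
  proof (intro conjI)
    show "continuous_map (top_of_set {0..1}) Z (\<lambda>t. p (s + (s' - s) * t))"
      by (rule sub_map[of "{0..1}"]) (use p b s in \<open>fastforce simp: pth_def intro!: continuous_intros\<close>)+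
  qed simp_all
  have a: "pth Z x (p s) (\<lambda>t. p (s * t))" by (rule pth_part[OF p]) (use s in auto)
  have "phom Z x (p s') (loop_join (\<lambda>t. p (s * t)) (\<lambda>t. p (s + (s' - s) * t))) (\<lambda>t. p (s' * t))"
  proof (rule phom_reparam[where P = p and f = "\<lambda>t. s * min 1 (2 * t) + (s' - s) * max 0 (2 * t - 1)" and g = "\<lambda>t. s' * t"])
    fix t :: real assume t: "t \<in> {0..1}"
    have "s * min 1 (2 * t) \<le> s * 1" "0 \<le> s * min 1 (2 * t)" using t s by (intro mult_left_mono mult_nonneg_nonneg; simp)+
    moreover have "(s' - s) * max 0 (2 * t - 1) \<le> (s' - s) * 1" "0 \<le> (s' - s) * max 0 (2 * t - 1)"
      using t s by (intro mult_left_mono mult_nonneg_nonneg; simp)+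
    ultimately show "s * min 1 (2 * t) + (s' - s) * max 0 (2 * t - 1) \<in> {0..1}" using s by auto
    show "s' * t \<in> {0..1}" using t s by (simp add: mult_le_one)
    show "loop_join (\<lambda>t. p (s * t)) (\<lambda>t. p (s + (s' - s) * t)) t = p (s * min 1 (2 * t) + (s' - s) * max 0 (2 * t - 1))"
      by (cases "t \<le> 1/2") (simp_all add: loop_join_def min_absorb1 min_absorb2 max_absorb1 max_absorb2)
  qed (use p in \<open>auto simp: pth_def intro!: continuous_intros\<close>)
  from cg_trans[OF cg_sym[OF Xv_phom[OF this]] Xv_join[OF a q]]
  show "cg 1 (Xv (\<lambda>t. p (s' * t))) (Xv (\<lambda>t. p (s * t)) + Xv (\<lambda>t. p (s + (s' - s) * t)))" .
qed

text \<open>Along a chain the partial sums of transition values follow the value of the character on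
  the initial part of the path; the terms \<open>lam\<close> telescope. For loops with
  \<open>i = j\<close> the cocycle thus recovers the character.\<close>

theorem hol_gc:
  assumes p: "pth Z x y p" and xy: "x \<in> U i" "y \<in> U j"
  shows "cg 1 (hol gc p i j) (lam i x + Xv p - lam j y)"
proof -
  obtain m k where k: "chain p m k" using chain_exists[OF p] by blast
  have m: "0 < m" using k by (simp add: chain_def)
  let ?x = "\<lambda>l. real l / real m"
  have seg: "cg 1 (Xv (\<lambda>t. p (?x (Suc l) * t))) (Xv (\<lambda>t. p (?x l * t)) + (lam (k l) (p (?x (Suc l))) - lam (k l) (p (?x l))))"
    if l: "l < m" for l
  proof -
    have s: "0 \<le> ?x l" "?x l \<le> ?x (Suc l)" "?x (Suc l) \<le> 1" using l m by (auto simp: divide_simps)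
    have "p (?x l + (?x (Suc l) - ?x l) * t) \<in> U (k l)" if "t \<in> {0..1}" for t
    proof -
      have "(?x (Suc l) - ?x l) * t \<le> (?x (Suc l) - ?x l) * 1" "0 \<le> (?x (Suc l) - ?x l) * t"
        using that s by (intro mult_left_mono mult_nonneg_nonneg; simp)+
      then show ?thesis using k l unfolding chain_def by auto
    qed
    from cg_add[OF cg_refl lam_path[OF Xv_part(2)[OF p s] this]] show ?thesis
      using cg_trans[OF Xv_part(1)[OF p s]] by blast
  qed
  have "cg 1 (wv gc i k l) (lam i x + Xv (\<lambda>t. p (?x l * t)) - lam (k l) (p (?x l)))" if "l < m" for l
    using that
  proof (induction l)
    case 0
    have "x \<in> U (k 0)" using chain_first[OF k] p by (simp add: pth_def)
    then have 1: "cg 1 (gc i (k 0)) (lam i x - lam (k 0) x)" by (rule gc_lam[OF xy(1)])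
    have "p 0 = x" using p by (simp add: pth_def)
    then show ?case using cg_lin2[OF 1 cg_sym[OF Xv_const[OF U_top[OF xy(1)]]]] by simp
  next
    case (Suc l)
    have l: "l < m" using Suc.prems by simp
    have IH: "cg 1 (wv gc i k l) (lam i x + Xv (\<lambda>t. p (?x l * t)) - lam (k l) (p (?x l)))" using Suc by simp
    have "p (?x (Suc l)) \<in> U (k l)" "p (?x (Suc l)) \<in> U (k (Suc l))"
      using chain_point[OF k l] chain_point[OF k Suc.prems] by auto
    then have 2: "cg 1 (gc (k l) (k (Suc l))) (lam (k l) (p (?x (Suc l))) - lam (k (Suc l)) (p (?x (Suc l))))" by (rule gc_lam)
    show ?case by (rule cg_lin3[OF IH 2 cg_sym[OF seg[OF l]]]) simp
  qed
  from this[of "m - 1"] have 1: "cg 1 (wv gc i k (m - 1)) (lam i x + Xv (\<lambda>t. p (?x (m - 1) * t)) - lam (k (m - 1)) (p (?x (m - 1))))"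
    using m by simp
  have 2: "cg 1 (Xv p) (Xv (\<lambda>t. p (?x (m - 1) * t)) + (lam (k (m - 1)) y - lam (k (m - 1)) (p (?x (m - 1)))))"
    using seg[of "m - 1"] m p by (simp add: pth_def)
  have 3: "cg 1 (gc (k (m - 1)) j) (lam (k (m - 1)) y - lam j y)"
    by (rule gc_lam[OF _ xy(2)]) (use chain_last[OF k] p in \<open>simp add: pth_def\<close>)
  have 4: "cg 1 (val gc m k i j) (lam i x + Xv p - lam j y)"
    unfolding val_def by (rule cg_lin3[OF 1 3 cg_sym[OF 2]]) simp
  have "cg 1 (hol gc p i j) (val gc m k i j)"
    by (rule hol_val[OF cocycle_gc k]) (use p xy in \<open>simp_all add: pth_def\<close>)
  then show ?thesis using 4 cg_trans by blast
qed

end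

section \<open>Lifting and division of cocycles\<close>

context good_cover
begin

lemma charac_hol:
  assumes "cocycle d g" "b \<in> U i" shows "charac Z d b (\<lambda>p. hol g p i i)"
  unfolding charac_def using hol_phom[OF assms(1)] hol_join[OF assms(1)] assms(2) by blast

text \<open>A circle-valued character becomes a cocycle by \<open>gc\<close>; its real lift becomes
  a real character again by holonomy along loops. The two agree modulo 1 chain by chain.\<close>

theorem torsion_free_if_cocycles_lift:
  assumes lift: "\<And>g. cocycle 1 g ==> \<exists>g'. cocycle 0 g' \<and> (\<forall>i j. U i \<inter> U j \<noteq> {} --> cg 1 (g i j) (g' i j))"
    and b: "b \<in> topspace Z"
  shows "torsion_free_group (abelianization (fundamental_group Z b))"
proof (rule group.torsion_free_if_characters_lift[OF group_fundamental_group[OF b]])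
  let ?G = "fundamental_group Z b"
  fix f assume f: "mhom ?G 1 f"
  obtain B where B0: "good_base Z B" "B b = b" using good_base_exists[OF b] by blast
  define \<xi> where "\<xi> = (\<lambda>b' p. if b' = b then f (loop_class Z b p) else 0)"
  have \<xi>0: "charac Z 1 b' (\<xi> b')" for b'
    using charac_of_mhom[OF f] by (auto simp: \<xi>_def charac_def)
  interpret cover_character Z U B \<xi> by unfold_locales (use B0 \<xi>0 in auto)
  obtain g' where g': "cocycle 0 g'" "\<And>i j. U i \<inter> U j \<noteq> {} ==> cg 1 (gc i j) (g' i j)"
    using lift[OF cocycle_gc] by blast
  obtain i where i: "b \<in> U i" using U_cover[OF b] by blast
  obtain f' where f': "mhom ?G 0 f'" "\<And>p. pth Z b b p ==> cg 0 (f' (loop_class Z b p)) (hol g' p i i)"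
    using mhom_of_charac[OF charac_hol[OF g'(1) i]] by blast
  have "cg 1 (f (loop_class Z b p)) (f' (loop_class Z b p))" if p: "pth Z b b p" for p
  proof -
    have g: "pth Z b b (gam b)" using gam[OF b] B0(2) by simp
    let ?c = "\<lambda>p. f (loop_class Z b p)"
    have ch: "\<And>p q. phom Z b b p q ==> cg 1 (?c p) (?c q)"
      "\<And>p q. pth Z b b p ==> pth Z b b q ==> cg 1 (?c (loop_join p q)) (?c p + ?c q)"
      using charac_of_mhom[OF f] unfolding charac_def by blast+
    have X1: "Xv p = ?c (loop_join (loop_join (gam b) p) (loop_rev (gam b)))"
      unfolding Xv_def using p B0(2) by (simp add: \<xi>_def pth_def)
    have 1: "cg 1 (?c (loop_join (loop_join (gam b) p) (loop_rev (gam b)))) (?c (loop_join (gam b) p) + ?c (loop_rev (gam b)))"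
      by (rule ch(2)[OF pth_join[OF g p] pth_rev[OF g]])
    have 2: "cg 1 (?c (loop_join (gam b) p)) (?c (gam b) + ?c p)" by (rule ch(2)[OF g p])
    have 3: "cg 1 (?c (gam b) + ?c (loop_rev (gam b))) 0"
      using cg_trans[OF cg_sym[OF ch(2)[OF g pth_rev[OF g]]]
        cg_trans[OF ch(1)[OF phom_rev_join(2)[OF g]] charac_const[OF charac_of_mhom[OF f] b]]] .
    have Xp: "cg 1 (Xv p) (?c p)" unfolding X1 by (rule cg_lin3[OF 1 2 3]) simp
    have 4: "cg 1 (hol gc p i i) (?c p)" using cg_trans[OF hol_gc[OF p i i], of "?c p"] Xp by simp
    obtain m k where k: "chain p m k" using chain_exists[OF p] by blast
    have e: "p 0 \<in> U i" "p 1 \<in> U i" using p i by (auto simp: pth_def)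
    have m: "0 < m" using k by (simp add: chain_def)
    have "cg 1 (wv gc i k l) (wv g' i k l)" if "l < m" for l
      using that
    proof (induction l)
      case 0
      show ?case using g'(2)[of i "k 0"] e(1) chain_first[OF k] by auto
    next
      case (Suc l)
      have "p (real (Suc l) / real m) \<in> U (k l) \<inter> U (k (Suc l))"
        using chain_point[OF k, of l] chain_point[OF k, of "Suc l"] Suc.prems by auto
      then show ?case using Suc by (simp add: cg_add g'(2) disjoint_iff) (meson cg_add g'(2) disjoint_iff)
    qed
    from this[of "m - 1"] have w: "cg 1 (wv gc i k (m - 1)) (wv g' i k (m - 1))" using m by simp
    have "cg 1 (gc (k (m - 1)) i) (g' (k (m - 1)) i)" using g'(2)[of "k (m - 1)" i] e(2) chain_last[OF k] by auto
    from cg_add[OF w this] have 5: "cg 1 (val gc m k i i) (val g' m k i i)" by (simp add: val_def)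
    have 6: "cg 1 (hol gc p i i) (val gc m k i i)" by (rule hol_val[OF cocycle_gc k e])
    have "hol g' p i i = val g' m k i i" using hol_val[OF g'(1) k e] by (simp add: cg_0)
    then have "f' (loop_class Z b p) = val g' m k i i" using f'(2)[OF p] by (simp add: cg_0)
    then show ?thesis using cg_trans[OF cg_sym[OF 4] cg_trans[OF 6 5]] by simp
  qed
  then show "\<exists>f'. mhom ?G 0 f' \<and> (\<forall>x\<in>carrier ?G. cg 1 (f x) (f' x))"
    using f'(1) by (auto simp: fundamental_group_simps)
qed

text \<open>Apply \<open>quarter_character\<close> to the holonomy of \<open>s\<close> at each base
  point and turn the result into a cocycle modulo 1. Four times this cocycle has the right holonomy
  modulo 2 and is therefore \<open>s\<close> up to a coboundary, which is subtracted as
  \<open>\<tau>\<close>.\<close>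

theorem quarter_cocycle:
  assumes tf: "\<And>b. b \<in> topspace Z ==> torsion_free_group (abelianization (fundamental_group Z b))"
    and s: "cocycle 2 s"
  shows "\<exists>c. cocycle 4 c \<and> (\<forall>i j. U i \<inter> U j \<noteq> {} --> cg 2 (c i j) (s i j))"
proof (cases "topspace Z = {}")
  case True
  then have "U i = {}" for i using openin_subset[OF U_open[of i]] by blast
  then show ?thesis by (auto simp: cocycle_def)
next
  case False
  define idx where "idx = (\<lambda>b. SOME i. b \<in> U i)"
  have idx: "b \<in> U (idx b)" if "b \<in> topspace Z" for b unfolding idx_def by (rule someI_ex[OF U_cover[OF that]])
  have "\<exists>\<xi>. charac Z 1 b \<xi> \<and> (\<forall>p. pth Z b b p --> cg 2 (4 * \<xi> p) (hol s p (idx b) (idx b)))" if b: "b \<in> topspace Z" for b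
  proof -
    obtain f where f: "mhom (fundamental_group Z b) 2 f"
      "\<And>p. pth Z b b p ==> cg 2 (f (loop_class Z b p)) (hol s p (idx b) (idx b))"
      using mhom_of_charac[OF charac_hol[OF s idx[OF b]]] by blast
    obtain h where h: "mhom (fundamental_group Z b) 1 h" "\<And>x. x \<in> carrier (fundamental_group Z b) ==> cg 2 (4 * h x) (f x)"
      using group.quarter_character[OF group_fundamental_group[OF b] tf[OF b] f(1)] by blast
    have "cg 2 (4 * h (loop_class Z b p)) (hol s p (idx b) (idx b))" if "pth Z b b p" for p
      by (rule cg_trans[OF h(2) f(2)[OF that]]) (simp add: fundamental_group_simps that)
    then show ?thesis using charac_of_mhom[OF h(1)] by blast
  qed
  then obtain \<xi> where \<xi>0: "\<And>b. b \<in> topspace Z ==> charac Z 1 b (\<xi> b)"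
    "\<And>b p. b \<in> topspace Z ==> pth Z b b p ==> cg 2 (4 * \<xi> b p) (hol s p (idx b) (idx b))" by metis
  obtain B where B0: "good_base Z B" using False good_base_exists by fastforce
  have Btop: "B x \<in> topspace Z" if "x \<in> topspace Z" for x
    using B0 that pth_ends(1) unfolding good_base_def by fastforce
  interpret cover_character Z U B \<xi> by unfold_locales (use B0 \<xi>0(1) Btop in auto)
  \<comment> \<open>\<open>\<sigma> i x\<close> is the holonomy of \<open>s\<close> from the base
    point to \<open>x\<close>, a local primitive of \<open>s\<close>. Four times \<open>lam\<close>
    plus \<open>\<sigma>\<close> is constant on \<open>U i\<close> modulo 2, and
    \<open>\<tau> i\<close> is that constant.\<close>
  define \<sigma> where "\<sigma> = (\<lambda>i x. hol s (gam x) (idx (B x)) i)"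
  define \<tau> where "\<tau> = (\<lambda>i. 4 * lam i (pt i) + \<sigma> i (pt i))"
  have c4: "cg 2 (4 * a) (4 * b)" if ab: "cg 1 a b" for a b
  proof -
    obtain k :: int where "a - b = of_int k" using ab by (auto simp: cg_def)
    then show ?thesis unfolding cg_def by (intro exI[of _ "2 * k"]) simp
  qed
  have const: "cg 2 (4 * lam i y + \<sigma> i y) (\<tau> i)" if y: "y \<in> U i" for i y
  proof -
    have pt: "pt i \<in> U i" unfolding pt_def by (rule someI[of _ y]) (rule y)
    obtain q where q: "pth Z (pt i) y q" "\<And>t. t \<in> {0..1} ==> q t \<in> U i" using in_path[OF pt y] by blast
    let ?x = "pt i" and ?j = "idx (B (pt i))"
    have top: "?x \<in> topspace Z" "y \<in> topspace Z" using U_top pt y by auto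
    have Beq: "B y = B ?x" using B_eq[OF q(1)] by simp
    have j: "B ?x \<in> U ?j" by (rule idx[OF Btop[OF top(1)]])
    have gx: "pth Z (B ?x) ?x (gam ?x)" by (rule gam[OF top(1)])
    have gy: "pth Z (B ?x) y (gam y)" using gam[OF top(2)] Beq by simp
    have 0: "cg 2 (4 * Xv q) (hol s (loop_join (loop_join (gam ?x) q) (loop_rev (gam y))) ?j ?j)"
      using \<xi>0(2)[OF Btop[OF top(1)] closed_up[OF q(1)]] q(1) by (simp add: Xv_def pth_def)
    have 1: "cg 2 (hol s (loop_join (loop_join (gam ?x) q) (loop_rev (gam y))) ?j ?j)
      (hol s (loop_join (gam ?x) q) ?j i + hol s (loop_rev (gam y)) i ?j)"
      by (rule hol_join[OF s pth_join[OF gx q(1)] pth_rev[OF gy] j y j])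
    have 2: "cg 2 (hol s (loop_join (gam ?x) q) ?j i) (hol s (gam ?x) ?j i + hol s q i i)"
      by (rule hol_join[OF s gx q(1) j pt y])
    have 3: "cg 2 (hol s (loop_rev (gam y)) i ?j) (- hol s (gam y) ?j i)" by (rule hol_rev[OF s gy j y])
    have si: "cg 2 (s i i) 0" by (rule cocycle_self[OF s y])
    have 4: "cg 2 (hol s q i i) 0" using cg_trans[OF hol_inside[OF s q pt y] cg_add[OF si si]] by simp
    have 5: "cg 2 (4 * Xv q) (4 * (lam i y - lam i ?x))" by (rule c4[OF lam_path[OF q]])
    have 6: "cg 2 (4 * Xv q) (\<sigma> i ?x + hol s q i i - \<sigma> i y)"
      unfolding \<sigma>_def Beq using cg_trans[OF 0 cg_trans[OF 1 cg_add[OF 2 3]]] by simp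
    show ?thesis unfolding \<tau>_def by (rule cg_lin3[OF cg_sym[OF 5] 6 4]) simp
  qed
  have \<sigma>s: "cg 2 (\<sigma> i x + s i j) (\<sigma> j x)" if x: "x \<in> U i" "x \<in> U j" for i j x
  proof -
    have top: "x \<in> topspace Z" using U_top x by auto
    note g = gam[OF top]
    have b: "B x \<in> U (idx (B x))" by (rule idx[OF Btop[OF top]])
    have k: "pth Z x x (\<lambda>t. x)" by (rule pth_const[OF top])
    have 1: "cg 2 (hol s (loop_join (gam x) (\<lambda>t. x)) (idx (B x)) j) (\<sigma> i x + hol s (\<lambda>t. x) i j)"
      unfolding \<sigma>_def by (rule hol_join[OF s g k b x])
    have 2: "cg 2 (hol s (loop_join (gam x) (\<lambda>t. x)) (idx (B x)) j) (\<sigma> j x)"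
      unfolding \<sigma>_def by (rule hol_phom[OF s phom_const_join(2)[OF g] b x(2)])
    have 3: "cg 2 (hol s (\<lambda>t. x) i j) (s i i + s i j)"
      by (rule hol_inside[OF s k _ x]) (rule x(1))
    have 4: "cg 2 (hol s (\<lambda>t. x) i j) (s i j)"
      by (rule cg_lin2[OF 3 cocycle_self[OF s x(1)]]) simp
    show ?thesis by (rule cg_lin3[OF cg_sym[OF 4] cg_sym[OF 1] 2]) simp
  qed
  define c where "c = (\<lambda>i j. 4 * gc i j - \<tau> i + \<tau> j)"
  have "cg 2 (c i j) (s i j)" if ne: "U i \<inter> U j \<noteq> {}" for i j
  proof -
    obtain x where x: "x \<in> U i" "x \<in> U j" using ne by blast
    have 1: "cg 2 (4 * gc i j) (4 * (lam i x - lam j x))" by (rule c4[OF gc_lam[OF x]])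
    have 2: "cg 2 (c i j) (\<sigma> j x - \<sigma> i x)"
      unfolding c_def by (rule cg_lin3[OF 1 const[OF x(1)] cg_sym[OF const[OF x(2)]]]) simp
    show ?thesis by (rule cg_lin2[OF 2 cg_sym[OF \<sigma>s[OF x]]]) simp
  qed
  moreover have "cocycle 4 c"
    unfolding cocycle_def
  proof (intro allI impI)
    fix i j k assume "U i \<inter> U j \<inter> U k \<noteq> {}"
    then have "cg 1 (gc i j + gc j k) (gc i k)" using cocycle_gc unfolding cocycle_def by blast
    then obtain l :: int where "gc i j + gc j k - gc i k = of_int l" by (auto simp: cg_def)
    then show "cg 4 (c i j + c j k) (c i k)" unfolding cg_def c_def by (intro exI[of _ l]) simp
  qed
  ultimately show ?thesis by blast
qed

end

section \<open>The unordered configuration space of two points of a graph\<close>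

lemma openin_UC2:
  "openin (UC2 T) O' \<longleftrightarrow> O' \<subseteq> {{x, y} | x y. x \<in> topspace T \<and> y \<in> topspace T \<and> x \<noteq> y} \<and>
     openin (conf2 T) {(x, y) \<in> topspace (conf2 T). {x, y} \<in> O'}"
proof -
  let ?P = "\<lambda>O'. O' \<subseteq> {{x, y} | x y. x \<in> topspace T \<and> y \<in> topspace T \<and> x \<noteq> y}"
  let ?S = "\<lambda>O'. {(x, y) \<in> topspace (conf2 T). {x, y} \<in> O'}"
  have "istopology (\<lambda>O'. ?P O' \<and> openin (conf2 T) (?S O'))"
    unfolding istopology_def
  proof (intro conjI allI impI)
    fix A B assume A: "?P A \<and> openin (conf2 T) (?S A)" and B: "?P B \<and> openin (conf2 T) (?S B)"
    show "?P (A \<inter> B)" by (rule order_trans[OF Int_lower1 conjunct1[OF A]])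
    have e: "?S (A \<inter> B) = ?S A \<inter> ?S B" by blast
    show "openin (conf2 T) (?S (A \<inter> B))" unfolding e by (rule openin_Int[OF conjunct2[OF A] conjunct2[OF B]])
  next
    fix K assume K: "\<forall>A\<in>K. ?P A \<and> openin (conf2 T) (?S A)"
    then show "?P (\<Union> K)" by (intro Union_least) blast
    have "?S (\<Union> K) = (\<Union>A\<in>K. ?S A)" by blast
    then show "openin (conf2 T) (?S (\<Union> K))" using K by auto
  qed
  from topology_inverse'[OF this] show ?thesis unfolding UC2_def by (rule fun_cong)
qed

definition upair :: "'a \<times> 'a => 'a set" where
  "upair z = {fst z, snd z}"

lemma upair_eq: "upair z = upair w \<longleftrightarrow> w = z \<or> w = prod.swap z"
  by (cases z; cases w) (auto simp: upair_def doubleton_eq_iff)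

lemma topspace_conf2: "topspace (conf2 T) = {z. fst z \<in> topspace T \<and> snd z \<in> topspace T \<and> fst z \<noteq> snd z}"
  by (auto simp: conf2_def)

lemma continuous_swap_conf2: "continuous_map (conf2 T) (conf2 T) prod.swap"
proof -
  have "continuous_map (prod_topology T T) (prod_topology T T) (\<lambda>z. (snd z, fst z))"
    by (intro continuous_map_pairedI continuous_map_fst continuous_map_snd)
  then have "continuous_map (conf2 T) (prod_topology T T) (\<lambda>z. (snd z, fst z))"
    unfolding conf2_def by (rule continuous_map_from_subtopology)
  then have "continuous_map (conf2 T) (subtopology (prod_topology T T) {(x, y). x \<noteq> y}) (\<lambda>z. (snd z, fst z))"
    unfolding continuous_map_in_subtopology by (auto simp: topspace_conf2)
  moreover have "(\<lambda>z. (snd z, fst z)) = (prod.swap :: 'a \<times> 'a => _)" by auto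
  ultimately show ?thesis by (simp add: conf2_def)
qed

lemma open_upair: assumes "openin (conf2 T) A" shows "openin (UC2 T) (upair ` A)"
  unfolding openin_UC2
proof
  have A: "A \<subseteq> topspace (conf2 T)" by (rule openin_subset[OF assms])
  then show "upair ` A \<subseteq> {{x, y} | x y. x \<in> topspace T \<and> y \<in> topspace T \<and> x \<noteq> y}"
    by (fastforce simp: topspace_conf2 upair_def)
  have "{(x, y) \<in> topspace (conf2 T). {x, y} \<in> upair ` A} = A \<union> {z \<in> topspace (conf2 T). prod.swap z \<in> A}"
  proof (rule Set.set_eqI)
    fix z
    have "{fst z, snd z} \<in> upair ` A \<longleftrightarrow> (\<exists>w\<in>A. upair w = upair z)" by (auto simp: upair_def)
    also have "\<dots> \<longleftrightarrow> z \<in> A \<or> prod.swap z \<in> A" unfolding upair_eq by (metis swap_swap)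
    finally show "z \<in> {(x, y) \<in> topspace (conf2 T). {x, y} \<in> upair ` A} \<longleftrightarrow>
        z \<in> A \<union> {z \<in> topspace (conf2 T). prod.swap z \<in> A}" using A by (cases z) auto
  qed
  then show "openin (conf2 T) {(x, y) \<in> topspace (conf2 T). {x, y} \<in> upair ` A}"
    using assms openin_continuous_map_preimage[OF continuous_swap_conf2 assms] by auto
qed

lemma topspace_UC2: "topspace (UC2 T) = upair ` topspace (conf2 T)"
proof
  show "topspace (UC2 T) \<subseteq> upair ` topspace (conf2 T)"
  proof
    fix e assume e: "e \<in> topspace (UC2 T)"
    have "openin (UC2 T) (topspace (UC2 T))" by simp
    then obtain x y where "e = {x, y}" "x \<in> topspace T" "y \<in> topspace T" "x \<noteq> y"
      using e unfolding openin_UC2 by blast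
    then have "e = upair (x, y)" "(x, y) \<in> topspace (conf2 T)" by (simp_all add: upair_def topspace_conf2)
    then show "e \<in> upair ` topspace (conf2 T)" by blast
  qed
  show "upair ` topspace (conf2 T) \<subseteq> topspace (UC2 T)" by (intro openin_subset open_upair) simp
qed

lemma continuous_upair: "continuous_map (conf2 T) (UC2 T) upair"
  unfolding continuous_map_def
proof (intro conjI allI impI)
  show "upair \<in> topspace (conf2 T) \<rightarrow> topspace (UC2 T)" by (auto simp: topspace_UC2)
  fix O' assume "openin (UC2 T) O'"
  moreover have "{z \<in> topspace (conf2 T). upair z \<in> O'} = {(x, y) \<in> topspace (conf2 T). {x, y} \<in> O'}"
    by (auto simp: upair_def)
  ultimately show "openin (conf2 T) {z \<in> topspace (conf2 T). upair z \<in> O'}" unfolding openin_UC2 by simp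
qed

definition (in sgraph) cl :: "nat => nat => bool" where
  "cl a b \<longleftrightarrow> a < n \<and> (a = b \<or> adj a b)"

text \<open>The geometric realisation in barycentric coordinates. The support condition also forces
  all coordinates from \<open>n\<close> on to vanish, since \<open>cl\<close> only relates numbers
  below \<open>n\<close>.\<close>

definition (in sgraph) KG :: "(nat => real) set" where
  "KG = {x. (\<forall>v. 0 \<le> x v) \<and> (\<Sum>v<n. x v) = 1 \<and> (\<exists>a b. cl a b \<and> (\<forall>v. v \<noteq> a --> v \<noteq> b --> x v = 0))}"

definition srt :: "nat => nat => nat \<times> nat" where
  "srt a b = (min a b, max a b)"

lemma srt_eq: "srt a b = srt c d \<longleftrightarrow> c = a \<and> d = b \<or> c = b \<and> d = a"
  by (auto simp: srt_def min_def max_def split: if_splits)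

lemma srt_commute: "srt a b = srt b a"
  by (simp add: srt_eq)

locale graph_model = sgraph +
  fixes Gr :: "'a topology" and lam :: "'a => nat => real" and mu :: "(nat => real) => 'a"
  assumes homeo: "homeomorphic_maps Gr (top_of_set KG) lam mu"
    and C4_free: "adj a b ==> adj b c ==> adj c d ==> adj d a ==> a = c \<or> b = d"
begin

lemma lam_KG: "x \<in> topspace Gr ==> lam x \<in> KG"
  using homeo unfolding homeomorphic_maps_def continuous_map_def by auto

lemma mu_top: "u \<in> KG ==> mu u \<in> topspace Gr"
  using homeo unfolding homeomorphic_maps_def continuous_map_def by auto

lemma mu_lam: "x \<in> topspace Gr ==> mu (lam x) = x"
  using homeo unfolding homeomorphic_maps_def by auto

lemma lam_mu: "u \<in> KG ==> lam (mu u) = u"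
  using homeo unfolding homeomorphic_maps_def by auto

lemma cl_sym: "cl a b ==> cl b a"
  unfolding cl_def using adj_sym adj_less by blast

lemma cl_less: "cl a b ==> a < n" "cl a b ==> b < n"
  unfolding cl_def using adj_less2 by blast+

lemma KG_clique: assumes "u \<in> KG" "u v \<noteq> 0" "u w \<noteq> 0" shows "cl v w"
proof -
  obtain a b where ab: "cl a b" "\<And>v. v \<noteq> a ==> v \<noteq> b ==> u v = 0" using assms(1) unfolding KG_def by blast
  then have "v = a \<or> v = b" "w = a \<or> w = b" using assms by auto
  then show ?thesis using ab(1) cl_sym[OF ab(1)] cl_less[OF ab(1)] by (auto simp: cl_def)
qed

lemma KG_less: "u \<in> KG ==> u v \<noteq> 0 ==> v < n"
  using KG_clique cl_less by blast

lemma continuous_coord: "continuous_map Gr euclideanreal (\<lambda>x. lam x v)"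
proof -
  have "continuous_map (top_of_set KG) euclideanreal (\<lambda>u. u v)"
    by (simp add: continuous_on_product_coordinates continuous_on_subset[OF _ subset_UNIV])
  from continuous_map_compose[OF _ this, of Gr lam] show ?thesis
    using homeo unfolding homeomorphic_maps_def by (simp add: o_def)
qed

definition sep :: "'a \<times> 'a => nat => nat => bool" where
  "sep z a b \<longleftrightarrow> lam (snd z) a < lam (fst z) a \<and> lam (fst z) b < lam (snd z) b"

definition W :: "nat set => nat set => ('a \<times> 'a) set" where
  "W A B = {z. fst z \<in> topspace Gr \<and> snd z \<in> topspace Gr \<and> (\<forall>a\<in>A. \<forall>b\<in>B. sep z a b)}"

definition V :: "nat set => nat set => 'a set set" where
  "V A B = upair ` W A B"

definition bary :: "nat set => nat => real" where
  "bary A v = of_bool (v \<in> A) / real (card A)"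

definition mv :: "nat set => real => 'a => nat => real" where
  "mv A t x v = (1 - t) * lam x v + t * bary A v"

lemma bary_KG: assumes "cl a b" shows "bary {a, b} \<in> KG"
proof -
  have "(\<Sum>v<n. bary {a, b} v) = (\<Sum>v\<in>{a, b}. bary {a, b} v)"
    using cl_less[OF assms] by (intro sum.mono_neutral_right) (auto simp: bary_def)
  also have "\<dots> = 1" by (cases "a = b") (auto simp: bary_def)
  finally have "(\<Sum>v<n. bary {a, b} v) = 1" .
  moreover have "0 \<le> bary {a, b} v" for v by (simp add: bary_def)
  moreover have "bary {a, b} v = 0" if "v \<noteq> a" "v \<noteq> b" for v using that by (simp add: bary_def)
  ultimately show ?thesis using assms unfolding KG_def by blast
qed

lemma W_conf2: assumes "A \<noteq> {}" "B \<noteq> {}" shows "W A B \<subseteq> topspace (conf2 Gr)"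
  using assms by (fastforce simp: W_def topspace_conf2 sep_def)

lemma W_pos: assumes "z \<in> W A B" "A \<noteq> {}" "B \<noteq> {}"
  shows "\<And>a. a \<in> A ==> 0 < lam (fst z) a" "\<And>b. b \<in> B ==> 0 < lam (snd z) b" "A \<inter> B = {}"
proof -
  have "lam (fst z) \<in> KG" "lam (snd z) \<in> KG" using assms lam_KG by (auto simp: W_def)
  then have p: "0 \<le> lam (fst z) v" "0 \<le> lam (snd z) v" for v by (auto simp: KG_def)
  have s: "sep z a b" if "a \<in> A" "b \<in> B" for a b using assms that by (auto simp: W_def)
  obtain a0 b0 where ab: "a0 \<in> A" "b0 \<in> B" using assms by blast
  show "0 < lam (fst z) a" if "a \<in> A" for a using s[OF that ab(2)] p(2)[of a] by (auto simp: sep_def)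
  show "0 < lam (snd z) b" if "b \<in> B" for b using s[OF ab(1) that] p(1)[of b] by (auto simp: sep_def)
  show "A \<inter> B = {}" using s by (force simp: sep_def)
qed

lemma mv_KG:
  assumes x: "x \<in> topspace Gr" and A: "A \<noteq> {}" "\<And>a. a \<in> A ==> 0 < lam x a" and t: "t \<in> {0..1}"
  shows "mv A t x \<in> KG"
proof -
  have K: "lam x \<in> KG" by (rule lam_KG[OF x])
  obtain a b where ab: "cl a b" "\<And>v. v \<noteq> a ==> v \<noteq> b ==> lam x v = 0" using K unfolding KG_def by blast
  have sub: "A \<subseteq> {a, b}" using A(2) ab(2) by fastforce
  have An: "A \<subseteq> {..<n}" using sub cl_less[OF ab(1)] by auto
  then have fin: "finite A" by (rule finite_subset) simp
  have "(\<Sum>v<n. bary A v) = (\<Sum>v\<in>A. bary A v)"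
    using An by (intro sum.mono_neutral_right) (auto simp: bary_def)
  also have "\<dots> = 1" using fin A(1) by (simp add: bary_def)
  finally have b1: "(\<Sum>v<n. bary A v) = 1" .
  have "(\<Sum>v<n. mv A t x v) = (1 - t) * (\<Sum>v<n. lam x v) + t * (\<Sum>v<n. bary A v)"
    by (simp add: mv_def sum.distrib sum_distrib_left)
  then have "(\<Sum>v<n. mv A t x v) = 1" using b1 K by (simp add: KG_def)
  moreover have "0 \<le> mv A t x v" for v using K t by (simp add: mv_def KG_def bary_def)
  moreover have "mv A t x v = 0" if "v \<noteq> a" "v \<noteq> b" for v using ab(2)[OF that] sub that by (auto simp: mv_def bary_def)
  ultimately show ?thesis using ab(1) unfolding KG_def by blast
qed

lemma mv_W:
  assumes z: "z \<in> W A B" and A: "A \<noteq> {}" "B \<noteq> {}" and t: "t \<in> {0..1}"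
  shows "(mu (mv A t (fst z)), mu (mv B t (snd z))) \<in> W A B"
proof -
  note p = W_pos[OF z A]
  have z': "fst z \<in> topspace Gr" "snd z \<in> topspace Gr" using z by (auto simp: W_def)
  have K: "mv A t (fst z) \<in> KG" "mv B t (snd z) \<in> KG" using mv_KG z' A p t by auto
  have less: "(1 - t) * r + t * 0 < (1 - t) * s + t * w" if "r < s" "0 < w" for r s w
  proof (cases "t = 1")
    case False
    then have "(1 - t) * r < (1 - t) * s" using that t by (intro mult_strict_left_mono) auto
    moreover have "0 \<le> t * w" using that t by simp
    ultimately show ?thesis by simp
  qed (use that in simp)
  have "finite A" "finite B" using p(1,2) KG_less lam_KG[OF z'(1)] lam_KG[OF z'(2)]
    by (metis finite_lessThan finite_subset lessThan_iff less_irrefl subsetI)+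
  then have pos: "0 < 1 / real (card A)" "0 < 1 / real (card B)" using A by (auto simp: card_gt_0_iff)
  have "sep (mu (mv A t (fst z)), mu (mv B t (snd z))) a b" if "a \<in> A" "b \<in> B" for a b
  proof -
    have "a \<notin> B" "b \<notin> A" "sep z a b" using p(3) that z by (auto simp: W_def)
    then show ?thesis using that less[OF _ pos(1), of "lam (snd z) a" "lam (fst z) a"]
        less[OF _ pos(2), of "lam (fst z) b" "lam (snd z) b"]
      unfolding sep_def fst_conv snd_conv lam_mu[OF K(1)] lam_mu[OF K(2)] by (simp add: mv_def bary_def)
  qed
  then show ?thesis using mu_top K by (simp add: W_def)
qed

lemma mv_continuous:
  assumes A: "A \<noteq> {}" "\<And>x. x \<in> topspace Y ==> f x \<in> topspace Gr" "\<And>x a. x \<in> topspace Y ==> a \<in> A ==> 0 < lam (f x) a"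
    and f: "continuous_map Y Gr f"
  shows "continuous_map (prod_topology Y (top_of_set {0..1})) Gr (\<lambda>z. mu (mv A (snd z) (f (fst z))))"
proof -
  let ?Z = "prod_topology Y (top_of_set {0..1::real})"
  have t: "continuous_map ?Z euclideanreal snd"
    by (rule continuous_map_into_fulltopology[OF continuous_map_snd])
  have l: "continuous_map ?Z euclideanreal (\<lambda>z. lam (f (fst z)) v)" for v
    using continuous_map_compose[OF continuous_map_compose[OF continuous_map_fst f] continuous_coord, of "top_of_set {0..1::real}" v]
    by (simp add: o_def)
  have "continuous_map ?Z euclideanreal (\<lambda>z. mv A (snd z) (f (fst z)) v)" for v
    unfolding mv_def by (intro continuous_map_add continuous_map_real_mult continuous_map_diff t l) auto
  then have "continuous_map ?Z euclidean (\<lambda>z. mv A (snd z) (f (fst z)))"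
    unfolding euclidean_product_topology[symmetric] continuous_map_componentwise_UNIV by blast
  moreover have "(\<lambda>z. mv A (snd z) (f (fst z))) \<in> topspace ?Z \<rightarrow> KG"
    using A by (intro funcsetI mv_KG) auto
  ultimately have "continuous_map ?Z (top_of_set KG) (\<lambda>z. mv A (snd z) (f (fst z)))"
    unfolding continuous_map_in_subtopology by auto
  from continuous_map_compose[OF this, of Gr mu] show ?thesis
    using homeo unfolding homeomorphic_maps_def by (simp add: o_def)
qed

lemma W_open: assumes "finite A" "finite B" "A \<noteq> {}" "B \<noteq> {}" shows "openin (conf2 Gr) (W A B)"
proof -
  let ?C = "conf2 Gr"
  have c: "continuous_map ?C Gr fst" "continuous_map ?C Gr snd"
    unfolding conf2_def by (intro continuous_map_from_subtopology continuous_map_fst continuous_map_snd)+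
  have l: "continuous_map ?C euclideanreal (\<lambda>z. lam (fst z) v)" "continuous_map ?C euclideanreal (\<lambda>z. lam (snd z) v)" for v
    using continuous_map_compose[OF c(1) continuous_coord, of v] continuous_map_compose[OF c(2) continuous_coord, of v]
    by (simp_all add: o_def)
  have o: "openin ?C {z \<in> topspace ?C. g z < h z}"
    if "continuous_map ?C euclideanreal g" "continuous_map ?C euclideanreal h" for g h
  proof -
    have "continuous_map ?C euclideanreal (\<lambda>z. h z - g z)" by (intro continuous_map_diff that)
    then have "openin ?C {z \<in> topspace ?C. h z - g z \<in> {0<..}}"
      by (rule openin_continuous_map_preimage) (simp add: open_openin[symmetric])
    then show ?thesis by simp
  qed
  have "openin ?C (\<Inter>p\<in>A \<times> B. {z \<in> topspace ?C. lam (snd z) (fst p) < lam (fst z) (fst p)} \<inter>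
      {z \<in> topspace ?C. lam (fst z) (snd p) < lam (snd z) (snd p)})"
    using assms by (intro openin_INT2 openin_Int o l) auto
  also have "\<dots> = W A B"
    using W_conf2[OF assms(3,4)] assms(3,4) by (fastforce simp: W_def sep_def topspace_conf2)
  finally show ?thesis .
qed

lemma V_open: "finite A ==> finite B ==> A \<noteq> {} ==> B \<noteq> {} ==> openin (UC2 Gr) (V A B)"
  unfolding V_def by (intro open_upair W_open)

text \<open>The inequalities at one \<open>a\<close> and one \<open>b\<close> tell the two points
  apart, so each unordered pair in \<open>V A B\<close> has a single ordering in
  \<open>W A B\<close>. The inverse is continuous because \<open>upair\<close> is an open
  map.\<close>

lemma V_lift:
  assumes "finite A" "finite B" "A \<noteq> {}" "B \<noteq> {}"
  shows "\<exists>s. continuous_map (subtopology (UC2 Gr) (V A B)) (subtopology (conf2 Gr) (W A B)) s \<and>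
     (\<forall>e\<in>V A B. s e \<in> W A B \<and> upair (s e) = e)"
proof -
  define s where "s = (\<lambda>e. SOME z. z \<in> W A B \<and> upair z = e)"
  have s: "s e \<in> W A B \<and> upair (s e) = e" if "e \<in> V A B" for e
    unfolding s_def by (rule someI_ex) (use that in \<open>auto simp: V_def\<close>)
  have uniq: "w = z" if "z \<in> W A B" "w \<in> W A B" "upair z = upair w" for z w
  proof -
    obtain a b where "a \<in> A" "b \<in> B" using assms by blast
    then have "sep z a b" "sep w a b" using that by (auto simp: W_def)
    then show ?thesis using that(3) by (auto simp: upair_eq sep_def)
  qed
  have top: "topspace (subtopology (UC2 Gr) (V A B)) = V A B"
    using openin_subset[OF V_open[OF assms]] by auto
  have topW: "topspace (subtopology (conf2 Gr) (W A B)) = W A B"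
    using W_conf2[OF assms(3,4)] by auto
  have "continuous_map (subtopology (UC2 Gr) (V A B)) (subtopology (conf2 Gr) (W A B)) s"
    unfolding continuous_map_def top topW
  proof (intro conjI allI impI)
    show "s \<in> V A B \<rightarrow> W A B" using s by blast
    fix Q assume "openin (subtopology (conf2 Gr) (W A B)) Q"
    then have Q: "openin (conf2 Gr) Q" "Q \<subseteq> W A B"
      using W_open[OF assms] by (auto simp: openin_open_subtopology)
    have "{e \<in> V A B. s e \<in> Q} = upair ` Q"
    proof (intro Set.set_eqI iffI)
      fix e assume "e \<in> upair ` Q"
      then obtain z where z: "z \<in> Q" "e = upair z" by blast
      then have e: "e \<in> V A B" using Q by (auto simp: V_def)
      then have "s e = z" using uniq[of z "s e"] s[OF e] z Q by fastforce
      then show "e \<in> {e \<in> V A B. s e \<in> Q}" using e z by auto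
    qed (use s in force)
    then show "openin (subtopology (UC2 Gr) (V A B)) {e \<in> V A B. s e \<in> Q}"
      using open_upair[OF Q(1)] V_open[OF assms] by (auto simp: openin_open_subtopology)
  qed
  then show ?thesis using s by blast
qed

text \<open>The straight-line contraction of a pair towards the barycentres of two disjoint cells.\<close>

lemma V_contract:
  assumes "finite A" "finite B" "A \<noteq> {}" "B \<noteq> {}"
  shows "\<exists>H c. continuous_map (prod_topology (subtopology (UC2 Gr) (V A B)) (top_of_set {0..1 :: real})) (UC2 Gr) H \<and>
     (\<forall>e\<in>V A B. H (e, 0) = e \<and> H (e, 1) = c \<and> (\<forall>t\<in>{0..1}. H (e, t) \<in> V A B))"
proof -
  obtain s where s: "continuous_map (subtopology (UC2 Gr) (V A B)) (subtopology (conf2 Gr) (W A B)) s"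
     "\<And>e. e \<in> V A B ==> s e \<in> W A B \<and> upair (s e) = e" using V_lift[OF assms] by blast
  define Y where "Y = subtopology (UC2 Gr) (V A B)"
  define G where "G = (\<lambda>z :: 'a set \<times> real. (mu (mv A (snd z) (fst (s (fst z)))), mu (mv B (snd z) (snd (s (fst z))))))"
  have top: "topspace Y = V A B" unfolding Y_def using openin_subset[OF V_open[OF assms]] by auto
  have sC: "continuous_map Y (prod_topology Gr Gr) s"
    using s(1) unfolding Y_def conf2_def continuous_map_in_subtopology by blast
  have c: "continuous_map Y Gr (\<lambda>e. fst (s e))" "continuous_map Y Gr (\<lambda>e. snd (s e))"
    using continuous_map_compose[OF sC continuous_map_fst] continuous_map_compose[OF sC continuous_map_snd]
    by (simp_all add: o_def)
  have sW: "fst (s e) \<in> topspace Gr" "snd (s e) \<in> topspace Gr" if "e \<in> V A B" for e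
    using s(2)[OF that] by (auto simp: W_def)
  have GW: "G (e, t) \<in> W A B" if "e \<in> V A B" "t \<in> {0..1}" for e t
    using mv_W[of "s e" A B t] s(2)[OF that(1)] assms that by (simp add: G_def)
  have "continuous_map (prod_topology Y (top_of_set {0..1})) (prod_topology Gr Gr) G"
    unfolding G_def
  proof (intro continuous_map_pairedI)
    show "continuous_map (prod_topology Y (top_of_set {0..1})) Gr (\<lambda>z. mu (mv A (snd z) (fst (s (fst z)))))"
      by (rule mv_continuous[OF assms(3) _ _ c(1)]) (use sW W_pos(1)[OF _ assms(3,4)] s(2) in \<open>auto simp: top\<close>)
    show "continuous_map (prod_topology Y (top_of_set {0..1})) Gr (\<lambda>z. mu (mv B (snd z) (snd (s (fst z)))))"
      by (rule mv_continuous[OF assms(4) _ _ c(2)]) (use sW W_pos(2)[OF _ assms(3,4)] s(2) in \<open>auto simp: top\<close>)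
  qed
  moreover have "G z \<in> {(x, y). x \<noteq> y}" if "z \<in> topspace (prod_topology Y (top_of_set {0..1}))" for z
    using GW[of "fst z" "snd z"] that W_conf2[OF assms(3,4)] by (cases z) (auto simp: top topspace_conf2)
  ultimately have "continuous_map (prod_topology Y (top_of_set {0..1})) (conf2 Gr) G"
    unfolding conf2_def continuous_map_in_subtopology by simp
  from continuous_map_compose[OF this continuous_upair]
  have H: "continuous_map (prod_topology Y (top_of_set {0..1})) (UC2 Gr) (\<lambda>z. upair (G z))" by (simp add: o_def)
  have e0: "upair (G (e, 0)) = e" if e: "e \<in> V A B" for e
  proof -
    have "mv A 0 x = lam x" "mv B 0 x = lam x" for x by (auto simp: mv_def)
    then have "G (e, 0) = s e" using sW[OF e] by (simp add: G_def mu_lam)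
    then show ?thesis using s(2)[OF e] by simp
  qed
  have e1: "upair (G (e, 1)) = upair (mu (bary A), mu (bary B))" for e
  proof -
    have "mv A 1 x = bary A" "mv B 1 x = bary B" for x by (auto simp: mv_def)
    then show ?thesis by (simp add: G_def)
  qed
  have e2: "upair (G (e, t)) \<in> V A B" if "e \<in> V A B" "t \<in> {0..1}" for e t
    using GW[OF that] by (simp add: V_def)
  have "\<forall>e\<in>V A B. upair (G (e, 0)) = e \<and> upair (G (e, 1)) = upair (mu (bary A), mu (bary B)) \<and>
      (\<forall>t\<in>{0..1}. upair (G (e, t)) \<in> V A B)"
    using e0 e1 e2 by blast
  with H[unfolded Y_def] show ?thesis
    by (intro exI[of _ "\<lambda>z. upair (G z)"] exI[of _ "upair (mu (bary A), mu (bary B))"] conjI)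
qed

lemma V_path:
  assumes A: "finite A" "finite B" "A \<noteq> {}" "B \<noteq> {}" and e: "e \<in> V A B" "e' \<in> V A B"
  shows "\<exists>p. pth (UC2 Gr) e e' p \<and> (\<forall>t\<in>{0..1}. p t \<in> V A B)"
proof -
  obtain H c where H: "continuous_map (prod_topology (subtopology (UC2 Gr) (V A B)) (top_of_set {0..1 :: real})) (UC2 Gr) H"
     "\<And>e. e \<in> V A B ==> H (e, 0) = e \<and> H (e, 1) = c \<and> (\<forall>t\<in>{0..1}. H (e, t) \<in> V A B)"
    using V_contract[OF A] by fastforce
  have p: "pth (UC2 Gr) e c (\<lambda>t. H (e, t))" if e: "e \<in> V A B" for e
  proof -
    have "e \<in> topspace (subtopology (UC2 Gr) (V A B))" using e openin_subset[OF V_open[OF A]] by auto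
    then have "continuous_map (top_of_set {0..1::real}) (prod_topology (subtopology (UC2 Gr) (V A B)) (top_of_set {0..1})) (\<lambda>t. (e, t))"
      by (intro continuous_map_pairedI) auto
    from continuous_map_compose[OF this H(1)] show ?thesis using H(2)[OF e] by (simp add: pth_def o_def)
  qed
  have "loop_join (\<lambda>t. H (e, t)) (loop_rev (\<lambda>t. H (e', t))) t \<in> V A B" if "t \<in> {0..1}" for t
    using H(2)[OF e(1)] H(2)[OF e(2)] that by (auto simp: loop_join_def loop_rev_def)
  then show ?thesis using pth_join[OF p[OF e(1)] pth_rev[OF p[OF e(2)]]] by blast
qed

lemma V_hom:
  assumes A: "finite A" "finite B" "A \<noteq> {}" "B \<noteq> {}"
    and p: "pth (UC2 Gr) e e' p" "\<And>t. t \<in> {0..1} ==> p t \<in> V A B"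
    and q: "pth (UC2 Gr) e e' q" "\<And>t. t \<in> {0..1} ==> q t \<in> V A B"
  shows "phom (UC2 Gr) e e' p q"
proof -
  obtain H c where H: "continuous_map (prod_topology (subtopology (UC2 Gr) (V A B)) (top_of_set {0..1 :: real})) (UC2 Gr) H"
     "\<And>e. e \<in> V A B ==> H (e, 0) = e \<and> H (e, 1) = c \<and> (\<forall>t\<in>{0..1}. H (e, t) \<in> V A B)"
    using V_contract[OF A] by fastforce
  have P: "pth (subtopology (UC2 Gr) (V A B)) e e' p" "pth (subtopology (UC2 Gr) (V A B)) e e' q"
    using p q unfolding pth_def continuous_map_in_subtopology by auto
  show ?thesis by (rule contraction_phom[OF H(1) _ _ P]) (use H(2) in auto)
qed

section \<open>The cover of the configuration space and its nerve\<close>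

definition U :: "nat \<times> nat => 'a set set" where
  "U i = {upair z | z a b. fst z \<in> topspace Gr \<and> snd z \<in> topspace Gr \<and> i = srt a b \<and> sep z a b}"

lemma sep_swap: "sep (prod.swap z) b a \<longleftrightarrow> sep z a b"
  by (auto simp: sep_def)

lemma upair_swap: "upair (prod.swap z) = upair z"
  by (auto simp: upair_def)

lemma upair_in_U:
  assumes "fst z \<in> topspace Gr" "snd z \<in> topspace Gr"
  shows "upair z \<in> U i \<longleftrightarrow> (\<exists>a b. i = srt a b \<and> sep z a b)"
proof
  assume "upair z \<in> U i"
  then obtain w a b where w: "upair z = upair w" "i = srt a b" "sep w a b" unfolding U_def by blast
  show "\<exists>a b. i = srt a b \<and> sep z a b"
  proof (cases "w = z")
    case True
    then show ?thesis using w by blast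
  next
    case False
    then have "w = prod.swap z" using w(1) by (simp add: upair_eq)
    then have "sep z b a" using w(3) sep_swap[of z a b] by simp
    then show ?thesis using w(2) srt_commute by blast
  qed
next
  assume "\<exists>a b. i = srt a b \<and> sep z a b"
  then show "upair z \<in> U i" using assms unfolding U_def by blast
qed

lemma U_srt: "U (srt a b) = V {a} {b}"
proof
  show "V {a} {b} \<subseteq> U (srt a b)" unfolding V_def W_def U_def by blast
  show "U (srt a b) \<subseteq> V {a} {b}"
  proof
    fix e assume "e \<in> U (srt a b)"
    then obtain z c d where z: "fst z \<in> topspace Gr" "snd z \<in> topspace Gr" "srt a b = srt c d" "sep z c d" "e = upair z"
      unfolding U_def by blast
    from z(3) consider "c = a" "d = b" | "c = b" "d = a" by (auto simp: srt_eq)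
    then show "e \<in> V {a} {b}"
    proof cases
      case 1
      then show ?thesis using z by (auto simp: V_def W_def)
    next
      case 2
      then have "prod.swap z \<in> W {a} {b}" using z sep_swap[of z a b] by (simp add: W_def)
      then show ?thesis using z(5) upair_swap[of z] unfolding V_def by (metis imageI)
    qed
  qed
qed

lemma U_cases: obtains a b where "i = srt a b" | "U i = {}"
  by (cases "\<exists>a b. i = srt a b") (auto simp: U_def)

text \<open>Inside this locale the name denotes adjacency in the nerve: \<open>a\<close>,
  \<open>a'\<close> and \<open>b\<close>, \<open>b'\<close> span two disjoint cells, each a vertex
  or an edge. It is unrelated to the value of a form called \<open>quad\<close> above.\<close>

definition quad :: "nat => nat => nat => nat => bool" where
  "quad a b a' b' \<longleftrightarrow> cl a a' \<and> cl b b' \<and> a \<noteq> b \<and> a \<noteq> b' \<and> a' \<noteq> b \<and> a' \<noteq> b'"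

lemma quad_swap: "quad a b a' b' \<longleftrightarrow> quad b a b' a'"
  by (auto simp: quad_def)

text \<open>If both ways of matching were possible, the four vertices would form a 4-cycle. An
  overlap of two cover sets could then consist of two pieces, one for each matching.\<close>

lemma quad_excl: assumes "quad a b a' b'" shows "\<not> quad a b b' a'"
proof
  assume "quad a b b' a'"
  then have "adj a a'" "adj a' b" "adj b b'" "adj b' a" "a \<noteq> b" "a' \<noteq> b'"
    using assms adj_sym by (auto simp: quad_def cl_def)
  then show False using C4_free by blast
qed

lemma sep_quad:
  assumes z: "fst z \<in> topspace Gr" "snd z \<in> topspace Gr" and "sep z a b" "sep z a' b'"
  shows "quad a b a' b'"
proof -
  note K = lam_KG[OF z(1)] lam_KG[OF z(2)]
  have p: "0 \<le> lam (fst z) v" "0 \<le> lam (snd z) v" for v using K by (auto simp: KG_def)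
  have ne: "lam (fst z) a \<noteq> 0" "lam (fst z) a' \<noteq> 0" "lam (snd z) b \<noteq> 0" "lam (snd z) b' \<noteq> 0"
    using assms(3,4) p(1)[of b] p(1)[of b'] p(2)[of a] p(2)[of a'] by (auto simp: sep_def)
  show ?thesis unfolding quad_def
    using KG_clique[OF K(1) ne(1,2)] KG_clique[OF K(2) ne(3,4)] assms(3,4) by (auto simp: sep_def)
qed

text \<open>Coverage: the coordinates of two distinct points have the same sum, so each point
  exceeds the other somewhere. A single set is some \<open>V {a} {b}\<close>, and a nonempty overlap
  is some \<open>V {a, a'} {b, b'}\<close>; both contract along straight lines.\<close>

sublocale good_cover "UC2 Gr" U
proof
  show "openin (UC2 Gr) (U i)" for i
    by (cases i rule: U_cases) (auto simp: U_srt intro!: V_open)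
  show "\<exists>i. e \<in> U i" if e: "e \<in> topspace (UC2 Gr)" for e
  proof -
    obtain z where z: "e = upair z" "fst z \<in> topspace Gr" "snd z \<in> topspace Gr" "fst z \<noteq> snd z"
      using e unfolding topspace_UC2 topspace_conf2 by blast
    let ?x = "lam (fst z)" and ?y = "lam (snd z)"
    note K = lam_KG[OF z(2)] lam_KG[OF z(3)]
    have "?x \<noteq> ?y" using z mu_lam by metis
    then obtain v where v: "?x v \<noteq> ?y v" by blast
    have vn: "v < n" using v KG_less[OF K(1), of v] KG_less[OF K(2), of v] by fastforce
    have eq: "(\<Sum>v<n. ?x v) = (\<Sum>v<n. ?y v)" using K by (simp add: KG_def)
    have "\<exists>a. ?y a < ?x a"
    proof (rule ccontr)
      assume "\<nexists>a. ?y a < ?x a"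
      then have le: "?x a \<le> ?y a" for a by (meson not_less)
      have "(\<Sum>v<n. ?x v) < (\<Sum>v<n. ?y v)"
        by (intro sum_strict_mono_ex1 ballI bexI[of _ v]) (use le v vn in \<open>auto simp: less_le\<close>)
      then show False using eq by simp
    qed
    moreover have "\<exists>a. ?x a < ?y a"
    proof (rule ccontr)
      assume "\<nexists>a. ?x a < ?y a"
      then have le: "?y a \<le> ?x a" for a by (meson not_less)
      have "(\<Sum>v<n. ?y v) < (\<Sum>v<n. ?x v)"
        by (intro sum_strict_mono_ex1 ballI bexI[of _ v]) (use le v vn in \<open>auto simp: less_le\<close>)
      then show False using eq by simp
    qed
    ultimately show ?thesis using z unfolding U_def sep_def by blast
  qed
  show "\<exists>p. pth (UC2 Gr) x y p \<and> (\<forall>t\<in>{0..1}. p t \<in> U i)" if "x \<in> U i" "y \<in> U i" for x y i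
    using that by (cases i rule: U_cases) (auto simp: U_srt intro!: V_path)
  show "phom (UC2 Gr) x y p q" if "pth (UC2 Gr) x y p" "pth (UC2 Gr) x y q"
    "\<And>t. t \<in> {0..1} ==> p t \<in> U i" "\<And>t. t \<in> {0..1} ==> q t \<in> U i" for x y p q i
  proof (cases i rule: U_cases)
    case (1 a b)
    show ?thesis by (rule V_hom[of "{a}" "{b}"]) (use that in \<open>simp_all add: 1 U_srt\<close>)
  next
    case 2
    then show ?thesis using that(3)[of 0] by simp
  qed
  show "\<exists>p. pth (UC2 Gr) x y p \<and> (\<forall>t\<in>{0..1}. p t \<in> U i \<inter> U j)" if xy: "x \<in> U i \<inter> U j" "y \<in> U i \<inter> U j" for x y i j
  proof -
    obtain z a b where z: "x = upair z" "fst z \<in> topspace Gr" "snd z \<in> topspace Gr" "i = srt a b" "sep z a b"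
      using xy(1) unfolding U_def by blast
    obtain a' b' where ab': "j = srt a' b'" "sep z a' b'" using xy(1) z upair_in_U by blast
    have q: "quad a b a' b'" by (rule sep_quad[OF z(2,3,5) ab'(2)])
    have sub: "V {a, a'} {b, b'} \<subseteq> U i \<inter> U j" unfolding V_def W_def U_def z(4) ab'(1) by fastforce
    have "y \<in> V {a} {b}" using xy(2) z(4) by (simp add: U_srt)
    then obtain w where w: "y = upair w" "fst w \<in> topspace Gr" "snd w \<in> topspace Gr" "sep w a b"
      by (auto simp: V_def W_def)
    obtain c d where cd: "j = srt c d" "sep w c d" using xy(2) w upair_in_U by blast
    have q': "quad a b c d" by (rule sep_quad[OF w(2-4) cd(2)])
    \<comment> \<open>Both points of the overlap use the same matching of the two index pairs, by
      the absence of 4-cycles, and hence lie in one contractible set.\<close>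
    have "c = a' \<and> d = b'" using cd(1) ab'(1) q q' quad_excl[OF q] by (auto simp: srt_eq)
    then have "w \<in> W {a, a'} {b, b'}" "z \<in> W {a, a'} {b, b'}"
      using w cd z ab' by (auto simp: W_def sep_def)
    then have "x \<in> V {a, a'} {b, b'}" "y \<in> V {a, a'} {b, b'}" using w z by (auto simp: V_def)
    then show ?thesis using V_path[of "{a, a'}" "{b, b'}" x y] sub by blast
  qed
qed

end

section \<open>Cocycles on the configuration space and cochains of the graph\<close>

lemma (in sgraph) odd_cochain_of_real:
  assumes r: "alt_cochain r"
    and par: "\<And>v a b. v < n ==> adj a b ==> v \<noteq> a ==> v \<noteq> b ==> a < b ==>
      \<exists>k::int. r v a b = of_int (of_bool ((v < a) \<noteq> (v < b)) + 2 * k)"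
    and dc: "\<And>x y. disj_edges x y ==> cg 4 (dcf r x y) 0"
  shows "\<exists>c. odd_cochain c"
proof -
  \<comment> \<open>Default values with the prescribed parity where the real cochain says nothing,
    namely when \<open>v\<close> is an end of the edge or not a vertex. Coboundaries on disjoint
    edges never touch them.\<close>
  define f where "f = (\<lambda>v a b. if v = a \<or> v = b \<or> n \<le> v then of_bool ((v < a) \<noteq> (v < b)) else \<lfloor>r v a b\<rfloor>)"
  define c where "c = (\<lambda>v a b. if a < b then f v a b else if b < a then - f v b a else 0)"
  have alt: "alt_cochain c" by (simp add: alt_cochain_def c_def)
  have fr: "\<exists>k::int. f v a b = of_bool ((v < a) \<noteq> (v < b)) + 2 * k \<and> r v a b = of_int (f v a b)"
    if v: "v < n" "adj a b" "v \<noteq> a" "v \<noteq> b" "a < b" for v a b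
  proof -
    obtain k :: int where k: "r v a b = of_int (of_bool ((v < a) \<noteq> (v < b)) + 2 * k)" using par[OF v] by blast
    then have "f v a b = of_bool ((v < a) \<noteq> (v < b)) + 2 * k" using v unfolding f_def k floor_of_int by simp
    then show ?thesis using k by (intro exI[of _ k]) simp
  qed
  have p: "odd (f v a b) \<longleftrightarrow> (v < a) \<noteq> (v < b)" if ab: "adj a b" "a < b" for v a b
  proof (cases "v = a \<or> v = b \<or> n \<le> v")
    case False
    then obtain k :: int where "f v a b = of_bool ((v < a) \<noteq> (v < b)) + 2 * k" using fr[of v a b] ab by auto
    then show ?thesis by simp
  qed (auto simp: f_def)
  have "odd (c v a b) \<longleftrightarrow> (v < a) \<noteq> (v < b)" if ab: "adj a b" for v a b
    using p[of a b v] p[of b a v] ab adj_sym[OF ab] adj_irrefl[of a] by (cases a b rule: linorder_cases) (auto simp: c_def)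
  moreover have "4 dvd dcf c x y" if de: "disj_edges x y" for x y
  proof -
    have rc: "of_int (c v a b) = r v a b" if v: "v < n" "adj a b" "v \<noteq> a" "v \<noteq> b" for v a b
    proof -
      have n: "r v b a = - r v a b" using r unfolding alt_cochain_def by blast
      show ?thesis
        using fr[of v a b] fr[of v b a] v adj_sym[OF v(2)] adj_irrefl[of a] n
        by (cases a b rule: linorder_cases) (auto simp: c_def)
    qed
    have "of_int (dcf c x y) = dcf r x y"
      using rc de adj_less adj_less2 by (auto simp: dcf_def disj_edges_def)
    then have "cg 4 (of_int (dcf c x y)) 0" using dc[OF de] by simp
    then obtain k :: int where "of_int (dcf c x y) = (of_int (k * 4) :: real)" by (auto simp: cg_def)
    then show ?thesis unfolding of_int_eq_iff by simp
  qed
  ultimately show ?thesis using alt unfolding odd_cochain_def by blast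
qed

context graph_model
begin

text \<open>The pair of barycentres of the two cells lies in all four cover sets.\<close>

lemma quad_meet:
  assumes "quad a b a' b'"
  shows "U (srt a b) \<inter> U (srt a' b') \<inter> (U (srt a b') \<inter> U (srt a' b)) \<noteq> {}"
proof -
  define z where "z = (mu (bary {a, a'}), mu (bary {b, b'}))"
  have K: "bary {a, a'} \<in> KG" "bary {b, b'} \<in> KG" using assms by (auto simp: quad_def intro!: bary_KG)
  have z: "fst z \<in> topspace Gr" "snd z \<in> topspace Gr" using K mu_top by (auto simp: z_def)
  have "sep z c d" if "c \<in> {a, a'}" "d \<in> {b, b'}" for c d
  proof -
    have "c \<notin> {b, b'}" "d \<notin> {a, a'}" using that assms by (auto simp: quad_def)
    then have "bary {b, b'} c < bary {a, a'} c" "bary {a, a'} d < bary {b, b'} d"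
      using that by (simp_all add: bary_def card_gt_0_iff)
    then show ?thesis using lam_mu[OF K(1)] lam_mu[OF K(2)] by (simp add: sep_def z_def)
  qed
  then have "upair z \<in> U (srt c d)" if "c \<in> {a, a'}" "d \<in> {b, b'}" for c d
    using that z upair_in_U by blast
  then show ?thesis by blast
qed

text \<open>The cochain of a cocycle: the transition between the cover sets at the two ends of the
  move. The value for \<open>b < a\<close> is defined by antisymmetry, because \<open>g\<close> is
  antisymmetric only up to the congruence.\<close>

definition gl :: "(nat \<times> nat => nat \<times> nat => real) => nat => nat => nat => real" where
  "gl g v a b = (if v = a \<or> v = b \<or> n \<le> v \<or> \<not> adj a b then 0
     else if a < b then g (srt v a) (srt v b) else - g (srt v b) (srt v a))"

lemma gl_alt: "alt_cochain (gl g)"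
  unfolding alt_cochain_def
proof (intro allI)
  fix v a b
  show "gl g v b a = - gl g v a b"
    using adj_sym[of a b] adj_sym[of b a] adj_irrefl[of a] by (cases a b rule: linorder_cases) (auto simp: gl_def)
qed

lemma cocycle_quad:
  assumes "cocycle d g" "quad a b a' b'"
  shows "cg d (g (srt a b) (srt a' b) + g (srt a' b) (srt a' b')) (g (srt a b) (srt a' b'))"
    "cg d (g (srt a b) (srt a b') + g (srt a b') (srt a' b')) (g (srt a b) (srt a' b'))"
proof -
  obtain e where e: "e \<in> U (srt a b)" "e \<in> U (srt a' b')" "e \<in> U (srt a b')" "e \<in> U (srt a' b)"
    using quad_meet[OF assms(2)] by blast
  show "cg d (g (srt a b) (srt a' b) + g (srt a' b) (srt a' b')) (g (srt a b) (srt a' b'))"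
    "cg d (g (srt a b) (srt a b') + g (srt a b') (srt a' b')) (g (srt a b) (srt a' b'))"
    using cocycleD[OF assms(1)] e by blast+
qed

lemma gl_cg:
  assumes g: "cocycle d g" and v: "v < n" "cl a b" "v \<noteq> a" "v \<noteq> b"
  shows "cg d (gl g v a b) (g (srt v a) (srt v b))"
proof -
  have q: "quad v a v b" using v by (auto simp: quad_def cl_def)
  obtain e where e: "e \<in> U (srt v a)" "e \<in> U (srt v b)" using quad_meet[OF q] by blast
  have self: "cg d (g (srt v a) (srt v a)) 0" by (rule cocycle_self[OF g e(1)])
  consider "a = b" | "adj a b" "a < b" | "adj a b" "b < a"
    using v(2) by (cases a b rule: linorder_cases) (auto simp: cl_def)
  then show ?thesis
  proof cases
    case 1
    then show ?thesis using cg_sym[OF self] adj_irrefl by (simp add: gl_def)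
  next
    case 2
    then show ?thesis using v by (simp add: gl_def)
  next
    case 3
    have h: "cg d (g (srt v a) (srt v b) + g (srt v b) (srt v a)) (g (srt v a) (srt v a))"
      by (rule cocycleD[OF g e(1,2,1)])
    have "cg d (g (srt v a) (srt v b)) (- g (srt v b) (srt v a))" by (rule cg_lin2[OF h self]) simp
    from cg_sym[OF this] show ?thesis using 3 v by (simp add: gl_def)
  qed
qed

lemma disj_edges_quad:
  assumes "disj_edges (p, q) (a, b)"
  shows "quad p a q b" "p < n" "q < n" "a < n" "b < n" "cl p q" "cl a b" "p \<noteq> a" "p \<noteq> b" "q \<noteq> a" "q \<noteq> b"
  using assms adj_less adj_less2 by (auto simp: disj_edges_def quad_def cl_def)

text \<open>The four cover sets at the corners of the square have a common point, so both ways from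
  the corner \<open>p\<close>, \<open>a\<close> to the corner \<open>q\<close>, \<open>b\<close>
  give the same sum.\<close>

lemma gl_dcf:
  assumes g: "cocycle d g" and de: "disj_edges x y" shows "cg d (dcf (gl g) x y) 0"
proof -
  obtain p q a b where xy: "x = (p, q)" "y = (a, b)" by (cases x; cases y) auto
  note D = disj_edges_quad[OF de[unfolded xy]]
  have 1: "cg d (gl g q a b) (g (srt q a) (srt q b))" "cg d (gl g p a b) (g (srt p a) (srt p b))"
    using gl_cg[OF g] D by auto
  have 2: "cg d (gl g b p q) (g (srt p b) (srt q b))" "cg d (gl g a p q) (g (srt p a) (srt q a))"
    using gl_cg[OF g, of b p q] gl_cg[OF g, of a p q] D by (auto simp: srt_commute)
  note c = cocycle_quad[OF g D(1)]
  have "cg d (dcf (gl g) x y) (g (srt q a) (srt q b) - g (srt p a) (srt p b) - g (srt p b) (srt q b) + g (srt p a) (srt q a))"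
    unfolding dcf_def xy fst_conv snd_conv by (intro cg_add cg_diff 1 2)
  moreover have "cg d (g (srt q a) (srt q b) - g (srt p a) (srt p b) - g (srt p b) (srt q b) + g (srt p a) (srt q a)) 0"
    by (rule cg_lin2[OF c(1) cg_sym[OF c(2)]]) simp
  ultimately show ?thesis by (rule cg_trans)
qed

text \<open>Subtracting an integral cochain with the same coboundary changes nothing modulo 1 and
  leaves a real cochain that is closed on all squares. Integrating it across a square gives a real
  cocycle that is congruent to the given one.\<close>

theorem torsion_free_if_cochains_lift:
  assumes lift: "\<And>c :: nat => nat => nat => real. alt_cochain c ==> (\<And>x y. disj_edges x y ==> dcf c x y \<in> \<int>) ==>
    \<exists>k :: nat => nat => nat => int. alt_cochain k \<and> (\<forall>x y. disj_edges x y --> dcf c x y = of_int (dcf k x y))"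
  shows "H1_B2_torsion_free Gr"
  unfolding H1_B2_torsion_free_def
proof (intro ballI torsion_free_if_cocycles_lift)
  fix g assume g: "cocycle 1 g"
  have "dcf (gl g) x y \<in> \<int>" if "disj_edges x y" for x y
    using gl_dcf[OF g that] by (simp add: cg_1_Ints)
  then obtain k :: "nat => nat => nat => int" where k: "alt_cochain k"
    "\<And>x y. disj_edges x y ==> dcf (gl g) x y = of_int (dcf k x y)" using lift[OF gl_alt] by blast
  define c where "c = (\<lambda>v a b. gl g v a b - of_int (k v a b))"
  have neg: "c v b a = - c v a b" for v a b
  proof -
    have "gl g v b a = - gl g v a b" "k v b a = - k v a b" using gl_alt k(1) unfolding alt_cochain_def by blast+
    then show ?thesis by (simp add: c_def)
  qed
  have zero: "c v a a = 0" for v a using neg[of v a a] by simp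
  have cyc: "c v a a' + c v a' a'' = c v a a''" if "cl a a'" "cl a a''" "cl a' a''" "\<not> (a \<noteq> a' \<and> a \<noteq> a'' \<and> a' \<noteq> a'')" for v a a' a''
    using that(4) neg[of v a a'] zero by auto
  have sq: "c b a a' + c a' b b' = c a b b' + c b' a a'" if q: "quad a b a' b'" for a b a' b'
  proof (cases "a = a' \<or> b = b'")
    case False
    then have "disj_edges (a, a') (b, b')" using q by (auto simp: quad_def disj_edges_def cl_def)
    from k(2)[OF this] show ?thesis by (simp add: dcf_def c_def)
  qed (auto simp: zero)
  \<comment> \<open>Move the first point from \<open>a\<close> to \<open>a'\<close> and afterwards
    the second from \<open>b\<close> to \<open>b'\<close>. By \<open>sq\<close> the other order
    gives the same value, so \<open>h\<close> does not depend on which point is called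
    first.\<close>
  define h where "h = (\<lambda>a b a' b'. c b a a' + c a' b b')"
  have hs: "h b a b' a' = h a b a' b'" if q: "quad a b a' b'" for a b a' b'
    unfolding h_def using sq[OF q] by simp
  define g' where "g' = (\<lambda>i j. if quad (fst i) (snd i) (fst j) (snd j) then h (fst i) (snd i) (fst j) (snd j)
     else h (fst i) (snd i) (snd j) (fst j))"
  have g': "g' (srt a b) (srt a' b') = h a b a' b'" if q: "quad a b a' b'" for a b a' b'
  proof -
    have x: "quad b a b' a'" "\<not> quad a b b' a'" "\<not> quad b a a' b'"
      using q quad_excl[OF q] quad_swap[of a b a' b'] quad_swap[of b a a' b'] by auto
    show ?thesis
      by (cases "a \<le> b"; cases "a' \<le> b'") (use x q hs[OF q] in \<open>auto simp: g'_def srt_def min_def max_def\<close>)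
  qed
  have "cocycle 0 g'"
    unfolding cocycle_def
  proof (intro allI impI)
    fix i j k assume "U i \<inter> U j \<inter> U k \<noteq> {}"
    then obtain e where e: "e \<in> U i" "e \<in> U j" "e \<in> U k" by blast
    obtain z a1 b1 where z: "e = upair z" "fst z \<in> topspace Gr" "snd z \<in> topspace Gr" "i = srt a1 b1" "sep z a1 b1"
      using e(1) unfolding U_def by blast
    obtain a2 b2 where 2: "j = srt a2 b2" "sep z a2 b2" using e(2) z upair_in_U by blast
    obtain a3 b3 where 3: "k = srt a3 b3" "sep z a3 b3" using e(3) z upair_in_U by blast
    note q = sep_quad[OF z(2,3,5) 2(2)] sep_quad[OF z(2,3) 2(2) 3(2)] sep_quad[OF z(2,3,5) 3(2)]
    note K = lam_KG[OF z(2)] lam_KG[OF z(3)]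
    have two: "\<not> (r \<noteq> s \<and> r \<noteq> t \<and> s \<noteq> t)" if "u \<in> KG" "u r \<noteq> 0" "u s \<noteq> 0" "u t \<noteq> 0" for u :: "nat => real" and r s t
    proof -
      obtain x y where "\<And>v. v \<noteq> x ==> v \<noteq> y ==> u v = 0" using \<open>u \<in> KG\<close> unfolding KG_def by blast
      then have "r \<in> {x, y}" "s \<in> {x, y}" "t \<in> {x, y}" using that by auto
      then show ?thesis by auto
    qed
    have p: "0 \<le> lam (fst z) v" "0 \<le> lam (snd z) v" for v using K by (auto simp: KG_def)
    have ne: "lam (fst z) v \<noteq> 0" "lam (snd z) w \<noteq> 0" if "sep z v w" for v w
      using that p(1)[of w] p(2)[of v] by (auto simp: sep_def)
    have ta: "\<not> (a1 \<noteq> a2 \<and> a1 \<noteq> a3 \<and> a2 \<noteq> a3)"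
      by (rule two[OF K(1) ne(1)[OF z(5)] ne(1)[OF 2(2)] ne(1)[OF 3(2)]])
    have tb: "\<not> (b1 \<noteq> b2 \<and> b1 \<noteq> b3 \<and> b2 \<noteq> b3)"
      by (rule two[OF K(2) ne(2)[OF z(5)] ne(2)[OF 2(2)] ne(2)[OF 3(2)]])
    have ca: "c v a1 a2 + c v a2 a3 = c v a1 a3" "c v b1 b2 + c v b2 b3 = c v b1 b3" for v
      using q ta tb by (auto simp: quad_def intro!: cyc)
    have "quad a2 b1 a3 b2" using q by (auto simp: quad_def)
    from sq[OF this] have "g' i j + g' j k = g' i k"
      using g'[OF q(1)] g'[OF q(2)] g'[OF q(3)] ca(1)[of b1] ca(2)[of a3] by (simp add: z(4) 2(1) 3(1) h_def)
    then show "cg 0 (g' i j + g' j k) (g' i k)" by simp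
  qed
  moreover have "cg 1 (g i j) (g' i j)" if ne: "U i \<inter> U j \<noteq> {}" for i j
  proof -
    obtain e where e: "e \<in> U i" "e \<in> U j" using ne by blast
    obtain z a b where z: "e = upair z" "fst z \<in> topspace Gr" "snd z \<in> topspace Gr" "i = srt a b" "sep z a b"
      using e(1) unfolding U_def by blast
    obtain a' b' where 2: "j = srt a' b'" "sep z a' b'" using e(2) z upair_in_U by blast
    have q: "quad a b a' b'" by (rule sep_quad[OF z(2,3,5) 2(2)])
    then have lt: "a' < n" "b < n" "cl a a'" "cl b b'" "b \<noteq> a" "b \<noteq> a'" "a' \<noteq> b'"
      using cl_less by (auto simp: quad_def)
    have cgl: "cg 1 (c v x y) (gl g v x y)" for v x y
      unfolding c_def cg_def by (intro exI[of _ "- k v x y"]) simp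
    have 1: "cg 1 (c b a a') (g (srt a b) (srt a' b))"
      using cg_trans[OF cgl gl_cg[OF g lt(2,3,5,6)]] by (simp add: srt_commute)
    have 3: "cg 1 (c a' b b') (g (srt a' b) (srt a' b'))"
      by (rule cg_trans[OF cgl gl_cg[OF g lt(1,4) not_sym[OF lt(6)] lt(7)]])
    have "cg 1 (g' i j) (g i j)"
      unfolding z(4) 2(1) g'[OF q] h_def by (rule cg_trans[OF cg_add[OF 1 3] cocycle_quad(1)[OF g q]])
    then show ?thesis by (rule cg_sym)
  qed
  ultimately show "\<exists>g'. cocycle 0 g' \<and> (\<forall>i j. U i \<inter> U j \<noteq> {} --> cg 1 (g i j) (g' i j))" by blast
qed

text \<open>The double cover of ordered pairs is trivial over each \<open>U i\<close>, and its
  transition functions give a cocycle modulo 2. \<open>quarter_cocycle\<close> produces from it a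
  cocycle modulo 4 with the same parities.\<close>

theorem odd_cochain_if_torsion_free:
  assumes tf: "H1_B2_torsion_free Gr" shows "\<exists>c. odd_cochain c"
proof -
  \<comment> \<open>Each index pair is sorted by vertex number; the value is 0 if the smaller
    members belong to the same point and 1 if the points exchange roles.\<close>
  define s :: "nat \<times> nat => nat \<times> nat => real" where "s = (\<lambda>i j. of_bool (\<not> quad (fst i) (snd i) (fst j) (snd j)))"
  have s: "s (srt a b) (srt a' b') = of_bool ((a < b) \<noteq> (a' < b'))" if q: "quad a b a' b'" for a b a' b'
  proof -
    have x: "quad b a b' a'" "\<not> quad a b b' a'" "\<not> quad b a a' b'" "a \<noteq> b" "a' \<noteq> b'"
      using q quad_excl[OF q] quad_swap[of a b a' b'] quad_swap[of b a a' b'] by (auto simp: quad_def)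
    show ?thesis
      by (cases a b rule: linorder_cases; cases a' b' rule: linorder_cases) (use x q in \<open>auto simp: s_def srt_def\<close>)
  qed
  have sc: "cocycle 2 s"
    unfolding cocycle_def
  proof (intro allI impI)
    fix i j k assume "U i \<inter> U j \<inter> U k \<noteq> {}"
    then obtain e where e: "e \<in> U i" "e \<in> U j" "e \<in> U k" by blast
    obtain z a1 b1 where z: "e = upair z" "fst z \<in> topspace Gr" "snd z \<in> topspace Gr" "i = srt a1 b1" "sep z a1 b1"
      using e(1) unfolding U_def by blast
    obtain a2 b2 where 2: "j = srt a2 b2" "sep z a2 b2" using e(2) z upair_in_U by blast
    obtain a3 b3 where 3: "k = srt a3 b3" "sep z a3 b3" using e(3) z upair_in_U by blast
    note q = sep_quad[OF z(2,3,5) 2(2)] sep_quad[OF z(2,3) 2(2) 3(2)] sep_quad[OF z(2,3,5) 3(2)]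
    have "\<exists>k::int. of_bool (P \<noteq> Q) + of_bool (Q \<noteq> R) - of_bool (P \<noteq> R) = (of_int k * 2 :: real)" for P Q R :: bool
      by (intro exI[of _ "of_bool (P \<noteq> Q \<and> Q \<noteq> R)"]) (cases P; cases Q; cases R; simp)
    then show "cg 2 (s i j + s j k) (s i k)" unfolding cg_def z(4) 2(1) 3(1) s[OF q(1)] s[OF q(2)] s[OF q(3)] .
  qed
  obtain C where C: "cocycle 4 C" "\<And>i j. U i \<inter> U j \<noteq> {} ==> cg 2 (C i j) (s i j)"
    using quarter_cocycle[OF _ sc] tf unfolding H1_B2_torsion_free_def by blast
  have gl: "\<exists>k::int. gl C v a b = of_int (of_bool ((v < a) \<noteq> (v < b)) + 2 * k)" if "v < n" "adj a b" "v \<noteq> a" "v \<noteq> b" "a < b" for v a b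
  proof -
    have q: "quad v a v b" using that adj_less[of a b] by (auto simp: quad_def cl_def)
    then have "U (srt v a) \<inter> U (srt v b) \<noteq> {}" using quad_meet by blast
    then obtain k :: int where "C (srt v a) (srt v b) - s (srt v a) (srt v b) = of_int k * 2" using C(2) unfolding cg_def by blast
    then show ?thesis using that unfolding s[OF q] by (intro exI[of _ k]) (auto simp: gl_def)
  qed
  show ?thesis by (rule odd_cochain_of_real[OF gl_alt gl gl_dcf[OF C(1)]])
qed

end

section \<open>The angle cochain of a plane drawing\<close>

text \<open>The total change of the argument along a curve in the punctured plane, read off a
  continuous logarithm; \<open>turn_unique\<close> makes the choice irrelevant.\<close>

definition turn :: "(real => complex) => real" where
  "turn f = (SOME r. \<exists>g. continuous_on {0..1} g \<and> (\<forall>s\<in>{0..1}. f s = exp (g s)) \<and> r = Im (g 1 - g 0))"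

text \<open>The difference of two logarithms is continuous and takes values in a discrete set with
  distances at least \<open>2 * pi\<close>, hence is constant on the interval.\<close>

lemma turn_unique:
  assumes g: "continuous_on {0..1::real} g" "\<And>s. s \<in> {0..1} ==> f s = exp (g s)"
    and h: "continuous_on {0..1} h" "\<And>s. s \<in> {0..1} ==> f s = exp (h s)"
  shows "g 1 - g 0 = h 1 - (h 0 :: complex)"
proof -
  have c: "continuous_on {0..1} (\<lambda>s. g s - h s)" using g h by (intro continuous_intros)
  have d: "\<exists>e>0. \<forall>y. y \<in> {0..1} \<and> g y - h y \<noteq> g x - h x --> e \<le> norm (g y - h y - (g x - h x))"
    if x: "x \<in> {0..1}" for x
  proof (intro exI[of _ "2 * pi"] conjI allI impI)
    have k: "\<exists>m::int. g y - h y = of_int (2 * m) * of_real pi * \<i>" if "y \<in> {0..1}" for y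
    proof -
      have "exp (g y) = exp (h y)" using g(2)[OF that] h(2)[OF that] by simp
      then obtain m :: int where "g y = h y + of_int (2 * m) * of_real pi * \<i>" unfolding exp_eq by auto
      then show ?thesis by (intro exI[of _ m]) simp
    qed
    fix y assume y: "y \<in> {0..1} \<and> g y - h y \<noteq> g x - h x"
    obtain m l :: int where ml: "g y - h y = of_int (2 * m) * of_real pi * \<i>" "g x - h x = of_int (2 * l) * of_real pi * \<i>"
      using k x y by meson
    then have "m \<noteq> l" using y by auto
    then have 1: "1 \<le> \<bar>m - l\<bar>" by simp
    have "g y - h y - (g x - h x) = of_int (m - l) * (2 * of_real pi * \<i>)" unfolding ml by (simp add: algebra_simps)
    then have "norm (g y - h y - (g x - h x)) = real_of_int \<bar>m - l\<bar> * (2 * pi)"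
      by (simp only: norm_mult norm_of_int norm_of_real norm_ii norm_numeral) simp
    moreover have "1 * (2 * pi) \<le> real_of_int \<bar>m - l\<bar> * (2 * pi)" using 1 by (intro mult_right_mono) (linarith, simp)
    ultimately show "2 * pi \<le> norm (g y - h y - (g x - h x))" by simp
  qed simp
  have "(\<lambda>s. g s - h s) constant_on {0..1}"
    by (rule continuous_discrete_range_constant[OF _ c]) (use d in \<open>auto simp: connected_Icc\<close>)
  then have "g 1 - h 1 = g 0 - h 0" by (force simp: constant_on_def)
  then show ?thesis by (simp add: algebra_simps)
qed

lemma turn_eq:
  assumes g: "continuous_on {0..1} g" "\<And>s. s \<in> {0..1} ==> f s = k * exp (g s)" and k: "k \<noteq> 0"
  shows "turn f = Im (g 1 - g 0)"
proof -
  define h where "h = (\<lambda>s. Ln k + g s)"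
  have h: "continuous_on {0..1} h" "\<And>s. s \<in> {0..1} ==> f s = exp (h s)" "h 1 - h 0 = g 1 - g 0"
    using g k by (auto simp: h_def exp_add intro!: continuous_intros)
  have "turn f = Im (h 1 - h 0)"
    unfolding turn_def
  proof (rule someI2_ex)
    show "\<exists>r g. continuous_on {0..1} g \<and> (\<forall>s\<in>{0..1}. f s = exp (g s)) \<and> r = Im (g 1 - g 0)" using h by blast
    fix r assume "\<exists>g. continuous_on {0..1} g \<and> (\<forall>s\<in>{0..1}. f s = exp (g s)) \<and> r = Im (g 1 - g 0)"
    then obtain g' where g': "continuous_on {0..1} g'" "\<And>s. s \<in> {0..1} ==> f s = exp (g' s)" "r = Im (g' 1 - g' 0)" by blast
    show "r = Im (h 1 - h 0)" unfolding g'(3) by (simp only: turn_unique[OF g'(1,2) h(1,2)])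
  qed
  then show ?thesis by (simp only: h(3))
qed

lemma turn_log:
  assumes "continuous_on {0..1} f" "\<And>s. s \<in> {0..1} ==> f s \<noteq> 0"
  obtains g where "continuous_on {0..1} g" "\<And>s. s \<in> {0..1} ==> f s = exp (g s)" "turn f = Im (g 1 - g 0)"
proof -
  obtain g where g: "continuous_on {0..1} g" "\<And>s. s \<in> {0..1} ==> f s = exp (g s)"
    using continuous_logarithm_on_contractible[of "{0..1::real}" f] assms convex_imp_contractible[of "{0..1::real}"] by auto
  show ?thesis by (rule that[OF g]) (use turn_eq[OF g(1), of f 1] g(2) in simp_all)
qed

lemma turn_rev:
  assumes f: "continuous_on {0..1} f" "\<And>s. s \<in> {0..1} ==> f s \<noteq> 0" and r: "\<And>s. s \<in> {0..1} ==> f' s = f (1 - s)"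
  shows "turn f' = - turn f"
proof -
  obtain g where g: "continuous_on {0..1} g" "\<And>s. s \<in> {0..1} ==> f s = exp (g s)" "turn f = Im (g 1 - g 0)"
    using turn_log[OF f] by blast
  have "continuous_on {0..1} (\<lambda>s. g (1 - s))"
    by (rule continuous_on_compose2[OF g(1)]) (auto intro!: continuous_intros)
  then have "turn f' = Im (g (1 - 1) - g (1 - 0))"
    by (rule turn_eq[where k = 1]) (use r g(2) in auto)
  then show ?thesis using g(3) by simp
qed

lemma turn_ends:
  assumes f: "continuous_on {0..1} f" "\<And>s. s \<in> {0..1} ==> f s \<noteq> 0"
    and e: "f 0 = of_real x0 * cis t0" "f 1 = of_real x1 * cis t1" "0 < x0" "0 < x1"
  shows "cg (2 * pi) (turn f) (t1 - t0)"
proof -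
  obtain g where g: "continuous_on {0..1} g" "\<And>s. s \<in> {0..1} ==> f s = exp (g s)" "turn f = Im (g 1 - g 0)"
    using turn_log[OF f] by blast
  have k: "cg (2 * pi) (Im z) t" if z: "exp z = of_real x * cis t" "0 < x" for z x t
  proof -
    have "of_real x * cis t = exp (Complex (ln x) t)" using z(2) by (simp add: exp_eq_polar exp_of_real[symmetric])
    then have "exp z = exp (Complex (ln x) t)" using z(1) by simp
    then obtain m :: int where "z = Complex (ln x) t + of_int (2 * m) * of_real pi * \<i>" unfolding exp_eq by auto
    then show ?thesis unfolding cg_def by (intro exI[of _ m]) simp
  qed
  have "exp (g 0) = of_real x0 * cis t0" "exp (g 1) = of_real x1 * cis t1" using g(2)[of 0] g(2)[of 1] e by auto
  from cg_diff[OF k[OF this(2) e(4)] k[OF this(1) e(3)]] show ?thesis using g(3) by simp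
qed

text \<open>The direction from the resting to the moving point turns by a certain angle; comparing
  its ends with the undirected reference angles \<open>th\<close> gives an integral number of half
  turns. The number is odd iff exactly one of the end directions is opposite to its reference. For
  disjoint edges the difference of the two points never vanishes on the square, so a logarithm
  exists there and the coboundary is 0.\<close>

theorem (in sgraph) odd_cochain_of_plane_drawing:
  assumes "drawing (euclidean :: (real \<times> real) topology) q P" shows "\<exists>c. odd_cochain c"
proof -
  define cx where "cx = (\<lambda>z :: real \<times> real. Complex (fst z) (snd z))"
  have cx: "cx z = cx w \<longleftrightarrow> z = w" for z w by (auto simp: cx_def prod_eq_iff)
  define Q where "Q = (\<lambda>a b s. cx (P a b s))"
  define r where "r = (\<lambda>v. cx (q v))"
  note d = drawingD(1,3-)[OF assms]
  have Qc: "continuous_on {0..1} (Q a b)" if "adj a b" for a b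
  proof -
    have "continuous_on {0..1} (\<lambda>s. of_real (fst (P a b s)) + \<i> * of_real (snd (P a b s)))"
      using d(2)[OF that] by (intro continuous_intros) auto
    then show ?thesis by (simp add: Q_def cx_def complex_eq_iff continuous_on_cong Complex_eq)
  qed
  have Qe: "Q a b 0 = r a" "Q a b 1 = r b" if "adj a b" for a b using d(2)[OF that] by (auto simp: Q_def r_def)
  have rn: "r v \<noteq> r w" if "v < n" "w < n" "v \<noteq> w" for v w
    using d(1) that by (auto simp: r_def cx inj_on_def)
  have Qv: "Q a b s \<noteq> r v" if "adj a b" "v < n" "v \<noteq> a" "v \<noteq> b" "s \<in> {0..1}" for a b v s
    using that rn[of a v] rn[of b v] adj_less[OF that(1)] adj_less2[OF that(1)] Qe[OF that(1)] d(4)[OF that(1,2), of s]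
    by (cases "s = 0"; cases "s = 1") (auto simp: Q_def r_def cx)
  have QQ: "Q a b t \<noteq> Q p q s" if h: "disj_edges (p, q) (a, b)" "t \<in> {0..1}" "s \<in> {0..1}" for a b p q s t
  proof -
    have D: "adj p q" "adj a b" "p \<noteq> a" "p \<noteq> b" "q \<noteq> a" "q \<noteq> b" using h(1) by (auto simp: disj_edges_def)
    have lt: "a < n" "b < n" "p < n" "q < n" using D adj_less adj_less2 by auto
    consider "t = 0" | "t = 1" | "s = 0" | "s = 1" | "0 < t" "t < 1" "0 < s" "s < 1" using h by fastforce
    then show ?thesis
    proof cases
      case 1
      then show ?thesis using Qe[OF D(2)] Qv[OF D(1) lt(1) _ _ h(3)] D by auto
    next
      case 2
      then show ?thesis using Qe[OF D(2)] Qv[OF D(1) lt(2) _ _ h(3)] D by auto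
    next
      case 3
      then show ?thesis using Qe[OF D(1)] Qv[OF D(2) lt(3) _ _ h(2)] D by auto
    next
      case 4
      then show ?thesis using Qe[OF D(1)] Qv[OF D(2) lt(4) _ _ h(2)] D by auto
    next
      case 5
      then show ?thesis using d(5)[OF D(2,1) 5] D by (auto simp: Q_def cx)
    qed
  qed
  \<comment> \<open>The angle of the line through two vertices, directed from the smaller to the
    larger number. It is symmetric in \<open>v\<close> and \<open>w\<close>, so it cancels in
    coboundaries; the direction from \<open>v\<close> to \<open>w\<close> differs from it by
    \<open>pi\<close> iff \<open>w < v\<close>.\<close>
  define th where "th = (\<lambda>v w. Arg (r (max v w) - r (min v w)))"
  have th_sym: "th w v = th v w" for v w by (simp add: th_def max.commute min.commute)
  define T where "T = (\<lambda>v a b. turn (\<lambda>s. Q a b s - r v))"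
  define c where "c = (\<lambda>v a b. if v = a \<or> v = b \<or> n \<le> v \<or> \<not> adj a b then 0 else (T v a b - th v b + th v a) / pi)"
  have logc: "continuous_on {0..1} (\<lambda>s. Q a b s - r v)" if "adj a b" for a b v
    using Qc[OF that] by (intro continuous_intros)
  have Talt: "T v b a = - T v a b" if ab: "adj a b" and v: "v \<noteq> a" "v \<noteq> b" "v < n" for v a b
    unfolding T_def
    by (rule turn_rev[OF logc[OF ab]]) (use Qv[OF ab v(3,1,2)] d(3)[OF adj_sym[OF ab]] in \<open>auto simp: Q_def\<close>)
  have alt: "alt_cochain c"
    unfolding alt_cochain_def
  proof (intro allI)
    fix v a b
    show "c v b a = - c v a b"
      using Talt[of a b v] adj_sym[of a b] adj_sym[of b a] by (auto simp: c_def divide_simps)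
  qed
  have ang: "\<exists>x>0. r w - r v = of_real x * cis (th v w + pi * of_bool (w < v))" if "v < n" "w < n" "v \<noteq> w" for v w
  proof (intro exI conjI)
    let ?z = "r (max v w) - r (min v w)"
    have nz: "?z \<noteq> 0" using rn[of v w] rn[of w v] that by (auto simp: max_def min_def)
    show "0 < cmod ?z" using nz by simp
    have p: "?z = of_real (cmod ?z) * cis (th v w)"
      unfolding th_def using Arg_eq[OF nz] by (simp add: cis_conv_exp)
    have "cis (th v w + pi) = - cis (th v w)" by (simp add: cis_mult[symmetric])
    then show "r w - r v = of_real (cmod ?z) * cis (th v w + pi * of_bool (w < v))"
      using p that(3) by (cases "w < v") (auto simp: max_def min_def)
  qed
  have par: "\<exists>k::int. c v a b = of_int (of_bool ((v < a) \<noteq> (v < b)) + 2 * k)"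
    if v: "v < n" and ab: "adj a b" and ne: "v \<noteq> a" "v \<noteq> b" for v a b
  proof -
    have lt: "a < n" "b < n" using ab adj_less adj_less2 by auto
    obtain x0 where x0: "0 < x0" "r a - r v = of_real x0 * cis (th v a + pi * of_bool (a < v))"
      using ang[OF v lt(1) ne(1)] by blast
    obtain x1 where x1: "0 < x1" "r b - r v = of_real x1 * cis (th v b + pi * of_bool (b < v))"
      using ang[OF v lt(2) ne(2)] by blast
    have "cg (2 * pi) (T v a b) (th v b + pi * of_bool (b < v) - (th v a + pi * of_bool (a < v)))"
      unfolding T_def
      by (rule turn_ends[OF logc[OF ab] _ _ _ x0(1) x1(1)]) (use Qv[OF ab v ne] Qe[OF ab] x0 x1 in auto)
    then obtain k :: int where "T v a b - th v b + th v a = pi * (of_bool (b < v) - of_bool (a < v) + 2 * of_int k)"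
      by (auto simp: cg_def algebra_simps)
    then have cv: "c v a b = of_bool (b < v) - of_bool (a < v) + 2 * of_int k" using v ab ne by (simp add: c_def)
    have "\<exists>l::int. c v a b = of_int (of_bool ((v < a) \<noteq> (v < b)) + 2 * l)"
    proof (intro exI)
      show "c v a b = of_int (of_bool ((v < a) \<noteq> (v < b)) + 2 * (k - of_bool (v < b \<and> a < v)))"
        using ne unfolding cv by (cases v a rule: linorder_cases; cases v b rule: linorder_cases) auto
    qed
    then show ?thesis .
  qed
  have "dcf c x y = 0" if de: "disj_edges x y" for x y
  proof -
    obtain p q a b where xy: "x = (p, q)" "y = (a, b)" by (cases x; cases y) auto
    have D: "adj p q" "adj a b" "p \<noteq> a" "p \<noteq> b" "q \<noteq> a" "q \<noteq> b" using de by (auto simp: xy disj_edges_def)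
    have lt: "a < n" "b < n" "p < n" "q < n" using D adj_less adj_less2 by auto
    define F where "F = (\<lambda>z :: real \<times> real. Q a b (snd z) - Q p q (fst z))"
    let ?S = "{0..1} \<times> {0..1} :: (real \<times> real) set"
    have cF: "continuous_on ?S F"
      unfolding F_def
      by (intro continuous_intros continuous_on_compose2[OF Qc[OF D(1)]] continuous_on_compose2[OF Qc[OF D(2)]]) auto
    have F0: "F z \<noteq> 0" if "z \<in> ?S" for z using QQ[of p q a b "snd z" "fst z"] de that by (auto simp: F_def xy)
    have "contractible ?S" by (intro convex_imp_contractible convex_Times) auto
    then obtain L where L: "continuous_on ?S L" "\<And>z. z \<in> ?S ==> F z = exp (L z)"
      using continuous_logarithm_on_contractible[OF cF] F0 by blast
    have cL: "continuous_on {0..1} (\<lambda>s. L (s, t))" "continuous_on {0..1} (\<lambda>s. L (t, s))" if "t \<in> {0..1}" for t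
      using that by (intro continuous_on_compose2[OF L(1)] continuous_intros; auto)+
    have FL: "Q a b t - Q p q s = exp (L (s, t))" if "s \<in> {0..1}" "t \<in> {0..1}" for s t
      using L(2)[of "(s, t)"] that by (simp add: F_def)
    have 1: "T q a b = Im (L (1, 1) - L (1, 0))"
      unfolding T_def by (rule turn_eq[where k = 1]) (use cL[of 1] FL[of 1] Qe[OF D(1)] in auto)
    have 2: "T p a b = Im (L (0, 1) - L (0, 0))"
      unfolding T_def by (rule turn_eq[where k = 1]) (use cL[of 0] FL[of 0] Qe[OF D(1)] in auto)
    \<comment> \<open>Here the other point moves, so the direction is minus \<open>F\<close>. The
      constant factor -1 does not affect the turn.\<close>
    have 3: "T b p q = Im (L (1, 1) - L (0, 1))"
      unfolding T_def by (rule turn_eq[where k = "-1"]) (use cL[of 1] FL[of _ 1, symmetric] Qe[OF D(2)] in auto)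
    have 4: "T a p q = Im (L (1, 0) - L (0, 0))"
      unfolding T_def by (rule turn_eq[where k = "-1"]) (use cL[of 0] FL[of _ 0, symmetric] Qe[OF D(2)] in auto)
    have "dcf c x y = ((T q a b - th q b + th q a) - (T p a b - th p b + th p a)
        - (T b p q - th b q + th b p) + (T a p q - th a q + th a p)) / pi"
      using D lt by (simp add: dcf_def xy c_def diff_divide_distrib add_divide_distrib)
    also have "\<dots> = 0" unfolding 1 2 3 4 th_sym[of b q] th_sym[of b p] th_sym[of a q] th_sym[of a p] by simp
    finally show ?thesis .
  qed
  then show ?thesis by (intro odd_cochain_of_real[OF alt par]) auto
qed

section \<open>Drawings and geometric realisations\<close>

context sgraph
begin

definition seg :: "nat => nat => real => nat => real" where
  "seg a b s = (\<lambda>v. (1 - s) * of_bool (v = a) + s * of_bool (v = b))"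

lemma seg_ends: "seg a b 0 = seg a a 0" "seg a b 1 = seg b b 0" "seg b a (1 - s) = seg a b s" "seg a a s = seg a a 0"
  by (auto simp: seg_def fun_eq_iff)

lemma seg_continuous: "continuous_on A (seg a b)"
  unfolding seg_def by (intro continuous_on_coordinatewise_then_product continuous_intros)

lemma seg_KG: assumes "cl a b" "s \<in> {0..1}" shows "seg a b s \<in> KG"
proof -
  have "a < n" "b < n" using assms adj_less2 by (auto simp: cl_def)
  then have "(\<Sum>v<n. seg a b s v) = 1" by (simp add: seg_def sum.distrib flip: sum_distrib_left)
  moreover have "0 \<le> seg a b s v" for v using assms by (simp add: seg_def)
  moreover have "seg a b s v = 0" if "v \<noteq> a" "v \<noteq> b" for v using that by (simp add: seg_def)
  ultimately show ?thesis using assms(1) unfolding KG_def by blast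
qed

lemma KG_seg: assumes "u \<in> KG" "a < n" "b < n" "\<forall>v. v \<noteq> a --> v \<noteq> b --> u v = 0"
  shows "u b \<in> {0..1}" "a \<noteq> b ==> u = seg a b (u b)" "a = b ==> u = seg a a 0"
proof -
  have u: "0 \<le> u v" "(\<Sum>v<n. u v) = 1" for v using assms(1) by (auto simp: KG_def)
  have "(\<Sum>v<n. u v) = (\<Sum>v\<in>{a, b}. u v)" using assms by (intro sum.mono_neutral_right) auto
  then have e: "(\<Sum>v\<in>{a, b}. u v) = 1" using u by simp
  show "u = seg a b (u b)" if "a \<noteq> b" using e that assms(4) by (auto simp: seg_def fun_eq_iff)
  show "u = seg a a 0" if "a = b" using e that assms(4) by (auto simp: seg_def fun_eq_iff)
  show "u b \<in> {0..1}" using e u(1)[of a] u(1)[of b] by (cases "a = b") auto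
qed

lemma KG_cases:
  assumes "u \<in> KG"
  obtains x where "x < n" "u = seg x x 0" | a b s where "adj a b" "0 < s" "s < 1" "u = seg a b s"
proof -
  obtain a b where ab: "cl a b" "\<forall>v. v \<noteq> a --> v \<noteq> b --> u v = 0" using assms unfolding KG_def by blast
  have lt: "a < n" "b < n" using ab adj_less2 by (auto simp: cl_def)
  note s = KG_seg[OF assms lt ab(2)]
  show thesis
  proof (cases "a = b")
    case True
    then show thesis using s(3) lt(1) that(1) by simp
  next
    case False
    have e: "u = seg a b (u b)" using s(2) False by simp
    consider "u b = 0" | "u b = 1" | "0 < u b" "u b < 1" using s(1) by fastforce
    then show thesis
    proof cases
      case 1
      then show thesis using that(1)[OF lt(1)] e seg_ends(1) by metis
    next
      case 2
      then show thesis using that(1)[OF lt(2)] e seg_ends(2) by metis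
    next
      case 3
      then show thesis using that(2)[OF _ 3 e] ab(1) False by (auto simp: cl_def)
    qed
  qed
qed

lemma seg_eq_vertex: assumes "a \<noteq> b" "0 < s" "s < 1" shows "seg a b s \<noteq> seg x x 0"
proof
  assume "seg a b s = seg x x 0"
  then have "seg a b s a = seg x x 0 a" "seg a b s b = seg x x 0 b" by simp_all
  then show False using assms by (auto simp: seg_def split: if_splits)
qed

lemma seg_eq_seg:
  assumes "a \<noteq> b" "0 < s" "s < 1" "c \<noteq> d" "0 < t" "t < 1" "seg a b s = seg c d t"
  shows "c = a \<and> d = b \<and> t = s \<or> c = b \<and> d = a \<and> t = 1 - s"
proof -
  have e: "seg a b s v = seg c d t v" for v using assms by simp
  have m: "seg x y r v \<noteq> 0 \<longleftrightarrow> v = x \<or> v = y" if "x \<noteq> y" "0 < r" "r < 1" for x y r v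
    using that by (auto simp: seg_def)
  have "{a, b} = {c, d}" using m[OF assms(1-3)] m[OF assms(4-6)] e by auto
  then consider "c = a" "d = b" | "c = b" "d = a" by (auto simp: doubleton_eq_iff)
  then show ?thesis
  proof cases
    case 1
    then show ?thesis using e[of b] assms(1) by (simp add: seg_def)
  next
    case 2
    then show ?thesis using e[of a] assms(1) by (simp add: seg_def)
  qed
qed

lemma compact_KG: "compact KG"
proof -
  have "KG = (\<Union>p\<in>{p \<in> {..<n} \<times> {..<n}. cl (fst p) (snd p)}. seg (fst p) (snd p) ` {0..1})"
  proof (intro equalityI subsetI)
    fix u assume u: "u \<in> KG"
    then show "u \<in> (\<Union>p\<in>{p \<in> {..<n} \<times> {..<n}. cl (fst p) (snd p)}. seg (fst p) (snd p) ` {0..1})"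
    proof (cases rule: KG_cases)
      case (1 x)
      then show ?thesis by (intro UN_I[of "(x, x)"]) (auto simp: cl_def)
    next
      case (2 a b s)
      then show ?thesis using adj_less adj_less2 by (intro UN_I[of "(a, b)"]) (auto simp: cl_def)
    qed
  qed (use seg_KG in auto)
  moreover have "compact (\<Union>p\<in>{p \<in> {..<n} \<times> {..<n}. cl (fst p) (snd p)}. seg (fst p) (snd p) ` {0..1})"
    by (intro compact_UN compact_continuous_image seg_continuous) auto
  ultimately show ?thesis by simp
qed

text \<open>The graph of the realisation map of a drawing. As a relation it is symmetric enough for one
lemma to say that it is functional and injective.\<close>

definition real_at :: "(nat => 'b) => (nat => nat => real => 'b) => (nat => real) => 'b => bool" where
  "real_at q P u y \<longleftrightarrow> (\<exists>x<n. u = seg x x 0 \<and> y = q x) \<or>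
     (\<exists>a b s. adj a b \<and> 0 < s \<and> s < 1 \<and> u = seg a b s \<and> y = P a b s)"

lemma real_at_unique:
  assumes D: "drawing T q P" and r: "real_at q P u y" "real_at q P u' y'"
  shows "u = u' \<longleftrightarrow> y = y'"
proof -
  note d = drawingD[OF D]
  have ne: "a \<noteq> b" if "adj a b" for a b using that adj_irrefl by auto
  have x1: "seg x x 0 = seg x' x' 0 \<longleftrightarrow> x = x'" for x x' by (auto simp: seg_def fun_eq_iff)
  have x2: "q x = q x' \<longleftrightarrow> x = x'" if "x < n" "x' < n" for x x' using d(1) that by (auto simp: inj_on_def)
  have x3: "seg a b s \<noteq> seg x x 0" "seg x x 0 \<noteq> seg a b s" "P a b s \<noteq> q x" "q x \<noteq> P a b s"
    if "adj a b" "0 < s" "s < 1" "x < n" for a b s x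
    using seg_eq_vertex[OF ne[OF that(1)] that(2,3), of x] d(5)[OF that(1,4,2,3)] by auto
  have x4: "seg a b s = seg c d' t \<longleftrightarrow> P a b s = P c d' t"
    if "adj a b" "0 < s" "s < 1" "adj c d'" "0 < t" "t < 1" for a b s c d' t
  proof
    assume "seg a b s = seg c d' t"
    then have "c = a \<and> d' = b \<and> t = s \<or> c = b \<and> d' = a \<and> t = 1 - s"
      using seg_eq_seg[OF ne[OF that(1)] that(2,3) ne[OF that(4)] that(5,6)] by simp
    then show "P a b s = P c d' t" using d(4)[OF that(1), of s] that by auto
  next
    assume "P a b s = P c d' t"
    then have "c = a \<and> d' = b \<and> t = s \<or> c = b \<and> d' = a \<and> t = 1 - s"
      using d(6)[OF that(1,4,2,3,5,6)] by simp
    then show "seg a b s = seg c d' t" using seg_ends(3) by metis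
  qed
  have r': "(\<exists>x<n. u = seg x x 0 \<and> y = q x) \<or> (\<exists>a b s. adj a b \<and> 0 < s \<and> s < 1 \<and> u = seg a b s \<and> y = P a b s)"
    "(\<exists>x<n. u' = seg x x 0 \<and> y' = q x) \<or> (\<exists>a b s. adj a b \<and> 0 < s \<and> s < 1 \<and> u' = seg a b s \<and> y' = P a b s)"
    using r unfolding real_at_def by blast+
  from r'(1) show ?thesis
  proof (elim disjE exE conjE)
    fix x assume x: "x < n" "u = seg x x 0" "y = q x"
    from r'(2) show ?thesis
      by (elim disjE exE conjE) (use x x1 x2 x3 in simp_all)
  next
    fix a b s assume x: "adj a b" "0 < s" "s < 1" "u = seg a b s" "y = P a b s"
    from r'(2) show ?thesis
    proof (elim disjE exE conjE)
      fix x' assume "x' < n" "u' = seg x' x' 0" "y' = q x'"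
      then show ?thesis using x x3 by simp
    next
      fix c d' t assume x': "adj c d'" "0 < t" "t < 1" "u' = seg c d' t" "y' = P c d' t"
      show ?thesis unfolding x(4,5) x'(4,5) by (rule x4[OF x(1-3) x'(1-3)])
    qed
  qed
qed

text \<open>The realisation map is continuous on each of finitely many closed cells and injective; a
  continuous injection of a compact space into a Hausdorff space is an embedding.\<close>

theorem drawing_embeds:
  assumes D: "drawing T q P" and T: "Hausdorff_space T"
  shows "\<exists>f. embedding_map (top_of_set KG) T f \<and> q ` {..<n} \<union> (\<Union>(a, b)\<in>{(a, b). adj a b}. P a b ` {0..1}) \<subseteq> f ` KG"
proof -
  note d = drawingD[OF D]
  define f where "f = (\<lambda>u. SOME y. real_at q P u y)"
  have fR: "real_at q P u (f u)" if u: "u \<in> KG" for u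
  proof -
    have "\<exists>y. real_at q P u y" using u by (cases rule: KG_cases) (unfold real_at_def, blast+)
    then show ?thesis unfolding f_def by (rule someI_ex)
  qed
  have f_eq: "f u = y" if "u \<in> KG" "real_at q P u y" for u y
    using real_at_unique[OF D fR[OF that(1)] that(2)] by simp
  have inj: "inj_on f KG"
    by (rule inj_onI) (metis real_at_unique[OF D] fR)
  have fv: "f (seg x x 0) = q x" if "x < n" for x
    by (rule f_eq) (use that seg_KG[of x x 0] in \<open>auto simp: cl_def real_at_def\<close>)
  have fe: "f (seg a b s) = P a b s" if ab: "adj a b" and s: "s \<in> {0..1}" for a b s
  proof -
    consider "s = 0" | "s = 1" | "0 < s" "s < 1" using s by fastforce
    then show ?thesis
    proof cases
      case 1
      then show ?thesis using fv[of a] adj_less[OF ab] d(3)[OF ab] seg_ends(1) by metis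
    next
      case 2
      then show ?thesis using fv[of b] adj_less2[OF ab] d(3)[OF ab] seg_ends(2) by metis
    next
      case 3
      have "seg a b s \<in> KG" using ab s adj_less by (intro seg_KG) (auto simp: cl_def)
      then show ?thesis using 3 ab by (intro f_eq) (auto simp: real_at_def)
    qed
  qed
  define I where "I = {p \<in> {..<n} \<times> {..<n}. cl (fst p) (snd p)}"
  define C where "C = (\<lambda>p :: nat \<times> nat. {u \<in> KG. \<forall>v. v \<noteq> fst p --> v \<noteq> snd p --> u v = 0})"
  define g where "g = (\<lambda>p u. if fst p = snd p then q (fst p) else P (fst p) (snd p) (u (snd p)))"
  have fg: "f u = g p u" if p: "p \<in> I" "u \<in> C p" for p u
  proof -
    have lt: "fst p < n" "snd p < n" using p by (auto simp: I_def)
    have u: "u \<in> KG" "\<forall>v. v \<noteq> fst p --> v \<noteq> snd p --> u v = 0" using p by (auto simp: C_def)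
    note s = KG_seg[OF u(1) lt u(2)]
    show ?thesis
    proof (cases "fst p = snd p")
      case True
      then show ?thesis using s(3) fv lt by (simp add: g_def)
    next
      case False
      then have ad: "adj (fst p) (snd p)" using p by (auto simp: I_def cl_def)
      have "f u = f (seg (fst p) (snd p) (u (snd p)))" by (rule arg_cong[OF s(2)[OF False]])
      then show ?thesis using fe[OF ad s(1)] False by (simp add: g_def)
    qed
  qed
  have cont: "continuous_map (top_of_set KG) T f"
  proof (rule pasting_lemma_closed[where I = I and T = C and f = g])
    show "finite I" by (simp add: I_def)
    show "closedin (top_of_set KG) (C p)" for p
    proof -
      have "closed {u :: nat => real. \<forall>v. v \<noteq> fst p --> v \<noteq> snd p --> u v = 0}"
        by (intro closed_Collect_all closed_Collect_imp closed_Collect_eq open_Collect_const)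
          (auto intro!: continuous_intros continuous_on_product_coordinates)
      then have "closedin (top_of_set KG) (KG \<inter> {u. \<forall>v. v \<noteq> fst p --> v \<noteq> snd p --> u v = 0})"
        by (rule closedin_closed_Int)
      then show ?thesis by (simp add: C_def Collect_conj_eq)
    qed
    show "continuous_map (subtopology (top_of_set KG) (C p)) T (g p)" if p: "p \<in> I" for p
    proof (cases "fst p = snd p")
      case True
      then show ?thesis using d(2)[of "fst p"] p by (auto simp: g_def I_def mem_Times_iff)
    next
      case False
      then have ad: "adj (fst p) (snd p)" and lt: "fst p < n" "snd p < n" using p by (auto simp: I_def cl_def)
      have sub: "subtopology (top_of_set KG) (C p) = top_of_set (C p)"
        by (simp add: subtopology_subtopology C_def Int_absorb1 Collect_conj_eq)
      have "continuous_map (top_of_set (C p)) T (\<lambda>u. P (fst p) (snd p) (u (snd p)))"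
      proof (rule sub_map[of "{0..1}"])
        show "continuous_on (C p) (\<lambda>u. u (snd p))"
          by (rule continuous_on_subset[OF continuous_on_product_coordinates subset_UNIV])
        show "u (snd p) \<in> {0..1}" if "u \<in> C p" for u
          by (rule KG_seg(1)[OF _ lt]) (use that in \<open>auto simp: C_def\<close>)
      qed (use d(3)[OF ad] in simp)
      then show ?thesis using False sub by (simp add: g_def)
    qed
    show "g p x = g p' x" if "p \<in> I" "p' \<in> I" "x \<in> topspace (top_of_set KG) \<inter> C p \<inter> C p'" for p p' x
      using fg that by (metis IntD1 IntD2)
    show "\<exists>p. p \<in> I \<and> u \<in> C p \<and> f u = g p u" if u: "u \<in> topspace (top_of_set KG)" for u
    proof -
      have u: "u \<in> KG" using u by simp
      then obtain a b where ab: "cl a b" "\<And>v. v \<noteq> a ==> v \<noteq> b ==> u v = 0" unfolding KG_def by blast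
      then have "(a, b) \<in> I" "u \<in> C (a, b)" using u adj_less2 by (auto simp: I_def C_def cl_def)
      then show ?thesis using fg by blast
    qed
  qed
  have "compact_space (top_of_set KG)" using compact_KG by (simp add: compact_space_subtopology)
  then have "closed_map (top_of_set KG) T f" using cont T by (intro T1_Spaces.continuous_imp_closed_map)
  then have "embedding_map (top_of_set KG) T f" using cont inj by (intro injective_closed_imp_embedding_map) auto
  moreover have "q x \<in> f ` KG" if "x < n" for x
    using fv[OF that] seg_KG[of x x 0] that by (metis atLeastAtMost_iff cl_def image_eqI le_numeral_extra(3) zero_le_one)
  moreover have "P a b s \<in> f ` KG" if "adj a b" "s \<in> {0..1}" for a b s
    using fe[OF that] seg_KG[of a b s] that adj_less by (metis cl_def image_eqI)
  ultimately show ?thesis by (intro exI[of _ f]) auto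
qed

end

context graph_model
begin

theorem planar_iff_drawing: "planar_space Gr \<longleftrightarrow> (\<exists>q P. drawing (euclidean :: (real \<times> real) topology) q P)"
proof
  assume "planar_space Gr"
  then obtain f :: "'a => real \<times> real" where f: "embedding_map Gr euclidean f" unfolding planar_space_def by blast
  have fc: "continuous_map Gr euclidean f" "inj_on f (topspace Gr)"
    using f by (auto simp: embedding_map_def homeomorphic_map_def dest: quotient_imp_continuous_map continuous_map_into_fulltopology)
  have g: "continuous_map (top_of_set KG) euclidean (\<lambda>u. f (mu u))"
    using continuous_map_compose[OF _ fc(1), of "top_of_set KG" mu] homeo unfolding homeomorphic_maps_def
    by (simp add: o_def)
  have inj: "f (mu u) = f (mu w) \<longleftrightarrow> u = w" if "u \<in> KG" "w \<in> KG" for u w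
    using fc(2) mu_top that lam_mu unfolding inj_on_def by metis
  have v: "seg x x 0 \<in> KG" if "x < n" for x using that by (intro seg_KG) (auto simp: cl_def)
  have e: "seg a b s \<in> KG" if "adj a b" "s \<in> {0..1}" for a b s using that adj_less by (intro seg_KG) (auto simp: cl_def)
  have ne: "a \<noteq> b" if "adj a b" for a b using that adj_irrefl by auto
  have "drawing (euclidean :: (real \<times> real) topology) (\<lambda>x. f (mu (seg x x 0))) (\<lambda>a b s. f (mu (seg a b s)))"
    unfolding drawing_def
  proof (intro conjI allI impI)
    show "inj_on (\<lambda>x. f (mu (seg x x 0))) {..<n}"
    proof (rule inj_onI)
      fix x y assume "x \<in> {..<n}" "y \<in> {..<n}" "f (mu (seg x x 0)) = f (mu (seg y y 0))"
      then have "seg x x 0 = seg y y 0" using inj v by simp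
      then have "seg x x 0 x = seg y y 0 x" by simp
      then show "x = y" by (simp add: seg_def split: if_splits)
    qed
  next
    fix a b assume ab: "adj a b"
    show "continuous_map (top_of_set {0..1}) euclidean (\<lambda>s. f (mu (seg a b s)))"
      by (rule sub_map[OF g seg_continuous]) (use e ab in auto)
    show "f (mu (seg a b 0)) = f (mu (seg a a 0))" unfolding seg_ends(1)[of a b] ..
    show "f (mu (seg a b 1)) = f (mu (seg b b 0))" unfolding seg_ends(2)[of a b] ..
  next
    fix a b and s :: real
    show "f (mu (seg b a (1 - s))) = f (mu (seg a b s))" by (simp only: seg_ends(3))
  next
    fix a b x and s :: real assume s: "adj a b" "x < n" "0 < s" "s < 1"
    then show "f (mu (seg a b s)) \<noteq> f (mu (seg x x 0))"
      using inj[OF e[OF s(1), of s] v[OF s(2)]] seg_eq_vertex[OF ne[OF s(1)] s(3,4)] by auto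
  next
    fix a b c d and s t :: real
    assume s: "adj a b" "adj c d" "0 < s" "s < 1" "0 < t" "t < 1" "f (mu (seg a b s)) = f (mu (seg c d t))"
    then have "seg a b s = seg c d t" using inj[OF e[OF s(1), of s] e[OF s(2), of t]] by simp
    then show "c = a \<and> d = b \<and> t = s \<or> c = b \<and> d = a \<and> t = 1 - s"
      by (rule seg_eq_seg[OF ne[OF s(1)] s(3,4) ne[OF s(2)] s(5,6)])
  qed auto
  then show "\<exists>q P. drawing (euclidean :: (real \<times> real) topology) q P" by blast
next
  assume "\<exists>q P. drawing (euclidean :: (real \<times> real) topology) q P"
  then obtain q P where "drawing (euclidean :: (real \<times> real) topology) q P" by blast
  from drawing_embeds[OF this] obtain f :: "(nat => real) => real \<times> real" where f: "embedding_map (top_of_set KG) euclidean f" by auto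
  have "homeomorphic_map Gr (top_of_set KG) lam" using homeo homeomorphic_map_maps by blast
  then have "embedding_map Gr (top_of_set KG) lam" by (simp add: embedding_map_def homeomorphic_imp_surjective_map subtopology_subtopology)
  from embedding_map_compose[OF this f] show "planar_space Gr" unfolding planar_space_def by blast
qed

text \<open>The sum of the coordinates over the vertices reachable from \<open>a\<close> is
  continuous and takes only the values 0 and 1, because no edge leaves that set.\<close>

lemma conn_if_connected: assumes "connected_space Gr" shows "conn {..<n}"
  unfolding conn_def
proof (intro ballI, rule ccontr)
  fix a b assume ab: "a \<in> {..<n}" "b \<in> {..<n}" "\<not> reach {..<n} a b"
  define S where "S = {v \<in> {..<n}. reach {..<n} a v}"
  define h where "h = (\<lambda>x. \<Sum>v\<in>S. lam x v)"
  have S: "S \<subseteq> {..<n}" "finite S" by (auto simp: S_def)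
  have h: "continuous_map Gr euclideanreal h"
    unfolding h_def using S by (intro continuous_map_sum continuous_coord) auto
  have step: "w \<in> S" if "adj v w" "v \<in> S" for v w
    using that reach_trans[OF _ reach_step[of v "{..<n}" w]] adj_less2 by (auto simp: S_def)
  have h01: "h x \<in> {0, 1}" if x: "x \<in> topspace Gr" for x
  proof -
    have K: "lam x \<in> KG" by (rule lam_KG[OF x])
    obtain p r where pr: "cl p r" "\<And>v. v \<noteq> p ==> v \<noteq> r ==> lam x v = 0" using K unfolding KG_def by blast
    have iff: "p \<in> S \<longleftrightarrow> r \<in> S" using pr(1) step adj_sym by (auto simp: cl_def)
    show ?thesis
    proof (cases "p \<in> S")
      case True
      have "lam x v = 0" if "v \<notin> S" for v using pr(2)[of v] that True iff by metis
      then have "(\<Sum>v<n. lam x v) = (\<Sum>v\<in>S. lam x v)" using S by (intro sum.mono_neutral_right) auto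
      then show ?thesis using K by (simp add: h_def KG_def)
    next
      case False
      then have "h x = 0" unfolding h_def using iff pr(2) by (intro sum.neutral) metis
      then show ?thesis by simp
    qed
  qed
  have con: "connected (h ` topspace Gr)"
    using connectedin_continuous_map_image[OF h, of "topspace Gr"] assms by (simp add: connectedin_topspace)
  have v: "mu (seg x x 0) \<in> topspace Gr" "h (mu (seg x x 0)) = of_bool (x \<in> S)" if "x < n" for x
  proof -
    have K: "seg x x 0 \<in> KG" using that by (intro seg_KG) (auto simp: cl_def)
    then show "mu (seg x x 0) \<in> topspace Gr" by (rule mu_top)
    show "h (mu (seg x x 0)) = of_bool (x \<in> S)" unfolding h_def lam_mu[OF K] using S(2) by (simp add: seg_def)
  qed
  have "a \<in> S" "b \<notin> S" using ab by (auto simp: S_def)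
  then have "1 \<in> h ` topspace Gr" "0 \<in> h ` topspace Gr"
    using v[of a] v[of b] ab by (force intro!: image_eqI[of _ h])+
  then have "1 / 2 \<in> h ` topspace Gr"
    using connectedD_interval[OF con, of 0 1 "1 / 2"] by simp
  then show False using h01 by fastforce
qed

end

section \<open>Subdividing a finite graph\<close>

locale graph_cells =
  fixes Gr :: "'a topology" and Vs :: "'a set" and Es :: "(real => 'a) set"
  assumes Hausdorff: "Hausdorff_space Gr" and fin: "finite Vs" "finite Es" and Vs: "Vs \<subseteq> topspace Gr"
    and cont: "e \<in> Es ==> continuous_map (top_of_set {0..1}) Gr e"
    and ends: "e \<in> Es ==> e 0 \<in> Vs" "e \<in> Es ==> e 1 \<in> Vs"
    and inj: "e \<in> Es ==> inj_on e {0<..<1}" and off: "e \<in> Es ==> e ` {0<..<1} \<inter> Vs = {}"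
    and disj: "e \<in> Es ==> e' \<in> Es ==> e \<noteq> e' ==> e ` {0<..<1} \<inter> e' ` {0<..<1} = {}"
    and cover: "topspace Gr = Vs \<union> (\<Union>e\<in>Es. e ` {0..1})"
begin

lemma interior_eq:
  assumes "e \<in> Es" "e' \<in> Es" "0 < s" "s < 1" "0 < t" "t < 1" "e s = e' t" shows "e = e' \<and> s = t"
proof -
  have "e s \<in> e ` {0<..<1}" "e' t \<in> e' ` {0<..<1}" using assms(3-6) by auto
  then have "e = e'" using disj[OF assms(1,2)] assms(7) by auto
  then show ?thesis using inj[OF assms(1)] assms by (auto simp: inj_on_def)
qed

lemma interior_off: "e \<in> Es ==> 0 < s ==> s < 1 ==> e s \<notin> Vs"
  using off by fastforce

text \<open>Each edge is cut into three pieces at its points with parameters 1/3 and 2/3, so that the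
result has neither loops nor multiple edges nor 4-cycles. The points themselves serve as vertices:
\<open>cut x y e k\<close> says that piece number \<open>k\<close> of \<open>e\<close> runs from \<open>x\<close> to \<open>y\<close>.\<close>

definition cut :: "'a => 'a => (real => 'a) => real => bool" where
  "cut x y e k \<longleftrightarrow> e \<in> Es \<and> k \<in> {0, 1, 2} \<and> x = e (k / 3) \<and> y = e ((k + 1) / 3)"

definition pts :: "'a set" where
  "pts = Vs \<union> (\<lambda>e. e (1 / 3)) ` Es \<union> (\<lambda>e. e (2 / 3)) ` Es"

lemma cut_pts: "cut x y e k ==> x \<in> pts \<and> y \<in> pts"
  using ends by (auto simp: cut_def pts_def)

lemma cut_Vs: assumes "cut x y e k" shows "x \<in> Vs \<longleftrightarrow> k = 0" "y \<in> Vs \<longleftrightarrow> k = 2"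
  using assms ends[of e] interior_off[of e "1 / 3"] interior_off[of e "2 / 3"] by (auto simp: cut_def)

lemma cut_unique: assumes "cut x y e k" "cut x y e' k'" shows "e = e' \<and> k = k'"
proof -
  have k: "k = 0 \<longleftrightarrow> k' = 0" "k = 2 \<longleftrightarrow> k' = 2" "k \<in> {0, 1, 2}" "k' \<in> {0, 1, 2}"
    using cut_Vs[OF assms(1)] cut_Vs[OF assms(2)] assms by (auto simp: cut_def)
  then have kk: "k = k'" by auto
  have E: "e \<in> Es" "e' \<in> Es" using assms by (auto simp: cut_def)
  have "e = e'"
  proof (cases "k = 0")
    case True
    then have "e (1 / 3) = e' (1 / 3)" using assms kk by (auto simp: cut_def)
    then show ?thesis using interior_eq[OF E, of "1 / 3" "1 / 3"] by simp
  next
    case False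
    then have "e (k / 3) = e' (k / 3)" "0 < k / 3" "k / 3 < 1" using assms kk k(3) by (auto simp: cut_def)
    then show ?thesis using interior_eq[OF E, of "k / 3" "k / 3"] by simp
  qed
  then show ?thesis using kk by simp
qed

lemma cut_asym: assumes "cut x y e k" shows "\<not> cut y x e' k'"
proof
  assume c: "cut y x e' k'"
  have E: "e \<in> Es" "e' \<in> Es" using assms c by (auto simp: cut_def)
  have "k = 0 \<longleftrightarrow> k' = 2" "k = 2 \<longleftrightarrow> k' = 0" "k \<in> {0, 1, 2}" "k' \<in> {0, 1, 2}"
    using cut_Vs[OF assms] cut_Vs[OF c] assms c by (auto simp: cut_def)
  then consider "k = 0" "k' = 2" | "k = 2" "k' = 0" | "k = 1" "k' = 1" by auto
  then show False
  proof cases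
    case 1
    then have "e (1 / 3) = e' (2 / 3)" using assms c by (auto simp: cut_def)
    then show False using interior_eq[OF E, of "1 / 3" "2 / 3"] by simp
  next
    case 2
    then have "e (2 / 3) = e' (1 / 3)" using assms c by (auto simp: cut_def)
    then show False using interior_eq[OF E, of "2 / 3" "1 / 3"] by simp
  next
    case 3
    then have "e (1 / 3) = e' (2 / 3)" using assms c by (auto simp: cut_def)
    then show False using interior_eq[OF E, of "1 / 3" "2 / 3"] by simp
  qed
qed

definition lnk :: "'a => 'a => bool" where
  "lnk x y \<longleftrightarrow> (\<exists>e k. cut x y e k \<or> cut y x e k)"

lemma lnk_sym: "lnk x y ==> lnk y x"
  by (auto simp: lnk_def)

lemma lnk_Vs: "lnk x y ==> x \<in> Vs ==> y \<notin> Vs"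
  unfolding lnk_def using cut_Vs by fastforce

lemma lnk_third: assumes "e \<in> Es" "lnk (e (1 / 3)) y" shows "y = e 0 \<or> y = e (2 / 3)"
proof -
  obtain e' k where c: "cut (e (1 / 3)) y e' k \<or> cut y (e (1 / 3)) e' k" using assms by (auto simp: lnk_def)
  then have E: "e' \<in> Es" "k \<in> {0, 1, 2}" by (auto simp: cut_def)
  note i = interior_eq[OF assms(1) E(1), of "1 / 3"] and iv = interior_off[OF assms(1), of "1 / 3"] ends[OF E(1)]
  from c show ?thesis
  proof
    assume c: "cut (e (1 / 3)) y e' k"
    then show ?thesis using i[of "1 / 3"] i[of "2 / 3"] iv E(2) by (auto simp: cut_def)
  next
    assume c: "cut y (e (1 / 3)) e' k"
    then show ?thesis using i[of "1 / 3"] i[of "2 / 3"] iv E(2) by (auto simp: cut_def)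
  qed
qed

lemma lnk_two_thirds: assumes "e \<in> Es" "lnk (e (2 / 3)) y" shows "y = e 1 \<or> y = e (1 / 3)"
proof -
  obtain e' k where c: "cut (e (2 / 3)) y e' k \<or> cut y (e (2 / 3)) e' k" using assms by (auto simp: lnk_def)
  then have E: "e' \<in> Es" "k \<in> {0, 1, 2}" by (auto simp: cut_def)
  note i = interior_eq[OF assms(1) E(1), of "2 / 3"] and iv = interior_off[OF assms(1), of "2 / 3"] ends[OF E(1)]
  from c show ?thesis
  proof
    assume c: "cut (e (2 / 3)) y e' k"
    then show ?thesis using i[of "1 / 3"] i[of "2 / 3"] iv E(2) by (auto simp: cut_def)
  next
    assume c: "cut y (e (2 / 3)) e' k"
    then show ?thesis using i[of "1 / 3"] i[of "2 / 3"] iv E(2) by (auto simp: cut_def)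
  qed
qed

lemma lnk_pts: "lnk x y ==> x \<in> pts"
  unfolding lnk_def using cut_pts by blast

text \<open>A new vertex has just two neighbours, an original vertex and its twin on the same edge.
  The fourth corner must be linked to both; the twin offers only the starting point and an original
  vertex, and original vertices are never linked to each other.\<close>

lemma lnk_square_interior:
  assumes x: "x \<notin> Vs" and l: "lnk x y" "lnk y z" "lnk z w" "lnk w x" shows "x = z \<or> y = w"
proof -
  have "x \<in> pts" by (rule lnk_pts[OF l(1)])
  then obtain e where e: "e \<in> Es" "x = e (1 / 3) \<or> x = e (2 / 3)" using x by (auto simp: pts_def)
  note 1 = lnk_third[OF e(1)] and 2 = lnk_two_thirds[OF e(1)] and V = ends[OF e(1)]
  have n: "\<not> lnk a b" if "a \<in> Vs" "b \<in> Vs" for a b using lnk_Vs that by blast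
  from e(2) show ?thesis
  proof
    assume x: "x = e (1 / 3)"
    have yw: "y = e 0 \<or> y = e (2 / 3)" "w = e 0 \<or> w = e (2 / 3)" using 1 l lnk_sym unfolding x by blast+
    have "z = x" if "y = e (2 / 3)" "w = e 0"
      using 2[of z] l(2,3) n[of z w] V that x by auto
    moreover have "z = x" if "w = e (2 / 3)" "y = e 0"
      using 2[of z] lnk_sym[OF l(3)] l(2) n[of y z] V that x by auto
    ultimately show ?thesis using yw by auto
  next
    assume x: "x = e (2 / 3)"
    have yw: "y = e 1 \<or> y = e (1 / 3)" "w = e 1 \<or> w = e (1 / 3)" using 2 l lnk_sym unfolding x by blast+
    have "z = x" if "y = e (1 / 3)" "w = e 1"
      using 1[of z] l(2,3) n[of z w] V that x by auto
    moreover have "z = x" if "w = e (1 / 3)" "y = e 1"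
      using 1[of z] lnk_sym[OF l(3)] l(2) n[of y z] V that x by auto
    ultimately show ?thesis using yw by auto
  qed
qed

lemma lnk_square: assumes l: "lnk x y" "lnk y z" "lnk z w" "lnk w x" shows "x = z \<or> y = w"
proof (cases "x \<in> Vs")
  case True
  then have "y \<notin> Vs" by (rule lnk_Vs[OF l(1)])
  from lnk_square_interior[OF this l(2,3,4,1)] show ?thesis by auto
next
  case False
  from lnk_square_interior[OF this l] show ?thesis .
qed

text \<open>The subdivided graph is drawn in \<open>Gr\<close> itself. Compactness of the
  realisation and the Hausdorff property make this drawing an embedding, and it is onto because the
  pieces of the edges cover the space.\<close>

theorem graph_model_exists: "\<exists>n adj lam mu. graph_model n adj Gr lam mu"
proof -
  define n where "n = card pts"
  have finp: "finite pts" using fin by (simp add: pts_def)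
  obtain q where q: "bij_betw q {..<n} pts"
    using ex_bij_betw_nat_finite[OF finp] unfolding n_def atLeast0LessThan by blast
  have qi: "q a = q b \<longleftrightarrow> a = b" if "a < n" "b < n" for a b
    using q that by (auto simp: bij_betw_def inj_on_def)
  have qs: "\<exists>a<n. x = q a" if "x \<in> pts" for x using q that by (auto simp: bij_betw_def)
  have qp: "q a \<in> pts" if "a < n" for a using q that by (auto simp: bij_betw_def)
  define adj where "adj = (\<lambda>a b. a < n \<and> b < n \<and> lnk (q a) (q b))"
  interpret sgraph n adj
  proof
    show "\<not> adj a a" for a unfolding adj_def lnk_def using cut_asym by blast
  qed (auto simp: adj_def lnk_sym)
  \<comment> \<open>The description is definite: two vertices are joined by at most one piece, and
    in only one direction, by \<open>cut_unique\<close> and \<open>cut_asym\<close>.\<close>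
  define P where "P = (\<lambda>a b s. THE y. \<exists>e k. cut (q a) (q b) e k \<and> y = e ((k + s) / 3) \<or> cut (q b) (q a) e k \<and> y = e ((k + (1 - s)) / 3))"
  have P1: "P a b s = e ((k + s) / 3)" if c: "cut (q a) (q b) e k" for a b s e k
    unfolding P_def using c cut_unique[OF c] cut_asym[OF c] by (intro the_equality) blast+
  have P2: "P a b s = e ((k + (1 - s)) / 3)" if c: "cut (q b) (q a) e k" for a b s e k
    unfolding P_def using c cut_unique[OF c] cut_asym[OF c] by (intro the_equality) blast+
  have form: "\<exists>e k r. cut (q a) (q b) e k \<and> (\<forall>s. P a b s = e ((k + s) / 3)) \<or>
      cut (q b) (q a) e k \<and> (\<forall>s. P a b s = e ((k + (1 - s)) / 3))" if "adj a b" for a b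
    using that P1 P2 unfolding adj_def lnk_def by blast
  have k3: "0 \<le> k" "k \<le> 2" "e \<in> Es" if "cut x y e k" for x y e k using that by (auto simp: cut_def)
  have new: "e ((k + s) / 3) \<notin> pts" if c: "cut x y e k" and s: "0 < s" "s < 1" for x y e k s
  proof
    assume p: "e ((k + s) / 3) \<in> pts"
    note k = k3[OF c]
    have r: "0 < (k + s) / 3" "(k + s) / 3 < 1" using k s by auto
    have "e ((k + s) / 3) \<notin> Vs" by (rule interior_off[OF k(3) r])
    then have "\<exists>e'\<in>Es. e ((k + s) / 3) = e' (1 / 3) \<or> e ((k + s) / 3) = e' (2 / 3)" using p unfolding pts_def by blast
    then obtain e' r' where e': "e' \<in> Es" "r' = 1 / 3 \<or> r' = 2 / 3" "e ((k + s) / 3) = e' r'" by blast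
    then have "0 < r'" "r' < 1" by auto
    from interior_eq[OF k(3) e'(1) r this e'(3)] have "(k + s) / 3 = r'" by simp
    then show False using e'(2) c s by (auto simp: cut_def)
  qed
  have same: "e = e' \<and> k = k' \<and> s = t"
    if c: "cut x y e k" "cut x' y' e' k'" and s: "0 < s" "s < 1" "0 < t" "t < 1" and eq: "e ((k + s) / 3) = e' ((k' + t) / 3)"
    for x y e k x' y' e' k' s t
  proof -
    note k = k3[OF c(1)] and k' = k3[OF c(2)]
    have "e = e' \<and> (k + s) / 3 = (k' + t) / 3"
      by (rule interior_eq[OF k(3) k'(3) _ _ _ _ eq]) (use k k' s in auto)
    then show ?thesis using c s by (auto simp: cut_def)
  qed
  have "drawing Gr q P"
    unfolding drawing_def
  proof (intro conjI allI impI)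
    show "inj_on q {..<n}" using q by (simp add: bij_betw_def)
  next
    fix v assume "v < n"
    then have "q v \<in> pts" by (rule qp)
    moreover have "e s \<in> topspace Gr" if "e \<in> Es" "s \<in> {0..1}" for e s using that unfolding cover by blast
    ultimately show "q v \<in> topspace Gr" using Vs by (fastforce simp: pts_def)
  next
    fix a b assume ab: "adj a b"
    obtain e k where e: "cut (q a) (q b) e k \<and> (\<forall>s. P a b s = e ((k + s) / 3)) \<or>
      cut (q b) (q a) e k \<and> (\<forall>s. P a b s = e ((k + (1 - s)) / 3))" using form[OF ab] by auto
    then show "P a b 0 = q a" "P a b 1 = q b" by (auto simp: cut_def)
    from e show "continuous_map (top_of_set {0..1}) Gr (P a b)"
    proof
      assume c: "cut (q a) (q b) e k \<and> (\<forall>s. P a b s = e ((k + s) / 3))"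
      then have "P a b = (\<lambda>s. e ((k + s) / 3))" by auto
      moreover have "continuous_map (top_of_set {0..1}) Gr (\<lambda>s. e ((k + s) / 3))"
        by (rule sub_map[OF cont]) (use c k3 in \<open>fastforce intro!: continuous_intros\<close>)+
      ultimately show ?thesis by simp
    next
      assume c: "cut (q b) (q a) e k \<and> (\<forall>s. P a b s = e ((k + (1 - s)) / 3))"
      then have "P a b = (\<lambda>s. e ((k + (1 - s)) / 3))" by auto
      moreover have "continuous_map (top_of_set {0..1}) Gr (\<lambda>s. e ((k + (1 - s)) / 3))"
        by (rule sub_map[OF cont]) (use c k3 in \<open>fastforce intro!: continuous_intros\<close>)+
      ultimately show ?thesis by simp
    qed
  next
    fix a b and s :: real assume "adj a b"
    then obtain e k where "cut (q a) (q b) e k \<or> cut (q b) (q a) e k" by (auto simp: adj_def lnk_def)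
    then show "P b a (1 - s) = P a b s" using P1 P2 by auto
  next
    fix a b v and s :: real assume ab: "adj a b" "v < n" "0 < s" "s < 1"
    then have "P a b s \<notin> pts" using form[OF ab(1)] new[of _ _ _ _ s] new[of _ _ _ _ "1 - s"] by auto
    then show "P a b s \<noteq> q v" using qp[OF ab(2)] by auto
  next
    fix a b c d and s t :: real
    assume ab: "adj a b" and cd: "adj c d" and st: "0 < s" "s < 1" "0 < t" "t < 1" and eq: "P a b s = P c d t"
    have lt: "a < n" "b < n" "c < n" "d < n" using ab cd by (auto simp: adj_def)
    have key: "(e = e' \<and> k = k' \<and> s' = t') \<and> x = x' \<and> y = y'"
      if "cut x y e k" "cut x' y' e' k'" "0 < s'" "s' < 1" "0 < t'" "t' < 1" "e ((k + s') / 3) = e' ((k' + t') / 3)"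
      for x y e k x' y' e' k' s' t'
      using same[OF that] that(1,2) by (auto simp: cut_def)
    obtain e k where e: "cut (q a) (q b) e k \<or> cut (q b) (q a) e k" using ab by (auto simp: adj_def lnk_def)
    obtain e' k' where e': "cut (q c) (q d) e' k' \<or> cut (q d) (q c) e' k'" using cd by (auto simp: adj_def lnk_def)
    have st': "0 < 1 - s" "1 - s < 1" "0 < 1 - t" "1 - t < 1" using st by auto
    from e show "c = a \<and> d = b \<and> t = s \<or> c = b \<and> d = a \<and> t = 1 - s"
    proof
      assume 1: "cut (q a) (q b) e k"
      from e' show ?thesis
      proof
        assume 2: "cut (q c) (q d) e' k'"
        from key[OF 1 2 st] show ?thesis using eq P1[OF 1] P1[OF 2] qi lt by fastforce
      next
        assume 2: "cut (q d) (q c) e' k'"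
        from key[OF 1 2 st(1,2) st'(3,4)] show ?thesis using eq P1[OF 1] P2[OF 2] qi lt by auto
      qed
    next
      assume 1: "cut (q b) (q a) e k"
      from e' show ?thesis
      proof
        assume 2: "cut (q c) (q d) e' k'"
        from key[OF 1 2 st'(1,2) st(3,4)] show ?thesis using eq P2[OF 1] P1[OF 2] qi lt by auto
      next
        assume 2: "cut (q d) (q c) e' k'"
        from key[OF 1 2 st'] show ?thesis using eq P2[OF 1] P2[OF 2] qi lt by fastforce
      qed
    qed
  qed
  from drawing_embeds[OF this Hausdorff] obtain f where f: "embedding_map (top_of_set KG) Gr f"
    "q ` {..<n} \<union> (\<Union>(a, b)\<in>{(a, b). adj a b}. P a b ` {0..1}) \<subseteq> f ` KG" by blast
  have "topspace Gr \<subseteq> f ` KG"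
  proof
    fix x assume x: "x \<in> topspace Gr"
    show "x \<in> f ` KG"
    proof (cases "x \<in> Vs")
      case True
      then have "x \<in> q ` {..<n}" using q by (auto simp: bij_betw_def pts_def)
      then show ?thesis using f(2) by blast
    next
      case False
      then obtain e s where e: "e \<in> Es" "0 \<le> s" "s \<le> 1" "x = e s" using x by (auto simp: cover)
      obtain k :: real where k: "k \<in> {0, 1, 2}" "k \<le> 3 * s" "3 * s \<le> k + 1"
      proof -
        consider "3 * s \<le> 1" | "1 \<le> 3 * s" "3 * s \<le> 2" | "2 \<le> 3 * s" by linarith
        then show thesis using that[of 0] that[of 1] that[of 2] e(2,3) by cases auto
      qed
      have c: "cut (e (k / 3)) (e ((k + 1) / 3)) e k" using e k by (simp add: cut_def)
      obtain a b where ab: "a < n" "b < n" "e (k / 3) = q a" "e ((k + 1) / 3) = q b" using cut_pts[OF c] qs by meson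
      then have "adj a b" using c by (auto simp: adj_def lnk_def)
      moreover have "P a b (3 * s - k) = x" using P1[of a b e k "3 * s - k"] c ab e(4) by simp
      moreover have "3 * s - k \<in> {0..1}" using k by simp
      ultimately have "x \<in> (\<Union>(a, b)\<in>{(a, b). adj a b}. P a b ` {0..1})" by blast
      then show ?thesis using f(2) by blast
    qed
  qed
  moreover have "f ` KG \<subseteq> topspace Gr"
    using continuous_map_image_subset_topspace[OF continuous_map_into_fulltopology[OF
      homeomorphic_imp_continuous_map[OF f(1)[unfolded embedding_map_def]]]] by simp
  ultimately have "f ` KG = topspace Gr" by blast
  then have "homeomorphic_map (top_of_set KG) Gr f" using f(1) by (simp add: embedding_map_def)
  then obtain lam where "homeomorphic_maps (top_of_set KG) Gr f lam" using homeomorphic_map_maps by blast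
  then have h: "homeomorphic_maps Gr (top_of_set KG) lam f" by (rule homeomorphic_maps_sym[THEN iffD1])
  have "graph_model n adj Gr lam f"
  proof (unfold_locales, rule h)
    fix a b c d assume "adj a b" "adj b c" "adj c d" "adj d a"
    then show "a = c \<or> b = d" using lnk_square[of "q a" "q b" "q c" "q d"] qi by (auto simp: adj_def)
  qed
  then show ?thesis by blast
qed

end

text \<open>Either condition yields an odd cochain and with it a ranked tree, from which the other
  condition follows. The empty graph is treated apart, as it has no root.\<close>

theorem (in graph_model) planar_iff_torsion_free:
  assumes "connected_space Gr" shows "planar_space Gr \<longleftrightarrow> H1_B2_torsion_free Gr"
proof (cases "n = 0")
  case True
  then have e: "\<not> adj a b" for a b using adj_less by auto
  have "topspace Gr = {}" using lam_KG True unfolding KG_def by force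
  then have "topspace (UC2 Gr) = {}" by (auto simp: topspace_UC2 topspace_conf2)
  moreover have "drawing (euclidean :: (real \<times> real) topology) q P" for q P unfolding drawing_def using e True by simp
  ultimately show ?thesis unfolding planar_iff_drawing H1_B2_torsion_free_def by blast
next
  case False
  have tree: "\<exists>par dep \<rho>. ranked_tree n adj 0 par dep \<rho>" if "odd_cochain c" for c
    using ranked_tree_exists[OF _ conn_if_connected[OF assms] oddsys_of_odd_cochain[OF that]] False by simp
  show ?thesis
  proof
    assume "planar_space Gr"
    then obtain q P where "drawing (euclidean :: (real \<times> real) topology) q P" using planar_iff_drawing by blast
    then obtain c where "odd_cochain c" using odd_cochain_of_plane_drawing by blast
    then obtain par dep \<rho> where "ranked_tree n adj 0 par dep \<rho>" using tree by blast
    then interpret T: ranked_tree n adj 0 par dep \<rho> .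
    show "H1_B2_torsion_free Gr"
    proof (rule torsion_free_if_cochains_lift)
      fix c :: "nat => nat => nat => real"
      assume c: "alt_cochain c" and d: "\<And>x y. disj_edges x y ==> dcf c x y \<in> \<int>"
      show "\<exists>k :: nat => nat => nat => int. alt_cochain k \<and> (\<forall>x y. disj_edges x y --> dcf c x y = of_int (dcf k x y))"
        by (rule T.cochain_lift[OF c d])
    qed
  next
    assume "H1_B2_torsion_free Gr"
    then obtain c where "odd_cochain c" using odd_cochain_if_torsion_free by blast
    then obtain par dep \<rho> where "ranked_tree n adj 0 par dep \<rho>" using tree by blast
    then interpret T: ranked_tree n adj 0 par dep \<rho> .
    show "planar_space Gr" unfolding planar_iff_drawing using T.plane_drawing_of_ranks by blast
  qed
qed

theorem theorem5p1:
  fixes Gr :: "'a topology"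
  assumes "finite_graph_space Gr" and "connected_space Gr"
  shows "planar_space Gr \<longleftrightarrow> H1_B2_torsion_free Gr"
proof -
  from assms(1) obtain Vs :: "'a set" and Es :: "(real => 'a) set" where h: "Hausdorff_space Gr" "finite Vs" "finite Es"
    "Vs \<subseteq> topspace Gr" "\<forall>ed\<in>Es. continuous_map (top_of_set {0..1}) Gr ed \<and> ed 0 \<in> Vs \<and> ed 1 \<in> Vs \<and>
      inj_on ed {0<..<1} \<and> ed ` {0<..<1} \<inter> Vs = {}"
    "\<forall>ed\<in>Es. \<forall>ed'\<in>Es. ed \<noteq> ed' --> ed ` {0<..<1} \<inter> ed' ` {0<..<1} = {}"
    "topspace Gr = Vs \<union> (\<Union>ed\<in>Es. ed ` {0..1})"
    unfolding finite_graph_space_def by auto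
  interpret graph_cells Gr Vs Es by unfold_locales (use h in blast)+
  obtain n adj lam mu where "graph_model n adj Gr lam mu" using graph_model_exists by blast
  then show ?thesis by (rule graph_model.planar_iff_torsion_free[OF _ assms(2)])
qed

end
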